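(* Let $n\ge 2$, $G=\mathrm{SO}(n,1)^\circ$, $\rho=\frac{n-1}{2}$, and let $\Gamma<G(\mathbb{Z})$ be a torsion-free, geometrically finite, Zariski dense subgroup of $G$ with critical exponent $\delta_\Gamma>\rho$; put $X=\Gamma\backslash\mathbb{H}^n$. Let $\Gamma_i<\Gamma$ be a sequence of finite-index subgroups, with finite covers $p_i:X_i=\Gamma_i\backslash\mathbb{H}^n\to X$ of degree $D_i=[\Gamma:\Gamma_i]$. Fix $s\in(\rho,\delta_\Gamma]$ and suppose that $(X_i)$ has the uniform collar property at $s$, with compact set $\Omega\subset X$ and constant $c_s>0$. Then there is a constant $C>0$, independent of $i$ and $L$, such that for every $i$ and every $L\ge 2$, $$\frac{\mathcal{N}(\lambda_s,\Gamma_i)}{D_i}\le C\, e^{-(s-\rho)L}\,\mathcal{E}_i(L),$$ where $\mathcal{E}_i(L)$ is the normalized return energy defined using $\Omega$.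
   Context: $G=\mathrm{SO}(n,1)^\circ$ is the identity component of $\mathrm{SO}(n,1)$, embedded in $\mathrm{GL}_{n+1}(\mathbb{R})$ by its defining integral representation; $G(\mathbb{Z})=G\cap \mathrm{GL}_{n+1}(\mathbb{Z})$. $K<G$ is a maximal compact subgroup, $G/K=\mathbb{H}^n$ is real hyperbolic $n$-space with distance $d$, and $o=eK$. Haar measure on $G$ is normalized so that it induces hyperbolic volume on $G/K$; $dx$ denotes hyperbolic volume on $X_i$. The critical exponent $\delta_\Gamma$ is the abscissa of convergence of $\sum_{\gamma\in\Gamma}e^{-t\,d(o,\gamma o)}$. For $u\in(\rho,n-1]$ put $\lambda_u=u(n-1-u)$; each eigenvalue below $\rho^2$ of the nonnegative Laplacian is $\lambda_u$ for a unique $u\in(\rho,n-1]$, called the spectral parameter of the corresponding eigenfunctions. $\mathcal{N}(\lambda_s,\Gamma')$ is the number of eigenvalues in $[0,\lambda_s]$, counted with multiplicity, of the nonnegative Laplacian on $L^2(\Gamma'\backslash\mathbb{H}^n)$. Uniform collar property at $s$: there exist a compact subset $\Omega=\Omega_s\subset X$ and a constant $c_s>0$ such that, for every $i$, every $L^2$-normalized eigenfunction $\phi$ of the Laplacian on $X_i$ with spectral parameter $u\in[s,\delta_\Gamma]$ satisfies $\int_{p_i^{-1}(\Omega)}|\phi|^2\,dx\ge c_s$. Normalized return energy: put $\Omega_i=p_i^{-1}(\Omega)$. For $x=\Gamma_i gK\in\Omega_i$ and $\gamma\in\Gamma_i$ set $r_g(\gamma)=d(go,\gamma go)$, and $$\mathcal{E}_i(L)=\frac{1}{D_i}\int_{\Omega_i}\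 \sum_{\substack{\gamma\in\Gamma_i\\ r_g(\gamma)\le L}}e^{-\rho\, r_g(\gamma)}\,dx,$$ where the inner sum does not depend on the choice of representative $g$ of $x$. *)

theory Defs
  imports
    "HOL-Analysis.Analysis"
    "HOL-Algebra.Coset"
    "HOL-Library.Function_Algebras"
begin

text \<open>
  The dimension is \<open>n = CARD('n)\<close>. The ambient space of the hyperboloid model is
  \<open>real ^ 'n option\<close>: the indices \<open>Some i\<close> are spacelike and \<open>None\<close> is timelike.
\<close>

type_synonym 'n vec1 = "real ^ 'n option"
type_synonym 'n mat1 = "real ^ 'n option ^ 'n option"

definition mink :: "'n::finite vec1 \<Rightarrow> 'n vec1 \<Rightarrow> real" where
  "mink x y = (\<Sum>i\<in>UNIV. x $ Some i * y $ Some i) - x $ None * y $ None"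

definition SO_n1 :: "'n::finite mat1 set" where
  "SO_n1 = {A. det A = 1 \<and> (\<forall>x y. mink (A *v x) (A *v y) = mink x y)}"

definition lorentz_group :: "'n::finite mat1 monoid" where
  "lorentz_group =
     \<lparr>carrier = connected_component_set SO_n1 (mat 1), mult = (**), one = mat 1\<rparr>"

definition GL_int :: "'n::finite mat1 set" where
  "GL_int = {A. (\<forall>i j. A $ i $ j \<in> \<int>) \<and>
     (\<exists>B. (\<forall>i j. B $ i $ j \<in> \<int>) \<and> A ** B = mat 1 \<and> B ** A = mat 1)}"

definition maximal_compact_subgroup :: "'n::finite mat1 set \<Rightarrow> bool" where
  "maximal_compact_subgroup K \<longleftrightarrow> subgroup K lorentz_group \<and> compact K \<and>
     (\<forall>K'. subgroup K' lorentz_group \<and> compact K' \<and> K \<subseteq> K' \<longrightarrow> K' = K)"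

definition torsion_free :: "'n::finite mat1 set \<Rightarrow> bool" where
  "torsion_free \<Gamma> \<longleftrightarrow>
     (\<forall>\<gamma>\<in>\<Gamma>. \<forall>k::nat. k > 0 \<and> \<gamma> [^]\<^bsub>lorentz_group\<^esub> k = mat 1 \<longrightarrow> \<gamma> = mat 1)"

definition zariski_dense :: "'n::finite mat1 set \<Rightarrow> bool" where
  "zariski_dense \<Gamma> \<longleftrightarrow>
     (\<forall>P. real_polynomial_function P \<and> (\<forall>\<gamma>\<in>\<Gamma>. P \<gamma> = 0) \<longrightarrow>
        (\<forall>g\<in>carrier lorentz_group. P g = 0))"

definition index_in :: "'n::finite mat1 set \<Rightarrow> 'n mat1 set \<Rightarrow> nat" where
  "index_in \<Gamma> \<Gamma>' = card (rcosets\<^bsub>lorentz_group\<lparr>carrier := \<Gamma>\<rparr>\<^esub> \<Gamma>')"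

definition finite_index_subgroup :: "'n::finite mat1 set \<Rightarrow> 'n mat1 set \<Rightarrow> bool" where
  "finite_index_subgroup \<Gamma>' \<Gamma> \<longleftrightarrow> subgroup \<Gamma>' lorentz_group \<and> \<Gamma>' \<subseteq> \<Gamma> \<and>
     finite (rcosets\<^bsub>lorentz_group\<lparr>carrier := \<Gamma>\<rparr>\<^esub> \<Gamma>')"

definition hyp :: "'n::finite vec1 set" where
  "hyp = {x. mink x x = -1 \<and> x $ None > 0}"

definition hyp_dist :: "'n::finite vec1 \<Rightarrow> 'n vec1 \<Rightarrow> real" where
  "hyp_dist x y = arcosh (- mink x y)"

definition hyp_origin :: "'n::finite vec1" where
  "hyp_origin = axis None 1"

definition hyp_chart :: "real ^ 'n::finite \<Rightarrow> 'n vec1" where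
  "hyp_chart v = (\<chi> k. case k of None \<Rightarrow> sqrt (1 + v \<bullet> v) | Some i \<Rightarrow> v $ i)"

definition partial :: "'n::finite \<Rightarrow> (real ^ 'n \<Rightarrow> 'b::real_normed_vector) \<Rightarrow> real ^ 'n \<Rightarrow> 'b" where
  "partial i f v = vector_derivative (\<lambda>t. f (v + t *\<^sub>R axis i 1)) (at 0)"

text \<open>The Riemannian metric is the pullback of \<^const>\<open>mink\<close> along the chart.\<close>

definition hyp_metric :: "real ^ 'n::finite \<Rightarrow> real ^ 'n ^ 'n" where
  "hyp_metric v = (\<chi> i j. mink (partial i hyp_chart v) (partial j hyp_chart v))"

definition hyp_density :: "real ^ 'n::finite \<Rightarrow> real" where
  "hyp_density v = sqrt (det (hyp_metric v))"

text \<open>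
  Hyperbolic volume, as a Borel measure on the ambient space that is concentrated on
  \<^const>\<open>hyp\<close>.
\<close>

definition hyp_vol :: "'n::finite vec1 measure" where
  "hyp_vol = distr (density lborel (\<lambda>v. ennreal (hyp_density v))) borel hyp_chart"

text \<open>Sign convention: minus the divergence of the gradient, hence a nonnegative operator.\<close>

definition hyp_laplacian :: "(real ^ 'n::finite \<Rightarrow> complex) \<Rightarrow> real ^ 'n \<Rightarrow> complex" where
  "hyp_laplacian f v = - (1 / hyp_density v) *\<^sub>R
     (\<Sum>i\<in>UNIV. partial i
        (\<lambda>w. \<Sum>j\<in>UNIV. (hyp_density w * matrix_inv (hyp_metric w) $ i $ j) *\<^sub>R partial j f w) v)"

fun times_diff :: "nat \<Rightarrow> (real ^ 'n::finite \<Rightarrow> complex) \<Rightarrow> bool" where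
  "times_diff 0 f = continuous_on UNIV f"
| "times_diff (Suc k) f = (f differentiable_on UNIV \<and> (\<forall>i. times_diff k (partial i f)))"

definition smooth :: "(real ^ 'n::finite \<Rightarrow> complex) \<Rightarrow> bool" where
  "smooth f \<longleftrightarrow> (\<forall>k. times_diff k f)"

definition orb :: "'n::finite mat1 set \<Rightarrow> 'n vec1 \<Rightarrow> 'n vec1 set" where
  "orb \<Gamma> x = (\<lambda>\<gamma>. \<gamma> *v x) ` \<Gamma>"

definition hyp_quot :: "'n::finite mat1 set \<Rightarrow> 'n vec1 set set" where
  "hyp_quot \<Gamma> = orb \<Gamma> ` hyp"

definition quot_top :: "'n::finite mat1 set \<Rightarrow> 'n vec1 set topology" where
  "quot_top \<Gamma> = topology (\<lambda>U. U \<subseteq> hyp_quot \<Gamma> \<and>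
     openin (top_of_set hyp) {x \<in> hyp. orb \<Gamma> x \<in> U})"

definition dirichlet_domain :: "'n::finite mat1 set \<Rightarrow> 'n vec1 set" where
  "dirichlet_domain \<Gamma> =
     {x \<in> hyp. \<forall>\<gamma>\<in>\<Gamma>. hyp_dist x hyp_origin \<le> hyp_dist x (\<gamma> *v hyp_origin)}"

text \<open>
  For torsion-free discrete \<open>\<Gamma>\<close> the
  Dirichlet domain meets every orbit, and it meets an orbit more than once only in its boundary,
  a null set.
\<close>

definition quot_vol :: "'n::finite mat1 set \<Rightarrow> 'n vec1 set measure" where
  "quot_vol \<Gamma> = distr (restrict_space hyp_vol (dirichlet_domain \<Gamma>))
     (sigma (hyp_quot \<Gamma>) {U. openin (quot_top \<Gamma>) U}) (orb \<Gamma>)"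

text \<open>
  For \<open>\<Gamma>' \<subseteq> \<Gamma>\<close>, the covering \<open>\<Gamma>'x \<mapsto> \<Gamma>x\<close> sends an orbit of \<open>\<Gamma>'\<close> to its \<open>\<Gamma>\<close>-saturation.
\<close>

definition cover_map :: "'n::finite mat1 set \<Rightarrow> 'n vec1 set \<Rightarrow> 'n vec1 set" where
  "cover_map \<Gamma> A = (\<Union>x\<in>A. orb \<Gamma> x)"

definition cover_preimage ::
    "'n::finite mat1 set \<Rightarrow> 'n mat1 set \<Rightarrow> 'n vec1 set set \<Rightarrow> 'n vec1 set set" where
  "cover_preimage \<Gamma> \<Gamma>' \<Omega> = {x \<in> hyp_quot \<Gamma>'. cover_map \<Gamma> x \<in> \<Omega>}"

definition critical_exponent :: "'n::finite vec1 \<Rightarrow> 'n mat1 set \<Rightarrow> real" where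
  "critical_exponent p \<Gamma> =
     Inf {t. (\<lambda>\<gamma>. exp (- t * hyp_dist p (\<gamma> *v p))) summable_on \<Gamma>}"

text \<open>
  Points of the sphere at infinity are null vectors with time coordinate 1. After projective
  normalization \<open>x / x\<^sub>0\<close> (the Klein model), hyperbolic space is the open unit ball and geodesics
  are straight chords, so hyperbolic convex hulls become affine convex hulls.
\<close>

definition klein :: "'n::finite vec1 \<Rightarrow> 'n vec1" where
  "klein x = (1 / x $ None) *\<^sub>R x"

definition limit_set :: "'n::finite mat1 set \<Rightarrow> 'n vec1 set" where
  "limit_set \<Gamma> = {\<xi>. mink \<xi> \<xi> = 0 \<and> \<xi> $ None = 1 \<and>
     (\<exists>g::nat \<Rightarrow> 'n mat1. range g \<subseteq> \<Gamma> \<and> (\<lambda>k. klein (g k *v hyp_origin)) \<longlonglongrightarrow> \<xi>)}"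

definition limit_hull :: "'n::finite mat1 set \<Rightarrow> 'n vec1 set" where
  "limit_hull \<Gamma> = {x \<in> hyp. klein x \<in> convex hull (limit_set \<Gamma>)}"

text \<open>
  The convex core is the image of \<^const>\<open>limit_hull\<close> in the quotient; geometric finiteness says
  that its unit neighbourhood has finite volume.
\<close>

definition geometrically_finite :: "'n::finite mat1 set \<Rightarrow> bool" where
  "geometrically_finite \<Gamma> \<longleftrightarrow>
     emeasure (quot_vol \<Gamma>)
       (orb \<Gamma> ` {x \<in> hyp. \<exists>y\<in>limit_hull \<Gamma>. hyp_dist x y < 1}) < \<infinity>"

definition rho :: "nat \<Rightarrow> real" where
  "rho n = (real n - 1) / 2"

definition spectral_value :: "nat \<Rightarrow> real \<Rightarrow> real" where
  "spectral_value n u = u * (real n - 1 - u)"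

definition L2_mass :: "'n::finite mat1 set \<Rightarrow> ('n vec1 set \<Rightarrow> complex) \<Rightarrow> 'n vec1 set set \<Rightarrow> ennreal"
  where "L2_mass \<Gamma> \<phi> A = (\<integral>\<^sup>+x\<in>A. ennreal ((cmod (\<phi> x))\<^sup>2) \<partial>quot_vol \<Gamma>)"

text \<open>
  The \<open>L\<^sup>2\<close> solutions of \<open>\<Delta>\<phi> = \<mu>\<phi>\<close> on the quotient, taken as smooth functions and read through
  their lifts to hyperbolic space; they are extended by 0 outside the quotient so that linear
  independence of functions has its usual meaning.
\<close>

definition eigenspace :: "'n::finite mat1 set \<Rightarrow> real \<Rightarrow> ('n vec1 set \<Rightarrow> complex) set" where
  "eigenspace \<Gamma> \<mu> = {\<phi>.
     (\<forall>x. x \<notin> hyp_quot \<Gamma> \<longrightarrow> \<phi> x = 0) \<and>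
     smooth (\<lambda>v. \<phi> (orb \<Gamma> (hyp_chart v))) \<and>
     L2_mass \<Gamma> \<phi> (hyp_quot \<Gamma>) < \<infinity> \<and>
     (\<forall>v. hyp_laplacian (\<lambda>w. \<phi> (orb \<Gamma> (hyp_chart w))) v
            = complex_of_real \<mu> * \<phi> (orb \<Gamma> (hyp_chart v)))}"

text \<open>
  The complex dimension of the eigenspace. It is extended-valued, so that an infinite-dimensional
  eigenspace does not count as 0; it is positive exactly when \<open>\<mu>\<close> is an eigenvalue.
\<close>

definition multiplicity_of :: "'n::finite mat1 set \<Rightarrow> real \<Rightarrow> ennreal" where
  "multiplicity_of \<Gamma> \<mu> =
     (SUP B \<in> {B. finite B \<and> B \<subseteq> eigenspace \<Gamma> \<mu> \<and>
                  \<not> module.dependent (\<lambda>(c::complex) f x. c * f x) B}. of_nat (card B))"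

definition eigenvalue_count :: "'n::finite mat1 set \<Rightarrow> real \<Rightarrow> ennreal" where
  "eigenvalue_count \<Gamma> t = (\<Sum>\<^sub>\<infinity>\<mu>\<in>{0..t}. multiplicity_of \<Gamma> \<mu>)"

definition uniform_collar ::
    "'n::finite mat1 set \<Rightarrow> (nat \<Rightarrow> 'n mat1 set) \<Rightarrow> real \<Rightarrow> real \<Rightarrow> 'n vec1 set set \<Rightarrow> real \<Rightarrow> bool"
  where
  "uniform_collar \<Gamma> \<Gamma>s s \<delta> \<Omega> c \<longleftrightarrow>
     compactin (quot_top \<Gamma>) \<Omega> \<and> c > 0 \<and>
     (\<forall>i. \<forall>u\<in>{s..\<delta>}. \<forall>\<phi>\<in>eigenspace (\<Gamma>s i) (spectral_value CARD('n) u).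
        L2_mass (\<Gamma>s i) \<phi> (hyp_quot (\<Gamma>s i)) = 1 \<longrightarrow>
        L2_mass (\<Gamma>s i) \<phi> (cover_preimage \<Gamma> (\<Gamma>s i) \<Omega>) \<ge> ennreal c)"

definition return_length :: "'n::finite vec1 \<Rightarrow> 'n mat1 \<Rightarrow> 'n mat1 \<Rightarrow> real" where
  "return_length p g \<gamma> = hyp_dist (g *v p) (\<gamma> *v (g *v p))"

definition representative :: "'n::finite vec1 \<Rightarrow> 'n mat1 set \<Rightarrow> 'n vec1 set \<Rightarrow> 'n mat1" where
  "representative p \<Gamma> x = (SOME g. g \<in> carrier lorentz_group \<and> orb \<Gamma> (g *v p) = x)"

definition return_sum :: "'n::finite vec1 \<Rightarrow> 'n mat1 set \<Rightarrow> real \<Rightarrow> 'n vec1 set \<Rightarrow> ennreal" where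
  "return_sum p \<Gamma> L x =
     (let r = return_length p (representative p \<Gamma> x)
      in \<Sum>\<^sub>\<infinity>\<gamma>\<in>{\<gamma>\<in>\<Gamma>. r \<gamma> \<le> L}. ennreal (exp (- rho CARD('n) * r \<gamma>)))"

definition return_energy ::
    "'n::finite vec1 \<Rightarrow> 'n mat1 set \<Rightarrow> 'n mat1 set \<Rightarrow> 'n vec1 set set \<Rightarrow> real \<Rightarrow> ennreal" where
  "return_energy p \<Gamma> \<Gamma>' \<Omega> L =
     (\<integral>\<^sup>+x\<in>cover_preimage \<Gamma> \<Gamma>' \<Omega>. return_sum p \<Gamma>' L x \<partial>quot_vol \<Gamma>') / of_nat (index_in \<Gamma> \<Gamma>')"

end

theory Submission
  imports Defs
begin

text \<open>
  Write \<open>W = cosh (L / 2)\<close> and let \<open>\<psi>(z, y) = max 0 (W - cosh d(z, y)) ^ 3\<close>. By the mean value property,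
  convolution with \<open>\<psi>\<close> multiplies an eigenfunction with parameter \<open>u\<close> by a number that depends on \<open>u\<close> and \<open>W\<close>
  only; evaluating it on a horospherical function shows that it is at least a constant times \<open>W powr (u + 3)\<close>.
  Bessel's inequality for the automorphic kernel \<open>y \<mapsto> \<Sum>\<gamma>. \<psi>(z, \<gamma>y)\<close> and an orthonormal system of
  eigenfunctions with parameters at least \<open>s\<close> bounds \<open>W powr (2 * s + 6) * (\<Sum>j. |\<phi>\<^sub>j z|\<^sup>2)\<close> by the squared norm
  of the kernel. Unfolding turns that norm into a sum over \<open>\<gamma>\<close> of overlap integrals of two balls, which
  vanish unless \<open>d(z, \<gamma>z) \<le> L\<close> and are at most a constant times
  \<open>W powr (2 * \<rho> + 6) * exp (- \<rho> * d(z, \<gamma>z))\<close>. Integrating over \<open>\<Omega>\<^sub>i\<close>, the collar property bounds the number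
  of eigenfunctions. It applies to all of them because Schur's test excludes parameters above the
  critical exponent.
\<close>

subsection \<open>The Lorentz form and the hyperboloid\<close>

text \<open>The third power is the lowest that makes \<open>\<psi>\<close> twice continuously
  differentiable, as Green's identity requires. The moments of \<open>W - lor x y\<close> with
  powers 3, 2 and 1 are, up to factors, successive derivatives in \<open>W\<close>, and Green's
  identity becomes a linear differential equation between them; uniqueness for this equation takes
  the place of averaging over the stabilizer of a point. Green's identity is only applied against
  compactly supported functions in the chart. On the noncompact quotient, orthogonality of
  eigenspaces and the absence of large parameters are read off the symmetric kernel operator. On the
  hyperboloid \<open>lor x y\<close> is the hyperbolic cosine of the distance, so balls, their
  intersections and the triangle inequality become linear algebra in the ambient space. Balls of
  radius \<open>L / 2\<close> have the parameter \<open>W = cosh (L / 2)\<close>, and the quotient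
  \<open>W powr (2 * \<rho> - 2 * s)\<close> of the two kernel bounds has the size of
  \<open>exp (- (s - \<rho>) * L)\<close>. The integrand of the return energy goes through a chosen
  representative, so the final integration uses only inequalities that hold for arbitrary
  functions.\<close>

definition lor :: "'n::finite vec1 \<Rightarrow> 'n vec1 \<Rightarrow> real" where
  "lor x y = - mink x y"

definition space_part :: "'n::finite vec1 \<Rightarrow> real ^ 'n" where
  "space_part x = (\<chi> i. x $ Some i)"

definition mkvec :: "real \<Rightarrow> real ^ 'n::finite \<Rightarrow> 'n vec1" where
  "mkvec t v = (\<chi> k. case k of None \<Rightarrow> t | Some i \<Rightarrow> v $ i)"

lemma mkvec_nth [simp]: "mkvec t v $ None = t" "mkvec t v $ Some i = v $ i"
  by (simp_all add: mkvec_def)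

lemma space_part_nth [simp]: "space_part x $ i = x $ Some i"
  by (simp add: space_part_def)

lemma space_part_mkvec [simp]: "space_part (mkvec t v) = v"
  by (simp add: vec_eq_iff)

lemma vec1_eq_iff: "x = y \<longleftrightarrow> x $ None = y $ None \<and> (\<forall>i. x $ Some i = y $ Some i)"
  by (metis option.exhaust vec_eq_iff)

lemma mkvec_eta [simp]: "mkvec (x $ None) (space_part x) = x"
  by (simp add: vec1_eq_iff)

lemma mink_space_part: "mink x y = space_part x \<bullet> space_part y - x $ None * y $ None"
  by (simp add: mink_def inner_vec_def)

lemma hyp_chart_mkvec: "hyp_chart v = mkvec (sqrt (1 + v \<bullet> v)) v"
  by (simp add: hyp_chart_def mkvec_def)

lemma space_part_chart [simp]: "space_part (hyp_chart v) = v"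
  by (simp add: hyp_chart_mkvec)

lemma mink_sym: "mink x y = mink y x"
  by (simp add: mink_def mult.commute)

lemma mink_add_left: "mink (x + y) z = mink x z + mink y z"
  by (simp add: mink_def algebra_simps sum.distrib)

lemma mink_scale_left: "mink (a *\<^sub>R x) z = a * mink x z"
  by (simp add: mink_def algebra_simps sum_distrib_left)

lemma mink_add_right: "mink x (y + z) = mink x y + mink x z"
  by (simp add: mink_def algebra_simps sum.distrib)

lemma mink_scale_right: "mink x (a *\<^sub>R z) = a * mink x z"
  by (simp add: mink_def algebra_simps sum_distrib_left)

lemma mink_diff_left: "mink (x - y) z = mink x z - mink y z"
  by (simp add: mink_def algebra_simps sum_subtractf)

lemma mink_diff_right: "mink x (y - z) = mink x y - mink x z"
  by (simp add: mink_def algebra_simps sum_subtractf)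

lemma lor_sym: "lor x y = lor y x"
  by (simp add: lor_def mink_sym)

lemmas mink_bilinear = mink_add_left mink_add_right mink_scale_left mink_scale_right
  mink_diff_left mink_diff_right

lemma lor_bilinear:
  "lor (x + y) z = lor x z + lor y z" "lor z (x + y) = lor z x + lor z y"
  "lor (a *\<^sub>R x) z = a * lor x z" "lor z (a *\<^sub>R x) = a * lor z x"
  by (simp_all add: lor_def mink_bilinear)

lemma continuous_on_lor [continuous_intros]:
  "continuous_on S f \<Longrightarrow> continuous_on S g \<Longrightarrow> continuous_on S (\<lambda>x. lor (f x) (g x))"
  unfolding lor_def mink_def by (intro continuous_intros) auto

lemma borel_measurable_lor [measurable]:
  assumes [measurable]: "f \<in> borel_measurable M" "g \<in> borel_measurable M"
  shows "(\<lambda>x. lor (f x) (g x)) \<in> borel_measurable M"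
proof -
  have [measurable]: "(\<lambda>x. x $ i) \<in> borel_measurable borel" for i :: "'n::finite option"
    by (intro borel_measurable_continuous_onI continuous_intros)
  show ?thesis
    unfolding lor_def mink_def by measurable
qed

lemma hyp_chart_in_hyp [simp]: "hyp_chart v \<in> hyp"
proof -
  have "1 + v \<bullet> v > 0" by (simp add: add_pos_nonneg)
  then show ?thesis
    by (simp add: hyp_def mink_space_part hyp_chart_mkvec flip: power2_eq_square)
qed

lemma hyp_eq_chart: "x \<in> hyp \<Longrightarrow> x = hyp_chart (space_part x)"
proof -
  assume "x \<in> hyp"
  then have "(x $ None)\<^sup>2 = 1 + space_part x \<bullet> space_part x" and "x $ None > 0"
    by (auto simp: hyp_def mink_space_part power2_eq_square)
  then have "x $ None = sqrt (1 + space_part x \<bullet> space_part x)"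
    by (metis less_imp_le real_sqrt_unique)
  then show ?thesis
    by (metis hyp_chart_mkvec mkvec_eta)
qed

lemma continuous_on_hyp_chart [continuous_intros]: "continuous_on S hyp_chart"
  unfolding hyp_chart_def
proof (rule continuous_on_vec_lambda)
  fix k :: "'a option"
  show "continuous_on S (\<lambda>v :: real ^ 'a. case k of None \<Rightarrow> sqrt (1 + v \<bullet> v) | Some i \<Rightarrow> v $ i)"
    by (cases k) (auto intro!: continuous_intros)
qed

lemma continuous_on_space_part [continuous_intros]:
  "continuous_on S f \<Longrightarrow> continuous_on S (\<lambda>x. space_part (f x))"
  unfolding space_part_def by (intro continuous_intros)

lemma hyp_chart_0: "hyp_chart 0 = hyp_origin"
  by (simp add: hyp_chart_mkvec vec1_eq_iff hyp_origin_def axis_def)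

lemma hyp_origin_in_hyp [simp]: "hyp_origin \<in> hyp"
  by (metis hyp_chart_0 hyp_chart_in_hyp)

lemma lor_origin: "lor hyp_origin x = x $ None"
  by (simp add: lor_def mink_def hyp_origin_def axis_def)

text \<open>The strict sign condition may be relaxed to \<open>x $ None \<ge> 0\<close>: the
  equation \<open>lor x x = 1\<close> already keeps the time coordinate away from 0.\<close>

lemma closed_hyp: "closed (hyp :: 'n::finite vec1 set)"
proof -
  have hyp: "hyp = {x :: 'n vec1. lor x x = 1} \<inter> {x. x $ None \<ge> 0}"
  proof (intro equalityI subsetI)
    fix x :: "'n vec1"
    assume x: "x \<in> {x. lor x x = 1} \<inter> {x. x $ None \<ge> 0}"
    then have "(x $ None)\<^sup>2 = 1 + space_part x \<bullet> space_part x"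
      by (simp add: lor_def mink_space_part power2_eq_square)
    then have "x $ None \<noteq> 0"
      using inner_ge_zero [of "space_part x"] by (auto simp del: inner_ge_zero)
    then show "x \<in> hyp" using x by (auto simp: hyp_def lor_def)
  qed (auto simp: hyp_def lor_def)
  show ?thesis unfolding hyp
    by (auto intro!: closed_Int closed_Collect_eq closed_Collect_le continuous_intros)
qed

lemma lor_self: "x \<in> hyp \<Longrightarrow> lor x x = 1"
  by (simp add: hyp_def lor_def)

lemma mink_self_hyp: "x \<in> hyp \<Longrightarrow> mink x x = -1"
  by (simp add: hyp_def)

text \<open>Reverse Cauchy-Schwarz inequality. In the chart it is the ordinary one, together with
  \<open>2 * norm a * norm b \<le> (norm a)\<^sup>2 + (norm b)\<^sup>2\<close>.\<close>

lemma lor_ge_1: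
  assumes "x \<in> hyp" "y \<in> hyp" shows "lor x y \<ge> 1"
proof -
  obtain a b where x: "x = hyp_chart a" and y: "y = hyp_chart b"
    using assms hyp_eq_chart by blast
  have "(1 + norm a * norm b)\<^sup>2 \<le> (1 + a \<bullet> a) * (1 + b \<bullet> b)"
    using sum_squares_bound [of "norm a" "norm b"]
    by (simp add: power2_eq_square algebra_simps flip: power2_norm_eq_inner)
  then have "1 + norm a * norm b \<le> sqrt ((1 + a \<bullet> a) * (1 + b \<bullet> b))"
    by (rule real_le_rsqrt)
  moreover have "a \<bullet> b \<le> norm a * norm b"
    by (rule norm_cauchy_schwarz)
  ultimately show ?thesis
    by (simp add: x y lor_def mink_space_part hyp_chart_mkvec real_sqrt_mult)
qed

lemma lor_pos: "x \<in> hyp \<Longrightarrow> y \<in> hyp \<Longrightarrow> lor x y > 0"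
  using lor_ge_1 [of x y] by simp

text \<open>\<open>N\<close> is the \<open>lor\<close> square of the positive combination. The
  normalized vector lies on the geodesic segment between \<open>x\<close> and \<open>y\<close> and
  later serves as the centre of a ball that contains an intersection of two balls.\<close>

lemma combination_normalize_in_hyp:
  assumes "x \<in> hyp" "y \<in> hyp" "a > 0" "b > 0"
  defines "N \<equiv> a\<^sup>2 + b\<^sup>2 + 2 * a * b * lor x y"
  shows "(1 / sqrt N) *\<^sub>R (a *\<^sub>R x + b *\<^sub>R y) \<in> hyp"
proof -
  have N: "N > 0"
    unfolding N_def using lor_pos [OF assms(1,2)] assms(3,4) by (simp add: add_pos_pos)
  have "mink (a *\<^sub>R x + b *\<^sub>R y) (a *\<^sub>R x + b *\<^sub>R y) = - N"
    using assms(1,2) by (simp add: N_def hyp_def mink_bilinear lor_def mink_sym [of y x] power2_eq_square algebra_simps)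
  then show ?thesis
    using assms N by (simp add: hyp_def mink_scale_left mink_scale_right add_pos_pos
      flip: power2_eq_square) (simp add: field_simps power2_eq_square)
qed

text \<open>Pairing the normalization \<open>?m\<close> of \<open>x / W + y / W'\<close> with
  \<open>z\<close> gives a value between 1 and \<open>2 / sqrt ?N\<close>, and \<open>?N\<close>
  dominates its mixed term. This is the triangle inequality in the form
  \<open>cosh (a + b) \<le> 2 * cosh a * cosh b\<close>.\<close>

lemma lor_combination_ge:
  assumes "x \<in> hyp" "y \<in> hyp" "z \<in> hyp" "W > 0" "W' > 0" "lor x z \<le> W" "lor y z \<le> W'"
  shows "lor x y \<le> 2 * W * W'"
proof -
  let ?N = "(1/W)\<^sup>2 + (1/W')\<^sup>2 + 2 * (1/W) * (1/W') * lor x y"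
  let ?m = "(1 / sqrt ?N) *\<^sub>R ((1/W) *\<^sub>R x + (1/W') *\<^sub>R y)"
  have m: "?m \<in> hyp"
    using assms by (intro combination_normalize_in_hyp) auto
  have N0: "?N > 0"
    using lor_pos [OF assms(1,2)] assms(4,5) by (simp add: add_pos_pos)
  have "1 \<le> lor ?m z" using lor_ge_1 m assms by blast
  also have "lor ?m z = (1 / sqrt ?N) * ((1/W) * lor x z + (1/W') * lor y z)"
    by (simp only: lor_bilinear)
  also have "\<dots> \<le> (1 / sqrt ?N) * (1 + 1)"
    using assms N0 by (intro mult_left_mono add_mono) (auto simp: field_simps)
  finally have "sqrt ?N \<le> 2" using N0 by (simp add: field_simps)
  then have "?N \<le> 4" using real_sqrt_le_iff [of ?N 4] by simp
  moreover have "2 * (1/W) * (1/W') * lor x y \<le> ?N" by simp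
  ultimately have "2 * (1/W) * (1/W') * lor x y \<le> 4" by linarith
  then show ?thesis using assms(4,5) by (simp add: field_simps)
qed

lemma lor_triangle:
  "x \<in> hyp \<Longrightarrow> y \<in> hyp \<Longrightarrow> z \<in> hyp \<Longrightarrow> lor x y \<le> 2 * lor x z * lor z y"
  using lor_combination_ge [of x y z "lor x z" "lor y z"] lor_pos [of x z] lor_pos [of y z]
  by (simp add: lor_sym [of z y])

subsection \<open>The Lorentz group\<close>

lemma mink_axis: "mink (axis i 1) y = (if i = None then - (y $ None) else y $ i)"
  by (cases i) (auto simp: mink_def axis_def if_distrib [of "\<lambda>x. x * _"] sum.delta cong: if_cong)

lemma SO_n1_inverse:
  assumes "A \<in> SO_n1"
  obtains B where "B \<in> SO_n1" "A ** B = mat 1" "B ** A = mat 1"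
proof -
  have "invertible A" using assms by (simp add: SO_n1_def invertible_det_nz)
  then obtain B where B: "A ** B = mat 1" "B ** A = mat 1" by (auto simp: invertible_def)
  have "det A * det B = 1" using B(1) by (metis det_I det_mul)
  then have "det B = 1" using assms by (simp add: SO_n1_def)
  moreover have "mink (B *v x) (B *v y) = mink x y" for x y
  proof -
    have "mink (A *v (B *v x)) (A *v (B *v y)) = mink (B *v x) (B *v y)"
      using assms by (simp add: SO_n1_def)
    then show ?thesis by (simp add: matrix_vector_mul_assoc B)
  qed
  ultimately show ?thesis using B that by (auto simp: SO_n1_def)
qed

lemma SO_n1_mult: "A \<in> SO_n1 \<Longrightarrow> B \<in> SO_n1 \<Longrightarrow> A ** B \<in> SO_n1"
  by (auto simp: SO_n1_def det_mul simp flip: matrix_vector_mul_assoc)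

lemma SO_n1_one: "mat 1 \<in> SO_n1"
  by (simp add: SO_n1_def)

lemma linear_matrix_mult_left: "linear (\<lambda>x. A ** (x :: real ^ 'm ^ 'k))" for A :: "real ^ 'k ^ 'l"
  by (intro linearI) (simp_all add: vec_eq_iff matrix_matrix_mult_def algebra_simps sum.distrib
     sum_distrib_left)

abbreviation lorc :: "'n::finite mat1 set" where
  "lorc \<equiv> carrier lorentz_group"

lemma lorc_eq: "lorc = connected_component_set SO_n1 (mat 1)"
  by (simp add: lorentz_group_def)

lemma lorc_subset: "lorc \<subseteq> SO_n1"
  by (simp add: lorc_eq connected_component_subset)

lemma lorc_one: "mat 1 \<in> lorc"
  by (simp add: lorc_eq SO_n1_one)

lemma connected_lorc: "connected lorc"
  by (simp add: lorc_eq)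

lemma lorc_maximal: "connected T \<Longrightarrow> T \<subseteq> SO_n1 \<Longrightarrow> mat 1 \<in> T \<Longrightarrow> T \<subseteq> lorc"
  unfolding lorc_eq by (rule connected_component_maximal)

lemma connected_translate: "connected T \<Longrightarrow> connected ((\<lambda>x. A ** x) ` T)"
  for A :: "'n::finite mat1"
  using connected_continuous_image linear_continuous_on linear_conv_bounded_linear
    linear_matrix_mult_left by blast

text \<open>The component and its left translate by \<open>A\<close> share the element
  \<open>A\<close>, so their union is connected and contains the identity.\<close>

lemma lorc_mult:
  assumes "A \<in> lorc" "B \<in> lorc" shows "A ** B \<in> lorc"
proof -
  have "connected (lorc \<union> (\<lambda>x. A ** x) ` lorc)"
  proof (intro connected_Un connected_lorc connected_translate)
    have "A ** mat 1 \<in> (\<lambda>x. A ** x) ` lorc" using lorc_one by blast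
    then show "lorc \<inter> (\<lambda>x. A ** x) ` lorc \<noteq> {}" using assms(1) by auto
  qed
  moreover have "lorc \<union> (\<lambda>x. A ** x) ` lorc \<subseteq> SO_n1"
    using lorc_subset assms by (auto intro: SO_n1_mult)
  ultimately show ?thesis using lorc_maximal lorc_one assms by blast
qed

text \<open>The translate of the component by \<open>B\<close> is connected and contains
  \<open>B ** A = mat 1\<close>; hence it stays inside the component, and it contains
  \<open>B ** mat 1\<close>.\<close>

lemma lorc_inverse:
  assumes "A \<in> lorc"
  obtains B where "B \<in> lorc" "A ** B = mat 1" "B ** A = mat 1"
proof -
  obtain B where B: "B \<in> SO_n1" "A ** B = mat 1" "B ** A = mat 1"
    using SO_n1_inverse assms lorc_subset by blast
  have "(\<lambda>x. B ** x) ` lorc \<subseteq> lorc"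
  proof (rule lorc_maximal)
    show "connected ((\<lambda>x. B ** x) ` lorc)" by (intro connected_translate connected_lorc)
    show "(\<lambda>x. B ** x) ` lorc \<subseteq> SO_n1" using lorc_subset B(1) by (auto intro: SO_n1_mult)
    show "mat 1 \<in> (\<lambda>x. B ** x) ` lorc" using B(3) assms by force
  qed
  moreover have "B ** mat 1 \<in> (\<lambda>x. B ** x) ` lorc" using lorc_one by blast
  ultimately have "B \<in> lorc" by auto
  then show ?thesis using B that by blast
qed

lemma group_lorentz: "group lorentz_group"
proof (rule groupI)
  show "\<exists>y\<in>carrier lorentz_group. y \<otimes>\<^bsub>lorentz_group\<^esub> x = \<one>\<^bsub>lorentz_group\<^esub>"
    if "x \<in> carrier lorentz_group" for x :: "'a mat1"
    using lorc_inverse [OF that] by (metis lorentz_group_def monoid.simps(1,2))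
qed (use lorc_mult lorc_one in \<open>auto simp: lorentz_group_def matrix_mul_assoc\<close>)

lemma lorc_mink: "g \<in> lorc \<Longrightarrow> mink (g *v x) (g *v y) = mink x y"
  using lorc_subset by (auto simp: SO_n1_def)

lemma lorc_lor: "g \<in> lorc \<Longrightarrow> lor (g *v x) (g *v y) = lor x y"
  by (simp add: lor_def lorc_mink)

text \<open>The time coordinate of the image of the origin has absolute value at least 1. By
  connectedness of the component it keeps the sign that it has at the identity.\<close>

lemma lorc_origin:
  assumes "g \<in> lorc" shows "g *v hyp_origin \<in> hyp"
proof -
  let ?f = "\<lambda>g :: 'a mat1. (g *v hyp_origin) $ None"
  have ge: "\<bar>?f h\<bar> \<ge> 1" if "h \<in> lorc" for h
  proof -
    have "mink (h *v hyp_origin) (h *v hyp_origin) = - 1"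
      using lorc_mink [OF that] mink_self_hyp [OF hyp_origin_in_hyp] by simp
    then have "(?f h)\<^sup>2 = 1 + space_part (h *v hyp_origin) \<bullet> space_part (h *v hyp_origin)"
      by (simp add: mink_space_part power2_eq_square)
    then have "(?f h)\<^sup>2 \<ge> 1\<^sup>2" by simp
    then show ?thesis by (metis abs_one abs_le_square_iff)
  qed
  have f: "?f h = h $ None $ None" for h
    by (simp add: matrix_vector_mult_def hyp_origin_def axis_def if_distrib cong: if_cong)
  have "connected (?f ` lorc)"
    unfolding f by (intro connected_continuous_image connected_lorc continuous_intros)
  moreover have "1 \<in> ?f ` lorc"
    by (rule image_eqI [OF _ lorc_one]) (simp add: hyp_origin_def)
  moreover have "0 \<notin> ?f ` lorc" using ge by force
  ultimately have "?f g > 0"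
    using assms unfolding connected_iff_interval
    by (metis (no_types, lifting) imageI linorder_not_less zero_le_one)
  then show ?thesis
    using lorc_mink [OF assms, of hyp_origin hyp_origin] mink_self_hyp [OF hyp_origin_in_hyp]
    by (simp add: hyp_def)
qed

text \<open>Otherwise \<open>- (g *v x)\<close> would be on the upper sheet, and its pairing with
  \<open>g *v hyp_origin\<close> would be both at least 1 and equal to the negative number
  \<open>- lor x hyp_origin\<close>.\<close>

lemma lorc_hyp:
  assumes "g \<in> lorc" "x \<in> hyp" shows "g *v x \<in> hyp"
proof (rule ccontr)
  assume not: "g *v x \<notin> hyp"
  let ?y = "- (g *v x)"
  have m: "mink (g *v x) (g *v x) = -1"
    using lorc_mink [OF assms(1)] mink_self_hyp [OF assms(2)] by simp
  then have "(g *v x) $ None \<noteq> 0"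
    using inner_ge_zero [of "space_part (g *v x)"] by (auto simp: mink_space_part simp del: inner_ge_zero)
  moreover have "mink ?y ?y = -1" using m by (simp add: mink_def)
  ultimately have "?y \<in> hyp" using not m by (auto simp: hyp_def)
  then have "1 \<le> lor ?y (g *v hyp_origin)" using lorc_origin assms lor_ge_1 by blast
  also have "\<dots> = - lor x hyp_origin"
    using lorc_lor [OF assms(1), of x hyp_origin] by (simp add: lor_def mink_def sum_negf)
  finally show False using lor_pos [of x hyp_origin] assms by simp
qed

lemma lorc_hyp_iff: assumes "g \<in> lorc" shows "g *v x \<in> hyp \<longleftrightarrow> x \<in> hyp"
proof -
  obtain h where h: "h \<in> lorc" "h ** g = mat 1" using lorc_inverse assms by metis
  then have "h *v (g *v x) = x" by (simp add: matrix_vector_mul_assoc)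
  then show ?thesis using lorc_hyp assms h by metis
qed

text \<open>The product of the point reflections in the origin and in the midpoint of the origin
  and \<open>x\<close>, that is, the translation along the geodesic from the origin to \<open>x\<close>.\<close>

definition boost :: "'n::finite vec1 \<Rightarrow> 'n vec1 \<Rightarrow> 'n vec1" where
  "boost x y = y + (mink (hyp_origin + x) y / (1 - mink hyp_origin x)) *\<^sub>R (hyp_origin + x)
     - (2 * mink hyp_origin y) *\<^sub>R x"

lemma linear_boost: "linear (boost x)"
  by (intro linearI) (simp_all add: boost_def mink_bilinear algebra_simps add_divide_distrib)

lemma boost_mink:
  assumes "x \<in> hyp" shows "mink (boost x y) (boost x z) = mink y z"
proof -
  define c where "c = 1 - mink hyp_origin x"
  have c: "c \<noteq> 0" using lor_pos [OF hyp_origin_in_hyp assms] by (simp add: c_def lor_def)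
  have ox: "mink hyp_origin x = 1 - c" "mink x hyp_origin = 1 - c"
    by (simp_all add: c_def mink_sym)
  have oo: "mink hyp_origin hyp_origin = -1" by (rule mink_self_hyp) simp
  have xx: "mink x x = -1" using assms by (simp add: hyp_def)
  have s: "mink y hyp_origin = mink hyp_origin y" "mink y x = mink x y" by (simp_all add: mink_sym)
  show ?thesis
    unfolding boost_def c_def [symmetric] using c
    by (simp add: mink_bilinear ox oo xx s) (simp add: field_simps)
qed

lemma boost_origin: assumes "x \<in> hyp" shows "boost x hyp_origin = x"
proof -
  have oo: "mink hyp_origin hyp_origin = -1" by (rule mink_self_hyp) simp
  have c: "1 - mink hyp_origin x \<noteq> 0" using lor_pos [OF hyp_origin_in_hyp assms] by (simp add: lor_def)
  have "mink (hyp_origin + x) hyp_origin / (1 - mink hyp_origin x) = -1"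
    using c by (simp add: mink_bilinear oo mink_sym [of x] field_simps)
  then show ?thesis by (simp add: boost_def oo scaleR_2)
qed

lemma boost_at_origin: "boost hyp_origin y = y"
proof -
  have oo: "mink hyp_origin hyp_origin = -1" by (rule mink_self_hyp) simp
  show ?thesis by (simp add: boost_def oo mink_bilinear algebra_simps flip: scaleR_2)
qed

definition mink_matrix :: "'n::finite mat1" where
  "mink_matrix = (\<chi> i j. if i = j then (if i = None then -1 else 1) else 0)"

lemma mink_matrix_vector: "mink_matrix *v y = (\<chi> i. (if i = None then -1 else 1) * y $ i)"
  by (simp add: mink_matrix_def matrix_vector_mult_def if_distrib [of "\<lambda>a. a * _"] cong: if_cong)

lemma mink_eq_inner: "mink x y = x \<bullet> (mink_matrix *v y)"
proof -
  have U: "(UNIV :: 'a option set) = insert None (range Some)" by (rule UNIV_option_conv)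
  show ?thesis
    unfolding mink_matrix_vector inner_vec_def by (subst U) (simp add: mink_def sum.reindex)
qed

lemma mink_matrix_square: "mink_matrix ** mink_matrix = mat 1"
  unfolding matrix_eq by (simp add: mink_matrix_vector vec_eq_iff flip: matrix_vector_mul_assoc)

lemma mink_isometry_gram:
  assumes "\<And>x y. mink (A *v x) (A *v y) = mink x y"
  shows "transpose A ** mink_matrix ** A = mink_matrix"
proof -
  have "x \<bullet> ((transpose A ** mink_matrix ** A) *v y) = x \<bullet> (mink_matrix *v y)" for x y
    using assms [of x y] unfolding mink_eq_inner
    by (simp add: dot_lmul_matrix transpose_transpose flip: matrix_vector_mul_assoc)
      (metis dot_lmul_matrix transpose_matrix_vector transpose_transpose)
  then show ?thesis unfolding matrix_eq by (metis vector_eq_ldot)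
qed

text \<open>Stated for an arbitrary index type because it is applied both to Lorentz matrices and to
  their reindexed copies.\<close>

lemma det_square_of_gram:
  fixes A J :: "real ^ 'k::finite ^ 'k"
  assumes "transpose A ** J ** A = J" "J ** J = mat 1"
  shows "(det A)\<^sup>2 = 1"
proof -
  have "det A * det J * det A = det J" using assms(1) by (metis det_mul det_transpose)
  moreover have "det J * det J = 1" using assms(2) by (metis det_I det_mul)
  ultimately show ?thesis
    by (metis (no_types, lifting) mult.commute mult.left_commute mult.right_neutral power2_eq_square)
qed

lemma boost_matrix: "matrix (boost x) *v y = boost x y"
  by (metis linear_boost matrix_vector_mul)

lemma continuous_on_det:
  fixes f :: "'a::topological_space \<Rightarrow> real ^ 'n ^ 'n"
  assumes "continuous_on S f" shows "continuous_on S (\<lambda>x. det (f x))"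
proof -
  have "continuous_on S (\<lambda>x. f x $ i $ j)" for i j
    by (rule continuous_on_component [OF continuous_on_component [OF assms]])
  then have "continuous_on S (\<lambda>x. of_int (sign p) * (\<Prod>i\<in>UNIV. f x $ i $ p i))" for p
    by (intro continuous_on_mult_left continuous_on_prod)
  then show ?thesis
    unfolding det_def by (rule continuous_on_sum)
qed

text \<open>The boosts form a continuous image of the chart, with the identity at 0. Their
  determinants are \<open>1\<close> or \<open>-1\<close>, hence constantly 1 by connectedness, and
  the whole family lies in the identity component.\<close>

lemma boost_in_lorc: assumes "x \<in> hyp" shows "matrix (boost x) \<in> lorc"
proof -
  let ?F = "\<lambda>v. matrix (boost (hyp_chart v)) :: 'a mat1"
  have "continuous_on UNIV (\<lambda>v. boost (hyp_chart v) y)" for y :: "'a vec1"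
  proof -
    have 1: "1 - mink hyp_origin (hyp_chart v) \<noteq> 0" for v :: "real ^ 'a"
      using lor_pos [OF hyp_origin_in_hyp hyp_chart_in_hyp, of v] by (simp add: lor_def)
    have m: "mink a b = - lor a b" for a b :: "'a vec1" by (simp add: lor_def)
    show ?thesis unfolding boost_def
      by (intro continuous_intros; use 1 in \<open>auto simp: m intro!: continuous_intros\<close>)
  qed
  then have cont: "continuous_on UNIV ?F"
    unfolding matrix_def by (intro continuous_on_vec_lambda continuous_on_component)
  have sq: "(det (?F v))\<^sup>2 = 1" for v
    by (intro det_square_of_gram [OF mink_isometry_gram mink_matrix_square]) (simp add: boost_matrix boost_mink [OF hyp_chart_in_hyp])
  have F0: "?F 0 = mat 1"
    by (simp only: matrix_eq boost_matrix hyp_chart_0 boost_at_origin matrix_vector_mul_lid simp_thms)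
  define d where "d v = det (?F v)" for v
  have "continuous_on UNIV d"
    unfolding d_def by (rule continuous_on_det [OF cont])
  then have conn: "connected (range d)"
    using connected_continuous_image connected_UNIV by blast
  have d1: "d 0 = 1" by (simp only: d_def F0 det_I)
  have d: "d v = 1 \<or> d v = -1" for v
    using sq [of v] unfolding d_def [symmetric] by (simp only: power2_eq_1_iff)
  have "d v \<noteq> -1" for v
  proof
    assume v: "d v = -1"
    have "-1 \<in> range d" "1 \<in> range d" using v d1 by (metis rangeI)+
    then have "0 \<in> range d"
      using conn unfolding connected_iff_interval by (metis neg_le_0_iff_le zero_le_one)
    then show False using d by (metis imageE neg_equal_0_iff_equal zero_neq_one)
  qed
  then have "det (?F v) = 1" for v
    using d unfolding d_def [symmetric] by blast
  then have "range ?F \<subseteq> SO_n1" by (auto simp: SO_n1_def boost_matrix boost_mink)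
  moreover have "connected (range ?F)"
    by (intro connected_continuous_image connected_UNIV cont)
  moreover have "mat 1 \<in> range ?F" unfolding F0 [symmetric] by (rule rangeI)
  ultimately have "range ?F \<subseteq> lorc" by (intro lorc_maximal)
  then have "?F (space_part x) \<in> lorc" by blast
  then show ?thesis using hyp_eq_chart [OF assms] by simp
qed

lemma lorc_transitive_origin:
  assumes "x \<in> hyp" obtains g where "g \<in> lorc" "g *v hyp_origin = x"
proof
  show "matrix (boost x) \<in> lorc" by (rule boost_in_lorc [OF assms])
  show "matrix (boost x) *v hyp_origin = x"
    by (simp only: boost_matrix boost_origin [OF assms])
qed

lemma lorc_transitive:
  assumes "x \<in> hyp" "y \<in> hyp" obtains g where "g \<in> lorc" "g *v x = y"
proof -
  obtain g where g: "g \<in> lorc" "g *v hyp_origin = x" using lorc_transitive_origin assms by blast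
  obtain h where h: "h \<in> lorc" "h *v hyp_origin = y" using lorc_transitive_origin assms by blast
  obtain k where k: "k \<in> lorc" "k ** g = mat 1" using lorc_inverse g by metis
  have "(h ** k) *v x = y"
  proof -
    have "(h ** k) *v x = h *v ((k ** g) *v hyp_origin)"
      by (simp only: g(2) [symmetric] matrix_vector_mul_assoc matrix_mul_assoc)
    then show ?thesis by (simp only: k h matrix_vector_mul_lid)
  qed
  then show ?thesis using lorc_mult h k that by blast
qed

subsection \<open>Hyperbolic volume\<close>

lemma Basis_cart: "(Basis :: (real ^ 'k::finite) set) = range (\<lambda>i. axis i 1)"
  by (auto simp: Basis_vec_def)

lemma prod_Basis_cart: "prod ((\<bullet>) x) Basis = (\<Prod>i\<in>UNIV. (x :: real ^ 'k::finite) $ i)"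
proof -
  have "inj (\<lambda>i :: 'k. axis i (1::real))"
    by (auto simp: inj_on_def axis_eq_axis)
  then show ?thesis
    unfolding Basis_cart by (simp add: prod.reindex inner_axis)
qed

lemma measurable_space_part [measurable]: "space_part \<in> borel_measurable borel"
  by (intro borel_measurable_continuous_onI continuous_intros)

lemma measurable_hyp_chart [measurable]: "hyp_chart \<in> borel_measurable borel"
  by (intro borel_measurable_continuous_onI continuous_intros)

lemma continuous_on_mkvec [continuous_intros]:
  "continuous_on S f \<Longrightarrow> continuous_on S g \<Longrightarrow> continuous_on S (\<lambda>x. mkvec (f x) (g x))"
  unfolding mkvec_def
proof (rule continuous_on_vec_lambda)
  fix k :: "'b option"
  assume "continuous_on S f" "continuous_on S g"
  then show "continuous_on S (\<lambda>x. case k of None \<Rightarrow> f x | Some i \<Rightarrow> g x $ i)"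
    by (cases k) (auto intro!: continuous_intros)
qed

lemma measurable_mkvec [measurable]:
  assumes [measurable]: "f \<in> borel_measurable M" "g \<in> borel_measurable M"
  shows "(\<lambda>x. mkvec (f x) (g x)) \<in> borel_measurable M"
proof -
  have "(\<lambda>p. mkvec (fst p) (snd p)) \<in> borel_measurable borel"
    by (intro borel_measurable_continuous_onI continuous_intros)
  then have *: "(\<lambda>p. mkvec (fst p) (snd p)) \<in> borel_measurable (borel \<Otimes>\<^sub>M borel)"
    by (simp add: borel_prod)
  have "(\<lambda>x. (\<lambda>p. mkvec (fst p) (snd p)) (f x, g x)) \<in> borel_measurable M"
    by (rule measurable_compose [OF _ *]) measurable
  then show ?thesis by simp
qed

lemma hyp_in_borel [measurable]: "hyp \<in> sets borel"
  by (simp add: closed_hyp)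

lemma partial_hyp_chart:
  "partial i hyp_chart v = mkvec (v $ i / sqrt (1 + v \<bullet> v)) (axis i 1)"
proof -
  have pos: "0 < 1 + v \<bullet> v" by (simp add: add_pos_nonneg)
  \<comment> \<open>Only the time coordinate is nonlinear in \<open>t\<close>. It is split off along
    \<open>axis None 1\<close>, so that a single square root remains to be differentiated.\<close>
  have *: "hyp_chart (v + t *\<^sub>R axis i 1) = sqrt (1 + (v + t *\<^sub>R axis i 1) \<bullet> (v + t *\<^sub>R axis i 1)) *\<^sub>R axis None 1
      + (mkvec 0 v + t *\<^sub>R mkvec 0 (axis i 1))" for t
    by (simp add: hyp_chart_mkvec vec1_eq_iff axis_def)
  have q: "(v + t *\<^sub>R axis i 1) \<bullet> (v + t *\<^sub>R axis i 1) = v \<bullet> v + 2 * t * v $ i + t\<^sup>2" for t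
    
    by (simp only: inner_add_left inner_add_right inner_scaleR_left inner_scaleR_right inner_axis inner_axis'
      inner_axis_axis) (simp add: power2_eq_square distrib_left)
  have sq: "((\<lambda>t. sqrt (1 + (v \<bullet> v + 2 * t * v $ i + t\<^sup>2))) has_real_derivative v $ i / sqrt (1 + v \<bullet> v)) (at 0)"
  proof -
    let ?g = "\<lambda>t. 1 + (v \<bullet> v + 2 * t * v $ i + t\<^sup>2)"
    have 1: "(?g has_real_derivative 2 * v $ i) (at 0)"
      by (auto intro!: derivative_eq_intros)
    have 2: "(sqrt has_real_derivative inverse (sqrt (1 + v \<bullet> v)) / 2) (at (?g 0))"
    proof -
      have "?g 0 = 1 + v \<bullet> v" by simp
      then show ?thesis using DERIV_real_sqrt [OF pos] by (simp only:)
    qed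
    show ?thesis
      by (rule DERIV_cong [OF DERIV_chain2 [where g = ?g, OF 2 1]]) (simp add: inverse_eq_divide)
  qed
  have d1: "((\<lambda>t. sqrt (1 + (v \<bullet> v + 2 * t * v $ i + t\<^sup>2)) *\<^sub>R axis None (1::real)) has_vector_derivative
      (v $ i / sqrt (1 + v \<bullet> v)) *\<^sub>R (axis None 1 :: 'a vec1)) (at 0)"
    using has_vector_derivative_scaleR [OF sq has_vector_derivative_const] by simp
  have d2: "((\<lambda>t. t *\<^sub>R mkvec 0 (axis i 1)) has_vector_derivative mkvec 0 (axis i (1::real))) (at 0)"
    using has_vector_derivative_scaleR [OF DERIV_ident has_vector_derivative_const] by simp
  have "((\<lambda>t. hyp_chart (v + t *\<^sub>R axis i 1)) has_vector_derivative
      (v $ i / sqrt (1 + v \<bullet> v)) *\<^sub>R axis None 1 + (0 + mkvec 0 (axis i 1))) (at 0)"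
    unfolding * q by (intro has_vector_derivative_add has_vector_derivative_const d1 d2)
  then have "partial i hyp_chart v = (v $ i / sqrt (1 + v \<bullet> v)) *\<^sub>R axis None 1 + (0 + mkvec 0 (axis i 1))"
    unfolding partial_def by (rule vector_derivative_at)
  then show ?thesis by (simp add: vec1_eq_iff axis_def)
qed

lemma hyp_metric_eq: "hyp_metric v $ i $ j = (if i = j then 1 else 0) - v $ i * v $ j / (1 + v \<bullet> v)"
proof -
  have "sqrt (1 + v \<bullet> v) * sqrt (1 + v \<bullet> v) = 1 + v \<bullet> v"
    by (simp add: add_nonneg_nonneg)
  then show ?thesis
    by (simp add: hyp_metric_def partial_hyp_chart mink_space_part inner_axis_axis)
qed

lemma one_minus_rank_one_vector:
  "((\<chi> i j. (if i = j then 1 else 0) - c * (v $ i * v $ j)) :: real ^ 'n ^ 'n) *v x = x - (c * (v \<bullet> x)) *\<^sub>R v"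
  for v :: "real ^ 'n::finite"
proof -
  have "(((\<chi> i j. (if i = j then 1 else 0) - c * (v $ i * v $ j)) :: real ^ 'n ^ 'n) *v x) $ i = x $ i - (c * v $ i) * (v \<bullet> x)" for i
  proof -
    have "(((\<chi> i j. (if i = j then 1 else 0) - c * (v $ i * v $ j)) :: real ^ 'n ^ 'n) *v x) $ i
        = (\<Sum>j\<in>UNIV. (if i = j then x $ j else 0) - (c * v $ i) * (v $ j * x $ j))"
      unfolding matrix_vector_mult_def by (simp, intro sum.cong refl) (simp add: left_diff_distrib)
    also have "\<dots> = x $ i - (c * v $ i) * (\<Sum>j\<in>UNIV. v $ j * x $ j)"
      by (simp only: sum_subtractf sum_distrib_left [symmetric]) simp
    finally show ?thesis by (simp add: inner_vec_def)
  qed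
  then show ?thesis by (simp add: vec_eq_iff)
qed

text \<open>A rotation takes \<open>v\<close> to a multiple of a coordinate axis; conjugation by it
  turns the matrix into a diagonal one with a single entry different from 1.\<close>

lemma det_one_minus_rank_one:
  fixes v :: "real ^ 'n::finite"
  shows "det (\<chi> i j. (if i = j then 1 else 0) - c * (v $ i * v $ j)) = 1 - c * (v \<bullet> v)"
proof -
  define k :: 'n where "k = undefined"
  obtain f where f: "orthogonal_transformation f" "f v = norm v *\<^sub>R axis k (1::real)"
    using orthogonal_transformation_exists [of v "norm v *\<^sub>R axis k 1"] by auto
  define R where "R = matrix f"
  have R: "orthogonal_matrix R"
    using f(1) by (simp add: R_def orthogonal_transformation_matrix)
  have Rv: "R *v v = norm v *\<^sub>R axis k 1"
    using f matrix_vector_mul by (metis R_def orthogonal_transformation_def)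
  let ?M = "(\<chi> i j. (if i = j then 1 else 0) - c * (v $ i * v $ j)) :: real ^ 'n ^ 'n"
  let ?D = "(\<chi> i j. (if i = j then (if i = k then 1 - c * (v \<bullet> v) else 1) else 0)) :: real ^ 'n ^ 'n"
  have Mx: "?M *v x = x - (c * (v \<bullet> x)) *\<^sub>R v" for x
    by (rule one_minus_rank_one_vector)
  have vR: "v \<bullet> (transpose R *v x) = norm v * x $ k" for x
  proof -
    have "v \<bullet> (transpose R *v x) = (x v* R) \<bullet> v"
      by (simp add: transpose_matrix_vector inner_commute)
    also have "\<dots> = x \<bullet> (R *v v)" by (rule dot_lmul_matrix)
    finally show ?thesis by (simp add: Rv inner_axis)
  qed
  have RR: "R ** transpose R = mat 1" using R by (simp add: orthogonal_matrix_def)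
  have "(R ** ?M ** transpose R) *v x = ?D *v x" for x
  proof -
    have "(R ** ?M ** transpose R) *v x = R *v (?M *v (transpose R *v x))"
      by (simp only: matrix_vector_mul_assoc matrix_mul_assoc)
    also have "\<dots> = R *v (transpose R *v x) - (c * (norm v * x $ k)) *\<^sub>R (R *v v)"
      unfolding Mx vR by (simp add: matrix_vector_mult_diff_distrib matrix_vector_mult_scaleR)
    also have "\<dots> = x - (c * (norm v * x $ k)) *\<^sub>R (norm v *\<^sub>R axis k 1)"
      by (simp only: matrix_vector_mul_assoc RR matrix_vector_mul_lid Rv)
    also have "\<dots> = ?D *v x"
    proof -
      have n: "v \<bullet> v = norm v * norm v" by (simp add: dot_square_norm power2_eq_square)
      have D: "(?D *v x) $ i = (if i = k then 1 - c * (v \<bullet> v) else 1) * x $ i" for i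
        by (simp add: matrix_vector_mult_def if_distrib [of "\<lambda>a. a * _"] cong: if_cong)
      show ?thesis
        unfolding vec_eq_iff D by (simp add: axis_def n left_diff_distrib)
    qed
    finally show ?thesis .
  qed
  then have "R ** ?M ** transpose R = ?D" unfolding matrix_eq by blast
  then have eq: "det (R ** ?M ** transpose R) = det ?D" by (rule arg_cong)
  have one: "det R * det (transpose R) = 1" using arg_cong [OF RR, of det] by (simp only: det_mul det_I)
  have "det ?M = (det R * det (transpose R)) * det ?M" unfolding one by simp
  also have "\<dots> = det (R ** ?M ** transpose R)" by (simp only: det_mul mult_ac)
  also have "\<dots> = det ?D" by (rule eq)
  also have "det ?D = (\<Prod>i\<in>UNIV. if i = k then 1 - c * (v \<bullet> v) else 1)"
    by (subst det_diagonal) auto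
  also have "\<dots> = 1 - c * (v \<bullet> v)" by simp
  finally show ?thesis .
qed

lemma hyp_density_eq: "hyp_density v = 1 / sqrt (1 + v \<bullet> v)"
proof -
  have pos: "0 < 1 + v \<bullet> v" by (simp add: add_pos_nonneg)
  have "hyp_metric v = (\<chi> i j. (if i = j then 1 else 0) - (1 / (1 + v \<bullet> v)) * (v $ i * v $ j))"
    by (simp add: vec_eq_iff hyp_metric_eq)
  then have "det (hyp_metric v) = 1 - (1 / (1 + v \<bullet> v)) * (v \<bullet> v)"
    by (simp only: det_one_minus_rank_one)
  also have "\<dots> = 1 / (1 + v \<bullet> v)" using pos by (simp add: field_simps)
  finally show ?thesis by (simp add: hyp_density_def real_sqrt_divide)
qed

lemma hyp_density_pos: "hyp_density v > 0"
  by (simp add: hyp_density_eq add_pos_nonneg)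

lemma continuous_on_hyp_density [continuous_intros]: "continuous_on S hyp_density"
  unfolding hyp_density_eq [abs_def]
  by (intro continuous_intros) (metis add_pos_nonneg inner_ge_zero less_irrefl real_sqrt_eq_zero_cancel_iff zero_less_one)

lemma measurable_hyp_density [measurable]: "hyp_density \<in> borel_measurable borel"
  by (intro borel_measurable_continuous_onI continuous_intros)

lemma sets_hyp_vol [measurable_cong, simp]: "sets hyp_vol = sets borel"
  by (simp add: hyp_vol_def)

lemma space_hyp_vol [simp]: "space hyp_vol = UNIV"
  by (simp add: hyp_vol_def)

lemma nn_integral_hyp_vol:
  assumes [measurable]: "f \<in> borel_measurable borel"
  shows "(\<integral>\<^sup>+x. f x \<partial>hyp_vol) = (\<integral>\<^sup>+v. ennreal (hyp_density v) * f (hyp_chart v) \<partial>lborel)"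
  unfolding hyp_vol_def by (simp add: nn_integral_distr nn_integral_density)

lemma integral_hyp_vol:
  fixes f :: "'n::finite vec1 \<Rightarrow> 'b::{banach, second_countable_topology}"
  assumes [measurable]: "f \<in> borel_measurable borel"
  shows "(\<integral>x. f x \<partial>hyp_vol) = (\<integral>v. hyp_density v *\<^sub>R f (hyp_chart v) \<partial>lborel)"
  unfolding hyp_vol_def
  by (subst integral_distr, simp, measurable)
    (subst integral_density, auto intro!: AE_I2 less_imp_le hyp_density_pos)

lemma AE_hyp: "AE x in hyp_vol. x \<in> hyp"
  unfolding hyp_vol_def by (simp add: AE_distr_iff AE_density)

lemma lborel_mkvec: "lborel = distr (lborel \<Otimes>\<^sub>M lborel) borel (\<lambda>(t, v :: real ^ 'n::finite). mkvec t v)"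
proof (rule lborel_eqI)
  fix l u :: "'n vec1"
  assume le: "\<And>b. b \<in> Basis \<Longrightarrow> l \<bullet> b \<le> u \<bullet> b"
  have le': "l $ i \<le> u $ i" for i
    using le [of "axis i 1"] by (simp add: Basis_cart inner_axis)
  have box: "(\<lambda>(t, v). mkvec t v) -` box l u = box (l $ None) (u $ None) \<times> box (space_part l) (space_part u)"
  proof -
    have all: "(\<forall>k. P k) \<longleftrightarrow> P None \<and> (\<forall>i. P (Some i))" for P :: "'n option \<Rightarrow> bool"
      by (metis option.exhaust)
    have "mkvec t v \<in> box l u \<longleftrightarrow> (l $ None < t \<and> t < u $ None) \<and> v \<in> box (space_part l) (space_part u)" for t v
      unfolding mem_box_cart all [of "\<lambda>k. l $ k < mkvec t v $ k \<and> mkvec t v $ k < u $ k"] by simp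
    then show ?thesis by (auto simp: box_real)
  qed
  have m: "(\<lambda>(t, v :: real ^ 'n). mkvec t v) \<in> borel_measurable (lborel \<Otimes>\<^sub>M lborel)"
    by measurable
  have "emeasure (distr (lborel \<Otimes>\<^sub>M lborel) borel (\<lambda>(t, v). mkvec t v)) (box l u)
      = emeasure (lborel \<Otimes>\<^sub>M lborel) (box (l $ None) (u $ None) \<times> box (space_part l) (space_part u))"
    using m by (simp add: emeasure_distr box space_pair_measure)
  also have "\<dots> = emeasure lborel (box (l $ None) (u $ None)) * emeasure lborel (box (space_part l) (space_part u))"
    by (intro lborel.emeasure_pair_measure_Times) auto
  also have "\<dots> = ennreal (u $ None - l $ None) * ennreal (\<Prod>i\<in>UNIV. (space_part u - space_part l) $ i)"
  proof -
    have "emeasure lborel (box (space_part l) (space_part u)) = ennreal (prod ((\<bullet>) (space_part u - space_part l)) Basis)"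
      by (rule emeasure_lborel_box) (use le' in \<open>auto simp: Basis_cart inner_axis\<close>)
    then show ?thesis using le' by (simp add: prod_Basis_cart)
  qed
  also have "\<dots> = ennreal ((u $ None - l $ None) * (\<Prod>i\<in>UNIV. (space_part u - space_part l) $ i))"
    using le' by (simp add: ennreal_mult prod_nonneg)
  also have "(u $ None - l $ None) * (\<Prod>i\<in>UNIV. (space_part u - space_part l) $ i) = prod ((\<bullet>) (u - l)) Basis"
    unfolding prod_Basis_cart UNIV_option_conv by (simp add: prod.reindex)
  finally show "emeasure (distr (lborel \<Otimes>\<^sub>M lborel) borel (\<lambda>(t, v). mkvec t v)) (box l u) = \<dots>" .
qed simp

lemma nn_integral_lborel_scale:
  fixes f :: "'a::euclidean_space \<Rightarrow> ennreal"
  assumes [measurable]: "f \<in> borel_measurable borel" and "c > 0"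
  shows "(\<integral>\<^sup>+x. f x \<partial>lborel) = ennreal (c ^ DIM('a)) * (\<integral>\<^sup>+x. f (c *\<^sub>R x) \<partial>lborel)"
  using assms(2)
  by (subst lborel_affine [of c 0]) (simp_all add: nn_integral_density nn_integral_distr nn_integral_cmult)

definition hproj :: "'n::finite vec1 \<Rightarrow> 'n vec1" where
  "hproj x = (1 / sqrt (lor x x)) *\<^sub>R x"

text \<open>The solid cone over the hyperboloid, cut off at \<open>lor x x = 1\<close>. Lebesgue
  measure on it splits into a radial factor and hyperbolic volume, which reduces the Lorentz
  invariance of \<open>hyp_vol\<close> to that of Lebesgue measure.\<close>

definition hcone :: "'n::finite vec1 set" where
  "hcone = {x. 0 < lor x x \<and> lor x x \<le> 1 \<and> hproj x \<in> hyp}"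

lemma measurable_hproj [measurable]: "hproj \<in> borel_measurable borel"
  unfolding hproj_def by measurable

lemma hcone_in_borel [measurable]: "hcone \<in> sets borel"
  unfolding hcone_def by measurable

lemma mkvec_in_hcone:
  assumes "mkvec t v \<in> hcone" shows "norm v \<le> t" "t \<le> sqrt ((norm v)\<^sup>2 + 1)"
proof -
  have l: "lor (mkvec t v) (mkvec t v) = t\<^sup>2 - (norm v)\<^sup>2"
    by (simp add: lor_def mink_space_part dot_square_norm power2_eq_square)
  have "t > 0"
    using assms by (auto simp: hcone_def hproj_def hyp_def zero_less_divide_iff)
  have "0 < lor (mkvec t v) (mkvec t v)" "lor (mkvec t v) (mkvec t v) \<le> 1"
    using assms by (simp_all only: hcone_def mem_Collect_eq)
  then have "(norm v)\<^sup>2 < t\<^sup>2" "t\<^sup>2 \<le> (norm v)\<^sup>2 + 1"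
    unfolding l by linarith+
  then show "norm v \<le> t" "t \<le> sqrt ((norm v)\<^sup>2 + 1)"
    using \<open>t > 0\<close> by (meson power2_le_imp_le real_le_rsqrt less_imp_le)+
qed

text \<open>The radial coordinate \<open>\<tau>\<close> is the square root of
  \<open>lor x x\<close>. For a fixed space part \<open>v\<close> it parametrizes the points of the
  cone above \<open>v\<close>.\<close>

lemma mkvec_hcone_polar:
  assumes "\<tau> > 0" "\<tau> \<le> 1"
  shows "mkvec (sqrt ((norm v)\<^sup>2 + \<tau>\<^sup>2)) v \<in> hcone"
    and "hproj (mkvec (sqrt ((norm v)\<^sup>2 + \<tau>\<^sup>2)) v) = hyp_chart ((1 / \<tau>) *\<^sub>R v)"
proof -
  let ?x = "mkvec (sqrt ((norm v)\<^sup>2 + \<tau>\<^sup>2)) v"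
  have l: "lor ?x ?x = \<tau>\<^sup>2"
    by (simp add: lor_def mink_space_part dot_square_norm add_nonneg_nonneg)
  have "sqrt ((norm v)\<^sup>2 + \<tau>\<^sup>2) = sqrt (\<tau>\<^sup>2 * (1 + ((1 / \<tau>) *\<^sub>R v) \<bullet> ((1 / \<tau>) *\<^sub>R v)))"
    using assms by (simp add: dot_square_norm field_simps)
  also have "\<dots> = \<tau> * sqrt (1 + ((1 / \<tau>) *\<^sub>R v) \<bullet> ((1 / \<tau>) *\<^sub>R v))"
    using assms by (simp add: real_sqrt_mult)
  finally have eq: "sqrt ((norm v)\<^sup>2 + \<tau>\<^sup>2) / \<tau> = sqrt (1 + ((1 / \<tau>) *\<^sub>R v) \<bullet> ((1 / \<tau>) *\<^sub>R v))"
    using assms by simp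
  have "hproj ?x = (1 / \<tau>) *\<^sub>R ?x" using assms by (simp only: hproj_def l) simp
  then show *: "hproj ?x = hyp_chart ((1 / \<tau>) *\<^sub>R v)"
    unfolding hyp_chart_mkvec eq [symmetric] by (simp add: vec1_eq_iff)
  show "?x \<in> hcone" unfolding hcone_def mem_Collect_eq l * using assms by (simp add: power_le_one)
qed

text \<open>For fixed \<open>v\<close> the time coordinate is replaced by \<open>\<tau>\<close>,
  which produces the factor \<open>\<tau> / sqrt ((norm v)\<^sup>2 + \<tau>\<^sup>2)\<close>. After
  exchanging the integrals, scaling \<open>v\<close> by \<open>\<tau>\<close> turns this factor into
  \<open>hyp_density\<close> and contributes the power of \<open>\<tau>\<close>.\<close>

lemma nn_integral_hcone:
  fixes f :: "'n::finite vec1 \<Rightarrow> ennreal"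
  assumes [measurable]: "f \<in> borel_measurable borel"
  shows "(\<integral>\<^sup>+x. f (hproj x) * indicator hcone x \<partial>lborel)
    = (\<integral>\<^sup>+\<tau>. ennreal (\<tau> ^ CARD('n)) * indicator {0<..1} \<tau> \<partial>lborel) * (\<integral>\<^sup>+x. f x \<partial>hyp_vol)"
proof -
  define F where "F t v = f (hproj (mkvec t v)) * indicator hcone (mkvec t v)" for t and v :: "real ^ 'n"
  have [measurable]: "(\<lambda>x. F (fst x) (snd x)) \<in> borel_measurable (lborel \<Otimes>\<^sub>M lborel)"
    unfolding F_def by measurable
  have "(\<integral>\<^sup>+x. f (hproj x) * indicator hcone x \<partial>lborel) = (\<integral>\<^sup>+p. F (fst p) (snd p) \<partial>(lborel \<Otimes>\<^sub>M lborel))"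
    unfolding lborel_mkvec F_def by (subst nn_integral_distr) (auto simp: case_prod_beta)
  also have "\<dots> = (\<integral>\<^sup>+v. \<integral>\<^sup>+t. F t v \<partial>lborel \<partial>lborel)"
    by (subst lborel_pair.nn_integral_snd [symmetric]) auto
  also have "\<dots> = (\<integral>\<^sup>+v. \<integral>\<^sup>+\<tau>. f (hyp_chart ((1 / \<tau>) *\<^sub>R v)) * ennreal (\<tau> / sqrt ((norm v)\<^sup>2 + \<tau>\<^sup>2))
      * indicator {0<..1} \<tau> \<partial>lborel \<partial>lborel)"
  proof (rule nn_integral_cong_AE, rule AE_mp [OF AE_lborel_singleton [of 0]], intro AE_I2 impI)
    \<comment> \<open>The null set \<open>v = 0\<close> is left out because there \<open>g\<close>
      vanishes at \<open>\<tau> = 0\<close>, where \<open>\<tau> / g \<tau>\<close> is not its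
      derivative.\<close>
    fix v :: "real ^ 'n" assume v: "v \<noteq> 0"
    define g where "g \<tau> = sqrt ((norm v)\<^sup>2 + \<tau>\<^sup>2)" for \<tau>
    have pos: "(norm v)\<^sup>2 + \<tau>\<^sup>2 > 0" for \<tau> using v by (simp add: add_pos_nonneg)
    have g0: "g 0 = norm v" by (simp add: g_def)
    have g1: "g 1 = sqrt ((norm v)\<^sup>2 + 1)" by (simp add: g_def)
    have "(\<integral>\<^sup>+t. F t v \<partial>lborel) = (\<integral>\<^sup>+t. F t v * indicator {g 0..g 1} t \<partial>lborel)"
      by (intro nn_integral_cong) (auto simp: F_def g0 g1 mkvec_in_hcone split: split_indicator)
    also have "\<dots> = (\<integral>\<^sup>+\<tau>. F (g \<tau>) v * ennreal (\<tau> / g \<tau>) * indicator {0..1} \<tau> \<partial>lborel)"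
    proof (rule nn_integral_substitution_aux)
      show "(\<lambda>t. F t v) \<in> borel_measurable borel" unfolding F_def by measurable
      show "(g has_real_derivative \<tau> / g \<tau>) (at \<tau>)" for \<tau>
        unfolding g_def using pos [of \<tau>] by (auto intro!: derivative_eq_intros simp: field_simps)
      show "continuous_on {0..1} (\<lambda>\<tau>. \<tau> / g \<tau>)"
        unfolding g_def using pos by (auto intro!: continuous_intros simp: less_imp_neq [symmetric])
    qed (auto simp: g_def)
    also have "\<dots> = (\<integral>\<^sup>+\<tau>. f (hyp_chart ((1 / \<tau>) *\<^sub>R v)) * ennreal (\<tau> / sqrt ((norm v)\<^sup>2 + \<tau>\<^sup>2))
        * indicator {0<..1} \<tau> \<partial>lborel)"
      by (intro nn_integral_cong) (auto simp: F_def g_def mkvec_hcone_polar split: split_indicator)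
    finally show "(\<integral>\<^sup>+t. F t v \<partial>lborel) = \<dots>" .
  qed
  also have "\<dots> = (\<integral>\<^sup>+\<tau>. \<integral>\<^sup>+v. f (hyp_chart ((1 / \<tau>) *\<^sub>R v)) * ennreal (\<tau> / sqrt ((norm v)\<^sup>2 + \<tau>\<^sup>2))
      * indicator {0<..1} \<tau> \<partial>lborel \<partial>lborel)"
    by (rule lborel_pair.Fubini') measurable
  also have "\<dots> = (\<integral>\<^sup>+\<tau>. (ennreal (\<tau> ^ CARD('n)) * indicator {0<..1} \<tau>) * (\<integral>\<^sup>+x. f x \<partial>hyp_vol) \<partial>lborel)"
  proof (intro nn_integral_cong)
    fix \<tau> :: real
    show "(\<integral>\<^sup>+v. f (hyp_chart ((1 / \<tau>) *\<^sub>R v)) * ennreal (\<tau> / sqrt ((norm v)\<^sup>2 + \<tau>\<^sup>2))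
        * indicator {0<..1} \<tau> \<partial>lborel) = (ennreal (\<tau> ^ CARD('n)) * indicator {0<..1} \<tau>) * (\<integral>\<^sup>+x. f x \<partial>hyp_vol)"
    proof (cases "\<tau> \<in> {0<..1}")
      case True
      \<comment> \<open>With \<open>v = \<tau> *\<^sub>R u\<close> the Jacobian of the substitution
        becomes the density at \<open>u\<close>, independently of \<open>\<tau>\<close>.\<close>
      have s: "\<tau> / sqrt ((norm (\<tau> *\<^sub>R u))\<^sup>2 + \<tau>\<^sup>2) = hyp_density u" for u :: "real ^ 'n"
      proof -
        have "(norm (\<tau> *\<^sub>R u))\<^sup>2 + \<tau>\<^sup>2 = \<tau>\<^sup>2 * (1 + u \<bullet> u)"
          using True by (simp add: dot_square_norm power_mult_distrib) (simp add: algebra_simps)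
        then show ?thesis using True by (simp add: hyp_density_eq real_sqrt_mult)
      qed
      have "(\<integral>\<^sup>+v. f (hyp_chart ((1 / \<tau>) *\<^sub>R v)) * ennreal (\<tau> / sqrt ((norm v)\<^sup>2 + \<tau>\<^sup>2)) \<partial>lborel)
        = ennreal (\<tau> ^ CARD('n)) * (\<integral>\<^sup>+u. f (hyp_chart u) * ennreal (hyp_density u) \<partial>lborel)"
        using True by (subst nn_integral_lborel_scale [of _ \<tau>]) (auto simp: s [symmetric] simp del: norm_scaleR)
      then show ?thesis using True by (simp add: nn_integral_hyp_vol mult.commute)
    qed auto
  qed
  also have "\<dots> = (\<integral>\<^sup>+\<tau>. ennreal (\<tau> ^ CARD('n)) * indicator {0<..1} \<tau> \<partial>lborel) * (\<integral>\<^sup>+x. f x \<partial>hyp_vol)"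
    by (rule nn_integral_multc) measurable
  finally show ?thesis .
qed

text \<open>The value plays no part in the argument; the radial factor only has to be cancelled in
  \<open>ennreal\<close>, which is possible exactly because it is neither 0 nor infinite.\<close>

lemma radial_constant:
  fixes n :: nat
  shows "(\<integral>\<^sup>+\<tau>. ennreal (\<tau> ^ n) * indicator {0<..1} \<tau> \<partial>lborel) \<noteq> 0"
    and "(\<integral>\<^sup>+\<tau>. ennreal (\<tau> ^ n) * indicator {0<..1} \<tau> \<partial>lborel) \<noteq> \<infinity>"
proof -
  have "(\<integral>\<^sup>+\<tau>. ennreal (\<tau> ^ n) * indicator {0<..1} \<tau> \<partial>lborel) \<le> (\<integral>\<^sup>+\<tau>. indicator {0<..1::real} \<tau> \<partial>lborel)"
    by (intro nn_integral_mono) (auto split: split_indicator simp: power_le_one)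
  also have "\<dots> = 1" by simp
  finally show "(\<integral>\<^sup>+\<tau>. ennreal (\<tau> ^ n) * indicator {0<..1} \<tau> \<partial>lborel) \<noteq> \<infinity>"
    by (auto simp: top_unique infinity_ennreal_def)
  have "(\<integral>\<^sup>+\<tau>. ennreal ((1/2) ^ n) * indicator {1/2..1::real} \<tau> \<partial>lborel)
      \<le> (\<integral>\<^sup>+\<tau>. ennreal (\<tau> ^ n) * indicator {0<..1} \<tau> \<partial>lborel)"
    by (intro nn_integral_mono) (auto split: split_indicator intro!: power_mono ennreal_leI)
  moreover have "(\<integral>\<^sup>+\<tau>. ennreal ((1/2) ^ n) * indicator {1/2..1::real} \<tau> \<partial>lborel) = ennreal ((1/2)^n) * ennreal (1/2)"
    by (simp add: nn_integral_cmult)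
  moreover have "ennreal ((1/2)^n) * ennreal (1/2) > 0"
    by (subst ennreal_mult [symmetric]) (auto simp only: ennreal_less_zero_iff, auto)
  ultimately show "(\<integral>\<^sup>+\<tau>. ennreal (\<tau> ^ n) * indicator {0<..1} \<tau> \<partial>lborel) \<noteq> 0" by auto
qed

section \<open>Lorentz invariance of Lebesgue measure and of hyperbolic volume\<close>

lemma measurable_matrix_vector [measurable]: "(\<lambda>x. (A :: real ^ 'k::finite ^ 'm::finite) *v x) \<in> borel_measurable borel"
  by (intro borel_measurable_continuous_onI matrix_vector_mult_linear_continuous_on)

text \<open>The library's change of variables asks for a well-ordered index type.
  This copy of an index type carries an arbitrary well-order.\<close>

typedef 'a idx = "UNIV :: 'a set" ..

instance idx :: (finite) finite
proof
  have "range Abs_idx = (UNIV :: 'a idx set)"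
    by (metis Rep_idx_inverse surjI)
  then show "finite (UNIV :: 'a idx set)" by (metis finite_imageI finite)
qed

instantiation idx :: (finite) wellorder
begin

definition less_eq_idx :: "'a idx \<Rightarrow> 'a idx \<Rightarrow> bool" where
  "less_eq_idx a b \<longleftrightarrow> to_nat (Rep_idx a) \<le> to_nat (Rep_idx b)"

definition less_idx :: "'a idx \<Rightarrow> 'a idx \<Rightarrow> bool" where
  "less_idx a b \<longleftrightarrow> to_nat (Rep_idx a) < to_nat (Rep_idx b)"

instance
proof
  fix a b :: "'a idx" and P
  show "a \<le> b \<Longrightarrow> b \<le> a \<Longrightarrow> a = b"
    by (simp add: less_eq_idx_def Rep_idx_inject)
  show "P a" if "\<And>x. (\<And>y. y < x \<Longrightarrow> P y) \<Longrightarrow> P x"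
    by (induction a rule: measure_induct_rule [of "\<lambda>a. to_nat (Rep_idx a)"])
      (use that in \<open>auto simp: less_idx_def\<close>)
qed (auto simp: less_eq_idx_def less_idx_def)

end

lemma sum_idx: "(\<Sum>k\<in>UNIV. f (Rep_idx k)) = (\<Sum>i\<in>UNIV. f i)"
  for f :: "'a::finite \<Rightarrow> real"
  by (rule sum.reindex_bij_witness [of _ Abs_idx Rep_idx]) (auto simp: Abs_idx_inverse Rep_idx_inverse)

definition reindex_vec :: "real ^ 'a::finite idx \<Rightarrow> real ^ 'a" where
  "reindex_vec x = (\<chi> i. x $ Abs_idx i)"

definition reindex_mat :: "real ^ 'a::finite ^ 'a \<Rightarrow> real ^ 'a idx ^ 'a idx" where
  "reindex_mat A = (\<chi> k l. A $ Rep_idx k $ Rep_idx l)"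

lemma measurable_reindex_vec [measurable]: "reindex_vec \<in> borel_measurable borel"
  unfolding reindex_vec_def by (intro borel_measurable_continuous_onI continuous_intros)

lemma lborel_reindex: "lborel = distr lborel borel (reindex_vec :: real ^ 'a::finite idx \<Rightarrow> _)"
proof (rule lborel_eqI)
  fix l u :: "real ^ 'a"
  assume le: "\<And>b. b \<in> Basis \<Longrightarrow> l \<bullet> b \<le> u \<bullet> b"
  have le': "l $ i \<le> u $ i" for i
    using le [of "axis i 1"] by (simp add: Basis_cart inner_axis)
  let ?T = "\<lambda>x :: real ^ 'a. (\<chi> k. x $ Rep_idx k) :: real ^ 'a idx"
  have all: "(\<forall>k. P (Rep_idx k)) \<longleftrightarrow> (\<forall>i. P i)" for P :: "'a \<Rightarrow> bool"
    by (metis Abs_idx_inverse UNIV_I)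
  have "reindex_vec x \<in> box l u \<longleftrightarrow> x \<in> box (?T l) (?T u)" for x
    unfolding mem_box_cart
      all [of "\<lambda>i. l $ i < reindex_vec x $ i \<and> reindex_vec x $ i < u $ i", symmetric]
    by (simp add: reindex_vec_def Rep_idx_inverse)
  then have box: "reindex_vec -` box l u = box (?T l) (?T u)" by blast
  have "emeasure (distr lborel borel reindex_vec) (box l u) = emeasure lborel (box (?T l) (?T u))"
    by (simp add: emeasure_distr box)
  also have "\<dots> = ennreal (prod ((\<bullet>) (?T u - ?T l)) Basis)"
    by (rule emeasure_lborel_box) (use le' in \<open>auto simp: Basis_cart inner_axis\<close>)
  also have "prod ((\<bullet>) (?T u - ?T l)) Basis = prod ((\<bullet>) (u - l)) Basis"
    unfolding prod_Basis_cart
    by (rule prod.reindex_bij_witness [of _ Abs_idx Rep_idx]) (auto simp: Abs_idx_inverse Rep_idx_inverse)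
  finally show "emeasure (distr lborel borel reindex_vec) (box l u) = ennreal (prod ((\<bullet>) (u - l)) Basis)" .
qed simp

lemma reindex_mat_vector: "A *v reindex_vec x = reindex_vec (reindex_mat A *v x)"
proof -
  have "(A *v reindex_vec x) $ i = reindex_vec (reindex_mat A *v x) $ i" for i
    using sum_idx [of "\<lambda>j. A $ i $ j * x $ Abs_idx j"]
    by (simp add: reindex_vec_def reindex_mat_def matrix_vector_mult_def Abs_idx_inverse Rep_idx_inverse)
  then show ?thesis by (simp add: vec_eq_iff)
qed

lemma reindex_mat_mult: "reindex_mat (A ** B) = reindex_mat A ** reindex_mat B"
proof -
  have "reindex_mat (A ** B) $ k $ l = (reindex_mat A ** reindex_mat B) $ k $ l" for k l
    using sum_idx [of "\<lambda>j. A $ Rep_idx k $ j * B $ j $ Rep_idx l"]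
    by (simp add: reindex_mat_def matrix_matrix_mult_def)
  then show ?thesis by (simp add: vec_eq_iff)
qed

lemma reindex_mat_transpose: "reindex_mat (transpose A) = transpose (reindex_mat A)"
  by (simp add: reindex_mat_def transpose_def vec_eq_iff)

lemma reindex_mat_one: "reindex_mat (mat 1) = mat 1"
  by (simp add: reindex_mat_def mat_def vec_eq_iff Rep_idx_inject)

text \<open>The preimage of a box under \<open>A\<close> is its image under the inverse
  \<open>B\<close>, which is why the determinant condition is placed on \<open>B\<close>.\<close>

lemma lborel_linear_image_wellorder:
  fixes A B :: "real ^ 'k::{finite,wellorder} ^ 'k::_"
  assumes "A ** B = mat 1" "B ** A = mat 1" "\<bar>det B\<bar> = 1"
  shows "lborel = distr lborel borel (\<lambda>x. A *v x)"
proof (rule lborel_eqI)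
  fix l u :: "real ^ 'k::_"
  assume le: "\<And>b. b \<in> Basis \<Longrightarrow> l \<bullet> b \<le> u \<bullet> b"
  have inv: "A *v (B *v x) = x" "B *v (A *v x) = x" for x
    by (simp_all only: matrix_vector_mul_assoc assms matrix_vector_mul_lid)
  have im: "(\<lambda>x. A *v x) -` box l u = (\<lambda>x. B *v x) ` box l u"
  proof (intro equalityI subsetI)
    fix x assume "x \<in> (\<lambda>x. A *v x) -` box l u"
    then show "x \<in> (\<lambda>x. B *v x) ` box l u" using inv(2) [of x] by (metis image_eqI vimageE)
  qed (use inv in auto)
  have lm: "box l u \<in> lmeasurable" by (rule lmeasurable_box)
  have fm: "(\<lambda>x. B *v x) ` box l u \<in> lmeasurable"
    by (rule measurable_linear_image [OF matrix_vector_mul_linear lm])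
  have b: "(\<lambda>x. B *v x) ` box l u \<in> sets borel"
    unfolding im [symmetric] by (rule measurable_sets_borel [OF measurable_matrix_vector]) simp
  have leb: "emeasure lborel S = ennreal (measure lebesgue S)" if "S \<in> lmeasurable" "S \<in> sets borel" for S :: "(real ^ 'k::_) set"
    using emeasure_eq_measure2 [OF that(1)] that(2) by (simp add: main_part_sets)
  have "emeasure (distr lborel borel (\<lambda>x. A *v x)) (box l u) = emeasure lborel ((\<lambda>x. B *v x) ` box l u)"
    by (simp add: emeasure_distr im)
  also have "\<dots> = ennreal (measure lebesgue ((\<lambda>x. B *v x) ` box l u))"
    by (rule leb [OF fm b])
  also have "measure lebesgue ((\<lambda>x. B *v x) ` box l u) = measure lebesgue (box l u)"
    using measure_linear_image [OF matrix_vector_mul_linear lm, of B] assms(3) by simp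
  also have "ennreal \<dots> = emeasure lborel (box l u)"
    by (rule leb [symmetric]) (auto simp: lm)
  also have "\<dots> = ennreal (prod ((\<bullet>) (u - l)) Basis)" using le by (rule emeasure_lborel_box)
  finally show "emeasure (distr lborel borel (\<lambda>x. A *v x)) (box l u) = \<dots>" .
qed simp

lemma lborel_lorc:
  fixes g :: "'n::finite mat1"
  assumes "g \<in> lorc" shows "lborel = distr lborel borel (\<lambda>x. g *v x)"
proof -
  obtain h where h: "h \<in> lorc" "g ** h = mat 1" "h ** g = mat 1" using lorc_inverse [OF assms] .
  have "transpose h ** mink_matrix ** h = mink_matrix"
    by (rule mink_isometry_gram) (rule lorc_mink [OF h(1)])
  \<comment> \<open>The determinant is recomputed from the reindexed Gram relation, so that
    determinants over the two index types need not be compared.\<close>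
  then have "(det (reindex_mat h))\<^sup>2 = 1"
    by (intro det_square_of_gram [of _ "reindex_mat mink_matrix"])
      (metis reindex_mat_mult reindex_mat_transpose, metis mink_matrix_square reindex_mat_mult reindex_mat_one)
  then have "\<bar>det (reindex_mat h)\<bar> = 1" by (auto simp: power2_eq_1_iff)
  then have l: "(lborel :: (real ^ 'n option idx) measure) = distr lborel borel (\<lambda>x. reindex_mat g *v x)"
    using h by (intro lborel_linear_image_wellorder [of _ "reindex_mat h"])
      (simp_all only: reindex_mat_mult [symmetric] reindex_mat_one)
  have "distr lborel borel (\<lambda>x. g *v x) = distr lborel borel (\<lambda>x :: real ^ 'n option idx. g *v reindex_vec x)"
    by (subst lborel_reindex, subst distr_distr) (auto simp: comp_def)
  also have "\<dots> = distr (distr lborel borel (\<lambda>x. reindex_mat g *v x)) borel reindex_vec"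
    by (subst distr_distr) (auto simp: comp_def reindex_mat_vector)
  also have "\<dots> = lborel" by (simp add: l [symmetric] lborel_reindex [symmetric])
  finally show ?thesis by simp
qed

text \<open>The group commutes with \<open>hproj\<close> and preserves \<open>hcone\<close>;
  invariance of Lebesgue measure gives the claim up to the radial factor, which cancels.\<close>

lemma nn_integral_hyp_vol_lorc:
  fixes f :: "'n::finite vec1 \<Rightarrow> ennreal"
  assumes [measurable]: "f \<in> borel_measurable borel" and g: "g \<in> lorc"
  shows "(\<integral>\<^sup>+x. f (g *v x) \<partial>hyp_vol) = (\<integral>\<^sup>+x. f x \<partial>hyp_vol)"
proof -
  let ?c = "\<integral>\<^sup>+\<tau>. ennreal (\<tau> ^ CARD('n)) * indicator {0<..1} \<tau> \<partial>lborel"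
  obtain h where h: "h \<in> lorc" "g ** h = mat 1" "h ** g = mat 1" using lorc_inverse [OF g] .
  have pr: "hproj (g *v x) = g *v hproj x" for x
    by (simp add: hproj_def lorc_lor [OF g] matrix_vector_mult_scaleR)
  have co: "g *v x \<in> hcone \<longleftrightarrow> x \<in> hcone" for x
    by (simp add: hcone_def lorc_lor [OF g] pr lorc_hyp_iff [OF g])
  have "?c * (\<integral>\<^sup>+x. f (g *v x) \<partial>hyp_vol) = (\<integral>\<^sup>+x. f (g *v hproj x) * indicator hcone x \<partial>lborel)"
    by (subst nn_integral_hcone) auto
  also have "\<dots> = (\<integral>\<^sup>+x. f (hproj (g *v x)) * indicator hcone (g *v x) \<partial>lborel)"
    by (simp add: pr co indicator_def)
  also have "\<dots> = (\<integral>\<^sup>+x. f (hproj x) * indicator hcone x \<partial>distr lborel borel (\<lambda>x. g *v x))"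
    by (subst nn_integral_distr) auto
  also have "\<dots> = (\<integral>\<^sup>+x. f (hproj x) * indicator hcone x \<partial>lborel)"
    using lborel_lorc [OF g] by simp
  also have "\<dots> = ?c * (\<integral>\<^sup>+x. f x \<partial>hyp_vol)"
    by (subst nn_integral_hcone) auto
  finally show ?thesis
    using radial_constant [of "CARD('n)"] unfolding ennreal_mult_cancel_left infinity_ennreal_def by blast
qed

lemma distr_hyp_vol_lorc: "g \<in> lorc \<Longrightarrow> distr hyp_vol borel (\<lambda>x. g *v x) = hyp_vol"
proof (rule measure_eqI)
  fix A assume g: "g \<in> lorc" and "A \<in> sets (distr hyp_vol borel (\<lambda>x. g *v x))"
  then have [measurable]: "A \<in> sets borel" by simp
  have "emeasure (distr hyp_vol borel (\<lambda>x. g *v x)) A = (\<integral>\<^sup>+x. indicator A x \<partial>distr hyp_vol borel (\<lambda>x. g *v x))"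
    by simp
  also have "\<dots> = (\<integral>\<^sup>+x. indicator A (g *v x) \<partial>hyp_vol)" by (subst nn_integral_distr) auto
  also have "\<dots> = (\<integral>\<^sup>+x. indicator A x \<partial>hyp_vol)" using g by (subst nn_integral_hyp_vol_lorc) auto
  finally show "emeasure (distr hyp_vol borel (\<lambda>x. g *v x)) A = emeasure hyp_vol A" by simp
qed simp

lemma integral_hyp_vol_lorc:
  fixes f :: "'n::finite vec1 \<Rightarrow> 'b::{banach, second_countable_topology}"
  assumes [measurable]: "f \<in> borel_measurable borel" and g: "g \<in> lorc"
  shows "(\<integral>x. f (g *v x) \<partial>hyp_vol) = (\<integral>x. f x \<partial>hyp_vol)"
proof -
  have "(\<integral>x. f x \<partial>hyp_vol) = (\<integral>x. f x \<partial>distr hyp_vol borel (\<lambda>x. g *v x))"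
    by (simp add: distr_hyp_vol_lorc [OF g])
  also have "\<dots> = (\<integral>x. f (g *v x) \<partial>hyp_vol)" by (rule integral_distr) auto
  finally show ?thesis by simp
qed

text \<open>The cone over the section of the hyperboloid by a hyperplane lies in that hyperplane, a
  Lebesgue null set. This will make the equidistant sets between orbit points negligible.\<close>

lemma AE_hyp_not_hyperplane:
  assumes "b \<noteq> 0" shows "AE y in hyp_vol. mink b y \<noteq> 0"
proof -
  let ?c = "\<integral>\<^sup>+\<tau>. ennreal (\<tau> ^ CARD('a)) * indicator {0<..1} \<tau> \<partial>lborel"
  let ?b = "mkvec (- (b $ None)) (space_part b)"
  have mb: "mink b y = ?b \<bullet> y" for y
    unfolding inner_vec_def UNIV_option_conv by (simp add: mink_def sum.reindex)
  have b0: "?b \<noteq> 0" using assms by (auto simp: vec1_eq_iff)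
  let ?H = "{y. mink b y = 0}"
  have m: "(\<lambda>y. mink b y) = (\<lambda>y. - lor b y)" by (simp add: lor_def)
  have [measurable]: "(\<lambda>y. mink b y) \<in> borel_measurable borel" unfolding m by measurable
  have H: "?H \<in> sets borel" by measurable
  have "emeasure lborel ?H = 0"
  proof -
    have "negligible ?H" unfolding mb using negligible_hyperplane [of ?b 0] b0 by blast
    then have "?H \<in> null_sets lebesgue" by (simp add: negligible_iff_null_sets)
    then have "emeasure lebesgue ?H = 0" by (rule null_setsD1)
    then show ?thesis using H by (simp add: main_part_sets)
  qed
  have "?c * emeasure hyp_vol ?H = ?c * (\<integral>\<^sup>+x. indicator ?H x \<partial>hyp_vol)" using H by simp
  also have "\<dots> = (\<integral>\<^sup>+x. indicator ?H (hproj x) * indicator hcone x \<partial>lborel)"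
    using H by (subst nn_integral_hcone) auto
  also have "\<dots> \<le> (\<integral>\<^sup>+x. indicator ?H x \<partial>lborel)"
    by (intro nn_integral_mono) (auto simp: hproj_def hcone_def mink_scale_right split: split_indicator)
  also have "\<dots> = 0" using H \<open>emeasure lborel ?H = 0\<close> by simp
  finally have "emeasure hyp_vol ?H = 0"
    using radial_constant(1) [of "CARD('a)"] by auto
  then have "?H \<in> null_sets hyp_vol" using H by auto
  from AE_not_in [OF this] show ?thesis by simp
qed

subsection \<open>Volumes of balls\<close>

text \<open>A closed ball whose parameter \<open>W\<close> is the hyperbolic cosine of the radius;
  it is empty for \<open>W < 1\<close> when \<open>x\<close> is on the hyperboloid.\<close>

definition hball :: "'n::finite vec1 \<Rightarrow> real \<Rightarrow> 'n vec1 set" where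
  "hball x W = {y \<in> hyp. lor x y \<le> W}"

lemma hball_in_borel [measurable]: "hball x W \<in> sets borel"
  unfolding hball_def by measurable

lemma emeasure_hball_origin:
  assumes "(x :: 'n vec1) \<in> hyp" shows "emeasure hyp_vol (hball x W) = emeasure hyp_vol (hball (hyp_origin :: 'n::finite vec1) W)"
proof -
  obtain g where g: "g \<in> lorc" "g *v hyp_origin = x" using lorc_transitive_origin [OF assms] .
  have mem: "g *v y \<in> hball x W \<longleftrightarrow> y \<in> hball hyp_origin W" for y
    unfolding hball_def mem_Collect_eq g(2) [symmetric] lorc_lor [OF g(1)] lorc_hyp_iff [OF g(1)] ..
  have "emeasure hyp_vol (hball x W) = (\<integral>\<^sup>+y. indicator (hball x W) y \<partial>hyp_vol)"
    by simp
  also have "\<dots> = (\<integral>\<^sup>+y. indicator (hball x W) (g *v y) \<partial>hyp_vol)"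
    by (rule nn_integral_hyp_vol_lorc [symmetric]) (use g in auto)
  also have "\<dots> = (\<integral>\<^sup>+y. indicator (hball hyp_origin W) y \<partial>(hyp_vol :: 'n vec1 measure))"
    by (simp only: indicator_def mem)
  finally show ?thesis by simp
qed

lemma chart_in_hball_origin:
  assumes "W \<ge> 1"
  shows "hyp_chart v \<in> hball hyp_origin W \<longleftrightarrow> v \<in> cball 0 (sqrt (W\<^sup>2 - 1))"
proof -
  have "hyp_chart v \<in> hball hyp_origin W \<longleftrightarrow> sqrt (1 + v \<bullet> v) \<le> W"
    by (simp add: hball_def lor_origin) (simp add: hyp_chart_mkvec)
  also have "\<dots> \<longleftrightarrow> 1 + v \<bullet> v \<le> W\<^sup>2"
    using assms by (simp add: real_sqrt_le_iff' )
  also have "\<dots> \<longleftrightarrow> (norm v)\<^sup>2 \<le> W\<^sup>2 - 1" by (simp add: dot_square_norm algebra_simps)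
  also have "\<dots> \<longleftrightarrow> norm v \<le> sqrt (W\<^sup>2 - 1)"
    by (metis norm_ge_zero real_sqrt_abs real_sqrt_le_iff abs_norm_cancel)
  finally show ?thesis by simp
qed

lemma emeasure_hball_chart:
  fixes W :: real
  assumes "W \<ge> 1"
  shows "emeasure (hyp_vol :: 'n::finite vec1 measure) (hball hyp_origin W)
    = (\<integral>\<^sup>+v. ennreal (hyp_density v) * indicator (cball 0 (sqrt (W\<^sup>2 - 1))) (v :: real ^ 'n) \<partial>lborel)"
proof -
  have "emeasure (hyp_vol :: 'n vec1 measure) (hball hyp_origin W) = (\<integral>\<^sup>+y. indicator (hball hyp_origin W) y \<partial>(hyp_vol :: 'n vec1 measure))"
    by simp
  also have "\<dots> = (\<integral>\<^sup>+v. ennreal (hyp_density v) * indicator (hball hyp_origin W) (hyp_chart (v :: real ^ 'n)) \<partial>lborel)"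
    by (rule nn_integral_hyp_vol [of "indicator (hball hyp_origin W)"]) measurable
  finally show ?thesis by (simp only: indicator_def chart_in_hball_origin [OF assms])
qed

lemma hyp_density_le: "hyp_density v \<le> 1"
proof -
  have "1 \<le> sqrt (1 + v \<bullet> v)" by simp
  then show ?thesis unfolding hyp_density_eq by (simp add: divide_le_eq)
qed

lemma hyp_density_le_norm: "v \<noteq> 0 \<Longrightarrow> hyp_density v \<le> 1 / norm v"
proof -
  assume "v \<noteq> 0"
  then have "norm v > 0" by simp
  moreover have "norm v \<le> sqrt (1 + v \<bullet> v)"
    by (rule real_le_rsqrt) (simp add: dot_square_norm)
  moreover have "0 < sqrt (1 + v \<bullet> v)" by (simp add: add_pos_nonneg)
  ultimately show ?thesis unfolding hyp_density_eq by (intro divide_left_mono mult_pos_pos) auto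
qed

lemma emeasure_cball_lborel:
  "r \<ge> 0 \<Longrightarrow> emeasure lborel (cball (0 :: real ^ 'n::finite) r) = ennreal (unit_ball_vol CARD('n) * r ^ CARD('n))"
  by (simp add: emeasure_cball)

lemma chart_cball_le_power:
  assumes "S \<ge> 0"
  shows "(\<integral>\<^sup>+v. ennreal (hyp_density v) * indicator (cball 0 S) (v :: real ^ 'n::finite) \<partial>lborel)
    \<le> ennreal (unit_ball_vol CARD('n) * S ^ CARD('n))"
proof -
  have "(\<integral>\<^sup>+v. ennreal (hyp_density v) * indicator (cball 0 S) (v :: real ^ 'n) \<partial>lborel)
      \<le> (\<integral>\<^sup>+v. indicator (cball 0 S) (v :: real ^ 'n) \<partial>lborel)"
    by (intro nn_integral_mono) (auto simp: hyp_density_le split: split_indicator)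
  then show ?thesis using assms by (simp add: emeasure_cball_lborel)
qed

lemma emeasure_hball_le_small:
  assumes "W \<ge> 1" "x \<in> hyp"
  shows "emeasure hyp_vol (hball (x :: 'n::finite vec1) W) \<le> ennreal (unit_ball_vol CARD('n) * sqrt (W\<^sup>2 - 1) ^ CARD('n))"
  unfolding emeasure_hball_origin [OF assms(2)] emeasure_hball_chart [OF assms(1)]
  by (rule chart_cball_le_power) (use assms in simp)

text \<open>Outside the ball of radius \<open>S / 2\<close> the density is at most
  \<open>2 / S\<close>. Halving the radius thus costs \<open>2 / S\<close> times a Euclidean volume,
  that is \<open>2 * unit_ball_vol n * S ^ (n - 1)\<close>. The constant 4 reproduces itself because
  \<open>(1/2) ^ (n - 1) \<le> 1/2\<close> for \<open>n \<ge> 2\<close>; \<open>k\<close> only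
  counts the halvings needed to reach radius 1.\<close>

lemma chart_cball_le:
  assumes "CARD('n::finite) \<ge> 2" "0 \<le> S" "S \<le> 2 ^ k"
  shows "(\<integral>\<^sup>+v. ennreal (hyp_density v) * indicator (cball 0 S) (v :: real ^ 'n) \<partial>lborel)
    \<le> ennreal (4 * unit_ball_vol CARD('n) * S ^ (CARD('n) - 1))"
  using assms(2,3)
proof (induction k arbitrary: S)
  let ?w = "unit_ball_vol CARD('n)"
  let ?n = "CARD('n)"
  let ?V = "\<lambda>S. (\<integral>\<^sup>+v. ennreal (hyp_density v) * indicator (cball 0 S) (v :: real ^ 'n) \<partial>lborel)"
  have [measurable]: "cball (0 :: real ^ 'n) r \<in> sets borel" for r by (simp add: borel_closed)
  have w: "?w > 0" by simp
  have pw: "S ^ ?n = S * S ^ (?n - 1)" for S :: real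
    using assms(1) by (metis power_eq_if not_numeral_le_zero)
  have small: "?V S \<le> ennreal (4 * ?w * S ^ (?n - 1))" if "0 \<le> S" "S \<le> 1" for S
  proof -
    have "S * S ^ (?n - 1) \<le> 4 * S ^ (?n - 1)" using that by (intro mult_right_mono) auto
    then have "?w * S ^ ?n \<le> 4 * ?w * S ^ (?n - 1)"
      unfolding pw using w by simp
    then show ?thesis
      using chart_cball_le_power [OF that(1), where ?'n = 'n] by (meson ennreal_leI order_trans)
  qed
  {
    case 0
    then show ?case using small by simp
  next
    case (Suc k)
    show ?case
    proof (cases "S \<le> 1")
      case True
      then show ?thesis using small Suc.prems by simp
    next
      case False
      have IH: "?V (S/2) \<le> ennreal (4 * ?w * (S/2) ^ (?n - 1))"
        using Suc.prems by (intro Suc.IH) auto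
      have "?V S \<le> (\<integral>\<^sup>+v. ennreal (hyp_density v) * indicator (cball 0 (S/2)) v
          + ennreal (2 / S) * indicator (cball 0 S) (v :: real ^ 'n) \<partial>lborel)"
      proof (intro nn_integral_mono)
        fix v :: "real ^ 'n"
        have "hyp_density v \<le> 2 / S" if "norm v > S / 2"
        proof -
          have "hyp_density v \<le> 1 / norm v" using that False by (intro hyp_density_le_norm) auto
          also have "\<dots> \<le> 1 / (S / 2)" using that False by (intro divide_left_mono mult_pos_pos) auto
          finally show ?thesis by simp
        qed
        then show "ennreal (hyp_density v) * indicator (cball 0 S) v \<le> ennreal (hyp_density v) * indicator (cball 0 (S/2)) v
            + ennreal (2 / S) * indicator (cball 0 S) v"
          by (cases "norm v > S / 2") (auto simp: ennreal_leI split: split_indicator)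
      qed
      also have "\<dots> = ?V (S/2) + ennreal (2/S) * emeasure lborel (cball (0 :: real ^ 'n) S)"
        by (subst nn_integral_add, measurable) (subst nn_integral_cmult_indicator, auto simp: borel_closed)
      also have "\<dots> \<le> ennreal (4 * ?w * (S/2) ^ (?n - 1)) + ennreal (2/S) * ennreal (?w * S ^ ?n)"
        using IH False by (intro add_mono) (auto simp: emeasure_cball_lborel)
      also have "\<dots> = ennreal (4 * ?w * (S/2) ^ (?n - 1) + 2/S * (?w * S ^ ?n))"
        using False w by (subst ennreal_mult [symmetric], simp, simp) (subst ennreal_plus, auto)
      also have "\<dots> \<le> ennreal (4 * ?w * S ^ (?n - 1))"
      proof (rule ennreal_leI)
        have "(1/2::real) ^ (?n - 1) \<le> (1/2) ^ 1" using assms(1) by (intro power_decreasing) auto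
        then have "(S/2) ^ (?n - 1) \<le> S ^ (?n - 1) / 2"
          using False by (simp add: power_divide field_simps)
        then have 1: "4 * ?w * (S/2) ^ (?n - 1) \<le> 4 * ?w * (S ^ (?n - 1) / 2)"
          using w by (intro mult_left_mono) auto
        have 2: "2/S * (?w * S ^ ?n) = 2 * ?w * S ^ (?n - 1)"
          unfolding pw using False by simp
        show "4 * ?w * (S/2) ^ (?n - 1) + 2/S * (?w * S ^ ?n) \<le> 4 * ?w * S ^ (?n - 1)"
          using 1 unfolding 2 by simp
      qed
      finally show ?thesis .
    qed
  }
qed

lemma emeasure_hball_le:
  assumes "CARD('n::finite) \<ge> 2" "W \<ge> 1" "x \<in> hyp"
  shows "emeasure hyp_vol (hball (x :: 'n vec1) W) \<le> ennreal (4 * unit_ball_vol CARD('n) * W ^ (CARD('n) - 1))"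
proof -
  obtain k where k: "sqrt (W\<^sup>2 - 1) < 2 ^ k" using real_arch_pow [of 2] by auto
  have "sqrt (W\<^sup>2 - 1) \<le> sqrt (W\<^sup>2)" by (rule real_sqrt_le_mono) simp
  then have le: "sqrt (W\<^sup>2 - 1) \<le> W" using assms(2) by simp
  have "emeasure hyp_vol (hball x W) \<le> ennreal (4 * unit_ball_vol CARD('n) * sqrt (W\<^sup>2 - 1) ^ (CARD('n) - 1))"
    unfolding emeasure_hball_origin [OF assms(3)] emeasure_hball_chart [OF assms(2)]
    using k assms by (intro chart_cball_le [of _ k]) auto
  also have "\<dots> \<le> ennreal (4 * unit_ball_vol CARD('n) * W ^ (CARD('n) - 1))"
    using le assms(2) by (intro ennreal_leI mult_left_mono power_mono) auto
  finally show ?thesis .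
qed

text \<open>In the chart the ball contains the Euclidean ball of radius \<open>W / 2\<close>, on
  which the density is at least \<open>1 / W\<close>. The parameter \<open>(1 + W) / 2\<close>
  leaves room inside the ball with parameter \<open>W\<close>, so that the test function stays large
  there; the inclusion requires exactly \<open>W \<ge> 3/2\<close>.\<close>

lemma emeasure_hball_ge:
  assumes "W \<ge> 3/2" "x \<in> hyp"
  shows "emeasure hyp_vol (hball (x :: 'n::finite vec1) ((1 + W) / 2))
    \<ge> ennreal (unit_ball_vol CARD('n) * (1/2) ^ CARD('n) * W ^ (CARD('n) - 1))"
proof -
  let ?w = "unit_ball_vol CARD('n)"
  have "(W/2)\<^sup>2 \<le> ((1 + W) / 2)\<^sup>2 - 1"
    using assms(1) by (simp add: power2_eq_square field_simps)
  then have S: "W/2 \<le> sqrt (((1 + W) / 2)\<^sup>2 - 1)" by (rule real_le_rsqrt)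
  have pw: "W ^ CARD('n) = W * W ^ (CARD('n) - 1)"
    by (metis One_nat_def Suc_pred' power_Suc zero_less_card_finite)
  have "?w * (1/2) ^ CARD('n) * W ^ (CARD('n) - 1) = (1/W) * (?w * (W/2) ^ CARD('n))"
    using assms(1) by (simp add: power_divide pw)
  then have "ennreal (?w * (1/2) ^ CARD('n) * W ^ (CARD('n) - 1)) = ennreal (1/W) * ennreal (?w * (W/2) ^ CARD('n))"
    using assms(1) by (simp only:) (rule ennreal_mult, auto)
  also have "\<dots> = (\<integral>\<^sup>+v. ennreal (1/W) * indicator (cball 0 (W/2)) (v :: real ^ 'n) \<partial>lborel)"
    using assms(1) by (subst nn_integral_cmult_indicator) (auto simp: emeasure_cball_lborel)
  also have "\<dots> \<le> (\<integral>\<^sup>+v. ennreal (hyp_density v) * indicator (cball 0 (sqrt (((1 + W) / 2)\<^sup>2 - 1))) (v :: real ^ 'n) \<partial>lborel)"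
  proof (intro nn_integral_mono)
    fix v :: "real ^ 'n"
    have "1 / W \<le> hyp_density v" if "norm v \<le> W / 2"
    proof -
      have "(norm v)\<^sup>2 \<le> (W/2)\<^sup>2" using that by (intro power_mono) auto
      moreover have "1 + (W/2)\<^sup>2 \<le> W\<^sup>2"
      proof -
        have "(3/2)\<^sup>2 \<le> W\<^sup>2" using assms(1) by (intro power_mono) auto
        then show ?thesis by (simp add: power2_eq_square)
      qed
      ultimately have "1 + v \<bullet> v \<le> W\<^sup>2" by (simp add: dot_square_norm)
      then have "sqrt (1 + v \<bullet> v) \<le> W" using assms(1) by (intro real_le_lsqrt) auto
      moreover have "0 < sqrt (1 + v \<bullet> v)" by (simp add: add_pos_nonneg)
      ultimately show ?thesis unfolding hyp_density_eq using assms(1) by (intro divide_left_mono mult_pos_pos) auto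
    qed
    then show "ennreal (1/W) * indicator (cball 0 (W/2)) v
        \<le> ennreal (hyp_density v) * indicator (cball 0 (sqrt (((1 + W) / 2)\<^sup>2 - 1))) v"
      using S by (auto simp: ennreal_leI split: split_indicator)
  qed
  also have "\<dots> = emeasure hyp_vol (hball x ((1 + W) / 2))"
    unfolding emeasure_hball_origin [OF assms(2)] using assms(1) by (subst emeasure_hball_chart) auto
  finally show ?thesis .
qed

lemma rho_pos: "CARD('n::finite) \<ge> 2 \<Longrightarrow> rho CARD('n) > 0"
  by (simp add: rho_def)

definition ball_const :: "nat \<Rightarrow> real" where
  "ball_const n = 4 * unit_ball_vol n * 2 powr rho n"

lemma ball_const_pos: "ball_const n > 0"
  by (simp add: ball_const_def)

text \<open>The intersection lies in the ball around the normalization of \<open>x / W + y / W'\<close>.\<close>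

lemma emeasure_hball_Int_le:
  assumes n: "CARD('n::finite) \<ge> 2" and xy: "x \<in> hyp" "y \<in> hyp" and W: "W > 0" "W' > 0"
  shows "emeasure hyp_vol (hball (x :: 'n vec1) W \<inter> hball y W')
    \<le> ennreal (ball_const CARD('n) * (W * W' / lor x y) powr rho CARD('n))"
proof (cases "hball x W \<inter> hball y W' = {}")
  case False
  define N where "N = (1/W)\<^sup>2 + (1/W')\<^sup>2 + 2 * (1/W) * (1/W') * lor x y"
  define m where "m = (1 / sqrt N) *\<^sub>R ((1/W) *\<^sub>R x + (1/W') *\<^sub>R y)"
  have l: "lor x y > 0" by (rule lor_pos [OF xy])
  have m: "m \<in> hyp"
    unfolding m_def N_def using xy W by (intro combination_normalize_in_hyp) auto
  have N: "2 * lor x y / (W * W') \<le> N" unfolding N_def using W by simp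
  have q: "0 < 2 * lor x y / (W * W')" using l W by simp
  have N0: "N > 0" using N q by linarith
  have sub: "hball x W \<inter> hball y W' \<subseteq> hball m (2 / sqrt N)"
  proof
    fix z assume z: "z \<in> hball x W \<inter> hball y W'"
    have "lor m z = (1 / sqrt N) * (lor x z / W + lor y z / W')"
      unfolding m_def lor_bilinear by simp
    also have "\<dots> \<le> (1 / sqrt N) * (1 + 1)"
      using z W N0 by (intro mult_left_mono add_mono) (auto simp: hball_def)
    finally show "z \<in> hball m (2 / sqrt N)" using z by (simp add: hball_def)
  qed
  obtain z where "z \<in> hball m (2 / sqrt N)" using sub False by blast
  then have R1: "1 \<le> 2 / sqrt N" using lor_ge_1 [OF m, of z] by (auto simp: hball_def)
  \<comment> \<open>Only the mixed term of \<open>N\<close> is kept. The ball parameter is then a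
    square root, which turns the growth exponent \<open>n - 1\<close> of the volume into
    \<open>rho n\<close>.\<close>
  have "2 / sqrt N = sqrt (4 / N)" by (simp add: real_sqrt_divide)
  also have "\<dots> \<le> sqrt (4 / (2 * lor x y / (W * W')))"
    using N mult_pos_pos [OF N0 q] by (intro real_sqrt_le_mono divide_left_mono) auto
  also have "\<dots> = sqrt (2 * (W * W' / lor x y))" using l W by (simp add: field_simps)
  also have "\<dots> = (2 * (W * W' / lor x y)) powr (1/2)" using l W by (simp add: powr_half_sqrt)
  finally have R: "2 / sqrt N \<le> (2 * (W * W' / lor x y)) powr (1/2)" .
  have "emeasure hyp_vol (hball x W \<inter> hball y W') \<le> emeasure hyp_vol (hball m (2 / sqrt N))"
    by (rule emeasure_mono [OF sub]) simp
  also have "\<dots> \<le> ennreal (4 * unit_ball_vol CARD('n) * (2 / sqrt N) ^ (CARD('n) - 1))"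
    by (rule emeasure_hball_le [OF n R1 m])
  also have "\<dots> \<le> ennreal (4 * unit_ball_vol CARD('n) * ((2 * (W * W' / lor x y)) powr (1/2)) ^ (CARD('n) - 1))"
    using R N0 by (intro ennreal_leI mult_left_mono power_mono) auto
  also have "((2 * (W * W' / lor x y)) powr (1/2)) ^ (CARD('n) - 1) = (2 * (W * W' / lor x y)) powr rho CARD('n)"
  proof -
    have "real (CARD('n) - 1) = real CARD('n) - 1" using n by simp
    moreover have "(2 * (W * W' / lor x y)) powr (1/2) > 0" using l W by simp
    ultimately show ?thesis by (simp add: powr_powr rho_def flip: powr_realpow)
  qed
  also have "(2 * (W * W' / lor x y)) powr rho CARD('n) = 2 powr rho CARD('n) * (W * W' / lor x y) powr rho CARD('n)"
    using l W by (subst powr_mult) auto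
  finally show ?thesis by (simp add: ball_const_def mult.assoc)
qed simp

lemma dyadic_scale:
  fixes r :: real assumes "r \<ge> 1" obtains k :: nat where "2 ^ k \<le> r" "r \<le> 2 ^ Suc k"
proof -
  obtain m where m: "r < 2 ^ m" using real_arch_pow [of 2 r] by auto
  define k where "k = (LEAST m. r < 2 ^ m)"
  have k: "r < 2 ^ k" unfolding k_def using m by (rule LeastI)
  then have "k \<noteq> 0" using assms by (cases k) auto
  then obtain j where j: "k = Suc j" by (cases k) auto
  have "\<not> r < 2 ^ j" using not_less_Least [of j "\<lambda>m. r < 2 ^ m"] j by (simp add: k_def)
  then show ?thesis using that [of j] k j by simp
qed

text \<open>The ball around \<open>x\<close> is covered by dyadic balls around \<open>z\<close>,
  starting at \<open>a\<close>, the least value of \<open>lor z y\<close> that the triangle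
  inequality allows on it. Each intersection has volume at most a constant times
  \<open>2 powr (k * \<rho>)\<close>, and the series converges geometrically because
  \<open>t > \<rho>\<close>. The resulting power of \<open>lor z x\<close> is the one integrated, so
  this function can serve as a weight in Schur's test.\<close>

lemma nn_integral_lor_powr_le:
  assumes n: "CARD('n::finite) \<ge> 2" and xz: "x \<in> hyp" "z \<in> hyp" and W: "W > 0" and t: "t > rho CARD('n)"
  shows "(\<integral>\<^sup>+y. ennreal (lor z y powr (- t)) * indicator (hball (x :: 'n vec1) W) y \<partial>hyp_vol)
    \<le> ennreal (ball_const CARD('n) * 2 powr t / (1 - 2 powr (rho CARD('n) - t)) * W powr t * lor z x powr (- t))"
proof -
  let ?\<rho> = "rho CARD('n)"
  define a where "a = lor x z / (2 * W)"
  have l: "lor x z > 0" by (rule lor_pos [OF xz])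
  have a: "a > 0" using l W by (simp add: a_def)
  have t0: "t > 0" using rho_pos [OF n] t by linarith
  define q where "q = (2::real) powr (?\<rho> - t)"
  have q: "0 < q" "q < 1" using t by (auto simp: q_def powr_less_one)
  have "(\<integral>\<^sup>+y. ennreal (lor z y powr (- t)) * indicator (hball x W) y \<partial>hyp_vol)
      \<le> (\<integral>\<^sup>+y. (\<Sum>k. ennreal ((2 ^ k * a) powr (- t)) * indicator (hball x W \<inter> hball z (2 ^ Suc k * a)) y) \<partial>hyp_vol)"
  proof (intro nn_integral_mono)
    fix y
    show "ennreal (lor z y powr (- t)) * indicator (hball x W) y
      \<le> (\<Sum>k. ennreal ((2 ^ k * a) powr (- t)) * indicator (hball x W \<inter> hball z (2 ^ Suc k * a)) y)" (is "_ \<le> (\<Sum>k. ?f k)")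
    proof (cases "y \<in> hball x W")
      case True
      then have y: "y \<in> hyp" "lor x y \<le> W" by (auto simp: hball_def)
      have "lor x z \<le> 2 * W * lor z y"
        using lor_combination_ge [OF xz y(1) W lor_pos [OF xz(2) y(1)] y(2)] by simp
      then have "1 \<le> lor z y / a" using W l a by (simp add: a_def field_simps)
      then obtain k :: nat where k: "2 ^ k \<le> lor z y / a" "lor z y / a \<le> 2 ^ Suc k" by (rule dyadic_scale)
      have k1: "2 ^ k * a \<le> lor z y" and k2: "lor z y \<le> 2 ^ Suc k * a"
        using k a by (simp_all add: field_simps)
      have "y \<in> hball x W \<inter> hball z (2 ^ Suc k * a)" using True k2 y by (simp add: hball_def)
      moreover have "lor z y powr (- t) \<le> (2 ^ k * a) powr (- t)"
        using k1 a t0 by (intro powr_mono2') auto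
      ultimately have "ennreal (lor z y powr (- t)) * indicator (hball x W) y \<le> ?f k"
        using True by (simp add: ennreal_leI)
      also have "\<dots> = (\<Sum>j\<in>{k}. ?f j)"
        by (simp only: sum.insert finite.emptyI empty_iff not_False_eq_True sum.empty add_0_right)
      also have "\<dots> \<le> (\<Sum>k. ?f k)" by (rule sum_le_suminf) auto
      finally show ?thesis .
    qed simp
  qed
  also have "\<dots> = (\<Sum>k. ennreal ((2 ^ k * a) powr (- t)) * emeasure hyp_vol (hball x W \<inter> hball z (2 ^ Suc k * a)))"
    by (subst nn_integral_suminf) (auto simp: nn_integral_cmult)
  also have "\<dots> \<le> (\<Sum>k. ennreal (ball_const CARD('n) * a powr (- t) * q ^ k))"
  proof (intro suminf_le)
    fix k
    have "ennreal ((2 ^ k * a) powr (- t)) * emeasure hyp_vol (hball x W \<inter> hball z (2 ^ Suc k * a))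
      \<le> ennreal ((2 ^ k * a) powr (- t)) * ennreal (ball_const CARD('n) * (W * (2 ^ Suc k * a) / lor x z) powr ?\<rho>)"
      using W a by (intro mult_left_mono emeasure_hball_Int_le [OF n xz]) auto
    also have "\<dots> = ennreal ((2 ^ k * a) powr (- t) * (ball_const CARD('n) * (W * (2 ^ Suc k * a) / lor x z) powr ?\<rho>))"
      using ball_const_pos by (intro ennreal_mult [symmetric]) (auto simp: less_imp_le)
    also have "W * (2 ^ Suc k * a) / lor x z = 2 ^ k" using W l by (simp add: a_def)
    also have "(2 ^ k * a) powr (- t) * (ball_const CARD('n) * (2 ^ k) powr ?\<rho>) = ball_const CARD('n) * a powr (- t) * q ^ k"
    proof -
      have "(2 ^ k) powr (- t) * (2 ^ k) powr ?\<rho> = (2 ^ k) powr (?\<rho> - t)" by (simp add: powr_add [symmetric])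
      also have "\<dots> = q ^ k"
        by (simp add: q_def powr_power powr_realpow [symmetric] powr_powr mult.commute)
      finally show ?thesis using a by (simp add: powr_mult algebra_simps)
    qed
    finally show "ennreal ((2 ^ k * a) powr (- t)) * emeasure hyp_vol (hball x W \<inter> hball z (2 ^ Suc k * a))
      \<le> ennreal (ball_const CARD('n) * a powr (- t) * q ^ k)" .
  qed auto
  also have "\<dots> = ennreal (ball_const CARD('n) * a powr (- t) * (1 / (1 - q)))"
  proof (rule suminf_ennreal_eq)
    show "(\<lambda>k. ball_const CARD('n) * a powr (- t) * q ^ k) sums (ball_const CARD('n) * a powr (- t) * (1 / (1 - q)))"
      by (intro sums_mult geometric_sums) (use q in auto)
  qed (use q ball_const_pos [of "CARD('n)"] in \<open>auto simp: less_imp_le\<close>)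
  also have "a powr (- t) = 2 powr t * W powr t * lor z x powr (- t)"
    unfolding a_def lor_sym [of z x] using W l by (simp add: powr_divide powr_minus powr_mult field_simps)
  finally show ?thesis by (simp add: q_def mult.assoc mult.left_commute)
qed

subsection \<open>Partial derivatives\<close>

definition C1 :: "(real ^ 'n::finite \<Rightarrow> 'b::real_normed_vector) \<Rightarrow> bool" where
  "C1 f \<longleftrightarrow> f differentiable_on UNIV \<and> (\<forall>i. continuous_on UNIV (partial i f))"

text \<open>The cut-off cubes are only twice continuously differentiable across their boundary
  spheres, so the calculus is built on this class and not on \<open>smooth\<close>.\<close>

definition C2 :: "(real ^ 'n::finite \<Rightarrow> 'b::real_normed_vector) \<Rightarrow> bool" where
  "C2 f \<longleftrightarrow> f differentiable_on UNIV \<and> (\<forall>i. C1 (partial i f))"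

lemma smooth_imp_C2: "smooth f \<Longrightarrow> C2 f"
proof -
  assume "smooth f"
  then have "times_diff (Suc (Suc 0)) f" by (simp only: smooth_def)
  then show ?thesis by (simp add: C2_def C1_def)
qed

lemma partial_has_derivative:
  assumes "(f has_derivative f') (at v)" shows "partial i f v = f' (axis i 1)"
proof -
  interpret linear f' using assms by (rule has_derivative_linear)
  have "((\<lambda>t. v + t *\<^sub>R axis i 1) has_derivative (\<lambda>t. t *\<^sub>R axis i 1)) (at (0::real))"
    by (auto intro!: derivative_eq_intros)
  then have "((\<lambda>t. f (v + t *\<^sub>R axis i 1)) has_derivative (\<lambda>t. f' (t *\<^sub>R axis i 1))) (at 0)"
    by (rule has_derivative_compose) (simp add: assms)
  then have "((\<lambda>t. f (v + t *\<^sub>R axis i 1)) has_vector_derivative f' (axis i 1)) (at 0)"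
    by (simp add: has_vector_derivative_def scale)
  then show ?thesis unfolding partial_def by (rule vector_derivative_at)
qed

lemma differentiable_has_derivative:
  assumes "f differentiable_on UNIV"
  obtains f' where "\<And>v. (f has_derivative f' v) (at v)"
  using assms unfolding differentiable_on_def differentiable_def
  by (metis UNIV_I)

lemma C1_differentiable: "C1 f \<Longrightarrow> f differentiable_on UNIV"
  by (simp add: C1_def)

lemma C1_continuous: "C1 f \<Longrightarrow> continuous_on UNIV f"
  by (simp add: C1_def differentiable_imp_continuous_on)

lemma C1_partial_continuous: "C1 f \<Longrightarrow> continuous_on UNIV (partial i f)"
  by (simp add: C1_def)

lemma C2_continuous: "C2 f \<Longrightarrow> continuous_on UNIV f"
  by (simp add: C2_def differentiable_imp_continuous_on)

lemma C2_partial: "C2 f \<Longrightarrow> C1 (partial i f)"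
  by (simp add: C2_def)

lemma C2_imp_C1: "C2 f \<Longrightarrow> C1 f"
  by (simp add: C2_def C1_def differentiable_imp_continuous_on)

lemma partial_eqI:
  assumes "\<And>v. (f has_derivative f' v) (at v)" shows "partial i f = (\<lambda>v. f' v (axis i 1))"
  using partial_has_derivative [OF assms] by (simp add: fun_eq_iff)

lemma C1I:
  assumes "\<And>v. (f has_derivative f' v) (at v)" "\<And>i. continuous_on UNIV (\<lambda>v. f' v (axis i 1))"
  shows "C1 f"
  unfolding C1_def partial_eqI [OF assms(1)] using assms
  by (metis differentiable_def differentiable_on_def)

lemma partial_line:
  assumes "f differentiable_on UNIV"
  shows "((\<lambda>s. f (v + s *\<^sub>R axis i 1)) has_vector_derivative partial i f (v + t *\<^sub>R axis i 1)) (at t)"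
proof -
  obtain f' where f': "\<And>v. (f has_derivative f' v) (at v)" using differentiable_has_derivative [OF assms] by blast
  let ?u = "v + t *\<^sub>R axis i 1"
  interpret linear "f' ?u" using f' by (rule has_derivative_linear)
  have "((\<lambda>t. v + t *\<^sub>R axis i 1) has_derivative (\<lambda>t. t *\<^sub>R axis i 1)) (at t)"
    by (auto intro!: derivative_eq_intros)
  then have "((\<lambda>t. f (v + t *\<^sub>R axis i 1)) has_derivative (\<lambda>t. f' ?u (t *\<^sub>R axis i 1))) (at t)"
    by (rule has_derivative_compose) (rule f')
  then show ?thesis
    by (simp add: has_vector_derivative_def scale partial_has_derivative [OF f'])
qed

lemma partial_add:
  assumes "f differentiable_on UNIV" "g differentiable_on UNIV"
  shows "partial i (\<lambda>v. f v + g v) = (\<lambda>v. partial i f v + partial i g v)"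
proof -
  obtain f' where f: "\<And>v. (f has_derivative f' v) (at v)" using differentiable_has_derivative [OF assms(1)] by blast
  obtain g' where g: "\<And>v. (g has_derivative g' v) (at v)" using differentiable_has_derivative [OF assms(2)] by blast
  show ?thesis
    unfolding partial_eqI [OF has_derivative_add [OF f g]] partial_eqI [OF f] partial_eqI [OF g] ..
qed

lemma partial_scaleR:
  fixes a :: "real ^ 'n::finite \<Rightarrow> real"
  assumes "a differentiable_on UNIV" "g differentiable_on UNIV"
  shows "partial i (\<lambda>v. a v *\<^sub>R g v) = (\<lambda>v. a v *\<^sub>R partial i g v + partial i a v *\<^sub>R g v)"
proof -
  obtain f' where f: "\<And>v. (a has_derivative f' v) (at v)" using differentiable_has_derivative [OF assms(1)] by blast
  obtain g' where g: "\<And>v. (g has_derivative g' v) (at v)" using differentiable_has_derivative [OF assms(2)] by blast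
  show ?thesis
    unfolding partial_eqI [OF has_derivative_scaleR [OF f g]] partial_eqI [OF f] partial_eqI [OF g] ..
qed

lemma partial_mult:
  fixes f g :: "real ^ 'n::finite \<Rightarrow> 'b::real_normed_algebra"
  assumes "f differentiable_on UNIV" "g differentiable_on UNIV"
  shows "partial i (\<lambda>v. f v * g v) = (\<lambda>v. f v * partial i g v + partial i f v * g v)"
proof -
  obtain f' where f: "\<And>v. (f has_derivative f' v) (at v)" using differentiable_has_derivative [OF assms(1)] by blast
  obtain g' where g: "\<And>v. (g has_derivative g' v) (at v)" using differentiable_has_derivative [OF assms(2)] by blast
  show ?thesis
    unfolding partial_eqI [OF has_derivative_mult [OF f g]] partial_eqI [OF f] partial_eqI [OF g] ..
qed

lemma partial_cmult:
  fixes f :: "real ^ 'n::finite \<Rightarrow> 'b::real_normed_algebra"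
  assumes "f differentiable_on UNIV"
  shows "partial i (\<lambda>v. c * f v) = (\<lambda>v. c * partial i f v)"
proof -
  obtain f' where f: "\<And>v. (f has_derivative f' v) (at v)" using differentiable_has_derivative [OF assms(1)] by blast
  show ?thesis
    unfolding partial_eqI [OF has_derivative_mult_right [OF f]] partial_eqI [OF f] ..
qed

lemma C1_add: "C1 f \<Longrightarrow> C1 g \<Longrightarrow> C1 (\<lambda>v. f v + g v)"
  unfolding C1_def by (simp add: partial_add differentiable_on_add continuous_on_add)

lemma partial_const: "partial i (\<lambda>v. c) = (\<lambda>v. 0)"
  by (rule partial_eqI [OF has_derivative_const])

lemma C1_const: "C1 (\<lambda>v. c)"
  unfolding C1_def partial_const by simp

lemma C1_sum: "finite A \<Longrightarrow> (\<And>a. a \<in> A \<Longrightarrow> C1 (f a)) \<Longrightarrow> C1 (\<lambda>v. \<Sum>a\<in>A. f a v)"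
  by (induction A rule: finite_induct) (simp_all add: C1_const C1_add)

lemma C1_scaleR: "C1 a \<Longrightarrow> C1 f \<Longrightarrow> C1 (\<lambda>v. a v *\<^sub>R f v)"
proof -
  assume a: "C1 a" and f: "C1 f"
  have "(\<lambda>v. a v *\<^sub>R f v) differentiable_on UNIV"
    using a f by (simp add: C1_def differentiable_on_def differentiable_scaleR)
  then show ?thesis using a f unfolding C1_def
    by (auto simp: partial_scaleR intro!: continuous_on_add continuous_on_scaleR intro: differentiable_imp_continuous_on)
qed

lemma C1_mult:
  fixes f g :: "real ^ 'n::finite \<Rightarrow> 'b::real_normed_algebra"
  shows "C1 f \<Longrightarrow> C1 g \<Longrightarrow> C1 (\<lambda>v. f v * g v)"
proof -
  assume a: "C1 f" and f: "C1 g"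
  have "(\<lambda>v. f v * g v) differentiable_on UNIV"
    using a f by (simp add: C1_def differentiable_on_mult)
  then show ?thesis using a f unfolding C1_def
    by (auto simp: partial_mult intro!: continuous_on_add continuous_on_mult intro: differentiable_imp_continuous_on)
qed

lemma C1_of_real:
  assumes "C1 f" shows "C1 (\<lambda>v. of_real (f v) :: 'b::real_normed_algebra_1)"
    and "partial i (\<lambda>v. of_real (f v) :: 'b) = (\<lambda>v. of_real (partial i f v))"
proof -
  obtain f' where f: "\<And>v. (f has_derivative f' v) (at v)"
    using differentiable_has_derivative [OF C1_differentiable [OF assms]] by blast
  have *: "((\<lambda>v. of_real (f v) :: 'b) has_derivative (\<lambda>h. of_real (f' v h))) (at v)" for v
    by (rule bounded_linear.has_derivative [OF bounded_linear_of_real f])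
  show "partial i (\<lambda>v. of_real (f v) :: 'b) = (\<lambda>v. of_real (partial i f v))"
    unfolding partial_eqI [OF *] partial_eqI [OF f] ..
  show "C1 (\<lambda>v. of_real (f v) :: 'b)"
    using assms by (intro C1I [OF *] continuous_intros) (simp add: C1_def partial_eqI [OF f])
qed

lemma C2_linear_combination:
  fixes f g :: "real ^ 'n::finite \<Rightarrow> complex"
  assumes "C2 f" "C2 g" shows "C2 (\<lambda>v. a * f v + b * g v)"
proof -
  have d: "f differentiable_on UNIV" "g differentiable_on UNIV" using assms by (simp_all add: C2_def)
  have da: "(\<lambda>v. a * f v) differentiable_on UNIV" "(\<lambda>v. b * g v) differentiable_on UNIV"
    using d by (simp_all add: differentiable_on_mult)
  have "C1 (\<lambda>v. a * partial i f v + b * partial i g v)" for i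
    using assms by (intro C1_add C1_mult C1_const) (simp_all add: C2_def)
  then show ?thesis
    unfolding C2_def partial_add [OF da] partial_cmult [OF d(1)] partial_cmult [OF d(2)]
    using da by (simp add: differentiable_on_add)
qed

subsection \<open>Integration by parts\<close>

lemma integrable_compact_support:
  fixes g :: "real ^ 'n::finite \<Rightarrow> 'b::{banach, second_countable_topology}"
  assumes "continuous_on UNIV g" "\<And>v. norm v > S \<Longrightarrow> g v = 0"
  shows "integrable lborel g"
proof -
  have "integrable lborel (\<lambda>v. indicator (cball 0 S) v *\<^sub>R g v)"
    by (intro borel_integrable_compact compact_cball) (metis assms(1) continuous_on_subset subset_UNIV)
  also have "(\<lambda>v. indicator (cball 0 S) v *\<^sub>R g v) = g"
    using assms(2) by (auto simp: fun_eq_iff indicator_def)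
  finally show ?thesis .
qed

lemma bounded_compact_support:
  fixes g :: "real ^ 'n::finite \<Rightarrow> 'b::real_normed_vector"
  assumes "continuous_on UNIV g" "\<And>v. norm v > S \<Longrightarrow> g v = 0"
  obtains B where "B > 0" "\<And>v. norm (g v) \<le> B"
proof -
  have "compact (g ` cball 0 S)"
    by (intro compact_continuous_image compact_cball) (metis assms(1) continuous_on_subset subset_UNIV)
  then obtain B where B: "B > 0" "\<And>y. y \<in> g ` cball 0 S \<Longrightarrow> norm y \<le> B"
    using compact_imp_bounded bounded_pos by metis
  have "norm (g v) \<le> B" for v
    using B assms(2) [of v] by (cases "norm v \<le> S") auto
  then show ?thesis using B(1) that by blast
qed

lemma partial_outside_support:
  assumes "f differentiable_on UNIV" "\<And>v. norm v > S \<Longrightarrow> f v = 0" "norm v > S"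
  shows "partial i f v = 0"
proof -
  have "open {v. norm v > S}" by (intro open_Collect_less continuous_intros)
  then have "(f has_derivative (\<lambda>h. 0)) (at v)"
    using has_derivative_transform_within_open [OF has_derivative_const [of 0 "at v"], of "{v. norm v > S}" f] assms
    by auto
  then show ?thesis by (rule partial_has_derivative)
qed

lemma norm_line_bound:
  assumes "f differentiable_on UNIV" "\<And>v. norm (partial i f v) \<le> B" "h > 0"
  shows "norm (f (v + h *\<^sub>R axis i 1) - f v) \<le> B * h"
proof -
  let ?g = "\<lambda>s. f (v + s *\<^sub>R axis i 1)"
  have d: "(?g has_vector_derivative partial i f (v + t *\<^sub>R axis i 1)) (at t)" for t
    by (rule partial_line [OF assms(1)])
  have "norm (?g h - ?g 0) \<le> B * h - B * 0"
  proof (rule differentiable_bound_general [where f' = "\<lambda>t. partial i f (v + t *\<^sub>R axis i 1)" and \<phi>' = "\<lambda>_. B"])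
    show "continuous_on {0..h} ?g"
      using d by (meson continuous_at_imp_continuous_on has_vector_derivative_continuous)
    show "((*) B has_vector_derivative B) (at x)" for x
      by (auto intro!: derivative_eq_intros simp flip: has_real_derivative_iff_has_vector_derivative)
  qed (use assms d in \<open>auto intro!: continuous_intros\<close>)
  then show ?thesis by simp
qed

lemma tendsto_difference_quotient:
  fixes g :: "real \<Rightarrow> 'b::real_normed_vector"
  assumes "(g has_vector_derivative d) (at 0)"
  shows "((\<lambda>h. (1 / h) *\<^sub>R (g h - g 0)) \<longlongrightarrow> d) (at 0)"
proof -
  have "((\<lambda>h. norm (g (0 + h) - g 0 - h *\<^sub>R d) / norm h) \<longlongrightarrow> 0) (at 0)"
    using assms unfolding has_vector_derivative_def has_derivative_at by blast
  then have "((\<lambda>h. norm ((1 / h) *\<^sub>R (g h - g 0) - d)) \<longlongrightarrow> 0) (at 0)"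
  proof (rule Lim_transform_eventually)
    have "norm (g (0 + h) - g 0 - h *\<^sub>R d) / norm h = norm ((1 / h) *\<^sub>R (g h - g 0) - d)" if "h \<noteq> 0" for h
    proof -
      have "(1 / h) *\<^sub>R (g h - g 0) - d = (1 / h) *\<^sub>R (g h - g 0 - h *\<^sub>R d)"
        using that by (simp add: scaleR_diff_right)
      then show ?thesis by simp
    qed
    then show "\<forall>\<^sub>F h in at 0. norm (g (0 + h) - g 0 - h *\<^sub>R d) / norm h = norm ((1 / h) *\<^sub>R (g h - g 0) - d)"
      by (auto simp: eventually_at intro!: exI [of _ 1])
  qed
  then show ?thesis by (rule LIM_zero_cancel [OF tendsto_norm_zero_cancel])
qed

text \<open>Translation invariance of Lebesgue measure: the difference quotients integrate to 0.\<close>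

lemma integral_partial_eq_0:
  fixes f :: "real ^ 'n::finite \<Rightarrow> complex"
  assumes "C1 f" and supp: "\<And>v. norm v > S \<Longrightarrow> f v = 0"
  shows "(\<integral>v. partial i f v \<partial>lborel) = 0"
proof -
  have df: "f differentiable_on UNIV" and cf: "continuous_on UNIV f" and cp: "continuous_on UNIV (partial i f)"
    using assms(1) C1_continuous by (auto simp: C1_def)
  have supp': "partial i f v = 0" if "norm v > S" for v
    by (rule partial_outside_support [OF df supp that])
  obtain B where B: "B > 0" "\<And>v. norm (partial i f v) \<le> B"
    using bounded_compact_support [OF cp supp'] by blast
  define h where "h k = 1 / real (Suc k)" for k
  have h: "h k > 0" "h k \<le> 1" for k by (auto simp: h_def)
  define D where "D k v = (1 / h k) *\<^sub>R (f (v + h k *\<^sub>R axis i 1) - f v)" for k v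
  have fi: "integrable lborel f" by (rule integrable_compact_support [OF cf supp])
  have tr: "(\<integral>v. f (v + c) \<partial>lborel) = (\<integral>v. f v \<partial>lborel)" "integrable lborel (\<lambda>v. f (v + c))" for c
  proof -
    have m: "f \<in> borel_measurable borel" using cf by (rule borel_measurable_continuous_onI)
    have "lborel = distr lborel borel (\<lambda>v. c + v)" by (rule lborel_distr_plus [symmetric])
    then have "(\<integral>v. f v \<partial>lborel) = (\<integral>v. f v \<partial>distr lborel borel (\<lambda>v. c + v))"
      and "integrable lborel f \<longleftrightarrow> integrable (distr lborel borel (\<lambda>v. c + v)) f" by simp_all
    then show "(\<integral>v. f (v + c) \<partial>lborel) = (\<integral>v. f v \<partial>lborel)" "integrable lborel (\<lambda>v. f (v + c))"
      using fi m by (simp_all add: integral_distr integrable_distr_eq add.commute)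
  qed
  have "(\<integral>v. D k v \<partial>lborel) = 0" for k
    unfolding D_def using fi tr by (simp add: integral_diff)
  \<comment> \<open>Dominated convergence: the steps \<open>h k\<close> are at most 1, so all
    difference quotients live in the ball of radius \<open>S + 1\<close>, and the mean value
    inequality bounds them by the supremum of the partial derivative.\<close>
  moreover have "(\<lambda>k. \<integral>v. D k v \<partial>lborel) \<longlonglongrightarrow> (\<integral>v. partial i f v \<partial>lborel)"
  proof (rule integral_dominated_convergence [where w = "\<lambda>v. indicator (cball 0 (S + 1)) v *\<^sub>R B"])
    show "partial i f \<in> borel_measurable lborel"
      using borel_measurable_continuous_onI [OF cp] by simp
    show "D k \<in> borel_measurable lborel" for k
      unfolding D_def using borel_measurable_integrable [OF fi] borel_measurable_integrable [OF tr(2)]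
      by (intro borel_measurable_scaleR borel_measurable_diff) auto
    show "integrable lborel (\<lambda>v :: real ^ 'n. indicator (cball 0 (S + 1)) v *\<^sub>R B)"
      by (intro borel_integrable_compact compact_cball continuous_intros)
    show "AE v in lborel. (\<lambda>k. D k v) \<longlonglongrightarrow> partial i f v"
    proof (rule AE_I2)
      fix v
      have "((\<lambda>s. f (v + s *\<^sub>R axis i 1)) has_vector_derivative partial i f v) (at 0)"
        using partial_line [OF df, of v i 0] by simp
      then have "((\<lambda>s. (1 / s) *\<^sub>R (f (v + s *\<^sub>R axis i 1) - f (v + 0 *\<^sub>R axis i 1))) \<longlongrightarrow> partial i f v) (at 0)"
        by (rule tendsto_difference_quotient)
      moreover have "filterlim h (at 0) sequentially"
        unfolding h_def filterlim_at using LIMSEQ_inverse_real_of_nat by (auto simp: inverse_eq_divide)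
      ultimately have "(\<lambda>k. (1 / h k) *\<^sub>R (f (v + h k *\<^sub>R axis i 1) - f (v + 0 *\<^sub>R axis i 1))) \<longlonglongrightarrow> partial i f v"
        by (rule filterlim_compose)
      then show "(\<lambda>k. D k v) \<longlonglongrightarrow> partial i f v" by (simp add: D_def)
    qed
    show "AE v in lborel. norm (D k v) \<le> indicator (cball 0 (S + 1)) v *\<^sub>R B" for k
    proof (rule AE_I2)
      fix v
      show "norm (D k v) \<le> indicator (cball 0 (S + 1)) v *\<^sub>R B"
      proof (cases "norm v \<le> S + 1")
        case True
        have "norm (f (v + h k *\<^sub>R axis i 1) - f v) \<le> B * h k"
          by (rule norm_line_bound [OF df B(2) h(1)])
        then have "(1 / h k) * norm (f (v + h k *\<^sub>R axis i 1) - f v) \<le> (1 / h k) * (B * h k)"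
          using h [of k] by (intro mult_left_mono) auto
        then show ?thesis using True h [of k] unfolding D_def norm_scaleR by simp
      next
        case False
        have "norm v \<le> norm (v + h k *\<^sub>R axis i 1) + norm (h k *\<^sub>R axis i (1::real))"
          by (metis add_diff_cancel norm_triangle_ineq4)
        then have "norm (v + h k *\<^sub>R axis i 1) > S" using False h [of k] by simp
        then show ?thesis using False B(1) supp by (simp add: D_def)
      qed
    qed
  qed
  ultimately show ?thesis by (simp add: LIMSEQ_const_iff)
qed

subsection \<open>The Laplacian in the chart\<close>

text \<open>Sherman-Morrison formula for a rank-one perturbation of the identity. As
  \<open>matrix_inv\<close> is a choice, the explicit inverse is identified with it by uniqueness of
  two-sided inverses.\<close>

lemma matrix_inv_hyp_metric:
  "matrix_inv (hyp_metric v) $ i $ j = (if i = j then 1 else 0) + v $ i * v $ j"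
proof -
  define s where "s = 1 + v \<bullet> v"
  have s: "s > 0" by (simp add: s_def add_pos_nonneg)
  let ?M = "(\<chi> i j. (if i = j then 1 else 0) - (1/s) * (v $ i * v $ j)) :: real ^ 'a ^ 'a"
  let ?N = "(\<chi> i j. (if i = j then 1 else 0) - (-1) * (v $ i * v $ j)) :: real ^ 'a ^ 'a"
  have M: "hyp_metric v = ?M" by (simp add: vec_eq_iff hyp_metric_eq s_def)
  have c: "- 1 * a - (1/s) * (a + a * (v \<bullet> v)) * (-1) = 0" for a
    using s by (simp add: s_def field_simps)
  have "(?M ** ?N) *v x = x" for x
  proof -
    have "(?M ** ?N) *v x = ?M *v (?N *v x)" by (simp only: matrix_vector_mul_assoc)
    also have "\<dots> = (x + (v \<bullet> x) *\<^sub>R v) - ((1/s) * (v \<bullet> (x + (v \<bullet> x) *\<^sub>R v))) *\<^sub>R v"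
      unfolding one_minus_rank_one_vector by simp
    also have "(1/s) * (v \<bullet> (x + (v \<bullet> x) *\<^sub>R v)) = v \<bullet> x"
      using s by (simp add: inner_add_right s_def field_simps)
    finally show ?thesis by simp
  qed
  then have MN: "?M ** ?N = mat 1" unfolding matrix_eq by simp
  then have NM: "?N ** ?M = mat 1" by (simp only: matrix_left_right_inverse)
  have "matrix_inv ?M = ?N"
    unfolding matrix_inv_def
  proof (rule some_equality)
    fix X assume "?M ** X = mat 1 \<and> X ** ?M = mat 1"
    then have "X = X ** (?M ** ?N)" "X ** ?M = mat 1" unfolding MN by simp_all
    then show "X = ?N" by (simp only: matrix_mul_assoc matrix_mul_lid)
  qed (simp only: MN NM)
  then show ?thesis unfolding M by simp
qed

definition flux_coeff :: "'n::finite \<Rightarrow> 'n \<Rightarrow> real ^ 'n \<Rightarrow> real" where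
  "flux_coeff i j w = hyp_density w * ((if i = j then 1 else 0) + w $ i * w $ j)"

text \<open>The gradient multiplied by the volume density; the Laplacian is minus its Euclidean
  divergence divided by the density.\<close>

definition flux :: "'n::finite \<Rightarrow> (real ^ 'n \<Rightarrow> complex) \<Rightarrow> real ^ 'n \<Rightarrow> complex" where
  "flux i f w = (\<Sum>j\<in>UNIV. flux_coeff i j w *\<^sub>R partial j f w)"

lemma flux_coeff_sym: "flux_coeff i j w = flux_coeff j i w"
  by (auto simp: flux_coeff_def mult.commute)

lemma hyp_laplacian_flux:
  "hyp_laplacian f v = - (1 / hyp_density v) *\<^sub>R (\<Sum>i\<in>UNIV. partial i (flux i f) v)"
  unfolding hyp_laplacian_def flux_def flux_coeff_def matrix_inv_hyp_metric ..

lemma has_derivative_sigma: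
  "((\<lambda>v :: real ^ 'n::finite. sqrt (1 + v \<bullet> v)) has_derivative (\<lambda>h. (v \<bullet> h) / sqrt (1 + v \<bullet> v))) (at v)"
proof -
  have pos: "0 < 1 + v \<bullet> v" by (simp add: add_pos_nonneg)
  have 1: "((\<lambda>v. 1 + v \<bullet> v) has_derivative (\<lambda>h. 0 + (v \<bullet> h + h \<bullet> v))) (at v)"
    by (intro has_derivative_add has_derivative_const has_derivative_inner has_derivative_ident)
  show ?thesis
    by (rule has_derivative_eq_rhs [OF has_derivative_real_sqrt [OF pos 1]])
      (simp add: fun_eq_iff inner_commute inverse_eq_divide)
qed

lemma C1_hyp_density: "C1 (hyp_density :: real ^ 'n::finite \<Rightarrow> real)"
  and partial_hyp_density: "partial i hyp_density (v :: real ^ 'n) = - (v $ i) / sqrt (1 + v \<bullet> v) ^ 3"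
proof -
  have nz: "sqrt (1 + v \<bullet> v) \<noteq> 0" for v :: "real ^ 'n"
    by (metis add_pos_nonneg inner_ge_zero less_irrefl real_sqrt_eq_zero_cancel_iff zero_less_one)
  have d: "(hyp_density has_derivative (\<lambda>h. - (v \<bullet> h) / sqrt (1 + v \<bullet> v) ^ 3)) (at v)" for v :: "real ^ 'n"
  proof -
    have eq: "hyp_density = (\<lambda>v :: real ^ 'n. inverse (sqrt (1 + v \<bullet> v)))"
      by (simp add: fun_eq_iff hyp_density_eq inverse_eq_divide)
    show ?thesis
      unfolding eq
      by (rule has_derivative_eq_rhs [OF Deriv.has_derivative_inverse [OF nz has_derivative_sigma]])
        (simp add: fun_eq_iff inverse_eq_divide power3_eq_cube)
  qed
  show "C1 (hyp_density :: real ^ 'n \<Rightarrow> real)"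
  proof (rule C1I [OF d])
    show "continuous_on UNIV (\<lambda>v. - (v \<bullet> axis i 1) / sqrt (1 + v \<bullet> v) ^ 3)" for i :: 'n
      by (intro continuous_intros ballI power_not_zero) (metis add_pos_nonneg inner_ge_zero less_irrefl real_sqrt_eq_zero_cancel_iff zero_less_one)
  qed
  show "partial i hyp_density v = - (v $ i) / sqrt (1 + v \<bullet> v) ^ 3"
    by (simp add: partial_has_derivative [OF d] inner_axis)
qed

lemma C1_nth: "C1 (\<lambda>v :: real ^ 'n::finite. v $ i)"
  and partial_nth: "partial j (\<lambda>v :: real ^ 'n. v $ i) v = (if i = j then 1 else 0)"
proof -
  have d: "((\<lambda>v :: real ^ 'n. v $ i) has_derivative (\<lambda>h. h $ i)) (at v)" for v
    by (rule bounded_linear.has_derivative [OF bounded_linear_vec_nth has_derivative_ident])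
  show "C1 (\<lambda>v :: real ^ 'n. v $ i)" by (rule C1I [OF d]) (intro continuous_intros)
  show "partial j (\<lambda>v :: real ^ 'n. v $ i) v = (if i = j then 1 else 0)"
    by (simp add: partial_has_derivative [OF d] axis_def)
qed

lemma C1_flux_coeff: "C1 (flux_coeff i j)"
  unfolding flux_coeff_def [abs_def] by (intro C1_mult C1_add C1_hyp_density C1_nth C1_const)

lemma C1_flux: "C2 f \<Longrightarrow> C1 (flux i f)"
  unfolding flux_def [abs_def] by (intro C1_sum C1_scaleR C1_flux_coeff C2_partial) auto

lemma flux_outside_support:
  assumes "C2 f" "\<And>v. norm v > S \<Longrightarrow> f v = 0" "norm v > S"
  shows "flux i f v = 0"
  using partial_outside_support [OF _ assms(2,3)] assms(1) by (simp add: flux_def C2_def)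

lemma hyp_laplacian_linear_combination:
  assumes "C2 f" "C2 g"
  shows "hyp_laplacian (\<lambda>v. a * f v + b * g v) v = a * hyp_laplacian f v + b * hyp_laplacian g v"
proof -
  have d: "f differentiable_on UNIV" "g differentiable_on UNIV" using assms by (simp_all add: C2_def)
  have da: "(\<lambda>v. a * f v) differentiable_on UNIV" "(\<lambda>v. b * g v) differentiable_on UNIV"
    using d by (simp_all add: differentiable_on_mult)
  have fl: "flux i (\<lambda>v. a * f v + b * g v) = (\<lambda>w. a * flux i f w + b * flux i g w)" for i
    unfolding flux_def partial_add [OF da] partial_cmult [OF d(1)] partial_cmult [OF d(2)]
    by (simp add: fun_eq_iff scaleR_add_right sum.distrib sum_distrib_left)
  have dfl: "flux i f differentiable_on UNIV" "flux i g differentiable_on UNIV" for i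
    using C1_flux assms C1_differentiable by blast+
  have dfla: "(\<lambda>w. a * flux i f w) differentiable_on UNIV" "(\<lambda>w. b * flux i g w) differentiable_on UNIV" for i
    using dfl by (simp_all add: differentiable_on_mult)
  show ?thesis
    unfolding hyp_laplacian_flux fl partial_add [OF dfla] partial_cmult [OF dfl(1)] partial_cmult [OF dfl(2)]
    by (simp add: sum.distrib scaleR_add_right flip: sum_distrib_left)
qed

text \<open>The support conditions concern products, so that the lemma applies with either factor
  compactly supported and can be used in both directions.\<close>

lemma green_half:
  assumes "C2 f" "C2 g" and supp: "\<And>v. norm v > S \<Longrightarrow> f v = 0 \<or> g v = 0"
    and supp2: "\<And>v i. norm v > S \<Longrightarrow> flux i f v * g v = 0 \<and> partial i (flux i f) v * g v = 0 \<and> flux i f v * partial i g v = 0"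
  shows "(\<integral>v. (\<Sum>i\<in>UNIV. partial i (flux i f) v) * g v \<partial>lborel)
    = - (\<integral>v. (\<Sum>i\<in>UNIV. flux i f v * partial i g v) \<partial>lborel)"
proof -
  have c: "C1 (flux i f)" "C1 g" for i using assms C1_flux C2_imp_C1 by auto
  have d: "flux i f differentiable_on UNIV" "g differentiable_on UNIV" for i using c C1_differentiable by auto
  have i1: "integrable lborel (\<lambda>v. partial i (flux i f) v * g v)" for i
    using c by (intro integrable_compact_support [where S = S] continuous_on_mult C1_partial_continuous C1_continuous)
      (use supp2 in auto)
  have i2: "integrable lborel (\<lambda>v. flux i f v * partial i g v)" for i
    using c by (intro integrable_compact_support [where S = S] continuous_on_mult C1_partial_continuous C1_continuous)
      (use supp2 in auto)
  have "(\<integral>v. partial i (flux i f) v * g v \<partial>lborel) = - (\<integral>v. flux i f v * partial i g v \<partial>lborel)" for i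
  proof -
    have "(\<integral>v. partial i (\<lambda>v. flux i f v * g v) v \<partial>lborel) = 0"
      by (rule integral_partial_eq_0 [OF C1_mult [OF c(1) c(2)], where S = S]) (use supp2 in auto)
    then show ?thesis
      unfolding partial_mult [OF d(1) d(2)] using i1 i2 by (simp add: add_eq_0_iff)
  qed
  then show ?thesis
    by (simp add: sum_distrib_right integral_sum i1 i2 sum_negf)
qed

text \<open>Both sides equal the same Dirichlet form, which is symmetric because
  \<open>flux_coeff\<close> is. Only \<open>g\<close> has bounded support; \<open>f\<close> will be
  an eigenfunction lifted to the whole space.\<close>

lemma green_identity:
  assumes "C2 f" "C2 g" and supp: "\<And>v. norm v > S \<Longrightarrow> g v = 0"
  shows "(\<integral>v. hyp_density v *\<^sub>R (hyp_laplacian f v * g v) \<partial>lborel)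
    = (\<integral>v. hyp_density v *\<^sub>R (f v * hyp_laplacian g v) \<partial>lborel)"
proof -
  have dg: "g differentiable_on UNIV" using assms by (simp add: C2_def)
  have pg: "partial i g v = 0" if "norm v > S" for i v by (rule partial_outside_support [OF dg supp that])
  have fg: "flux i g v = 0" if "norm v > S" for i v by (rule flux_outside_support [OF assms(2) supp that])
  have pfg: "partial i (flux i g) v = 0" if "norm v > S" for i v
    by (rule partial_outside_support [OF C1_differentiable [OF C1_flux [OF assms(2)]] fg that])
  have e: "hyp_density v *\<^sub>R (hyp_laplacian f v * g v) = - ((\<Sum>i\<in>UNIV. partial i (flux i f) v) * g v)" for f g v
    using hyp_density_pos [of v] by (simp add: hyp_laplacian_flux)
  have "(\<integral>v. hyp_density v *\<^sub>R (hyp_laplacian f v * g v) \<partial>lborel) = (\<integral>v. (\<Sum>i\<in>UNIV. flux i f v * partial i g v) \<partial>lborel)"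
    unfolding e by (simp add: green_half [OF assms(1,2), of S] supp pg)
  also have "(\<lambda>v. \<Sum>i\<in>UNIV. flux i f v * partial i g v) = (\<lambda>v. \<Sum>i\<in>UNIV. flux i g v * partial i f v)"
  proof
    fix v
    have "(\<Sum>i\<in>UNIV. flux i f v * partial i g v) = (\<Sum>i\<in>UNIV. \<Sum>j\<in>UNIV. flux_coeff i j v *\<^sub>R (partial j f v * partial i g v))"
      by (simp add: flux_def sum_distrib_right)
    also have "\<dots> = (\<Sum>j\<in>UNIV. \<Sum>i\<in>UNIV. flux_coeff i j v *\<^sub>R (partial j f v * partial i g v))"
      by (rule sum.swap)
    also have "\<dots> = (\<Sum>i\<in>UNIV. flux i g v * partial i f v)"
      by (simp only: flux_def sum_distrib_right mult_scaleR_left) (simp add: flux_coeff_sym mult.commute)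
    finally show "(\<Sum>i\<in>UNIV. flux i f v * partial i g v) = (\<Sum>i\<in>UNIV. flux i g v * partial i f v)" .
  qed
  also have "(\<integral>v. (\<Sum>i\<in>UNIV. flux i g v * partial i f v) \<partial>lborel) = (\<integral>v. hyp_density v *\<^sub>R (hyp_laplacian g v * f v) \<partial>lborel)"
    unfolding e by (simp add: green_half [OF assms(2,1), of S] supp fg pfg)
  finally show ?thesis by (simp add: mult.commute)
qed

subsection \<open>Radial functions\<close>

definition dlor :: "'n::finite vec1 \<Rightarrow> 'n \<Rightarrow> real ^ 'n \<Rightarrow> real" where
  "dlor b i v = b $ None * (v $ i * hyp_density v) - b $ Some i"

lemma sqrt_density: "sqrt (1 + v \<bullet> v) = (1 + v \<bullet> v) * hyp_density v"
  by (simp add: hyp_density_eq real_div_sqrt add_nonneg_nonneg)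

lemma density_square: "hyp_density v * hyp_density v * (1 + v \<bullet> v) = 1"
proof -
  have "0 < 1 + v \<bullet> v" by (simp add: add_pos_nonneg)
  then show ?thesis by (simp add: hyp_density_eq)
qed

lemma lor_chart: "lor b (hyp_chart v) = b $ None * sqrt (1 + v \<bullet> v) - space_part b \<bullet> v"
  by (simp add: lor_def mink_space_part) (simp add: hyp_chart_mkvec)

lemma has_derivative_lor_chart:
  "((\<lambda>v. lor b (hyp_chart v)) has_derivative (\<lambda>h. b $ None * ((v \<bullet> h) / sqrt (1 + v \<bullet> v)) - space_part b \<bullet> h)) (at v)"
  unfolding lor_chart
  by (intro has_derivative_diff has_derivative_mult_right has_derivative_sigma has_derivative_inner_right has_derivative_ident)

lemma dlor_axis: "b $ None * ((v \<bullet> axis i 1) / sqrt (1 + v \<bullet> v)) - space_part b \<bullet> axis i 1 = dlor b i v"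
  by (simp add: dlor_def hyp_density_eq inner_axis)

lemma C1_dlor: "C1 (dlor b i)"
proof -
  have "dlor b i = (\<lambda>v. b $ None * (v $ i * hyp_density v) + - (b $ Some i))"
    by (simp add: fun_eq_iff dlor_def)
  then show ?thesis by (simp only:) (intro C1_add C1_mult C1_const C1_nth C1_hyp_density)
qed

lemma C1_radial:
  assumes f: "\<And>v. (f has_real_derivative f1 (lor b (hyp_chart v))) (at (lor b (hyp_chart v)))"
    and c: "continuous_on UNIV (\<lambda>v. f1 (lor b (hyp_chart v)))"
  shows "C1 (\<lambda>v. f (lor b (hyp_chart v)))"
    and "partial i (\<lambda>v. f (lor b (hyp_chart v))) = (\<lambda>v. f1 (lor b (hyp_chart v)) * dlor b i v)"
proof -
  have d: "((\<lambda>v. f (lor b (hyp_chart v))) has_derivative (\<lambda>h. f1 (lor b (hyp_chart v)) *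
      (b $ None * ((v \<bullet> h) / sqrt (1 + v \<bullet> v)) - space_part b \<bullet> h))) (at v)" for v
    by (rule has_derivative_compose [OF has_derivative_lor_chart f [unfolded has_field_derivative_def]])
  show "C1 (\<lambda>v. f (lor b (hyp_chart v)))"
    by (rule C1I [OF d]) (unfold dlor_axis, intro continuous_on_mult c C1_continuous C1_dlor)
  show "partial i (\<lambda>v. f (lor b (hyp_chart v))) = (\<lambda>v. f1 (lor b (hyp_chart v)) * dlor b i v)"
    unfolding partial_eqI [OF d] dlor_axis ..
qed

context
  fixes f f1 f2 :: "real \<Rightarrow> real" and b :: "'n::finite vec1"
  assumes f: "\<And>v. (f has_real_derivative f1 (lor b (hyp_chart v))) (at (lor b (hyp_chart v)))"
    and f1: "\<And>v. (f1 has_real_derivative f2 (lor b (hyp_chart v))) (at (lor b (hyp_chart v)))"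
    and f2: "continuous_on UNIV (\<lambda>v. f2 (lor b (hyp_chart v)))"
begin

lemma C1_radial_f1: "C1 (\<lambda>v. f1 (lor b (hyp_chart v)))"
  by (rule C1_radial(1) [OF f1 f2])

lemma C1_radial_f: "C1 (\<lambda>v. f (lor b (hyp_chart v)))"
  by (rule C1_radial(1) [OF f C1_continuous [OF C1_radial_f1]])

lemma partial_radial:
  "partial i (\<lambda>v. complex_of_real (f (lor b (hyp_chart v)))) = (\<lambda>v. complex_of_real (f1 (lor b (hyp_chart v)) * dlor b i v))"
  unfolding C1_of_real(2) [OF C1_radial_f] C1_radial(2) [OF f C1_continuous [OF C1_radial_f1]] ..

lemma C2_radial: "C2 (\<lambda>v. complex_of_real (f (lor b (hyp_chart v))))"
proof -
  have a: "C1 (\<lambda>v. complex_of_real (f (lor b (hyp_chart v))))" by (rule C1_of_real(1) [OF C1_radial_f])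
  have "C1 (\<lambda>v. complex_of_real (f1 (lor b (hyp_chart v)) * dlor b i v))" for i
    by (rule C1_of_real(1) [OF C1_mult [OF C1_radial_f1 C1_dlor]])
  then show ?thesis
    unfolding C2_def partial_radial using C1_differentiable [OF a] by blast
qed

lemma sum_coord_dlor:
  "(\<Sum>i\<in>UNIV. v $ i * dlor b i v) = b $ None * (v \<bullet> v) * hyp_density v - space_part b \<bullet> v"
proof -
  have "(\<Sum>i\<in>UNIV. v $ i * dlor b i v) = (\<Sum>i\<in>UNIV. (b $ None * hyp_density v) * (v $ i * v $ i) - b $ Some i * v $ i)"
    by (intro sum.cong refl) (simp add: dlor_def right_diff_distrib)
  also have "\<dots> = (b $ None * hyp_density v) * (\<Sum>i\<in>UNIV. v $ i * v $ i) - (\<Sum>i\<in>UNIV. b $ Some i * v $ i)"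
    by (simp only: sum_subtractf sum_distrib_left)
  finally show ?thesis by (simp add: inner_vec_def mult_ac)
qed

lemma sum_base_dlor:
  "(\<Sum>i\<in>UNIV. b $ Some i * dlor b i v) = b $ None * (space_part b \<bullet> v) * hyp_density v - space_part b \<bullet> space_part b"
proof -
  have "(\<Sum>i\<in>UNIV. b $ Some i * dlor b i v) = (\<Sum>i\<in>UNIV. (b $ None * hyp_density v) * (b $ Some i * v $ i) - b $ Some i * b $ Some i)"
    by (intro sum.cong refl) (simp add: dlor_def right_diff_distrib)
  also have "\<dots> = (b $ None * hyp_density v) * (\<Sum>i\<in>UNIV. b $ Some i * v $ i) - (\<Sum>i\<in>UNIV. b $ Some i * b $ Some i)"
    by (simp only: sum_subtractf sum_distrib_left)
  finally show ?thesis by (simp add: inner_vec_def mult_ac)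
qed

text \<open>The tangential projection of \<open>- b\<close> at the point \<open>y\<close> of the
  hyperboloid is \<open>lor b y *\<^sub>R y - b\<close>; its space part appears here, times the
  derivative and the density.\<close>

lemma flux_radial:
  "flux i (\<lambda>v. complex_of_real (f (lor b (hyp_chart v))))
    = (\<lambda>v. complex_of_real (f1 (lor b (hyp_chart v)) * ((v $ i * lor b (hyp_chart v) + - (b $ Some i)) * hyp_density v)))"
proof
  fix v
  let ?w = "lor b (hyp_chart v)"
  have "(\<Sum>j\<in>UNIV. flux_coeff i j v * dlor b j v)
      = (\<Sum>j\<in>UNIV. (if i = j then hyp_density v * dlor b j v else 0) + (hyp_density v * v $ i) * (v $ j * dlor b j v))"
    by (intro sum.cong refl) (simp add: flux_coeff_def algebra_simps)
  also have "\<dots> = hyp_density v * dlor b i v + (hyp_density v * v $ i) * (\<Sum>j\<in>UNIV. v $ j * dlor b j v)"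
    by (simp add: sum.distrib sum_distrib_left)
  also have "\<dots> = (v $ i * ?w + - (b $ Some i)) * hyp_density v"
    unfolding sum_coord_dlor lor_chart sqrt_density by (simp add: dlor_def algebra_simps)
  finally have *: "(\<Sum>j\<in>UNIV. flux_coeff i j v * dlor b j v) = (v $ i * ?w + - (b $ Some i)) * hyp_density v" .
  have "flux i (\<lambda>v. complex_of_real (f (lor b (hyp_chart v)))) v
      = complex_of_real (\<Sum>j\<in>UNIV. f1 ?w * (flux_coeff i j v * dlor b j v))"
    unfolding flux_def partial_radial by (simp add: scaleR_conv_of_real mult_ac)
  also have "(\<Sum>j\<in>UNIV. f1 ?w * (flux_coeff i j v * dlor b j v)) = f1 ?w * ((v $ i * ?w + - (b $ Some i)) * hyp_density v)"
    by (simp only: sum_distrib_left [symmetric] *)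
  finally show "flux i (\<lambda>v. complex_of_real (f (lor b (hyp_chart v)))) v
      = complex_of_real (f1 ?w * ((v $ i * ?w + - (b $ Some i)) * hyp_density v))" .
qed

text \<open>Since \<open>b\<close> is any ambient vector, one computation serves two cases: a point
  of the hyperboloid, with \<open>mink b b = -1\<close>, gives radial functions, and a null vector
  gives horospherical ones.\<close>

lemma hyp_laplacian_radial:
  "hyp_laplacian (\<lambda>v. complex_of_real (f (lor b (hyp_chart v)))) v
    = - complex_of_real (((lor b (hyp_chart v))\<^sup>2 + mink b b) * f2 (lor b (hyp_chart v))
        + real CARD('n) * lor b (hyp_chart v) * f1 (lor b (hyp_chart v)))"
proof -
  let ?w = "\<lambda>v. lor b (hyp_chart v)"
  let ?D = "hyp_density v"
  have cw: "C1 ?w" and pw: "partial i ?w = (\<lambda>v. 1 * dlor b i v)" for i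
    using C1_radial [of "\<lambda>x. x" "\<lambda>_. 1" b] by auto
  have c1: "C1 (\<lambda>v. v $ i * ?w v)" for i by (intro C1_mult C1_nth cw)
  have c2: "C1 (\<lambda>v. v $ i * ?w v + - (b $ Some i))" for i by (intro C1_add c1 C1_const)
  have c3: "C1 (\<lambda>v. (v $ i * ?w v + - (b $ Some i)) * hyp_density v)" for i by (intro C1_mult c2 C1_hyp_density)
  have D3: "partial i hyp_density v = - (v $ i) * (?D * ?D * ?D)" for i
    by (simp add: partial_hyp_density hyp_density_eq power3_eq_cube)
  have pG: "partial i (\<lambda>v. f1 (?w v) * ((v $ i * ?w v + - (b $ Some i)) * hyp_density v)) v
    = (f1 (?w v) * ?D) * ((- (?w v * (?D * ?D))) * (v $ i * v $ i) + (?D * ?D) * (b $ Some i * v $ i) + v $ i * dlor b i v + ?w v)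
      + (f2 (?w v) * ?D) * (?w v * (v $ i * dlor b i v) + (- 1) * (b $ Some i * dlor b i v))" for i
    unfolding partial_mult [OF C1_differentiable [OF C1_radial_f1] C1_differentiable [OF c3]]
      partial_mult [OF C1_differentiable [OF c2] C1_differentiable [OF C1_hyp_density]]
      partial_add [OF C1_differentiable [OF c1] C1_differentiable [OF C1_const]]
      partial_mult [OF C1_differentiable [OF C1_nth] C1_differentiable [OF cw]]
      C1_radial(2) [OF f1 f2] pw partial_const D3 partial_nth
    by (simp add: algebra_simps)
  define A B where "A = v \<bullet> v" and "B = space_part b \<bullet> v"
  have sA: "(\<Sum>i\<in>UNIV. v $ i * v $ i) = A" by (simp add: A_def inner_vec_def)
  have sB: "(\<Sum>i\<in>UNIV. b $ Some i * v $ i) = B" by (simp add: B_def inner_vec_def)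
  have "(\<Sum>i\<in>UNIV. partial i (\<lambda>v. f1 (?w v) * ((v $ i * ?w v + - (b $ Some i)) * hyp_density v)) v)
    = (f1 (?w v) * ?D) * ((- (?w v * (?D * ?D))) * A + (?D * ?D) * B + (b $ None * A * ?D - B) + real CARD('n) * ?w v)
      + (f2 (?w v) * ?D) * (?w v * (b $ None * A * ?D - B) + (- 1) * (b $ None * B * ?D - space_part b \<bullet> space_part b))"
    unfolding pG by (simp only: sum.distrib sum_distrib_left [symmetric] sA sB sum_coord_dlor sum_base_dlor
      sum_constant A_def [symmetric] B_def [symmetric])
  also have "\<dots> = ?D * (((?w v)\<^sup>2 + mink b b) * f2 (?w v) + real CARD('n) * ?w v * f1 (?w v))"
  proof -
    have w: "?w v = b $ None * ((1 + A) * ?D) - B"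
      by (simp only: lor_chart sqrt_density A_def B_def)
    have DD: "?D * ?D * (1 + A) = 1" using density_square by (simp only: A_def)
    have m: "mink b b = space_part b \<bullet> space_part b - b $ None * b $ None" by (rule mink_space_part)
    \<comment> \<open>This bracket and the deviation in the next one are multiples of
      \<open>1 - ?D * ?D * (1 + A)\<close>, which vanishes by the formula for the density.\<close>
    have 1: "(- (?w v * (?D * ?D))) * A + (?D * ?D) * B + (b $ None * A * ?D - B) = 0"
    proof -
      have "(- (?w v * (?D * ?D))) * A + (?D * ?D) * B + (b $ None * A * ?D - B)
          = (1 - ?D * ?D * (1 + A)) * (b $ None * A * ?D - B)"
        unfolding w by algebra
      then show ?thesis unfolding DD by simp
    qed
    have 2: "?w v * (b $ None * A * ?D - B) + (- 1) * (b $ None * B * ?D - space_part b \<bullet> space_part b) = (?w v)\<^sup>2 + mink b b"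
    proof -
      have "?w v * (b $ None * A * ?D - B) + (- 1) * (b $ None * B * ?D - space_part b \<bullet> space_part b)
          - ((?w v)\<^sup>2 + mink b b) = (1 - ?D * ?D * (1 + A)) * (b $ None * b $ None)"
        unfolding w m by algebra
      then show ?thesis unfolding DD by simp
    qed
    show ?thesis unfolding 1 2 by (simp add: algebra_simps)
  qed
  finally have s: "(\<Sum>i\<in>UNIV. partial i (\<lambda>v. f1 (?w v) * ((v $ i * ?w v + - (b $ Some i)) * hyp_density v)) v)
    = ?D * (((?w v)\<^sup>2 + mink b b) * f2 (?w v) + real CARD('n) * ?w v * f1 (?w v))" .
  have D0: "?D \<noteq> 0" using hyp_density_pos [of v] by simp
  show ?thesis
    unfolding hyp_laplacian_flux flux_radial C1_of_real(2) [OF C1_mult [OF C1_radial_f1 c3]]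
      of_real_sum [symmetric] s
    using D0 by (simp add: scaleR_conv_of_real)
qed

end

subsection \<open>The radial test functions\<close>

text \<open>A quadratic error bound survives integration over a parameter, so the same criterion
  differentiates the powers of \<open>pp\<close> and, under the integral sign, the moments.\<close>

lemma has_vector_derivative_quadratic:
  fixes f :: "real \<Rightarrow> 'b::real_normed_vector"
  assumes "\<And>h. \<bar>h\<bar> \<le> 1 \<Longrightarrow> norm (f (x + h) - f x - h *\<^sub>R d) \<le> C * h\<^sup>2"
  shows "(f has_vector_derivative d) (at x)"
  unfolding has_vector_derivative_def has_derivative_at
proof
  show "bounded_linear (\<lambda>h. h *\<^sub>R d)" by (rule bounded_linear_scaleR_left)
  show "((\<lambda>h. norm (f (x + h) - f x - h *\<^sub>R d) / norm h) \<longlongrightarrow> 0) (at 0)"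
  proof (rule Lim_null_comparison)
    have "norm (norm (f (x + h) - f x - h *\<^sub>R d) / norm h) \<le> C * \<bar>h\<bar>" if "h \<noteq> 0" "\<bar>h\<bar> < 1" for h
    proof -
      have "norm (f (x + h) - f x - h *\<^sub>R d) \<le> (C * \<bar>h\<bar>) * \<bar>h\<bar>"
        using assms [of h] that by (simp add: power2_eq_square)
      then show ?thesis using that by (simp add: divide_le_eq)
    qed
    then show "\<forall>\<^sub>F h in at 0. norm (norm (f (x + h) - f x - h *\<^sub>R d) / norm h) \<le> C * \<bar>h\<bar>"
      unfolding eventually_at by (auto intro!: exI [of _ 1])
    have "((\<lambda>h. C * \<bar>h\<bar>) \<longlongrightarrow> C * \<bar>0\<bar>) (at (0::real))" by (intro tendsto_intros)
    then show "((\<lambda>h. C * \<bar>h\<bar>) \<longlongrightarrow> 0) (at (0::real))" by simp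
  qed
qed

definition pp :: "real \<Rightarrow> real" where "pp a = max 0 a"

lemma pp_nonneg [simp]: "0 \<le> pp a" by (simp add: pp_def)

lemma pp_neg: "a \<le> 0 \<Longrightarrow> pp a = 0" by (simp add: pp_def)

lemma continuous_on_pp [continuous_intros]: "continuous_on S f \<Longrightarrow> continuous_on S (\<lambda>x. pp (f x))"
  unfolding pp_def by (intro continuous_intros)

text \<open>Stated with an explicit error instead of as a derivative: the bound is uniform in
  \<open>a\<close>, also across the kink at 0, and can therefore be integrated.\<close>

lemma pp_square_estimate: "\<bar>(pp (a + h))\<^sup>2 - (pp a)\<^sup>2 - h * (2 * pp a)\<bar> \<le> h\<^sup>2"
proof (cases "a \<ge> 0")
  case a: True
  have 0: "(a + h)\<^sup>2 - a\<^sup>2 - h * (2 * a) = h\<^sup>2" by (simp add: power2_eq_square algebra_simps)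
  show ?thesis
  proof (cases "a + h \<ge> 0")
    case True
    then show ?thesis using a 0 by (simp add: pp_def)
  next
    case False
    then have "(a + h)\<^sup>2 \<le> h\<^sup>2" using a by (simp flip: abs_le_square_iff)
    moreover have "0 \<le> (a + h)\<^sup>2" by simp
    moreover have "(pp (a + h))\<^sup>2 - (pp a)\<^sup>2 - h * (2 * pp a) = h\<^sup>2 - (a + h)\<^sup>2"
      using False a 0 by (simp add: pp_def)
    ultimately show ?thesis by linarith
  qed
next
  case a: False
  show ?thesis
  proof (cases "a + h \<ge> 0")
    case True
    then have "(a + h)\<^sup>2 \<le> h\<^sup>2" using a by (simp flip: abs_le_square_iff)
    then show ?thesis using a True by (simp add: pp_def)
  qed (use a in \<open>simp add: pp_def\<close>)
qed

lemma pp_cube_estimate: "\<bar>(pp (a + h)) ^ 3 - (pp a) ^ 3 - h * (3 * (pp a)\<^sup>2)\<bar> \<le> 3 * (pp a + \<bar>h\<bar>) * h\<^sup>2"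
proof (cases "a \<ge> 0")
  case a: True
  show ?thesis
  proof (cases "a + h \<ge> 0")
    case True
    have "(a + h) ^ 3 - a ^ 3 - h * (3 * a\<^sup>2) = (3 * a + h) * h\<^sup>2"
      by (simp add: power2_eq_square power3_eq_cube algebra_simps)
    moreover have "\<bar>(3 * a + h) * h\<^sup>2\<bar> \<le> (3 * (a + \<bar>h\<bar>)) * h\<^sup>2"
      unfolding abs_mult using a by (intro mult_mono) auto
    ultimately show ?thesis using a True by (simp add: pp_def)
  next
    case False
    then have h: "a < - h" "h < 0" using a by auto
    have e: "- (a ^ 3) - h * (3 * a\<^sup>2) = a\<^sup>2 * (3 * (- h) - a)"
      by (simp add: power2_eq_square power3_eq_cube algebra_simps)
    have "0 \<le> a\<^sup>2 * (3 * (- h) - a)" using h a by (intro mult_nonneg_nonneg) auto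
    moreover have "a\<^sup>2 * (3 * (- h) - a) \<le> h\<^sup>2 * (3 * (a + \<bar>h\<bar>))"
    proof (rule mult_mono)
      show "a\<^sup>2 \<le> h\<^sup>2" using h a by (simp flip: abs_le_square_iff)
    qed (use h a in auto)
    ultimately have "\<bar>- (a ^ 3) - h * (3 * a\<^sup>2)\<bar> \<le> 3 * (a + \<bar>h\<bar>) * h\<^sup>2"
      unfolding e by (simp add: mult_ac)
    then show ?thesis using False a by (simp add: pp_def)
  qed
next
  case a: False
  show ?thesis
  proof (cases "a + h \<ge> 0")
    case True
    have "(a + h) ^ 3 \<le> h ^ 3" using a True by (intro power_mono) auto
    also have "\<dots> = \<bar>h\<bar> * h\<^sup>2" using a True by (simp add: power3_eq_cube power2_eq_square)
    also have "\<dots> \<le> 3 * \<bar>h\<bar> * h\<^sup>2" by (intro mult_right_mono) auto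
    finally show ?thesis using a True by (simp add: pp_def)
  qed (use a in \<open>simp add: pp_def\<close>)
qed

lemma DERIV_pp_square: "((\<lambda>x. (pp x)\<^sup>2) has_real_derivative 2 * pp x) (at x)"
  unfolding has_real_derivative_iff_has_vector_derivative
  by (rule has_vector_derivative_quadratic [where C = 1]) (use pp_square_estimate in simp)

lemma DERIV_pp_cube: "((\<lambda>x. (pp x) ^ 3) has_real_derivative 3 * (pp x)\<^sup>2) (at x)"
  unfolding has_real_derivative_iff_has_vector_derivative
proof (rule has_vector_derivative_quadratic [where C = "3 * (pp x + 1)"])
  fix h :: real assume "\<bar>h\<bar> \<le> 1"
  then have "3 * (pp x + \<bar>h\<bar>) * h\<^sup>2 \<le> 3 * (pp x + 1) * h\<^sup>2" by (intro mult_right_mono) auto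
  then show "norm ((pp (x + h)) ^ 3 - (pp x) ^ 3 - h *\<^sub>R (3 * (pp x)\<^sup>2)) \<le> 3 * (pp x + 1) * h\<^sup>2"
    using pp_cube_estimate [of x h] by simp
qed

lemma DERIV_pp_diff_cube: "((\<lambda>w. (pp (W - w)) ^ 3) has_real_derivative - 3 * (pp (W - w))\<^sup>2) (at w)"
proof -
  have "((\<lambda>w. W - w) has_real_derivative - 1) (at w)" by (auto intro!: derivative_eq_intros)
  from DERIV_chain2 [OF DERIV_pp_cube this] show ?thesis by simp
qed

lemma DERIV_pp_diff_square: "((\<lambda>w. - 3 * (pp (W - w))\<^sup>2) has_real_derivative 6 * pp (W - w)) (at w)"
proof -
  have "((\<lambda>w. W - w) has_real_derivative - 1) (at w)" by (auto intro!: derivative_eq_intros)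
  from DERIV_cmult [OF DERIV_chain2 [OF DERIV_pp_square this], of "- 3"] show ?thesis by simp
qed

lemma test_function_C2: "C2 (\<lambda>v. complex_of_real ((pp (W - lor b (hyp_chart v))) ^ 3))"
  by (rule C2_radial [OF DERIV_pp_diff_cube DERIV_pp_diff_square]) (intro continuous_intros)

lemma test_function_laplacian:
  "hyp_laplacian (\<lambda>v. complex_of_real ((pp (W - lor b (hyp_chart v))) ^ 3)) v
    = - complex_of_real (((lor b (hyp_chart v))\<^sup>2 + mink b b) * (6 * pp (W - lor b (hyp_chart v)))
        + real CARD('n) * lor b (hyp_chart v) * (- 3 * (pp (W - lor b (hyp_chart v)))\<^sup>2))"
  for b :: "'n::finite vec1"
  by (rule hyp_laplacian_radial [OF DERIV_pp_diff_cube DERIV_pp_diff_square]) (intro continuous_intros)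

text \<open>The integral over hyperbolic space of the function, read in the chart, against the
  \<open>k\<close>-th power of the cut-off of the ball with parameter \<open>W\<close> around
  \<open>x\<close>.\<close>

definition radial_moment :: "(real ^ 'n::finite \<Rightarrow> complex) \<Rightarrow> 'n vec1 \<Rightarrow> nat \<Rightarrow> real \<Rightarrow> complex" where
  "radial_moment \<Phi> x k W = (\<integral>v. (hyp_density v * (pp (W - lor x (hyp_chart v))) ^ k) *\<^sub>R \<Phi> v \<partial>lborel)"

lemma norm_chart_le: "x \<in> hyp \<Longrightarrow> norm v \<le> 2 * x $ None * lor x (hyp_chart v)"
proof -
  assume x: "x \<in> hyp"
  have "norm v \<le> sqrt (1 + v \<bullet> v)" by (rule real_le_rsqrt) (simp add: dot_square_norm)
  also have "\<dots> = lor hyp_origin (hyp_chart v)" by (simp add: lor_origin) (simp add: hyp_chart_mkvec)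
  also have "\<dots> \<le> 2 * lor hyp_origin x * lor x (hyp_chart v)" by (intro lor_triangle x) simp_all
  finally show ?thesis by (simp add: lor_origin)
qed

text \<open>The triangle inequality through the origin encloses a ball around \<open>x\<close> in a
  Euclidean ball of the chart, so the cut-off has the bounded support needed for integrability and
  for Green's identity.\<close>

lemma pp_outside:
  assumes "x \<in> hyp" "norm v > 2 * x $ None * \<bar>W\<bar>" shows "pp (W - lor x (hyp_chart v)) = 0"
proof (rule pp_neg, rule ccontr)
  assume "\<not> W - lor x (hyp_chart v) \<le> 0"
  then have "lor x (hyp_chart v) \<le> \<bar>W\<bar>" by simp
  moreover have "x $ None > 0" using assms by (simp add: hyp_def)
  ultimately have "2 * x $ None * lor x (hyp_chart v) \<le> 2 * x $ None * \<bar>W\<bar>" by (intro mult_left_mono) auto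
  then show False using norm_chart_le [OF assms(1), of v] assms(2) by simp
qed

lemma lor_chart_ge_1: "x \<in> hyp \<Longrightarrow> lor x (hyp_chart v) \<ge> 1"
  by (intro lor_ge_1) simp_all

context
  fixes \<Phi> :: "real ^ 'n::finite \<Rightarrow> complex" and x :: "'n vec1"
  assumes cont: "continuous_on UNIV \<Phi>" and x: "x \<in> hyp"
begin

lemma integrable_moment:
  "k > 0 \<Longrightarrow> integrable lborel (\<lambda>v. (hyp_density v * (pp (W - lor x (hyp_chart v))) ^ k) *\<^sub>R \<Phi> v)"
  by (rule integrable_compact_support [where S = "2 * x $ None * \<bar>W\<bar>"], intro continuous_intros cont)
    (simp add: pp_outside [OF x] power_0_left)

text \<open>The quadratic estimates for squares and cubes are integrated over one Euclidean ball
  that contains the supports for all increments of size at most 1.\<close>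

lemma moment_has_derivative:
  assumes k: "k = 1 \<or> k = 2"
  shows "(radial_moment \<Phi> x (Suc k) has_vector_derivative (real (Suc k) *\<^sub>R radial_moment \<Phi> x k W)) (at W)"
proof -
  let ?S = "2 * x $ None * (\<bar>W\<bar> + 1)"
  let ?B = "\<lambda>v. indicator (cball 0 ?S) v *\<^sub>R (3 * (\<bar>W\<bar> + 1) * norm (\<Phi> v))"
  let ?F = "\<lambda>k W v. (hyp_density v * (pp (W - lor x (hyp_chart v))) ^ k) *\<^sub>R \<Phi> v"
  have x0: "x $ None > 0" using x by (simp add: hyp_def)
  have Bi: "integrable lborel ?B"
    by (rule borel_integrable_compact [OF compact_cball])
      (intro continuous_intros continuous_on_subset [OF cont], simp)
  have bound: "norm (?F (Suc k) (W + h) v - ?F (Suc k) W v - h *\<^sub>R (real (Suc k) *\<^sub>R ?F k W v)) \<le> ?B v * h\<^sup>2"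
    if h: "\<bar>h\<bar> \<le> 1" for h v
  proof (cases "norm v \<le> ?S")
    case True
    let ?a = "W - lor x (hyp_chart v)"
    let ?d = "(pp (?a + h)) ^ Suc k - (pp ?a) ^ Suc k - h * (real (Suc k) * (pp ?a) ^ k)"
    have ap: "pp ?a \<le> \<bar>W\<bar>" using lor_chart_ge_1 [OF x, of v] by (auto simp: pp_def)
    have d: "\<bar>?d\<bar> \<le> 3 * (\<bar>W\<bar> + 1) * h\<^sup>2"
    proof (cases "k = 1")
      case True
      have "\<bar>?d\<bar> \<le> 1 * h\<^sup>2" using pp_square_estimate [of ?a h] True by (simp add: numeral_2_eq_2)
      also have "\<dots> \<le> 3 * (\<bar>W\<bar> + 1) * h\<^sup>2" by (intro mult_right_mono) auto
      finally show ?thesis .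
    next
      case False
      then have "\<bar>?d\<bar> \<le> 3 * (pp ?a + \<bar>h\<bar>) * h\<^sup>2"
        using pp_cube_estimate [of ?a h] k by (simp add: numeral_3_eq_3 numeral_2_eq_2)
      also have "\<dots> \<le> 3 * (\<bar>W\<bar> + 1) * h\<^sup>2" using ap h by (intro mult_right_mono) auto
      finally show ?thesis .
    qed
    have e: "W + h - lor x (hyp_chart v) = ?a + h" by simp
    have "?F (Suc k) (W + h) v - ?F (Suc k) W v - h *\<^sub>R (real (Suc k) *\<^sub>R ?F k W v) = (hyp_density v * ?d) *\<^sub>R \<Phi> v"
      unfolding e by (simp only: scaleR_scaleR scaleR_left_diff_distrib [symmetric] right_diff_distrib mult.left_commute mult.assoc)
    then have "norm (?F (Suc k) (W + h) v - ?F (Suc k) W v - h *\<^sub>R (real (Suc k) *\<^sub>R ?F k W v)) = (hyp_density v * \<bar>?d\<bar>) * norm (\<Phi> v)"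
      using hyp_density_pos [of v] by (simp add: abs_mult)
    also have "\<dots> \<le> (1 * (3 * (\<bar>W\<bar> + 1) * h\<^sup>2)) * norm (\<Phi> v)"
      using d hyp_density_le [of v] hyp_density_pos [of v] by (intro mult_right_mono mult_mono) auto
    finally show ?thesis using True by (simp add: mult_ac)
  next
    case False
    have "2 * x $ None * \<bar>W + h\<bar> \<le> ?S" "2 * x $ None * \<bar>W\<bar> \<le> ?S" using h x0 by (auto intro!: mult_left_mono)
    then have "pp (W + h - lor x (hyp_chart v)) = 0" "pp (W - lor x (hyp_chart v)) = 0"
      using False by (auto intro!: pp_outside [OF x])
    then show ?thesis using k by auto
  qed
  show ?thesis
  proof (rule has_vector_derivative_quadratic [where C = "\<integral>v. ?B v \<partial>lborel"])
    fix h :: real assume h: "\<bar>h\<bar> \<le> 1"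
    have k0: "Suc k > 0" "k > 0" using k by auto
    have i: "integrable lborel (?F (Suc k) (W + h))" "integrable lborel (?F (Suc k) W)" "integrable lborel (?F k W)"
      by (rule integrable_moment [OF k0(1)] integrable_moment [OF k0(2)])+
    let ?D = "\<lambda>v. ?F (Suc k) (W + h) v - ?F (Suc k) W v - h *\<^sub>R (real (Suc k) *\<^sub>R ?F k W v)"
    have i4: "integrable lborel (\<lambda>v. h *\<^sub>R (real (Suc k) *\<^sub>R ?F k W v))"
      by (intro integrable_scaleR_right i(3))
    have i5: "integrable lborel (\<lambda>v. ?F (Suc k) (W + h) v - ?F (Suc k) W v)"
      by (rule Bochner_Integration.integrable_diff [OF i(1,2)])
    have Di: "integrable lborel ?D" by (rule Bochner_Integration.integrable_diff [OF i5 i4])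
    have e1: "(\<integral>v. ?D v \<partial>lborel) = (\<integral>v. ?F (Suc k) (W + h) v - ?F (Suc k) W v \<partial>lborel)
        - (\<integral>v. h *\<^sub>R (real (Suc k) *\<^sub>R ?F k W v) \<partial>lborel)"
      by (rule Bochner_Integration.integral_diff [OF i5 i4])
    have e2: "(\<integral>v. ?F (Suc k) (W + h) v - ?F (Suc k) W v \<partial>lborel)
        = radial_moment \<Phi> x (Suc k) (W + h) - radial_moment \<Phi> x (Suc k) W"
      unfolding radial_moment_def by (rule Bochner_Integration.integral_diff [OF i(1,2)])
    have e3: "(\<integral>v. h *\<^sub>R (real (Suc k) *\<^sub>R ?F k W v) \<partial>lborel) = h *\<^sub>R (real (Suc k) *\<^sub>R radial_moment \<Phi> x k W)"
      unfolding radial_moment_def by (simp only: integral_scaleR_right)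
    have "norm (radial_moment \<Phi> x (Suc k) (W + h) - radial_moment \<Phi> x (Suc k) W
        - h *\<^sub>R (real (Suc k) *\<^sub>R radial_moment \<Phi> x k W)) = norm (\<integral>v. ?D v \<partial>lborel)"
      by (simp only: e1 e2 e3)
    also have "\<dots> \<le> (\<integral>v. norm (?D v) \<partial>lborel)"
      by (rule integral_norm_bound)
    also have "\<dots> \<le> (\<integral>v. ?B v * h\<^sup>2 \<partial>lborel)"
      by (rule integral_mono [OF integrable_norm [OF Di] integrable_mult_left [OF Bi]]) (rule bound [OF h])
    also have "\<dots> = (\<integral>v. ?B v \<partial>lborel) * h\<^sup>2" by (rule integral_mult_left_zero)
    finally show "norm (radial_moment \<Phi> x (Suc k) (W + h) - radial_moment \<Phi> x (Suc k) W
        - h *\<^sub>R (real (Suc k) *\<^sub>R radial_moment \<Phi> x k W)) \<le> (\<integral>v. ?B v \<partial>lborel) * h\<^sup>2" .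
  qed
qed

lemma moment_1_eq_0: "k > 0 \<Longrightarrow> radial_moment \<Phi> x k 1 = 0"
  using lor_chart_ge_1 [OF x] by (simp add: radial_moment_def pp_neg power_0_left)

text \<open>The Laplacian of the test function, rewritten in powers of the cut-off \<open>p\<close>
  by eliminating \<open>w\<close>. Every term contains a factor \<open>p\<close>, so the identity
  also holds where the cut-off vanishes.\<close>

lemma radial_identity:
  fixes p w W n :: real
  assumes "p = 0 \<or> p = W - w"
  shows "- ((w\<^sup>2 + - 1) * (6 * p) + n * w * (- 3 * p\<^sup>2))
    = (- 6 * (W\<^sup>2 - 1)) * p + ((12 + 3 * n) * W) * p\<^sup>2 - (6 + 3 * n) * p ^ 3"
proof (cases "p = 0")
  case False
  then have w: "w = W - p" using assms by simp
  show ?thesis unfolding w by (simp add: power2_eq_square power3_eq_cube algebra_simps)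
qed simp

text \<open>Green's identity for \<open>\<Phi>\<close> and the third-order test function.\<close>

lemma moment_ode:
  assumes C2: "C2 \<Phi>" and eig: "\<And>v. hyp_laplacian \<Phi> v = complex_of_real \<mu> * \<Phi> v"
  shows "(6 * (W\<^sup>2 - 1)) *\<^sub>R radial_moment \<Phi> x 1 W
    = ((12 + 3 * real CARD('n)) * W) *\<^sub>R radial_moment \<Phi> x 2 W
      - (6 + 3 * real CARD('n) + \<mu>) *\<^sub>R radial_moment \<Phi> x 3 W"
proof -
  let ?n = "real CARD('n)"
  let ?w = "\<lambda>v. lor x (hyp_chart v)"
  let ?F = "\<lambda>k v. (hyp_density v * (pp (W - ?w v)) ^ k) *\<^sub>R \<Phi> v"
  let ?g = "\<lambda>v. complex_of_real ((pp (W - ?w v)) ^ 3)"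
  have i: "integrable lborel (?F 1)" "integrable lborel (?F 2)" "integrable lborel (?F 3)"
    using integrable_moment [of 1 W] integrable_moment [of 2 W] integrable_moment [of 3 W] by simp_all
  have "(\<integral>v. hyp_density v *\<^sub>R (hyp_laplacian \<Phi> v * ?g v) \<partial>lborel) = (\<integral>v. hyp_density v *\<^sub>R (\<Phi> v * hyp_laplacian ?g v) \<partial>lborel)"
    by (rule green_identity [OF C2 test_function_C2, of "2 * x $ None * \<bar>W\<bar>"]) (simp add: pp_outside [OF x])
  moreover have "hyp_density v *\<^sub>R (hyp_laplacian \<Phi> v * ?g v) = \<mu> *\<^sub>R ?F 3 v" for v
    by (simp add: eig scaleR_conv_of_real mult_ac)
  moreover have "hyp_density v *\<^sub>R (\<Phi> v * hyp_laplacian ?g v)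
      = (- 6 * (W\<^sup>2 - 1)) *\<^sub>R ?F 1 v + ((12 + 3 * ?n) * W) *\<^sub>R ?F 2 v - (6 + 3 * ?n) *\<^sub>R ?F 3 v" for v
  proof -
    let ?p = "pp (W - ?w v)"
    have mx: "mink x x = - 1" using mink_self_hyp [OF x] .
    have p: "?p = 0 \<or> ?p = W - ?w v" by (auto simp: pp_def)
    have r: "- (((?w v)\<^sup>2 + - 1) * (6 * ?p) + ?n * ?w v * (- 3 * ?p\<^sup>2))
        = (- 6 * (W\<^sup>2 - 1)) * ?p + ((12 + 3 * ?n) * W) * ?p\<^sup>2 - (6 + 3 * ?n) * ?p ^ 3"
      by (rule radial_identity [OF p])
    have "hyp_density v *\<^sub>R (\<Phi> v * hyp_laplacian ?g v)
        = (hyp_density v * (- (((?w v)\<^sup>2 + - 1) * (6 * ?p) + ?n * ?w v * (- 3 * ?p\<^sup>2)))) *\<^sub>R \<Phi> v"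
      unfolding test_function_laplacian mx by (simp only: scaleR_conv_of_real of_real_mult of_real_minus mult_ac)
    also have "\<dots> = (hyp_density v * ((- 6 * (W\<^sup>2 - 1)) * ?p + ((12 + 3 * ?n) * W) * ?p\<^sup>2 - (6 + 3 * ?n) * ?p ^ 3)) *\<^sub>R \<Phi> v"
      unfolding r ..
    also have "\<dots> = (- 6 * (W\<^sup>2 - 1)) *\<^sub>R ?F 1 v + ((12 + 3 * ?n) * W) *\<^sub>R ?F 2 v - (6 + 3 * ?n) *\<^sub>R ?F 3 v"
      unfolding scaleR_scaleR scaleR_left_diff_distrib [symmetric] scaleR_left_distrib [symmetric]
      by (rule arg_cong [where f = "\<lambda>c. c *\<^sub>R _"]) (simp only: power_one_right, algebra)
    finally show ?thesis .
  qed
  ultimately have "\<mu> *\<^sub>R radial_moment \<Phi> x 3 W = (\<integral>v. (- 6 * (W\<^sup>2 - 1)) *\<^sub>R ?F 1 v + ((12 + 3 * ?n) * W) *\<^sub>R ?F 2 v - (6 + 3 * ?n) *\<^sub>R ?F 3 v \<partial>lborel)"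
    unfolding radial_moment_def by (simp only: integral_scaleR_right)
  also have "\<dots> = (- 6 * (W\<^sup>2 - 1)) *\<^sub>R radial_moment \<Phi> x 1 W + ((12 + 3 * ?n) * W) *\<^sub>R radial_moment \<Phi> x 2 W
      - (6 + 3 * ?n) *\<^sub>R radial_moment \<Phi> x 3 W"
    unfolding radial_moment_def
    by (subst Bochner_Integration.integral_diff,
        (intro Bochner_Integration.integrable_add integrable_scaleR_right i)+,
        subst Bochner_Integration.integral_add,
        (intro integrable_scaleR_right i)+, simp only: integral_scaleR_right)
  finally show ?thesis by (simp add: algebra_simps)
qed

text \<open>The cut-off is at most \<open>W - 1\<close> and the ball has volume of order
  \<open>sqrt (W\<^sup>2 - 1) ^ n\<close>. Because \<open>W - 1 \<le> W\<^sup>2 - 1\<close>, this is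
  the order of vanishing at \<open>W = 1\<close> by which the uniqueness proof divides.\<close>

lemma moment_square_bound:
  assumes W: "W > 1" and B: "\<And>v. lor x (hyp_chart v) \<le> W \<Longrightarrow> norm (\<Phi> v) \<le> B"
  shows "norm (radial_moment \<Phi> x 2 W) \<le> (W - 1)\<^sup>2 * B * (unit_ball_vol CARD('n) * sqrt (W\<^sup>2 - 1) ^ CARD('n))"
proof -
  let ?I = "\<lambda>v. hyp_density v * indicator (hball x W) (hyp_chart v)"
  let ?c = "unit_ball_vol CARD('n) * sqrt (W\<^sup>2 - 1) ^ CARD('n)"
  have B0: "B \<ge> 0"
  proof -
    have "lor x (hyp_chart (space_part x)) \<le> W" using W lor_self [OF x] hyp_eq_chart [OF x] by simp
    from B [OF this] show ?thesis using norm_ge_zero order_trans by blast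
  qed
  have c0: "?c \<ge> 0" using W by simp
  have nn: "(\<integral>\<^sup>+v. ennreal (?I v) \<partial>lborel) \<le> ennreal ?c"
  proof -
    have "(\<integral>\<^sup>+v. ennreal (?I v) \<partial>lborel) = (\<integral>\<^sup>+v. ennreal (hyp_density v) * indicator (hball x W) (hyp_chart v) \<partial>lborel)"
      using hyp_density_pos by (intro nn_integral_cong) (simp split: split_indicator)
    also have "\<dots> = emeasure hyp_vol (hball x W)"
      by (subst nn_integral_hyp_vol [symmetric, of "indicator (hball x W)"]) simp_all
    finally show ?thesis using emeasure_hball_le_small [OF _ x, of W] W by simp
  qed
  have Im: "?I \<in> borel_measurable lborel" by measurable
  have Ii: "integrable lborel ?I"
    using nn Im hyp_density_pos by (intro integrableI_nonneg) (auto intro!: AE_I2 mult_nonneg_nonneg less_imp_le [OF hyp_density_pos] simp: le_less_trans)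
  have Ib: "(\<integral>v. ?I v \<partial>lborel) \<le> ?c"
  proof -
    have "0 \<le> ?I v" for v using hyp_density_pos [of v] by simp
    then have "(\<integral>\<^sup>+v. ennreal (?I v) \<partial>lborel) = ennreal (\<integral>v. ?I v \<partial>lborel)"
      by (intro nn_integral_eq_integral Ii AE_I2)
    then show ?thesis using nn c0 by (simp only: ennreal_le_iff)
  qed
  have "norm (radial_moment \<Phi> x 2 W) \<le> (\<integral>v. norm ((hyp_density v * (pp (W - lor x (hyp_chart v))) ^ 2) *\<^sub>R \<Phi> v) \<partial>lborel)"
    unfolding radial_moment_def by (rule integral_norm_bound)
  also have "\<dots> \<le> (\<integral>v. ((W - 1)\<^sup>2 * B) * ?I v \<partial>lborel)"
  proof (rule integral_mono)
    show "integrable lborel (\<lambda>v. norm ((hyp_density v * (pp (W - lor x (hyp_chart v))) ^ 2) *\<^sub>R \<Phi> v))"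
      by (intro integrable_norm integrable_moment) simp
    show "integrable lborel (\<lambda>v. ((W - 1)\<^sup>2 * B) * ?I v)" by (intro integrable_mult_right Ii)
    fix v
    show "norm ((hyp_density v * (pp (W - lor x (hyp_chart v))) ^ 2) *\<^sub>R \<Phi> v) \<le> ((W - 1)\<^sup>2 * B) * ?I v"
    proof (cases "lor x (hyp_chart v) \<le> W")
      case True
      then have "(pp (W - lor x (hyp_chart v)))\<^sup>2 \<le> (W - 1)\<^sup>2"
        using lor_chart_ge_1 [OF x, of v] by (intro power_mono) (auto simp: pp_def)
      moreover have "norm (\<Phi> v) \<le> B" by (rule B [OF True])
      ultimately have "(pp (W - lor x (hyp_chart v)))\<^sup>2 * norm (\<Phi> v) \<le> (W - 1)\<^sup>2 * B"
        using B0 by (intro mult_mono) auto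
      then have "hyp_density v * ((pp (W - lor x (hyp_chart v)))\<^sup>2 * norm (\<Phi> v)) \<le> hyp_density v * ((W - 1)\<^sup>2 * B)"
        using hyp_density_pos [of v] by (intro mult_left_mono) auto
      then show ?thesis using True hyp_density_pos [of v] by (simp add: hball_def abs_mult mult_ac)
    qed (simp add: pp_neg hball_def)
  qed
  also have "\<dots> = ((W - 1)\<^sup>2 * B) * (\<integral>v. ?I v \<partial>lborel)" by (rule integral_mult_right_zero)
  also have "\<dots> \<le> ((W - 1)\<^sup>2 * B) * ?c" using Ib B0 by (intro mult_left_mono) auto
  finally show ?thesis .
qed

text \<open>The third moment vanishes at \<open>W = 1\<close> and has 3 times the second moment as
  its derivative.\<close>

lemma moment_cube_bound:
  assumes W: "W > 1" and K: "\<And>\<tau>. 1 < \<tau> \<Longrightarrow> \<tau> < W \<Longrightarrow> norm (radial_moment \<Phi> x 2 \<tau>) \<le> K"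
  shows "norm (radial_moment \<Phi> x 3 W) \<le> 3 * K * (W - 1)"
proof -
  have d: "(radial_moment \<Phi> x 3 has_vector_derivative 3 *\<^sub>R radial_moment \<Phi> x 2 \<tau>) (at \<tau>)" for \<tau>
    using moment_has_derivative [of 2 \<tau>] by (simp add: numeral_3_eq_3)
  have "norm (radial_moment \<Phi> x 3 W - radial_moment \<Phi> x 3 1) \<le> 3 * K * W - 3 * K * 1"
  proof (rule differentiable_bound_general [where f' = "\<lambda>\<tau>. 3 *\<^sub>R radial_moment \<Phi> x 2 \<tau>" and \<phi>' = "\<lambda>_. 3 * K", OF W])
    show "continuous_on {1..W} (radial_moment \<Phi> x 3)"
      using d by (meson continuous_at_imp_continuous_on has_vector_derivative_continuous)
    show "((*) (3 * K) has_vector_derivative 3 * K) (at \<tau>)" for \<tau>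
      by (auto intro!: derivative_eq_intros simp flip: has_real_derivative_iff_has_vector_derivative)
  qed (use d K in \<open>auto intro!: continuous_intros\<close>)
  then show ?thesis by (simp add: moment_1_eq_0 algebra_simps)
qed

end

subsection \<open>The mean value property\<close>

text \<open>Moving \<open>x\<close> to the origin by the group makes small hyperbolic balls around
  it Euclidean balls around 0 in the chart, where continuity applies.\<close>

lemma locally_small:
  fixes \<Phi> :: "real ^ 'n::finite \<Rightarrow> complex"
  assumes x: "x \<in> hyp" and cont: "continuous_on UNIV \<Phi>" and zero: "\<Phi> (space_part x) = 0" and e: "e > 0"
  obtains d where "d > 0" "\<And>v W. W < 1 + d \<Longrightarrow> lor x (hyp_chart v) \<le> W \<Longrightarrow> norm (\<Phi> v) < e"
proof -
  obtain g where g: "g \<in> lorc" "g *v hyp_origin = x" using lorc_transitive_origin [OF x] .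
  obtain h where h: "h \<in> lorc" "g ** h = mat 1" "h ** g = mat 1" using lorc_inverse [OF g(1)] .
  let ?\<Psi> = "\<lambda>u. \<Phi> (space_part (g *v hyp_chart u))"
  have "continuous_on UNIV (\<lambda>u. g *v hyp_chart u)"
    by (rule continuous_on_compose2 [OF _ continuous_on_hyp_chart subset_UNIV]) (rule matrix_vector_mult_linear_continuous_on)
  then have "continuous_on UNIV ?\<Psi>"
    by (intro continuous_on_compose2 [OF cont] continuous_on_space_part) simp_all
  moreover have "?\<Psi> 0 = 0" by (simp add: hyp_chart_0 g zero)
  ultimately obtain r where r: "r > 0" "\<And>u. norm u < r \<Longrightarrow> norm (?\<Psi> u) < e"
    using e unfolding continuous_on_iff by (metis UNIV_I dist_0_norm dist_commute)
  \<comment> \<open>The bound \<open>d \<le> 1\<close> gives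
    \<open>(1 + d)\<^sup>2 \<le> 1 + 3 * d\<close>, and \<open>4 * d \<le> r\<^sup>2\<close> then
    leads to \<open>norm u < r\<close>.\<close>
  define d where "d = min 1 (r\<^sup>2 / 4)"
  have d: "d > 0" "d \<le> 1" "4 * d \<le> r\<^sup>2" using r(1) by (auto simp: d_def)
  have "norm (\<Phi> v) < e" if W: "W < 1 + d" "lor x (hyp_chart v) \<le> W" for v W
  proof -
    have "h *v hyp_chart v \<in> hyp" by (intro lorc_hyp h) simp
    then obtain u where u: "h *v hyp_chart v = hyp_chart u" using hyp_eq_chart by blast
    have gu: "g *v hyp_chart u = hyp_chart v"
      by (simp only: u [symmetric] matrix_vector_mul_assoc h matrix_vector_mul_lid)
    have "lor x (hyp_chart v) = lor hyp_origin (hyp_chart u)"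
      by (simp only: g(2) [symmetric] gu [symmetric] lorc_lor [OF g(1)])
    then have "sqrt (1 + u \<bullet> u) < 1 + d"
      using W by (simp add: lor_origin) (simp add: hyp_chart_mkvec)
    then have "1 + u \<bullet> u < (1 + d)\<^sup>2"
    proof -
      have "(sqrt (1 + u \<bullet> u))\<^sup>2 < (1 + d)\<^sup>2"
        using \<open>sqrt (1 + u \<bullet> u) < 1 + d\<close> by (intro power_strict_mono) (auto simp: add_nonneg_nonneg)
      then show ?thesis by (simp add: add_nonneg_nonneg)
    qed
    also have "(1 + d)\<^sup>2 \<le> 1 + 3 * d" using d by (simp add: power2_eq_square algebra_simps)
    finally have "(norm u)\<^sup>2 < r\<^sup>2" using d by (simp add: dot_square_norm)
    then have "norm u < r" using r(1) power_less_imp_less_base [of "norm u" 2 r] by simp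
    from r(2) [OF this] show ?thesis by (simp only: gu space_part_chart)
  qed
  then show ?thesis using that d(1) by blast
qed

lemma locally_bounded:
  fixes \<Phi> :: "real ^ 'n::finite \<Rightarrow> complex"
  assumes x: "x \<in> hyp" and cont: "continuous_on UNIV \<Phi>"
  obtains B where "\<And>v. lor x (hyp_chart v) \<le> W \<Longrightarrow> norm (\<Phi> v) \<le> B"
proof -
  let ?S = "2 * x $ None * W"
  have x0: "x $ None > 0" using x by (simp add: hyp_def)
  have "compact (\<Phi> ` cball 0 ?S)"
    by (intro compact_continuous_image compact_cball continuous_on_subset [OF cont]) simp
  then obtain B where B: "\<And>y. y \<in> \<Phi> ` cball 0 ?S \<Longrightarrow> norm y \<le> B"
    using compact_imp_bounded bounded_pos by metis
  have "norm (\<Phi> v) \<le> B" if "lor x (hyp_chart v) \<le> W" for v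
  proof -
    have "norm v \<le> 2 * x $ None * lor x (hyp_chart v)" by (rule norm_chart_le [OF x])
    also have "\<dots> \<le> ?S" using that x0 by (intro mult_left_mono) auto
    finally show ?thesis by (intro B) auto
  qed
  then show ?thesis using that by blast
qed

text \<open>The moments solve an ODE with a regular singular point at \<open>W = 1\<close>. After division by
  \<open>(W\<^sup>2 - 1) powr ((4 + n) / 2)\<close>, vanishing of \<open>\<Phi>\<close> at \<open>x\<close> becomes a zero initial condition,
  and a weighted supremum (Gronwall) argument applies.\<close>

lemma moment_unique:
  fixes \<Phi> :: "real ^ 'n::finite \<Rightarrow> complex"
  assumes C2: "C2 \<Phi>" and eig: "\<And>v. hyp_laplacian \<Phi> v = complex_of_real \<mu> * \<Phi> v"
    and x: "x \<in> hyp" and zero: "\<Phi> (space_part x) = 0" and W1: "W1 > 1"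
  shows "radial_moment \<Phi> x 3 W1 = 0"
proof -
  have cont: "continuous_on UNIV \<Phi>" by (rule C2_continuous [OF C2])
  let ?n = "real CARD('n)"
  let ?\<omega> = "unit_ball_vol ?n"
  define N where "N = (4 + ?n) / 2"
  define c where "c = 6 + 3 * ?n + \<mu>"
  define Q where "Q k = radial_moment \<Phi> x k" for k
  define G where "G W = (W\<^sup>2 - 1) powr (- N) *\<^sub>R Q 2 W" for W
  define G' where "G' W = (- (c / 3) * (W\<^sup>2 - 1) powr (- N - 1)) *\<^sub>R Q 3 W" for W
  have s_pos: "W\<^sup>2 - 1 > 0" if "W > 1" for W :: real using that by (simp add: one_less_power)
  have QG: "norm (Q 2 W) = (W\<^sup>2 - 1) powr N * norm (G W)" if "W > 1" for W
    using s_pos [OF that] by (simp add: G_def powr_minus)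
  \<comment> \<open>The differential equation eliminates the first moment. The exponent
    \<open>N\<close> solves \<open>6 * N = 12 + 3 * n\<close>, so the terms with the second moment
    cancel and only the third moment is left.\<close>
  have derG: "(G has_vector_derivative G' W) (at W)" if W: "W > 1" for W
  proof -
    let ?s = "W\<^sup>2 - 1"
    have s: "?s > 0" by (rule s_pos [OF W])
    have p: "((\<lambda>W. (W\<^sup>2 - 1) powr (- N)) has_real_derivative (- N * ?s powr (- N - 1)) * (2 * W)) (at W)"
    proof -
      have a: "((\<lambda>W. W\<^sup>2 - 1) has_real_derivative 2 * W) (at W)" by (auto intro!: derivative_eq_intros)
      have b: "((\<lambda>y. y powr (- N)) has_real_derivative - N * ?s powr (- N - 1)) (at ?s)"
        by (rule has_real_derivative_powr [OF s])
      show ?thesis by (rule DERIV_chain2 [where g = "\<lambda>W. W\<^sup>2 - 1", OF b a])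
    qed
    have q: "(Q 2 has_vector_derivative 2 *\<^sub>R Q 1 W) (at W)"
      using moment_has_derivative [OF cont x, of 1 W] by (simp add: Q_def numeral_2_eq_2)
    have ode: "(6 * ?s) *\<^sub>R Q 1 W = ((12 + 3 * ?n) * W) *\<^sub>R Q 2 W - c *\<^sub>R Q 3 W"
      using moment_ode [OF cont x C2 eig] by (simp only: Q_def c_def)
    have sp: "?s powr (- N) = ?s powr (- N - 1) * ?s"
      using s powr_add [of ?s "- N - 1" 1] by simp
    have "(G has_vector_derivative (?s powr (- N) *\<^sub>R (2 *\<^sub>R Q 1 W) + ((- N * ?s powr (- N - 1)) * (2 * W)) *\<^sub>R Q 2 W)) (at W)"
      unfolding G_def by (rule has_vector_derivative_scaleR [OF p q])
    also have "?s powr (- N) *\<^sub>R (2 *\<^sub>R Q 1 W) + ((- N * ?s powr (- N - 1)) * (2 * W)) *\<^sub>R Q 2 W = G' W"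
    proof -
      have "?s powr (- N) *\<^sub>R (2 *\<^sub>R Q 1 W) = (?s powr (- N - 1) / 3) *\<^sub>R ((6 * ?s) *\<^sub>R Q 1 W)"
        unfolding sp by simp
      also have "\<dots> = (?s powr (- N - 1) * (2 * N * W)) *\<^sub>R Q 2 W - (?s powr (- N - 1) * c / 3) *\<^sub>R Q 3 W"
      proof -
        have 1: "?s powr (- N - 1) / 3 * ((12 + 3 * ?n) * W) = ?s powr (- N - 1) * (2 * N * W)"
          by (simp add: N_def algebra_simps)
        have 2: "?s powr (- N - 1) / 3 * c = ?s powr (- N - 1) * c / 3" by simp
        show ?thesis unfolding ode by (simp only: scaleR_diff_right scaleR_scaleR 1 2)
      qed
      finally show ?thesis by (simp add: G'_def algebra_simps)
    qed
    finally show ?thesis .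
  qed
  have G_bound: "norm (G W) \<le> B * ?\<omega>" if W: "W > 1" and B: "\<And>v. lor x (hyp_chart v) \<le> W \<Longrightarrow> norm (\<Phi> v) \<le> B" for W B
  proof -
    let ?s = "W\<^sup>2 - 1"
    have s: "?s > 0" by (rule s_pos [OF W])
    have B0: "B \<ge> 0"
    proof -
      have "lor x (hyp_chart (space_part x)) \<le> W" using W lor_self [OF x] hyp_eq_chart [OF x] by simp
      from B [OF this] show ?thesis using norm_ge_zero order_trans by blast
    qed
    have "sqrt ?s ^ CARD('n) = ?s powr (?n / 2)"
      using s by (simp add: powr_half_sqrt [symmetric] powr_realpow [symmetric] powr_powr)
    then have "norm (Q 2 W) \<le> (W - 1)\<^sup>2 * B * (?\<omega> * ?s powr (?n / 2))"
      using moment_square_bound [OF cont x W B] by (simp add: Q_def)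
    then have "norm (G W) \<le> ?s powr (- N) * ((W - 1)\<^sup>2 * B * (?\<omega> * ?s powr (?n / 2)))"
      unfolding G_def by (simp add: mult_left_mono)
    also have "\<dots> = (W - 1)\<^sup>2 * (?s powr (- N) * ?s powr (?n / 2)) * (B * ?\<omega>)" by simp
    also have "?s powr (- N) * ?s powr (?n / 2) = ?s powr (- 2)"
      unfolding powr_add [symmetric] N_def by (rule arg_cong [where f = "(powr) ?s"]) (simp add: field_simps)
    also have "(W - 1)\<^sup>2 * ?s powr (- 2) * (B * ?\<omega>) \<le> 1 * (B * ?\<omega>)"
    proof (rule mult_right_mono)
      have "(W - 1)\<^sup>2 \<le> ?s\<^sup>2"
      proof (rule power_mono)
        have "W * 1 \<le> W * W" using W by (intro mult_left_mono) auto
        then show "W - 1 \<le> ?s" by (simp add: power2_eq_square)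
      qed (use W in simp)
      then show "(W - 1)\<^sup>2 * ?s powr (- 2) \<le> 1"
        using s by (simp add: powr_minus divide_le_eq flip: divide_inverse)
    qed (use B0 in simp)
    finally show ?thesis by simp
  qed
  obtain B where B: "\<And>v. lor x (hyp_chart v) \<le> W1 \<Longrightarrow> norm (\<Phi> v) \<le> B"
    using locally_bounded [OF x cont] by blast
  define A where "A = \<bar>c\<bar> + 1"
  \<comment> \<open>With this rate, \<open>A * M * exp (ll * W)\<close> has the primitive
    \<open>M / 2 * exp (ll * W)\<close>; the factor one half makes the supremum \<open>M\<close>
    collapse.\<close>
  define ll where "ll = 2 * A"
  have A: "A > 0" "ll > 0" by (auto simp: A_def ll_def)
  define Z where "Z = (\<lambda>W. exp (- ll * W) * norm (G W)) ` {1<..W1}"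
  have Zne: "Z \<noteq> {}" using W1 by (auto simp: Z_def)
  have Zb: "bdd_above Z"
    unfolding Z_def
  proof (rule bdd_aboveI2)
    fix W assume W: "W \<in> {1<..W1}"
    have "norm (G W) \<le> B * ?\<omega>" using W B by (intro G_bound) auto
    moreover have "exp (- ll * W) \<le> 1" using W A by simp
    ultimately have "exp (- ll * W) * norm (G W) \<le> 1 * (B * ?\<omega>)" by (intro mult_mono) auto
    then show "exp (- ll * W) * norm (G W) \<le> B * ?\<omega>" by simp
  qed
  define M where "M = Sup Z"
  have M: "norm (G W) \<le> M * exp (ll * W)" if "W \<in> {1<..W1}" for W
  proof -
    have "exp (- ll * W) * norm (G W) \<le> M"
      unfolding M_def using that Zb by (intro cSup_upper) (auto simp: Z_def)
    then have "exp (ll * W) * (exp (- ll * W) * norm (G W)) \<le> exp (ll * W) * M" by (intro mult_left_mono) auto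
    moreover have "exp (ll * W) * (exp (- ll * W) * norm (G W)) = norm (G W)"
      by (simp add: mult.assoc [symmetric] exp_add [symmetric])
    ultimately show ?thesis by (simp only: mult.commute [of M])
  qed
  have M0: "M \<ge> 0"
  proof -
    have "0 \<le> norm (G W1)" by simp
    also have "\<dots> \<le> M * exp (ll * W1)" using W1 by (intro M) auto
    finally show ?thesis by (simp add: zero_le_mult_iff)
  qed
  have Q2: "norm (Q 2 \<tau>) \<le> (W\<^sup>2 - 1) powr N * (M * exp (ll * W))" if "1 < \<tau>" "\<tau> \<le> W" "W \<le> W1" for \<tau> W
  proof -
    have N0: "N \<ge> 0" by (simp add: N_def)
    have "\<tau>\<^sup>2 \<le> W\<^sup>2" using that by (intro power_mono) auto
    then have "(\<tau>\<^sup>2 - 1) powr N \<le> (W\<^sup>2 - 1) powr N" using s_pos [OF that(1)] N0 by (intro powr_mono2) auto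
    moreover have "norm (G \<tau>) \<le> M * exp (ll * W)"
    proof -
      have "norm (G \<tau>) \<le> M * exp (ll * \<tau>)" using that by (intro M) auto
      also have "\<dots> \<le> M * exp (ll * W)" using that A M0 by (intro mult_left_mono) auto
      finally show ?thesis .
    qed
    ultimately show ?thesis unfolding QG [OF that(1)] by (intro mult_mono) auto
  qed
  have G'_bound: "norm (G' W) \<le> A * M * exp (ll * W)" if W: "W \<in> {1<..W1}" for W
  proof -
    let ?s = "W\<^sup>2 - 1"
    have s: "?s > 0" using W by (intro s_pos) auto
    have "norm (Q 3 W) \<le> 3 * (?s powr N * (M * exp (ll * W))) * (W - 1)"
      unfolding Q_def using W Q2 [unfolded Q_def, of _ W] by (intro moment_cube_bound [OF cont x]) auto
    also have "\<dots> \<le> 3 * (?s powr N * (M * exp (ll * W))) * ?s"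
    proof (rule mult_left_mono)
      have "W * 1 \<le> W * W" using W by (intro mult_left_mono) auto
      then show "W - 1 \<le> ?s" by (simp add: power2_eq_square)
    qed (use M0 in simp)
    finally have q3: "norm (Q 3 W) \<le> 3 * (?s powr N * (M * exp (ll * W))) * ?s" .
    have "norm (G' W) = (\<bar>c\<bar> / 3 * ?s powr (- N - 1)) * norm (Q 3 W)"
      unfolding G'_def by (simp add: abs_mult)
    also have "\<dots> \<le> (\<bar>c\<bar> / 3 * ?s powr (- N - 1)) * (3 * (?s powr N * (M * exp (ll * W))) * ?s)"
      by (rule mult_left_mono [OF q3]) simp
    also have "\<dots> = \<bar>c\<bar> * (?s powr (- N - 1) * ?s powr N * ?s) * (M * exp (ll * W))" by simp
    also have "?s powr (- N - 1) * ?s powr N * ?s = 1"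
      using s by (simp add: powr_add [symmetric] powr_minus)
    also have "\<bar>c\<bar> * 1 * (M * exp (ll * W)) \<le> A * (M * exp (ll * W))"
      using M0 by (intro mult_right_mono) (auto simp: A_def)
    finally show ?thesis by simp
  qed
  \<comment> \<open>The initial value is taken at a point \<open>a\<close> near 1, where the
    vanishing of the function at \<open>x\<close> makes \<open>G a\<close> smaller than any given
    \<open>e\<close>; beyond \<open>a\<close> the bound on the derivative is integrated.\<close>
  have half: "norm (G W) \<le> M / 2 * exp (ll * W)" if W: "W \<in> {1<..W1}" for W
  proof (rule field_le_epsilon)
    fix e :: real assume e: "e > 0"
    define e' where "e' = e / ?\<omega>"
    have e': "e' > 0" using e unit_ball_vol_pos [of ?n] by (simp add: e'_def)
    obtain d where d: "d > 0" "\<And>v W. W < 1 + d \<Longrightarrow> lor x (hyp_chart v) \<le> W \<Longrightarrow> norm (\<Phi> v) < e'"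
      using locally_small [OF x cont zero e'] by blast
    define a where "a = min (1 + d / 2) ((1 + W) / 2)"
    have a: "1 < a" "a < W" "a < 1 + d" using W d(1) by (auto simp: a_def min_def)
    have "norm (G a) \<le> e' * ?\<omega>"
      using a d(2) by (intro G_bound) (auto intro: less_imp_le)
    moreover have "?\<omega> \<noteq> 0" by (rule less_imp_neq [THEN not_sym]) simp
    ultimately have Ga: "norm (G a) \<le> e" by (simp add: e'_def)
    have "norm (G W - G a) \<le> M / 2 * exp (ll * W) - M / 2 * exp (ll * a)"
    proof (rule differentiable_bound_general [where f' = G' and \<phi>' = "\<lambda>\<tau>. A * M * exp (ll * \<tau>)", OF a(2)])
      show "continuous_on {a..W} G"
        using derG a by (meson atLeastAtMost_iff continuous_at_imp_continuous_on has_vector_derivative_continuous less_le_trans)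
      show "(G has_vector_derivative G' \<tau>) (at \<tau>)" if "a < \<tau>" "\<tau> < W" for \<tau>
        using that a by (intro derG) auto
      show "((\<lambda>\<tau>. M / 2 * exp (ll * \<tau>)) has_vector_derivative A * M * exp (ll * \<tau>)) (at \<tau>)" for \<tau>
        unfolding has_real_derivative_iff_has_vector_derivative [symmetric]
        by (auto intro!: derivative_eq_intros simp: ll_def)
      show "norm (G' \<tau>) \<le> A * M * exp (ll * \<tau>)" if "a < \<tau>" "\<tau> < W" for \<tau>
        using that a W by (intro G'_bound) auto
    qed (intro continuous_intros)
    moreover have "0 \<le> M / 2 * exp (ll * a)" using M0 by simp
    moreover have "norm (G W) \<le> norm (G W - G a) + norm (G a)" by (metis diff_add_cancel norm_triangle_ineq)
    ultimately show "norm (G W) \<le> M / 2 * exp (ll * W) + e" using Ga by linarith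
  qed
  have "M \<le> M / 2"
  proof (rule cSup_least [OF Zne, folded M_def])
    fix z assume "z \<in> Z"
    then obtain W where W: "W \<in> {1<..W1}" "z = exp (- ll * W) * norm (G W)" by (auto simp: Z_def)
    have "z \<le> exp (- ll * W) * (M / 2 * exp (ll * W))" unfolding W(2) using half [OF W(1)] by (intro mult_left_mono) auto
    also have "\<dots> = M / 2 * (exp (- ll * W) * exp (ll * W))" by (simp only: mult_ac)
    also have "exp (- ll * W) * exp (ll * W) = 1" by (simp flip: exp_add)
    finally show "z \<le> M / 2" by simp
  qed
  then have "M = 0" using M0 by linarith
  then have "norm (radial_moment \<Phi> x 2 \<tau>) \<le> 0" if "1 < \<tau>" "\<tau> < W1" for \<tau>
    using Q2 [of \<tau> W1] that by (simp add: Q_def)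
  then have "norm (radial_moment \<Phi> x 3 W1) \<le> 3 * 0 * (W1 - 1)"
    by (intro moment_cube_bound [OF cont x W1]) auto
  then show ?thesis by simp
qed

text \<open>A point at infinity on an arbitrary coordinate axis, normalized to pair to 1 with the
  origin.\<close>

definition null_vec :: "'n::finite vec1" where
  "null_vec = mkvec 1 (axis undefined 1)"

lemma mink_null_vec: "mink null_vec null_vec = 0"
  by (simp add: null_vec_def mink_space_part inner_axis_axis)

lemma lor_null_vec_origin: "lor hyp_origin null_vec = 1"
  by (simp add: lor_origin null_vec_def)

lemma lor_null_vec_pos: assumes "y \<in> hyp" shows "0 < lor null_vec y" "lor null_vec y \<le> 2 * lor hyp_origin y"
proof -
  obtain v where y: "y = hyp_chart v" using hyp_eq_chart [OF assms] by blast
  have l: "lor null_vec y = sqrt (1 + v \<bullet> v) - v $ undefined"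
    by (simp add: y lor_chart null_vec_def inner_axis')
  have "\<bar>v $ undefined\<bar> \<le> norm v" by (rule component_le_norm_cart)
  moreover have "norm v < sqrt (1 + v \<bullet> v)" by (rule real_less_rsqrt) (simp add: dot_square_norm)
  moreover have "lor hyp_origin y = sqrt (1 + v \<bullet> v)" by (simp add: y lor_origin) (simp add: hyp_chart_mkvec)
  ultimately show "0 < lor null_vec y" "lor null_vec y \<le> 2 * lor hyp_origin y" unfolding l by linarith+
qed

text \<open>The Selberg transform of the radial kernel, computed on a horospherical function that
  equals 1 at the origin. The type argument only carries the dimension.\<close>

definition spherical_factor :: "'n::finite itself \<Rightarrow> real \<Rightarrow> real \<Rightarrow> real" where
  "spherical_factor _ \<alpha> W = (\<integral>y. (pp (W - lor hyp_origin y)) ^ 3 * lor null_vec y powr (- \<alpha>) \<partial>(hyp_vol :: 'n vec1 measure))"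

text \<open>A power of the Poisson kernel with boundary point \<open>\<xi>\<close>, that is, an
  exponential of a Busemann function; it is constant on the horospheres at
  \<open>\<xi>\<close>.\<close>

definition horo :: "real \<Rightarrow> 'n::finite vec1 \<Rightarrow> real ^ 'n \<Rightarrow> complex" where
  "horo \<alpha> \<xi> v = complex_of_real (lor \<xi> (hyp_chart v) powr (- \<alpha>))"

lemma horo_eigenfunction:
  assumes pos: "\<And>v. lor \<xi> (hyp_chart v) > 0" and null: "mink \<xi> \<xi> = 0"
  shows "C2 (horo \<alpha> (\<xi> :: 'n::finite vec1))"
    and "hyp_laplacian (horo \<alpha> \<xi>) v = complex_of_real (\<alpha> * (real CARD('n) - 1 - \<alpha>)) * horo \<alpha> \<xi> v"
proof -
  let ?w = "\<lambda>v. lor \<xi> (hyp_chart v)"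
  have f: "((\<lambda>w. w powr (- \<alpha>)) has_real_derivative (\<lambda>w. - \<alpha> * w powr (- \<alpha> - 1)) (?w v)) (at (?w v))" for v
    by (rule has_real_derivative_powr [OF pos])
  have f1: "((\<lambda>w. - \<alpha> * w powr (- \<alpha> - 1)) has_real_derivative (\<lambda>w. - \<alpha> * ((- \<alpha> - 1) * w powr (- \<alpha> - 1 - 1))) (?w v)) (at (?w v))" for v
    by (rule DERIV_cmult [OF has_real_derivative_powr [OF pos]])
  have f2: "continuous_on UNIV (\<lambda>v. (\<lambda>w. - \<alpha> * ((- \<alpha> - 1) * w powr (- \<alpha> - 1 - 1))) (?w v))"
    using pos by (intro continuous_intros) (metis less_irrefl)
  have h: "horo \<alpha> \<xi> = (\<lambda>v. complex_of_real ((\<lambda>w. w powr (- \<alpha>)) (?w v)))" by (simp add: fun_eq_iff horo_def)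
  show "C2 (horo \<alpha> \<xi>)" unfolding h by (rule C2_radial [OF f f1 f2])
  have w1: "?w v * ?w v powr (- \<alpha> - 1) = ?w v powr (- \<alpha>)"
    using pos [of v] powr_add [of "?w v" 1 "- \<alpha> - 1"] by simp
  have w2: "(?w v)\<^sup>2 * ?w v powr (- \<alpha> - 1 - 1) = ?w v powr (- \<alpha>)"
    using pos [of v] powr_add [of "?w v" 2 "- \<alpha> - 1 - 1"] by simp
  have "- (((?w v)\<^sup>2 + 0) * (- \<alpha> * ((- \<alpha> - 1) * ?w v powr (- \<alpha> - 1 - 1))) + real CARD('n) * ?w v * (- \<alpha> * ?w v powr (- \<alpha> - 1)))
      = - (- \<alpha> * (- \<alpha> - 1) * ((?w v)\<^sup>2 * ?w v powr (- \<alpha> - 1 - 1)) + real CARD('n) * (- \<alpha>) * (?w v * ?w v powr (- \<alpha> - 1)))"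
    by (simp only: mult_ac add_0_right)
  also have "\<dots> = \<alpha> * (real CARD('n) - 1 - \<alpha>) * ?w v powr (- \<alpha>)"
    unfolding w1 w2 by (simp add: algebra_simps)
  finally have e: "- (((?w v)\<^sup>2 + 0) * (- \<alpha> * ((- \<alpha> - 1) * ?w v powr (- \<alpha> - 1 - 1))) + real CARD('n) * ?w v * (- \<alpha> * ?w v powr (- \<alpha> - 1)))
      = \<alpha> * (real CARD('n) - 1 - \<alpha>) * ?w v powr (- \<alpha>)" .
  show "hyp_laplacian (horo \<alpha> \<xi>) v = complex_of_real (\<alpha> * (real CARD('n) - 1 - \<alpha>)) * horo \<alpha> \<xi> v"
    unfolding h hyp_laplacian_radial [OF f f1 f2] null
    by (simp only: of_real_minus [symmetric] of_real_mult [symmetric] e)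
qed

text \<open>Invariance of the volume moves the centre to the origin and the boundary point to
  \<open>null_vec\<close>, so the moment does not depend on \<open>g\<close>.\<close>

lemma horo_moment:
  fixes g :: "'n::finite mat1"
  assumes g: "g \<in> lorc"
  shows "radial_moment (horo \<alpha> (g *v null_vec)) (g *v hyp_origin) 3 W
    = complex_of_real (spherical_factor TYPE('n) \<alpha> W)"
proof -
  let ?f = "\<lambda>y. (pp (W - lor (g *v hyp_origin) y)) ^ 3 * lor (g *v null_vec) y powr (- \<alpha>)"
  have [measurable]: "pp \<in> borel_measurable borel" unfolding pp_def [abs_def] by measurable
  have m: "?f \<in> borel_measurable borel" by measurable
  have "radial_moment (horo \<alpha> (g *v null_vec)) (g *v hyp_origin) 3 W
      = (\<integral>v. complex_of_real (hyp_density v *\<^sub>R ?f (hyp_chart v)) \<partial>lborel)"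
    unfolding radial_moment_def horo_def by (simp add: scaleR_conv_of_real mult_ac)
  also have "\<dots> = complex_of_real (\<integral>v. hyp_density v *\<^sub>R ?f (hyp_chart v) \<partial>lborel)"
    by (rule integral_complex_of_real)
  also have "(\<integral>v. hyp_density v *\<^sub>R ?f (hyp_chart v) \<partial>lborel) = (\<integral>y. ?f y \<partial>hyp_vol)"
    by (rule integral_hyp_vol [OF m, symmetric])
  also have "\<dots> = (\<integral>y. ?f (g *v y) \<partial>hyp_vol)"
    by (rule integral_hyp_vol_lorc [OF m g, symmetric])
  also have "\<dots> = spherical_factor TYPE('n) \<alpha> W"
    unfolding spherical_factor_def lorc_lor [OF g] ..
  finally show ?thesis .
qed

text \<open>Subtracting from \<open>\<Phi>\<close> the multiple of a horospherical eigenfunction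
  with the same eigenvalue and the same value at \<open>x\<close> leaves an eigenfunction that
  vanishes at \<open>x\<close>. Its third moment is 0 by uniqueness, and the horospherical moment is
  known.\<close>

theorem mean_value:
  fixes \<Phi> :: "real ^ 'n::finite \<Rightarrow> complex"
  assumes C2: "C2 \<Phi>"
    and eig: "\<And>v. hyp_laplacian \<Phi> v = complex_of_real (\<alpha> * (real CARD('n) - 1 - \<alpha>)) * \<Phi> v"
    and x: "x \<in> hyp" and W: "W > 1"
  shows "radial_moment \<Phi> x 3 W = complex_of_real (spherical_factor TYPE('n) \<alpha> W) * \<Phi> (space_part x)"
proof -
  obtain g where g: "g \<in> lorc" "g *v hyp_origin = x" using lorc_transitive_origin [OF x] .
  obtain h where h: "h \<in> lorc" "g ** h = mat 1" "h ** g = mat 1" using lorc_inverse [OF g(1)] .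
  let ?\<xi> = "g *v null_vec :: 'n vec1"
  let ?e = "horo \<alpha> ?\<xi>"
  have "lor ?\<xi> y = lor null_vec (h *v y)" for y
  proof -
    have "y = g *v (h *v y)" by (simp only: matrix_vector_mul_assoc h matrix_vector_mul_lid)
    then have "lor ?\<xi> y = lor ?\<xi> (g *v (h *v y))" by (rule arg_cong)
    then show ?thesis by (simp only: lorc_lor [OF g(1)])
  qed
  then have pos: "lor ?\<xi> (hyp_chart v) > 0" for v
    using lor_null_vec_pos [OF lorc_hyp [OF h(1) hyp_chart_in_hyp]] by simp
  have null: "mink ?\<xi> ?\<xi> = 0" by (simp add: lorc_mink [OF g(1)] mink_null_vec)
  have e1: "?e (space_part x) = 1"
  proof -
    have "lor ?\<xi> x = 1" using lorc_lor [OF g(1), of null_vec hyp_origin] lor_null_vec_origin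
      by (simp add: g(2) lor_sym)
    then show ?thesis by (simp add: horo_def hyp_eq_chart [OF x, symmetric])
  qed
  note e = horo_eigenfunction [OF pos null, of \<alpha>]
  let ?c = "\<Phi> (space_part x)"
  let ?D = "\<lambda>v. 1 * \<Phi> v + (- ?c) * ?e v"
  have D: "C2 ?D" by (rule C2_linear_combination [OF C2 e(1)])
  have "radial_moment ?D x 3 W = 0"
  proof (rule moment_unique [OF D _ x _ W])
    show "hyp_laplacian ?D v = complex_of_real (\<alpha> * (real CARD('n) - 1 - \<alpha>)) * ?D v" for v
      unfolding hyp_laplacian_linear_combination [OF C2 e(1)] eig e(2) by (simp add: algebra_simps)
  qed (simp add: e1)
  moreover have "radial_moment ?D x 3 W = radial_moment \<Phi> x 3 W - ?c * radial_moment ?e x 3 W"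
  proof -
    let ?F = "\<lambda>\<Phi> v. (hyp_density v * (pp (W - lor x (hyp_chart v))) ^ 3) *\<^sub>R \<Phi> v"
    have i: "integrable lborel (?F \<Phi>)" "integrable lborel (?F ?e)"
      using C2_continuous C2 e(1) x by (auto intro!: integrable_moment)
    have "?F ?D v = ?F \<Phi> v - ?c * ?F ?e v" for v by (simp add: scaleR_diff_right)
    then have "radial_moment ?D x 3 W = (\<integral>v. ?F \<Phi> v - ?c * ?F ?e v \<partial>lborel)"
      unfolding radial_moment_def by (simp only:)
    also have "\<dots> = (\<integral>v. ?F \<Phi> v \<partial>lborel) - ?c * (\<integral>v. ?F ?e v \<partial>lborel)"
      using Bochner_Integration.integral_diff [OF i(1) integrable_mult_right [OF i(2), of ?c]]
      by (simp only: integral_mult_right_zero)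
    finally show ?thesis by (simp only: radial_moment_def)
  qed
  ultimately show ?thesis
    using horo_moment [OF g(1), of \<alpha> W] by (simp add: g(2))
qed

subsection \<open>Discrete groups and the Dirichlet domain\<close>

lemma finite_cart: "finite S \<Longrightarrow> finite {x :: 'a ^ 'k::finite. \<forall>i. x $ i \<in> S}"
proof -
  assume S: "finite S"
  have "vec_nth ` {x :: 'a ^ 'k. \<forall>i. x $ i \<in> S} \<subseteq> PiE UNIV (\<lambda>_. S)" by auto
  then have "finite (vec_nth ` {x :: 'a ^ 'k. \<forall>i. x $ i \<in> S})"
    by (rule finite_subset) (intro finite_PiE finite S)
  then show ?thesis by (rule finite_imageD) (auto simp: inj_on_def vec_nth_inject)
qed

lemma finite_bounded_integer_matrices:
  "finite {A :: real ^ 'k::finite ^ 'm::finite. \<forall>i j. A $ i $ j \<in> \<int> \<and> \<bar>A $ i $ j\<bar> \<le> B}"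
proof -
  have "finite {z :: real. z \<in> \<int> \<and> \<bar>z\<bar> \<le> B}"
    using finite_abs_int_segment [of B] by simp
  from finite_cart [OF finite_cart [OF this]]
  have "finite {A :: real ^ 'k ^ 'm. \<forall>i. A $ i \<in> {x. \<forall>j. x $ j \<in> {z. z \<in> \<int> \<and> \<bar>z\<bar> \<le> B}}}" .
  then show ?thesis by simp
qed

text \<open>The top row of \<open>A\<close> consists, up to sign, of the coordinates of the inverse
  image of the origin, a point of the hyperboloid with the same time coordinate as
  \<open>A *v hyp_origin\<close>. Each column has \<open>mink\<close> square at most 1, so its space
  part is controlled by its top entry.\<close>

lemma lorentz_entries_bound:
  assumes A: "A \<in> lorc" and R: "lor hyp_origin (A *v hyp_origin) \<le> R"
  shows "\<bar>A $ i $ j\<bar> \<le> 1 + R"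
proof -
  let ?w = "lor hyp_origin (A *v hyp_origin)"
  obtain B where B: "B \<in> lorc" "A ** B = mat 1" "B ** A = mat 1" using lorc_inverse [OF A] .
  have w1: "?w \<ge> 1" by (intro lor_ge_1 lorc_hyp A) simp_all
  have BA: "B *v (A *v y) = y" for y by (simp only: matrix_vector_mul_assoc B matrix_vector_mul_lid)
  have ent: "(A *v axis j 1) $ i = A $ i $ j" for i j
    by (simp add: matrix_vector_mul_component inner_axis)
  have top: "\<bar>A $ None $ j\<bar> \<le> ?w" for j
  proof -
    let ?b = "B *v hyp_origin"
    have b: "?b \<in> hyp" by (intro lorc_hyp B) simp
    have bN: "?b $ None = ?w"
      using lorc_lor [OF B(1), of "A *v hyp_origin" hyp_origin] lor_origin [of ?b]
      by (simp add: BA lor_sym)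
    have bS: "\<bar>?b $ Some k\<bar> \<le> ?w" for k
    proof -
      have "\<bar>space_part ?b $ k\<bar> \<le> norm (space_part ?b)" by (rule component_le_norm_cart)
      also have "\<dots> \<le> sqrt (1 + space_part ?b \<bullet> space_part ?b)" by (rule real_le_rsqrt) (simp add: dot_square_norm)
      also have "\<dots> = ?b $ None" using hyp_eq_chart [OF b] by (metis hyp_chart_mkvec mkvec_nth(1))
      finally show ?thesis by (simp add: bN)
    qed
    have "A $ None $ j = lor hyp_origin (A *v axis j 1)" by (simp add: lor_origin ent)
    also have "\<dots> = lor ?b (axis j 1)"
      using lorc_lor [OF B(1), of hyp_origin "A *v axis j 1"] by (simp add: BA)
    also have "\<bar>\<dots>\<bar> \<le> ?w"
      using bS bN w1 by (cases j) (simp_all add: lor_def mink_sym [of ?b] mink_axis)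
    finally show ?thesis .
  qed
  show ?thesis
  proof (cases i)
    case None
    then show ?thesis using top [of j] R by simp
  next
    case (Some k)
    let ?a = "A *v axis j 1"
    have "mink ?a ?a \<le> 1" unfolding lorc_mink [OF A] by (cases j) (simp_all add: mink_axis)
    then have "space_part ?a \<bullet> space_part ?a \<le> 1 + (A $ None $ j)\<^sup>2"
      by (simp add: mink_space_part ent power2_eq_square)
    also have "\<dots> \<le> (1 + ?w)\<^sup>2"
    proof -
      have "(A $ None $ j)\<^sup>2 \<le> ?w\<^sup>2" using top [of j] by (simp add: abs_le_square_iff [symmetric])
      then show ?thesis using w1 by (simp add: power2_eq_square algebra_simps)
    qed
    finally have sq: "space_part ?a \<bullet> space_part ?a \<le> (1 + ?w)\<^sup>2" .
    have "norm (space_part ?a) \<le> 1 + ?w"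
    proof (rule power2_le_imp_le)
      show "(norm (space_part ?a))\<^sup>2 \<le> (1 + ?w)\<^sup>2" using sq by (simp only: power2_norm_eq_inner)
      show "0 \<le> 1 + ?w" using w1 by linarith
    qed
    moreover have "\<bar>space_part ?a $ k\<bar> \<le> norm (space_part ?a)" by (rule component_le_norm_cart)
    ultimately show ?thesis using R Some by (simp add: ent)
  qed
qed

lemma lorentz_group_simps [simp]:
  "\<one>\<^bsub>lorentz_group\<^esub> = mat 1" "A \<otimes>\<^bsub>lorentz_group\<^esub> B = A ** B"
  by (simp_all add: lorentz_group_def)

lemma cosh_hyp_dist:
  assumes "x \<in> hyp" "y \<in> hyp" shows "cosh (hyp_dist x y) = lor x y" "hyp_dist x y \<ge> 0"
  using lor_ge_1 [OF assms] by (simp_all add: hyp_dist_def lor_def)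

lemma hyp_dist_le_iff:
  assumes "x \<in> hyp" "y \<in> hyp" "a \<in> hyp" "b \<in> hyp"
  shows "hyp_dist x y \<le> hyp_dist a b \<longleftrightarrow> lor x y \<le> lor a b"
  using cosh_real_nonneg_le_iff [OF cosh_hyp_dist(2) [OF assms(1,2)] cosh_hyp_dist(2) [OF assms(3,4)]]
  by (simp add: cosh_hyp_dist assms)

text \<open>Integrality yields discreteness, and the absence of torsion yields a free action. Both
  the ambient group and all its finite-index subgroups are instances.\<close>

locale discrete_group =
  fixes \<Gamma> :: "'n::finite mat1 set"
  assumes subgroup: "subgroup \<Gamma> lorentz_group" and integral: "\<Gamma> \<subseteq> GL_int" and torsion_free: "torsion_free \<Gamma>"
begin

lemma lorc: "\<gamma> \<in> \<Gamma> \<Longrightarrow> \<gamma> \<in> lorc"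
  using subgroup by (meson subgroup.subset subsetD)

lemma one: "mat 1 \<in> \<Gamma>"
  using subgroup.one_closed [OF subgroup] by simp

lemma mult: "\<gamma> \<in> \<Gamma> \<Longrightarrow> \<gamma>' \<in> \<Gamma> \<Longrightarrow> \<gamma> ** \<gamma>' \<in> \<Gamma>"
  using subgroup.m_closed [OF subgroup] by simp

definition ginv :: "'n mat1 \<Rightarrow> 'n mat1" where
  "ginv \<gamma> = inv\<^bsub>lorentz_group\<^esub> \<gamma>"

lemma ginv: assumes "\<gamma> \<in> \<Gamma>" shows "ginv \<gamma> \<in> \<Gamma>" "\<gamma> ** ginv \<gamma> = mat 1" "ginv \<gamma> ** \<gamma> = mat 1"
proof -
  show "ginv \<gamma> \<in> \<Gamma>"
    unfolding ginv_def by (rule subgroup.m_inv_closed [OF subgroup assms])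
  show "\<gamma> ** ginv \<gamma> = mat 1"
    using group.r_inv [OF group_lorentz lorc [OF assms]] by (simp add: ginv_def)
  show "ginv \<gamma> ** \<gamma> = mat 1"
    using group.l_inv [OF group_lorentz lorc [OF assms]] by (simp add: ginv_def)
qed

lemma ginv_act: "\<gamma> \<in> \<Gamma> \<Longrightarrow> ginv \<gamma> *v (\<gamma> *v y) = y" "\<gamma> \<in> \<Gamma> \<Longrightarrow> \<gamma> *v (ginv \<gamma> *v y) = y"
  by (simp_all only: matrix_vector_mul_assoc ginv matrix_vector_mul_lid)

lemma ginv_ginv: "\<gamma> \<in> \<Gamma> \<Longrightarrow> ginv (ginv \<gamma>) = \<gamma>"
  unfolding ginv_def by (rule group.inv_inv [OF group_lorentz lorc])

lemma lor_ginv: assumes "\<gamma> \<in> \<Gamma>" shows "lor (ginv \<gamma> *v x) y = lor x (\<gamma> *v y)"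
  using lorc_lor [OF lorc [OF assms], of "ginv \<gamma> *v x" y] by (simp add: ginv_act assms)

lemma act_hyp: "\<gamma> \<in> \<Gamma> \<Longrightarrow> x \<in> hyp \<Longrightarrow> \<gamma> *v x \<in> hyp"
  by (intro lorc_hyp lorc)

lemma act_hyp_iff: "\<gamma> \<in> \<Gamma> \<Longrightarrow> \<gamma> *v x \<in> hyp \<longleftrightarrow> x \<in> hyp"
  by (intro lorc_hyp_iff lorc)

lemma lor_act: "\<gamma> \<in> \<Gamma> \<Longrightarrow> lor (\<gamma> *v x) (\<gamma> *v y) = lor x y"
  by (intro lorc_lor lorc)

lemma bij_ginv: "bij_betw ginv \<Gamma> \<Gamma>"
  by (rule bij_betw_byWitness [of _ ginv]) (auto simp: ginv_ginv ginv(1))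

lemma bij_mult_right: assumes "\<gamma>0 \<in> \<Gamma>" shows "bij_betw (\<lambda>\<gamma>. \<gamma> ** \<gamma>0) \<Gamma> \<Gamma>"
proof (rule bij_betw_byWitness [of _ "\<lambda>\<gamma>. \<gamma> ** ginv \<gamma>0"])
  show "\<forall>\<gamma>\<in>\<Gamma>. \<gamma> ** \<gamma>0 ** ginv \<gamma>0 = \<gamma>" "\<forall>\<gamma>\<in>\<Gamma>. \<gamma> ** ginv \<gamma>0 ** \<gamma>0 = \<gamma>"
    by (simp_all add: matrix_mul_assoc [symmetric] ginv assms)
qed (auto intro!: mult ginv(1) assms)

lemma bij_mult_left: assumes "\<gamma>0 \<in> \<Gamma>" shows "bij_betw (\<lambda>\<gamma>. \<gamma>0 ** \<gamma>) \<Gamma> \<Gamma>"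
proof (rule bij_betw_byWitness [of _ "\<lambda>\<gamma>. ginv \<gamma>0 ** \<gamma>"])
  show "\<forall>\<gamma>\<in>\<Gamma>. ginv \<gamma>0 ** (\<gamma>0 ** \<gamma>) = \<gamma>" "\<forall>\<gamma>\<in>\<Gamma>. \<gamma>0 ** (ginv \<gamma>0 ** \<gamma>) = \<gamma>"
    by (simp_all add: matrix_mul_assoc ginv assms)
qed (auto intro!: mult ginv(1) assms)

lemma finite_orbit_origin: "finite {\<gamma> \<in> \<Gamma>. lor hyp_origin (\<gamma> *v hyp_origin) \<le> R}"
proof (rule finite_subset [OF _ finite_bounded_integer_matrices [of "1 + R"]])
  show "{\<gamma> \<in> \<Gamma>. lor hyp_origin (\<gamma> *v hyp_origin) \<le> R} \<subseteq> {A. \<forall>i j. A $ i $ j \<in> \<int> \<and> \<bar>A $ i $ j\<bar> \<le> 1 + R}"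
  proof
    fix \<gamma> assume g: "\<gamma> \<in> {\<gamma> \<in> \<Gamma>. lor hyp_origin (\<gamma> *v hyp_origin) \<le> R}"
    then have "\<gamma> \<in> lorc" "lor hyp_origin (\<gamma> *v hyp_origin) \<le> R" using lorc by blast+
    note b = lorentz_entries_bound [OF this]
    have "\<gamma> \<in> GL_int" using g integral by blast
    with b show "\<gamma> \<in> {A. \<forall>i j. A $ i $ j \<in> \<int> \<and> \<bar>A $ i $ j\<bar> \<le> 1 + R}" by (simp add: GL_int_def)
  qed
qed

lemma finite_orbit:
  assumes "x \<in> hyp" "y \<in> hyp" shows "finite {\<gamma> \<in> \<Gamma>. lor x (\<gamma> *v y) \<le> R}"
proof (rule finite_subset [OF _ finite_orbit_origin [of "2 * lor hyp_origin x * (2 * R * lor y hyp_origin)"]], safe)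
  fix \<gamma> assume g: "\<gamma> \<in> \<Gamma>" "lor x (\<gamma> *v y) \<le> R"
  have "lor hyp_origin (\<gamma> *v hyp_origin) \<le> 2 * lor hyp_origin x * lor x (\<gamma> *v hyp_origin)"
    using g assms by (intro lor_triangle act_hyp) simp_all
  also have "\<dots> \<le> 2 * lor hyp_origin x * (2 * lor x (\<gamma> *v y) * lor (\<gamma> *v y) (\<gamma> *v hyp_origin))"
    using g assms lor_pos [of hyp_origin x] by (intro mult_left_mono lor_triangle act_hyp) simp_all
  also have "lor (\<gamma> *v y) (\<gamma> *v hyp_origin) = lor y hyp_origin" by (rule lor_act [OF g(1)])
  also have "2 * lor hyp_origin x * (2 * lor x (\<gamma> *v y) * lor y hyp_origin) \<le> 2 * lor hyp_origin x * (2 * R * lor y hyp_origin)"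
    using g assms lor_pos [of hyp_origin x] lor_pos [of y hyp_origin] by (intro mult_left_mono mult_right_mono) simp_all
  finally show "lor hyp_origin (\<gamma> *v hyp_origin) \<le> 2 * lor hyp_origin x * (2 * R * lor y hyp_origin)" .
qed

lemma countable_group: "countable \<Gamma>"
proof -
  have "\<Gamma> \<subseteq> (\<Union>k::nat. {\<gamma> \<in> \<Gamma>. lor hyp_origin (\<gamma> *v hyp_origin) \<le> real k})"
    using real_arch_simple by blast
  moreover have "countable (\<Union>k::nat. {\<gamma> \<in> \<Gamma>. lor hyp_origin (\<gamma> *v hyp_origin) \<le> real k})"
    by (rule countable_UN) (simp_all add: countable_finite finite_orbit_origin)
  ultimately show ?thesis by (rule countable_subset)
qed

text \<open>All powers of \<open>\<gamma>\<close> fix \<open>y\<close>, and only finitely many group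
  elements do. Hence two powers coincide, and torsion-freeness applies to their quotient.\<close>

lemma free_action:
  assumes g: "\<gamma> \<in> \<Gamma>" and y: "y \<in> hyp" and fx: "\<gamma> *v y = y" shows "\<gamma> = mat 1"
proof -
  let ?p = "\<lambda>k::nat. \<gamma> [^]\<^bsub>lorentz_group\<^esub> k"
  interpret G: group lorentz_group by (rule group_lorentz)
  have p: "?p k \<in> \<Gamma> \<and> ?p k *v y = y" for k
  proof (induction k)
    case 0
    show ?case using one by simp
  next
    case (Suc k)
    have "?p (Suc k) = ?p k ** \<gamma>" by simp
    then show ?case using Suc mult g fx by (simp add: matrix_vector_mul_assoc [symmetric])
  qed
  have "finite {\<gamma> \<in> \<Gamma>. lor y (\<gamma> *v y) \<le> 1}" by (rule finite_orbit [OF y y])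
  then have "finite (range ?p)"
    by (rule finite_subset [rotated]) (use p lor_self [OF y] in auto)
  then have "\<not> inj ?p" using finite_imageD infinite_UNIV_nat by blast
  then obtain i j where ij: "?p i = ?p j" "i < j" unfolding inj_def by (metis linorder_neqE_nat)
  have "?p (j - i) = mat 1"
    using G.pow_eq_div2 [of \<gamma> j i] lorc [OF g] ij by simp
  then show ?thesis
    using torsion_free g ij(2) unfolding torsion_free_def by (metis zero_less_diff)
qed

lemma act_inj: assumes "\<gamma> \<in> \<Gamma>" "\<gamma>' \<in> \<Gamma>" "y \<in> hyp" "\<gamma> *v y = \<gamma>' *v y" shows "\<gamma> = \<gamma>'"
proof -
  have "(ginv \<gamma>' ** \<gamma>) *v y = y"
    using assms by (simp add: matrix_vector_mul_assoc [symmetric] ginv_act)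
  then have "ginv \<gamma>' ** \<gamma> = mat 1"
    using assms by (intro free_action [OF _ assms(3)] mult ginv(1))
  then have "\<gamma>' ** (ginv \<gamma>' ** \<gamma>) = \<gamma>'" by simp
  then show ?thesis by (simp only: matrix_mul_assoc ginv [OF assms(2)] matrix_mul_lid)
qed

section \<open>The Dirichlet domain as a fundamental domain\<close>

abbreviation dom :: "'n vec1 set" where "dom \<equiv> dirichlet_domain \<Gamma>"

lemma dom_iff: "x \<in> dom \<longleftrightarrow> x \<in> hyp \<and> (\<forall>\<gamma>\<in>\<Gamma>. lor x hyp_origin \<le> lor x (\<gamma> *v hyp_origin))"
  unfolding dirichlet_domain_def using hyp_dist_le_iff act_hyp hyp_origin_in_hyp by blast

lemma dom_subset: "dom \<subseteq> hyp" using dom_iff by blast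

lemma dom_in_borel [measurable]: "dom \<in> sets borel"
proof -
  have "dom = hyp \<inter> (\<Inter>\<gamma>\<in>\<Gamma>. {x. lor x hyp_origin \<le> lor x (\<gamma> *v hyp_origin)})"
    using dom_iff one by auto
  moreover have "closed \<dots>"
    by (intro closed_Int closed_hyp closed_INT ballI closed_Collect_le continuous_intros)
  ultimately show ?thesis by (simp add: borel_closed)
qed

text \<open>Reindexing the orbit shows that a translate of \<open>y\<close> lands in the domain
  exactly when the corresponding orbit point of the origin is a nearest one to
  \<open>y\<close>.\<close>

lemma ginv_in_dom_iff:
  assumes "y \<in> hyp" "\<gamma> \<in> \<Gamma>"
  shows "ginv \<gamma> *v y \<in> dom \<longleftrightarrow> (\<forall>\<gamma>'\<in>\<Gamma>. lor y (\<gamma> *v hyp_origin) \<le> lor y (\<gamma>' *v hyp_origin))"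
proof -
  have "ginv \<gamma> *v y \<in> dom \<longleftrightarrow> (\<forall>\<gamma>'\<in>\<Gamma>. lor y (\<gamma> *v hyp_origin) \<le> lor y (\<gamma> *v (\<gamma>' *v hyp_origin)))"
    using assms act_hyp [OF ginv(1)] by (simp add: dom_iff lor_ginv)
  also have "\<dots> \<longleftrightarrow> (\<forall>\<gamma>'\<in>\<Gamma>. lor y (\<gamma> *v hyp_origin) \<le> lor y (\<gamma>' *v hyp_origin))"
    (is "(\<forall>\<gamma>'\<in>\<Gamma>. ?P (\<gamma> *v (\<gamma>' *v hyp_origin))) \<longleftrightarrow> (\<forall>\<gamma>'\<in>\<Gamma>. ?P (\<gamma>' *v hyp_origin))")
  proof
    assume a: "\<forall>\<gamma>'\<in>\<Gamma>. ?P (\<gamma> *v (\<gamma>' *v hyp_origin))"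
    show "\<forall>\<gamma>'\<in>\<Gamma>. ?P (\<gamma>' *v hyp_origin)"
    proof
      fix \<gamma>' assume "\<gamma>' \<in> \<Gamma>"
      then have "ginv \<gamma> ** \<gamma>' \<in> \<Gamma>" by (intro mult ginv assms)
      then have "?P (\<gamma> *v ((ginv \<gamma> ** \<gamma>') *v hyp_origin))" using a by blast
      then show "?P (\<gamma>' *v hyp_origin)"
        by (simp only: matrix_vector_mul_assoc [symmetric] ginv_act [OF assms(2)])
    qed
  next
    assume a: "\<forall>\<gamma>'\<in>\<Gamma>. ?P (\<gamma>' *v hyp_origin)"
    show "\<forall>\<gamma>'\<in>\<Gamma>. ?P (\<gamma> *v (\<gamma>' *v hyp_origin))"
    proof
      fix \<gamma>' assume "\<gamma>' \<in> \<Gamma>"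
      then have "\<gamma> ** \<gamma>' \<in> \<Gamma>" by (intro mult assms)
      then have "?P ((\<gamma> ** \<gamma>') *v hyp_origin)" using a by blast
      then show "?P (\<gamma> *v (\<gamma>' *v hyp_origin))" by (simp only: matrix_vector_mul_assoc)
    qed
  qed
  finally show ?thesis .
qed

text \<open>A nearest orbit point exists, because only finitely many orbit points are as close to
  \<open>y\<close> as the origin itself.\<close>

lemma dom_covers: assumes "y \<in> hyp" obtains \<gamma> where "\<gamma> \<in> \<Gamma>" "ginv \<gamma> *v y \<in> dom"
proof -
  let ?S = "{\<gamma> \<in> \<Gamma>. lor y (\<gamma> *v hyp_origin) \<le> lor y hyp_origin}"
  let ?f = "\<lambda>\<gamma>. lor y (\<gamma> *v hyp_origin)"
  have fin: "finite ?S" by (intro finite_orbit assms) simp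
  have 1: "mat 1 \<in> ?S" using one by simp
  obtain \<gamma> where g: "\<gamma> \<in> ?S" "\<forall>\<gamma>'\<in>?S. ?f \<gamma> \<le> ?f \<gamma>'"
    using ex_min_if_finite [of "?f ` ?S"] fin 1 by (metis (mono_tags, lifting) arg_min_if_finite(1) arg_min_least empty_iff)
  have "?f \<gamma> \<le> ?f \<gamma>'" if "\<gamma>' \<in> \<Gamma>" for \<gamma>'
  proof (cases "\<gamma>' \<in> ?S")
    case False
    then show ?thesis using that g(1) by simp
  qed (use g(2) in blast)
  then have "ginv \<gamma> *v y \<in> dom" using g(1) assms by (simp add: ginv_in_dom_iff)
  then show ?thesis using g(1) that by blast
qed

text \<open>Two orbit points are distinct by freeness, so the points at equal distance from them lie
  in a hyperplane through 0; countably many such null sets are removed.\<close>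

lemma AE_distinct_distances:
  "AE y in hyp_vol. \<forall>\<gamma>\<in>\<Gamma>. \<forall>\<gamma>'\<in>\<Gamma>. \<gamma> \<noteq> \<gamma>' \<longrightarrow> lor y (\<gamma> *v hyp_origin) \<noteq> lor y (\<gamma>' *v hyp_origin)"
proof (intro AE_ball_countable' countable_group)
  fix \<gamma> \<gamma>' assume g: "\<gamma> \<in> \<Gamma>" "\<gamma>' \<in> \<Gamma>"
  show "AE y in hyp_vol. \<gamma> \<noteq> \<gamma>' \<longrightarrow> lor y (\<gamma> *v hyp_origin) \<noteq> lor y (\<gamma>' *v hyp_origin)"
  proof (cases "\<gamma> = \<gamma>'")
    case False
    then have "\<gamma> *v hyp_origin - \<gamma>' *v hyp_origin \<noteq> 0"
      using act_inj [OF g, of hyp_origin] by auto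
    from AE_hyp_not_hyperplane [OF this] show ?thesis
      by (rule AE_mp) (rule AE_I2, simp add: mink_diff_left lor_def mink_sym [of _ "\<gamma> *v hyp_origin"] mink_sym [of _ "\<gamma>' *v hyp_origin"])
  qed simp
qed

text \<open>Sums over the group are written as integrals for counting measure, so that exchanging
  sum and integral is Tonelli's theorem.\<close>

abbreviation gsum :: "('n mat1 \<Rightarrow> ennreal) \<Rightarrow> ennreal" where
  "gsum f \<equiv> \<integral>\<^sup>+\<gamma>. f \<gamma> \<partial>count_space \<Gamma>"

lemma gsum_ginv: "gsum (\<lambda>\<gamma>. f (ginv \<gamma>)) = gsum f"
  by (rule nn_integral_bij_count_space [OF bij_ginv])

lemma gsum_mult_right: "\<gamma>0 \<in> \<Gamma> \<Longrightarrow> gsum (\<lambda>\<gamma>. f (\<gamma> ** \<gamma>0)) = gsum f"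
  by (rule nn_integral_bij_count_space [OF bij_mult_right])

lemma gsum_mult_left: "\<gamma>0 \<in> \<Gamma> \<Longrightarrow> gsum (\<lambda>\<gamma>. f (\<gamma>0 ** \<gamma>)) = gsum f"
  by (rule nn_integral_bij_count_space [OF bij_mult_left])

lemma AE_dom_once: "AE y in hyp_vol. gsum (\<lambda>\<gamma>. indicator dom (\<gamma> *v y)) = 1"
  using AE_distinct_distances AE_hyp
proof eventually_elim
  case (elim y)
  obtain \<gamma>0 where g0: "\<gamma>0 \<in> \<Gamma>" "ginv \<gamma>0 *v y \<in> dom" using dom_covers [OF elim(2)] .
  have u: "ginv \<gamma> *v y \<in> dom \<longleftrightarrow> \<gamma> = \<gamma>0" if g: "\<gamma> \<in> \<Gamma>" for \<gamma>
  proof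
    assume "ginv \<gamma> *v y \<in> dom"
    then have "lor y (\<gamma> *v hyp_origin) = lor y (\<gamma>0 *v hyp_origin)"
      using g0 g elim(2) by (simp add: ginv_in_dom_iff antisym)
    then show "\<gamma> = \<gamma>0" using elim(1) g g0 by blast
  qed (use g0 in simp)
  have "gsum (\<lambda>\<gamma>. indicator dom (\<gamma> *v y)) = gsum (\<lambda>\<gamma>. indicator dom (ginv \<gamma> *v y))"
    by (rule gsum_ginv [symmetric])
  also have "\<dots> = gsum (indicator {\<gamma>0})"
    by (intro nn_integral_cong) (simp add: u indicator_def)
  also have "\<dots> = 1" using g0 by (subst nn_integral_indicator) simp_all
  finally show ?case .
qed

text \<open>The volume is cut down by a density and not by restricting the space: Borel functions on
  the ambient space remain measurable for it as they stand.\<close>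

definition dom_vol :: "'n vec1 measure" where
  "dom_vol = density hyp_vol (indicator dom)"

lemma sets_dom_vol [measurable_cong, simp]: "sets dom_vol = sets borel"
  by (simp add: dom_vol_def)

lemma space_dom_vol [simp]: "space dom_vol = UNIV"
  by (simp add: dom_vol_def)

lemma nn_integral_dom_vol:
  assumes [measurable]: "f \<in> borel_measurable borel"
  shows "(\<integral>\<^sup>+y. f y \<partial>dom_vol) = (\<integral>\<^sup>+y. indicator dom y * f y \<partial>hyp_vol)"
  unfolding dom_vol_def by (subst nn_integral_density) auto

lemma measurable_gsum [measurable]:
  assumes "\<And>\<gamma>. \<gamma> \<in> \<Gamma> \<Longrightarrow> f \<gamma> \<in> borel_measurable M"
  shows "(\<lambda>y. gsum (\<lambda>\<gamma>. f \<gamma> y)) \<in> borel_measurable M"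
proof -
  interpret sigma_finite_measure "count_space \<Gamma>"
    by (rule sigma_finite_measure_count_space_countable [OF countable_group])
  have "(\<lambda>p. f (snd p) (fst p)) \<in> borel_measurable (M \<Otimes>\<^sub>M count_space \<Gamma>)"
    by (rule measurable_compose_countable' [where f = "\<lambda>\<gamma> p. f \<gamma> (fst p)" and g = snd and I = \<Gamma>])
      (simp_all add: measurable_compose [OF measurable_fst assms] countable_group)
  then show ?thesis
    by (intro borel_measurable_nn_integral) (simp add: case_prod_beta)
qed

text \<open>Invariance of the volume moves each group element from \<open>h\<close> to the indicator
  of the domain; almost every point has exactly one translate in the domain.\<close>

lemma unfold_integral:
  assumes h [measurable]: "h \<in> borel_measurable borel"
  shows "(\<integral>\<^sup>+y. gsum (\<lambda>\<gamma>. h (\<gamma> *v y)) \<partial>dom_vol) = (\<integral>\<^sup>+y. h y \<partial>hyp_vol)"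
proof -
  have m: "(\<lambda>y. h (\<gamma> *v y)) \<in> borel_measurable borel" for \<gamma> by measurable
  have "(\<integral>\<^sup>+y. gsum (\<lambda>\<gamma>. h (\<gamma> *v y)) \<partial>dom_vol) = (\<integral>\<^sup>+y. indicator dom y * gsum (\<lambda>\<gamma>. h (\<gamma> *v y)) \<partial>hyp_vol)"
    by (intro nn_integral_dom_vol measurable_gsum m)
  also have "\<dots> = (\<integral>\<^sup>+y. gsum (\<lambda>\<gamma>. indicator dom y * h (\<gamma> *v y)) \<partial>hyp_vol)"
    by (intro nn_integral_cong nn_integral_cmult [symmetric]) simp
  also have "\<dots> = gsum (\<lambda>\<gamma>. \<integral>\<^sup>+y. indicator dom y * h (\<gamma> *v y) \<partial>hyp_vol)"
    by (intro nn_integral_count_space_nn_integral countable_group) measurable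
  also have "\<dots> = gsum (\<lambda>\<gamma>. \<integral>\<^sup>+y. indicator dom (ginv \<gamma> *v y) * h y \<partial>hyp_vol)"
  proof (rule nn_integral_cong)
    fix \<gamma> assume "\<gamma> \<in> space (count_space \<Gamma>)"
    then have g: "\<gamma> \<in> \<Gamma>" by simp
    have "(\<integral>\<^sup>+y. indicator dom (ginv \<gamma> *v y) * h y \<partial>hyp_vol)
        = (\<integral>\<^sup>+y. indicator dom (ginv \<gamma> *v (\<gamma> *v y)) * h (\<gamma> *v y) \<partial>hyp_vol)"
      by (rule nn_integral_hyp_vol_lorc [symmetric, OF _ lorc [OF g]]) measurable
    then show "(\<integral>\<^sup>+y. indicator dom y * h (\<gamma> *v y) \<partial>hyp_vol) = (\<integral>\<^sup>+y. indicator dom (ginv \<gamma> *v y) * h y \<partial>hyp_vol)"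
      by (simp only: ginv_act [OF g])
  qed
  also have "\<dots> = gsum (\<lambda>\<gamma>. \<integral>\<^sup>+y. indicator dom (\<gamma> *v y) * h y \<partial>hyp_vol)"
    by (rule gsum_ginv)
  also have "\<dots> = (\<integral>\<^sup>+y. gsum (\<lambda>\<gamma>. indicator dom (\<gamma> *v y) * h y) \<partial>hyp_vol)"
    by (intro nn_integral_count_space_nn_integral [symmetric] countable_group) measurable
  also have "\<dots> = (\<integral>\<^sup>+y. gsum (\<lambda>\<gamma>. indicator dom (\<gamma> *v y)) * h y \<partial>hyp_vol)"
    by (intro nn_integral_cong nn_integral_multc) simp
  also have "\<dots> = (\<integral>\<^sup>+y. h y \<partial>hyp_vol)"
    by (rule nn_integral_cong_AE) (use AE_dom_once in eventually_elim, simp)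
  finally show ?thesis .
qed

lemma unfold_integral_invariant:
  assumes [measurable]: "h \<in> borel_measurable borel" "F \<in> borel_measurable borel"
    and invar: "\<And>\<gamma> y. \<gamma> \<in> \<Gamma> \<Longrightarrow> F (\<gamma> *v y) = F y"
  shows "(\<integral>\<^sup>+y. F y * gsum (\<lambda>\<gamma>. h (\<gamma> *v y)) \<partial>dom_vol) = (\<integral>\<^sup>+y. F y * h y \<partial>hyp_vol)"
proof -
  have "(\<integral>\<^sup>+y. F y * h y \<partial>hyp_vol) = (\<integral>\<^sup>+y. gsum (\<lambda>\<gamma>. F (\<gamma> *v y) * h (\<gamma> *v y)) \<partial>dom_vol)"
    by (rule unfold_integral [symmetric]) measurable
  also have "\<dots> = (\<integral>\<^sup>+y. gsum (\<lambda>\<gamma>. F y * h (\<gamma> *v y)) \<partial>dom_vol)"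
    by (intro nn_integral_cong) (simp add: invar)
  also have "\<dots> = (\<integral>\<^sup>+y. F y * gsum (\<lambda>\<gamma>. h (\<gamma> *v y)) \<partial>dom_vol)"
    by (intro nn_integral_cong nn_integral_cmult) simp
  finally show ?thesis by simp
qed

subsection \<open>Functions on the quotient\<close>

lemma orb_act: assumes "\<gamma> \<in> \<Gamma>" shows "orb \<Gamma> (\<gamma> *v y) = orb \<Gamma> y"
proof -
  have "(\<lambda>\<gamma>'. \<gamma>' ** \<gamma>) ` \<Gamma> = \<Gamma>" using bij_mult_right [OF assms] by (simp add: bij_betw_def)
  then have "orb \<Gamma> y = (\<lambda>\<gamma>'. \<gamma>' *v y) ` (\<lambda>\<gamma>'. \<gamma>' ** \<gamma>) ` \<Gamma>" by (simp add: orb_def)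
  also have "\<dots> = orb \<Gamma> (\<gamma> *v y)" by (simp add: orb_def image_image matrix_vector_mul_assoc)
  finally show ?thesis by simp
qed

lemma self_in_orb: "y \<in> orb \<Gamma> y"
  unfolding orb_def using one by (metis image_eqI matrix_vector_mul_lid)

lemma orb_in_quot_iff: "orb \<Gamma> y \<in> hyp_quot \<Gamma> \<longleftrightarrow> y \<in> hyp"
proof
  assume "orb \<Gamma> y \<in> hyp_quot \<Gamma>"
  then obtain z where z: "z \<in> hyp" "orb \<Gamma> y = orb \<Gamma> z" by (auto simp: hyp_quot_def)
  then have "y \<in> orb \<Gamma> z" using self_in_orb by blast
  then show "y \<in> hyp" using z act_hyp by (auto simp: orb_def)
qed (simp add: hyp_quot_def)

text \<open>The function \<open>topology\<close> returns the given open sets only once these are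
  known to form a topology, which is checked here.\<close>

lemma openin_quot_top:
  "openin (quot_top \<Gamma>) U \<longleftrightarrow> U \<subseteq> hyp_quot \<Gamma> \<and> openin (top_of_set hyp) {x \<in> hyp. orb \<Gamma> x \<in> U}"
proof -
  have "istopology (\<lambda>U. U \<subseteq> hyp_quot \<Gamma> \<and> openin (top_of_set hyp) {x \<in> hyp. orb \<Gamma> x \<in> U})"
    unfolding istopology_def
  proof (intro conjI allI impI)
    fix S T assume S: "S \<subseteq> hyp_quot \<Gamma> \<and> openin (top_of_set hyp) {x \<in> hyp. orb \<Gamma> x \<in> S}"
      and T: "T \<subseteq> hyp_quot \<Gamma> \<and> openin (top_of_set hyp) {x \<in> hyp. orb \<Gamma> x \<in> T}"
    have "{x \<in> hyp. orb \<Gamma> x \<in> S \<inter> T} = {x \<in> hyp. orb \<Gamma> x \<in> S} \<inter> {x \<in> hyp. orb \<Gamma> x \<in> T}" by auto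
    then show "openin (top_of_set hyp) {x \<in> hyp. orb \<Gamma> x \<in> S \<inter> T}" using S T by (simp only: openin_Int)
    show "S \<inter> T \<subseteq> hyp_quot \<Gamma>" using S by blast
  next
    fix K assume K: "\<forall>U\<in>K. U \<subseteq> hyp_quot \<Gamma> \<and> openin (top_of_set hyp) {x \<in> hyp. orb \<Gamma> x \<in> U}"
    have "{x \<in> hyp. orb \<Gamma> x \<in> \<Union>K} = (\<Union>U\<in>K. {x \<in> hyp. orb \<Gamma> x \<in> U})" by auto
    then show "openin (top_of_set hyp) {x \<in> hyp. orb \<Gamma> x \<in> \<Union>K}" using K by (metis (no_types, lifting) imageE openin_Union)
    show "\<Union>K \<subseteq> hyp_quot \<Gamma>" using K by blast
  qed
  then show ?thesis unfolding quot_top_def by (simp add: topology_inverse')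
qed

abbreviation quot_sigma :: "'n vec1 set measure" where
  "quot_sigma \<equiv> sigma (hyp_quot \<Gamma>) {U. openin (quot_top \<Gamma>) U}"

lemma open_subset_Pow: "{U. openin (quot_top \<Gamma>) U} \<subseteq> Pow (hyp_quot \<Gamma>)"
  using openin_quot_top by auto

lemma space_quot_vol: "space (quot_vol \<Gamma>) = hyp_quot \<Gamma>"
  by (simp add: quot_vol_def space_measure_of [OF open_subset_Pow])

lemma sets_quot_vol [measurable_cong]: "sets (quot_vol \<Gamma>) = sets quot_sigma"
  by (simp add: quot_vol_def)

lemma orb_measurable: "orb \<Gamma> \<in> measurable (restrict_space hyp_vol dom) quot_sigma"
proof (rule measurable_sigma_sets [OF _ open_subset_Pow])
  show "sets quot_sigma = sigma_sets (hyp_quot \<Gamma>) {U. openin (quot_top \<Gamma>) U}"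
    by (rule sets_measure_of [OF open_subset_Pow])
  show "orb \<Gamma> \<in> space (restrict_space hyp_vol dom) \<rightarrow> hyp_quot \<Gamma>"
    using dom_subset by (auto simp: space_restrict_space hyp_quot_def)
  fix U assume "U \<in> {U. openin (quot_top \<Gamma>) U}"
  then have "openin (top_of_set hyp) {x \<in> hyp. orb \<Gamma> x \<in> U}" by (simp add: openin_quot_top)
  then obtain T where T: "open T" "{x \<in> hyp. orb \<Gamma> x \<in> U} = hyp \<inter> T" by (auto simp: openin_open)
  have "orb \<Gamma> -` U \<inter> space (restrict_space hyp_vol dom) = T \<inter> dom"
    using T(2) dom_subset by (auto simp: space_restrict_space)
  moreover have "T \<inter> dom \<in> sets (restrict_space hyp_vol dom)"
    using T(1) by (subst sets_restrict_space_iff) auto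
  ultimately show "orb \<Gamma> -` U \<inter> space (restrict_space hyp_vol dom) \<in> sets (restrict_space hyp_vol dom)" by simp
qed

lemma nn_integral_quot_vol:
  assumes f: "f \<in> borel_measurable quot_sigma" and f': "(\<lambda>y. f (orb \<Gamma> y)) \<in> borel_measurable borel"
  shows "(\<integral>\<^sup>+x. f x \<partial>quot_vol \<Gamma>) = (\<integral>\<^sup>+y. f (orb \<Gamma> y) \<partial>dom_vol)"
proof -
  have "(\<integral>\<^sup>+x. f x \<partial>quot_vol \<Gamma>) = (\<integral>\<^sup>+y. f (orb \<Gamma> y) \<partial>restrict_space hyp_vol dom)"
    unfolding quot_vol_def by (rule nn_integral_distr [OF orb_measurable]) (use f in simp)
  also have "\<dots> = (\<integral>\<^sup>+y. f (orb \<Gamma> y) * indicator dom y \<partial>hyp_vol)"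
    by (rule nn_integral_restrict_space) simp
  finally show ?thesis by (simp add: nn_integral_dom_vol [OF f'] mult.commute)
qed

definition lift :: "('n vec1 set \<Rightarrow> complex) \<Rightarrow> 'n vec1 \<Rightarrow> complex" where
  "lift \<phi> y = \<phi> (orb \<Gamma> y)"

definition chart_lift :: "('n vec1 set \<Rightarrow> complex) \<Rightarrow> real ^ 'n \<Rightarrow> complex" where
  "chart_lift \<phi> v = \<phi> (orb \<Gamma> (hyp_chart v))"

lemma lift_act: "\<gamma> \<in> \<Gamma> \<Longrightarrow> lift \<phi> (\<gamma> *v y) = lift \<phi> y"
  by (simp add: lift_def orb_act)

lemma lift_chart: "lift \<phi> (hyp_chart v) = chart_lift \<phi> v"
  by (simp add: lift_def chart_lift_def)

lemma lift_space_part: "y \<in> hyp \<Longrightarrow> lift \<phi> y = chart_lift \<phi> (space_part y)"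
  by (simp add: lift_def chart_lift_def hyp_eq_chart [symmetric])

text \<open>The two properties of eigenfunctions that measure theory needs: the quotient carries the
  Borel sets of the quotient topology, so continuity of the lift gives measurability downstairs and
  upstairs.\<close>

definition qfun :: "('n vec1 set \<Rightarrow> complex) \<Rightarrow> bool" where
  "qfun \<phi> \<longleftrightarrow> (\<forall>x. x \<notin> hyp_quot \<Gamma> \<longrightarrow> \<phi> x = 0) \<and> continuous_on UNIV (chart_lift \<phi>)"

lemma lift_outside: "qfun \<phi> \<Longrightarrow> y \<notin> hyp \<Longrightarrow> lift \<phi> y = 0"
  by (simp add: qfun_def lift_def orb_in_quot_iff)

lemma lift_measurable: assumes "qfun \<phi>" shows "lift \<phi> \<in> borel_measurable borel"
proof -
  have c: "continuous_on UNIV (chart_lift \<phi>)" using assms by (simp only: qfun_def)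
  have m: "(\<lambda>y. chart_lift \<phi> (space_part y)) \<in> borel_measurable borel"
    by (rule measurable_compose [OF measurable_space_part borel_measurable_continuous_onI [OF c]])
  have eq: "lift \<phi> = (\<lambda>y. if y \<in> hyp then chart_lift \<phi> (space_part y) else 0)"
  proof
    fix y show "lift \<phi> y = (if y \<in> hyp then chart_lift \<phi> (space_part y) else 0)"
      using lift_space_part [of y \<phi>] lift_outside [OF assms, of y] by (cases "y \<in> hyp") simp_all
  qed
  show ?thesis unfolding eq
  proof (rule measurable_If_set [OF m])
    show "(\<lambda>y. 0) \<in> borel_measurable borel" by simp
    show "hyp \<inter> space borel \<in> sets borel" using hyp_in_borel by simp
  qed
qed

lemma qfun_measurable: assumes "qfun \<phi>" shows "\<phi> \<in> borel_measurable quot_sigma"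
proof (rule borel_measurableI)
  fix S :: "complex set" assume S: "open S"
  have c: "continuous_on hyp (\<lambda>y. chart_lift \<phi> (space_part y))"
  proof (rule continuous_on_compose2 [OF _ continuous_on_space_part [OF continuous_on_id] subset_UNIV])
    show "continuous_on UNIV (chart_lift \<phi>)" using assms by (simp only: qfun_def)
  qed
  have "{x \<in> hyp. orb \<Gamma> x \<in> {x \<in> hyp_quot \<Gamma>. \<phi> x \<in> S}} = hyp \<inter> (\<lambda>y. chart_lift \<phi> (space_part y)) -` S"
    using lift_space_part orb_in_quot_iff by (auto simp: lift_def)
  then have "openin (quot_top \<Gamma>) {x \<in> hyp_quot \<Gamma>. \<phi> x \<in> S}"
    using continuous_openin_preimage_gen [OF c S] by (auto simp: openin_quot_top)
  moreover have "\<phi> -` S \<inter> space quot_sigma = {x \<in> hyp_quot \<Gamma>. \<phi> x \<in> S}"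
    by (auto simp: space_measure_of [OF open_subset_Pow])
  ultimately show "\<phi> -` S \<inter> space quot_sigma \<in> sets quot_sigma"
    by (auto simp: sets_measure_of [OF open_subset_Pow])
qed

lemma L2_mass_lift:
  assumes "qfun \<phi>" shows "L2_mass \<Gamma> \<phi> (hyp_quot \<Gamma>) = (\<integral>\<^sup>+y. ennreal ((cmod (lift \<phi> y))\<^sup>2) \<partial>dom_vol)"
proof -
  have "L2_mass \<Gamma> \<phi> (hyp_quot \<Gamma>) = (\<integral>\<^sup>+x. ennreal ((cmod (\<phi> x))\<^sup>2) \<partial>quot_vol \<Gamma>)"
    unfolding L2_mass_def by (intro nn_integral_cong) (simp add: space_quot_vol)
  also have "\<dots> = (\<integral>\<^sup>+y. ennreal ((cmod (\<phi> (orb \<Gamma> y)))\<^sup>2) \<partial>dom_vol)"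
  proof (rule nn_integral_quot_vol)
    have s: "(\<lambda>z :: complex. ennreal ((cmod z)\<^sup>2)) \<in> borel_measurable borel" by measurable
    show "(\<lambda>x. ennreal ((cmod (\<phi> x))\<^sup>2)) \<in> borel_measurable quot_sigma"
      by (rule measurable_compose [OF qfun_measurable [OF assms] s])
    show "(\<lambda>y. ennreal ((cmod (\<phi> (orb \<Gamma> y)))\<^sup>2)) \<in> borel_measurable borel"
      using measurable_compose [OF lift_measurable [OF assms] s] by (simp only: lift_def)
  qed
  finally show ?thesis by (simp add: lift_def)
qed

end

subsection \<open>The multiplier of the radial kernel\<close>

lemma measurable_pp [measurable]: "pp \<in> borel_measurable borel"
  unfolding pp_def [abs_def] by measurable

lemma measurable_cnj [measurable]:
  assumes "f \<in> borel_measurable M" shows "(\<lambda>x. cnj (f x)) \<in> borel_measurable M"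
  by (rule measurable_compose [OF assms borel_measurable_continuous_onI]) (intro continuous_on_cnj continuous_on_id)

lemma integrable_hyp_vol_iff:
  fixes f :: "'n::finite vec1 \<Rightarrow> 'b::{banach, second_countable_topology}"
  assumes f: "f \<in> borel_measurable borel"
  shows "integrable hyp_vol f \<longleftrightarrow> integrable lborel (\<lambda>v. hyp_density v *\<^sub>R f (hyp_chart v))"
proof -
  have m: "hyp_chart \<in> measurable (density lborel (\<lambda>v. ennreal (hyp_density v))) borel" by simp
  have fm: "(\<lambda>v. f (hyp_chart v)) \<in> borel_measurable lborel"
    using measurable_compose [OF measurable_hyp_chart f] by simp
  show ?thesis
    unfolding hyp_vol_def integrable_distr_eq [OF m f]
    by (rule integrable_density [OF fm]) (auto intro!: AE_I2 less_imp_le hyp_density_pos)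
qed

lemma horo_null_vec:
  shows "C2 (horo \<alpha> (null_vec :: 'n::finite vec1))"
    and "hyp_laplacian (horo \<alpha> null_vec) v = complex_of_real (\<alpha> * (real CARD('n) - 1 - \<alpha>)) * horo \<alpha> (null_vec :: 'n vec1) v"
    and "radial_moment (horo \<alpha> null_vec) (hyp_origin :: 'n vec1) 3 W = complex_of_real (spherical_factor TYPE('n) \<alpha> W)"
proof -
  have pos: "lor (null_vec :: 'n vec1) (hyp_chart v) > 0" for v by (intro lor_null_vec_pos) simp
  show "C2 (horo \<alpha> (null_vec :: 'n vec1))"
    and "hyp_laplacian (horo \<alpha> null_vec) v = complex_of_real (\<alpha> * (real CARD('n) - 1 - \<alpha>)) * horo \<alpha> (null_vec :: 'n vec1) v"
    by (rule horo_eigenfunction [OF pos mink_null_vec])+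
  show "radial_moment (horo \<alpha> null_vec) (hyp_origin :: 'n vec1) 3 W = complex_of_real (spherical_factor TYPE('n) \<alpha> W)"
    using horo_moment [OF lorc_one, where ?'n = 'n] by simp
qed

text \<open>On the smaller ball with parameter \<open>(1 + W) / 2\<close> the cut-off is at least
  \<open>(W - 1) / 2\<close>, hence at least \<open>W / 6\<close> for \<open>W \<ge> 3/2\<close>,
  and \<open>lor null_vec y\<close> is at most \<open>1 + W\<close>.\<close>

lemma spherical_factor_ge:
  assumes W: "W \<ge> 3/2" and \<alpha>: "\<alpha> \<ge> 0"
  shows "spherical_factor TYPE('n::finite) \<alpha> W
    \<ge> (W / 6) ^ 3 * (2 * W) powr (- \<alpha>) * (unit_ball_vol CARD('n) * (1/2) ^ CARD('n) * W ^ (CARD('n) - 1))"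
proof -
  let ?o = "hyp_origin :: 'n vec1"
  let ?f = "\<lambda>y. (pp (W - lor ?o y)) ^ 3 * lor null_vec y powr (- \<alpha>)"
  let ?B = "hball ?o ((1 + W) / 2)"
  let ?c = "(W / 6) ^ 3 * (2 * W) powr (- \<alpha>)"
  have fm: "?f \<in> borel_measurable borel" by measurable
  have "integrable lborel (\<lambda>v. (hyp_density v * (pp (W - lor ?o (hyp_chart v))) ^ 3) *\<^sub>R horo \<alpha> null_vec v)"
    by (rule integrable_moment [OF C2_continuous [OF horo_null_vec(1)]]) simp_all
  then have "integrable lborel (\<lambda>v. Re ((hyp_density v * (pp (W - lor ?o (hyp_chart v))) ^ 3) *\<^sub>R horo \<alpha> null_vec v))"
    by (rule integrable_Re)
  then have fi: "integrable hyp_vol ?f"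
    unfolding integrable_hyp_vol_iff [OF fm] by (simp add: horo_def mult.assoc)
  have fin: "emeasure hyp_vol ?B < \<infinity>"
    using emeasure_hball_le_small [of "(1 + W) / 2" ?o] W by (auto simp: le_less_trans)
  have Bm: "?B \<in> sets hyp_vol" by simp
  have Bi: "integrable hyp_vol (\<lambda>y. ?c * indicator ?B y)"
    by (intro integrable_mult_right integrable_real_indicator Bm fin)
  have "?c * (unit_ball_vol CARD('n) * (1/2) ^ CARD('n) * W ^ (CARD('n) - 1)) \<le> ?c * measure hyp_vol ?B"
  proof (rule mult_left_mono)
    have "ennreal (unit_ball_vol CARD('n) * (1/2) ^ CARD('n) * W ^ (CARD('n) - 1)) \<le> ennreal (measure hyp_vol ?B)"
      using emeasure_hball_ge [OF W, of ?o] fin by (simp add: emeasure_eq_ennreal_measure)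
    then show "unit_ball_vol CARD('n) * (1/2) ^ CARD('n) * W ^ (CARD('n) - 1) \<le> measure hyp_vol ?B"
      by (simp only: ennreal_le_iff measure_nonneg)
  qed (use W in simp)
  also have "\<dots> = (\<integral>y. ?c * indicator ?B y \<partial>hyp_vol)" by simp
  also have "\<dots> \<le> (\<integral>y. ?f y \<partial>hyp_vol)"
  proof (rule integral_mono [OF Bi fi])
    fix y
    show "?c * indicator ?B y \<le> ?f y"
    proof (cases "y \<in> ?B")
      case True
      then have y: "y \<in> hyp" "lor ?o y \<le> (1 + W) / 2" by (auto simp: hball_def)
      have "W / 6 \<le> pp (W - lor ?o y)" using y(2) W by (simp add: pp_def field_simps)
      then have 1: "(W / 6) ^ 3 \<le> (pp (W - lor ?o y)) ^ 3" using W by (intro power_mono) auto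
      have "lor null_vec y \<le> 2 * W" using lor_null_vec_pos(2) [OF y(1)] y(2) W by simp
      then have 2: "(2 * W) powr (- \<alpha>) \<le> lor null_vec y powr (- \<alpha>)"
        using lor_null_vec_pos(1) [OF y(1)] \<alpha> by (intro powr_mono2') auto
      have "?c \<le> ?f y" using 1 2 W by (intro mult_mono) auto
      then show ?thesis using True by simp
    qed simp
  qed
  finally show ?thesis by (simp only: spherical_factor_def)
qed

text \<open>Here \<open>1/216\<close> is the cube of \<open>1/6\<close>, and the last factor bounds
  \<open>2 powr (- \<alpha>)\<close> from below for all exponents \<open>\<alpha> \<le> n\<close> at
  once.\<close>

definition sf_const :: "nat \<Rightarrow> real" where
  "sf_const n = unit_ball_vol n * (1/2) ^ n * (1/216) * 2 powr (- real n)"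

lemma sf_const_pos: "sf_const n > 0"
  by (simp add: sf_const_def)

text \<open>The exponents \<open>u\<close> and \<open>n - 1 - u\<close> belong to the same
  eigenvalue. With \<open>n - 1 - u\<close> the cube, the horospherical function and the ball volume
  multiply to \<open>W powr (3 - (n - 1 - u) + (n - 1))\<close>, which is the wanted power.\<close>

lemma spherical_factor_ge_powr:
  assumes W: "W \<ge> 3/2" and u: "0 \<le> u" "u \<le> real CARD('n::finite) - 1"
  shows "spherical_factor TYPE('n) (real CARD('n) - 1 - u) W \<ge> sf_const CARD('n) * W powr (u + 3)"
proof -
  let ?n = "real CARD('n)"
  let ?\<alpha> = "?n - 1 - u"
  have W0: "W > 0" using W by simp
  have "W ^ (CARD('n) - 1) = W powr (?n - 1)"
    using W0 by (subst powr_realpow [symmetric]) (auto simp: of_nat_diff Suc_leI)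
  moreover have "W ^ 3 = W powr 3" using W0 by (simp add: powr_numeral)
  ultimately have W3: "W ^ 3 * W powr (- ?\<alpha>) * W ^ (CARD('n) - 1) = W powr (u + 3)"
    by (simp add: powr_add [symmetric] add.commute)
  have "(2::real) powr (- ?n) \<le> 2 powr (- ?\<alpha>)" using u by (intro powr_mono) auto
  then have "sf_const CARD('n) * W powr (u + 3)
      \<le> unit_ball_vol CARD('n) * (1/2) ^ CARD('n) * (1/216) * 2 powr (- ?\<alpha>) * W powr (u + 3)"
    unfolding sf_const_def by (intro mult_right_mono mult_left_mono) auto
  also have "\<dots> = (W / 6) ^ 3 * (2 * W) powr (- ?\<alpha>) * (unit_ball_vol CARD('n) * (1/2) ^ CARD('n) * W ^ (CARD('n) - 1))"
    unfolding W3 [symmetric] using W0 by (simp add: powr_mult power_divide mult_ac)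
  also have "\<dots> \<le> spherical_factor TYPE('n) ?\<alpha> W"
    using u by (intro spherical_factor_ge W) simp
  finally show ?thesis .
qed

text \<open>If the third moments agree for all \<open>W\<close>, so do their derivatives, the second
  and first moments. The differential equation at \<open>W = 2\<close> then determines the
  eigenvalue, since the third moment is nonzero there.\<close>

lemma spherical_factor_eigenvalue:
  assumes eq: "\<And>W. W > 1 \<Longrightarrow> spherical_factor TYPE('n::finite) \<alpha> W = spherical_factor TYPE('n) \<beta> W"
    and \<alpha>: "\<alpha> \<ge> 0"
  shows "\<alpha> * (real CARD('n) - 1 - \<alpha>) = \<beta> * (real CARD('n) - 1 - \<beta>)"
proof -
  let ?o = "hyp_origin :: 'n vec1"
  define Q where "Q \<gamma> k = radial_moment (horo \<gamma> null_vec) ?o k" for \<gamma> k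
  have der: "(Q \<gamma> (Suc k) has_vector_derivative real (Suc k) *\<^sub>R Q \<gamma> k W) (at W)" if "k = 1 \<or> k = 2" for \<gamma> k W
    unfolding Q_def by (rule moment_has_derivative [OF C2_continuous [OF horo_null_vec(1)] hyp_origin_in_hyp that])
  have step: "Q \<alpha> k W = Q \<beta> k W" if k: "k = 1 \<or> k = 2" and W: "W > 1" and e: "\<And>W. W > 1 \<Longrightarrow> Q \<alpha> (Suc k) W = Q \<beta> (Suc k) W" for k W
  proof -
    have "(Q \<beta> (Suc k) has_vector_derivative real (Suc k) *\<^sub>R Q \<alpha> k W) (at W)"
      by (rule has_vector_derivative_transform_within_open [OF der [OF k], of "{1<..}"]) (use W e in auto)
    from vector_derivative_unique_at [OF this der [OF k]] show ?thesis by simp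
  qed
  have 3: "Q \<alpha> 3 W = Q \<beta> 3 W" if "W > 1" for W
    unfolding Q_def horo_null_vec(3) using eq [OF that] by simp
  have 2: "Q \<alpha> 2 W = Q \<beta> 2 W" if "W > 1" for W
    by (rule step [OF _ that]) (use 3 in \<open>simp_all add: numeral_3_eq_3 numeral_2_eq_2\<close>)
  have 1: "Q \<alpha> 1 W = Q \<beta> 1 W" if "W > 1" for W
    by (rule step [OF _ that]) (use 2 in \<open>simp_all add: numeral_2_eq_2\<close>)
  have ode: "(6 * (W\<^sup>2 - 1)) *\<^sub>R Q \<gamma> 1 W = ((12 + 3 * real CARD('n)) * W) *\<^sub>R Q \<gamma> 2 W
      - (6 + 3 * real CARD('n) + \<gamma> * (real CARD('n) - 1 - \<gamma>)) *\<^sub>R Q \<gamma> 3 W" for \<gamma> W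
    unfolding Q_def
    by (rule moment_ode [OF C2_continuous [OF horo_null_vec(1)] hyp_origin_in_hyp horo_null_vec(1) horo_null_vec(2)])
  define a b where "a = 6 + 3 * real CARD('n) + \<alpha> * (real CARD('n) - 1 - \<alpha>)"
    and "b = 6 + 3 * real CARD('n) + \<beta> * (real CARD('n) - 1 - \<beta>)"
  have e1: "Q \<alpha> 1 2 = Q \<beta> 1 2" by (rule 1) simp
  have e2: "Q \<alpha> 2 2 = Q \<beta> 2 2" by (rule 2) simp
  have e3: "Q \<alpha> 3 2 = Q \<beta> 3 2" by (rule 3) simp
  have o1: "(6 * (2\<^sup>2 - 1)) *\<^sub>R Q \<beta> 1 2 = ((12 + 3 * real CARD('n)) * 2) *\<^sub>R Q \<beta> 2 2 - a *\<^sub>R Q \<alpha> 3 2"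
    using ode [where W = 2 and \<gamma> = \<alpha>] by (simp only: e1 e2 a_def)
  have o2: "(6 * (2\<^sup>2 - 1)) *\<^sub>R Q \<beta> 1 2 = ((12 + 3 * real CARD('n)) * 2) *\<^sub>R Q \<beta> 2 2 - b *\<^sub>R Q \<alpha> 3 2"
    using ode [where W = 2 and \<gamma> = \<beta>] by (simp only: e3 b_def)
  have "a *\<^sub>R Q \<alpha> 3 2 = b *\<^sub>R Q \<alpha> 3 2" using trans [OF o1 [symmetric] o2] by simp
  moreover have "Q \<alpha> 3 2 \<noteq> 0"
  proof -
    have "0 < ((2::real) / 6) ^ 3 * (2 * 2) powr (- \<alpha>) * (unit_ball_vol CARD('n) * (1/2) ^ CARD('n) * 2 ^ (CARD('n) - 1))"
      by simp
    also have "\<dots> \<le> spherical_factor TYPE('n) \<alpha> 2"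
      by (rule spherical_factor_ge [OF _ \<alpha>]) simp
    finally show ?thesis unfolding Q_def horo_null_vec(3) by simp
  qed
  ultimately have "a = b" by (simp only: scaleR_cancel_right) simp
  then show ?thesis by (simp add: a_def b_def)
qed

subsection \<open>The automorphic kernel\<close>

text \<open>The value 0 off the hyperboloid gives a kernel on the whole ambient space that is still
  Borel measurable and invariant under the group.\<close>

definition psi :: "real \<Rightarrow> 'n::finite vec1 \<Rightarrow> 'n vec1 \<Rightarrow> real" where
  "psi W x y = (if x \<in> hyp \<and> y \<in> hyp then (pp (W - lor x y)) ^ 3 else 0)"

lemma psi_nonneg [simp]: "psi W x y \<ge> 0" by (simp add: psi_def)

lemma psi_sym: "psi W x y = psi W y x" by (auto simp: psi_def lor_sym)

lemma psi_le: assumes "W > 0" shows "psi W x y \<le> W ^ 3 * indicator (hball x W) y"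
proof (cases "x \<in> hyp \<and> y \<in> hyp \<and> lor x y \<le> W")
  case True
  then have "pp (W - lor x y) \<le> W" using lor_pos [of x y] assms by (simp add: pp_def)
  then have "(pp (W - lor x y)) ^ 3 \<le> W ^ 3" by (intro power_mono) simp_all
  then show ?thesis using True by (simp add: psi_def hball_def)
next
  case False
  then have "psi W x y = 0" by (auto simp: psi_def pp_neg)
  then show ?thesis using assms by simp
qed

lemma psi_le_ennreal:
  assumes "W > 0" shows "ennreal (psi W x y) \<le> ennreal (W ^ 3) * indicator (hball x W) y"
proof (cases "y \<in> hball x W")
  case True
  then show ?thesis using psi_le [OF assms, of x y] by (simp add: ennreal_leI)
next
  case False
  then have "psi W x y = 0" using psi_le [OF assms, of x y] psi_nonneg [of W x y] by simp
  then show ?thesis by simp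
qed

lemma psi_measurable2: "(\<lambda>p. psi W (fst p) (snd p)) \<in> borel_measurable (borel \<Otimes>\<^sub>M borel)"
  unfolding psi_def by measurable

lemma psi_measurable [measurable]: "psi W x \<in> borel_measurable borel"
  unfolding psi_def [abs_def] by measurable

context discrete_group
begin

lemma psi_act: "\<gamma> \<in> \<Gamma> \<Longrightarrow> psi W (\<gamma> *v x) (\<gamma> *v y) = psi W x y"
  by (simp add: psi_def act_hyp_iff lor_act)

text \<open>The automorphic kernel on the quotient. Taking values in \<open>ennreal\<close>
  separates the unfolding identities from finiteness; \<open>PsiR\<close> is its real
  version.\<close>

definition Psi :: "real \<Rightarrow> 'n vec1 \<Rightarrow> 'n vec1 \<Rightarrow> ennreal" where
  "Psi W x y = gsum (\<lambda>\<gamma>. ennreal (psi W x (\<gamma> *v y)))"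

lemma Psi_sym: "Psi W x y = Psi W y x"
proof -
  have "Psi W y x = gsum (\<lambda>\<gamma>. ennreal (psi W y (ginv \<gamma> *v x)))"
    unfolding Psi_def by (rule gsum_ginv [symmetric])
  also have "\<dots> = Psi W x y"
    unfolding Psi_def
  proof (rule nn_integral_cong)
    fix \<gamma> assume "\<gamma> \<in> space (count_space \<Gamma>)"
    then have g: "\<gamma> \<in> \<Gamma>" by simp
    have "psi W y (ginv \<gamma> *v x) = psi W (\<gamma> *v y) (\<gamma> *v (ginv \<gamma> *v x))" by (rule psi_act [OF g, symmetric])
    then show "ennreal (psi W y (ginv \<gamma> *v x)) = ennreal (psi W x (\<gamma> *v y))"
      by (simp only: ginv_act [OF g] psi_sym)
  qed
  finally show ?thesis by simp
qed

lemma Psi_act: "\<gamma> \<in> \<Gamma> \<Longrightarrow> Psi W x (\<gamma> *v y) = Psi W x y"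
  unfolding Psi_def using gsum_mult_right [of \<gamma> "\<lambda>\<gamma>. ennreal (psi W x (\<gamma> *v y))"]
  by (simp add: matrix_vector_mul_assoc)

lemma Psi_measurable2: "(\<lambda>p :: 'n vec1 \<times> 'n vec1. Psi W (fst p) (snd p)) \<in> borel_measurable (borel \<Otimes>\<^sub>M borel)"
  unfolding Psi_def
proof (rule measurable_gsum)
  fix \<gamma> :: "'n mat1"
  have m: "(\<lambda>p :: 'n vec1 \<times> 'n vec1. (fst p, \<gamma> *v snd p)) \<in> measurable (borel \<Otimes>\<^sub>M borel) (borel \<Otimes>\<^sub>M borel)"
    by measurable
  show "(\<lambda>p :: 'n vec1 \<times> 'n vec1. ennreal (psi W (fst p) (\<gamma> *v snd p))) \<in> borel_measurable (borel \<Otimes>\<^sub>M borel)"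
    using measurable_compose [OF m measurable_compose [OF psi_measurable2 [of W] measurable_ennreal]] by simp
qed

lemma Psi_measurable [measurable]: "Psi W x \<in> borel_measurable borel"
proof -
  have m: "(\<lambda>y. (x, y)) \<in> measurable borel (borel \<Otimes>\<^sub>M borel)" by measurable
  show ?thesis using measurable_compose [OF m Psi_measurable2 [of W]] by simp
qed

lemma Psi_finite: assumes "W > 0" shows "Psi W x y < \<infinity>"
proof (cases "x \<in> hyp \<and> y \<in> hyp")
  case True
  let ?S = "{\<gamma> \<in> \<Gamma>. lor x (\<gamma> *v y) \<le> W}"
  have fin: "finite ?S" using True by (intro finite_orbit) auto
  have "Psi W x y \<le> gsum (\<lambda>\<gamma>. ennreal (W ^ 3) * indicator ?S \<gamma>)"
    unfolding Psi_def
  proof (rule nn_integral_mono)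
    fix \<gamma> assume "\<gamma> \<in> space (count_space \<Gamma>)"
    then have g: "\<gamma> \<in> \<Gamma>" by simp
    have "indicator (hball x W) (\<gamma> *v y) \<le> (indicator ?S \<gamma> :: ennreal)"
      using g by (auto simp: hball_def indicator_def)
    then show "ennreal (psi W x (\<gamma> *v y)) \<le> ennreal (W ^ 3) * indicator ?S \<gamma>"
      by (intro order_trans [OF psi_le_ennreal [OF assms] mult_left_mono]) simp_all
  qed
  also have "\<dots> = ennreal (W ^ 3) * of_nat (card ?S)"
    using fin by (subst nn_integral_cmult_indicator) (auto simp: emeasure_count_space)
  also have "\<dots> < \<infinity>" by (simp add: ennreal_mult_less_top of_nat_less_top)
  finally show ?thesis .
next
  case False
  have "Psi W x y = gsum (\<lambda>\<gamma>. 0)"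
    unfolding Psi_def using False by (intro nn_integral_cong) (auto simp: psi_def act_hyp_iff)
  then show ?thesis by simp
qed

definition PsiR :: "real \<Rightarrow> 'n vec1 \<Rightarrow> 'n vec1 \<Rightarrow> real" where
  "PsiR W x y = enn2real (Psi W x y)"

lemma ennreal_PsiR: "W > 0 \<Longrightarrow> ennreal (PsiR W x y) = Psi W x y"
  using Psi_finite [of W x y] by (simp add: PsiR_def)

lemma PsiR_nonneg [simp]: "PsiR W x y \<ge> 0" by (simp add: PsiR_def)

lemma PsiR_measurable [measurable]: "PsiR W x \<in> borel_measurable borel"
  unfolding PsiR_def [abs_def] by measurable

lemma PsiR_measurable2: "(\<lambda>p :: 'n vec1 \<times> 'n vec1. PsiR W (fst p) (snd p)) \<in> borel_measurable (borel \<Otimes>\<^sub>M borel)"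
  unfolding PsiR_def by (rule measurable_compose [OF Psi_measurable2 borel_measurable_enn2real]) simp

text \<open>The nonnegative unfolding formula is applied to \<open>f\<close> and to
  \<open>- f\<close>. As \<open>ennreal\<close> truncates negative numbers to 0, these are the
  formulas for the positive and negative parts.\<close>

lemma unfold_real:
  fixes f :: "'n vec1 \<Rightarrow> real"
  assumes fm: "f \<in> borel_measurable borel" and finv: "\<And>\<gamma> y. \<gamma> \<in> \<Gamma> \<Longrightarrow> f (\<gamma> *v y) = f y"
    and fi: "integrable hyp_vol (\<lambda>y. psi W x y * f y)" and W: "W > 0"
  shows "integrable dom_vol (\<lambda>y. PsiR W x y * f y)"
    and "(\<integral>y. PsiR W x y * f y \<partial>dom_vol) = (\<integral>y. psi W x y * f y \<partial>hyp_vol)"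
proof -
  have eq: "(\<integral>\<^sup>+y. ennreal (PsiR W x y * g y) \<partial>dom_vol) = (\<integral>\<^sup>+y. ennreal (psi W x y * g y) \<partial>hyp_vol)"
    if gm: "g \<in> borel_measurable borel" and ginv: "\<And>\<gamma> y. \<gamma> \<in> \<Gamma> \<Longrightarrow> g (\<gamma> *v y) = g y" for g :: "'n vec1 \<Rightarrow> real"
  proof -
    have "(\<integral>\<^sup>+y. ennreal (PsiR W x y * g y) \<partial>dom_vol) = (\<integral>\<^sup>+y. ennreal (g y) * gsum (\<lambda>\<gamma>. ennreal (psi W x (\<gamma> *v y))) \<partial>dom_vol)"
      unfolding Psi_def [symmetric] ennreal_PsiR [OF W, symmetric]
      by (intro nn_integral_cong) (simp add: ennreal_mult'' mult.commute [of "PsiR W x _"])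
    also have "\<dots> = (\<integral>\<^sup>+y. ennreal (g y) * ennreal (psi W x y) \<partial>hyp_vol)"
      by (rule unfold_integral_invariant) (use gm ginv in auto)
    also have "\<dots> = (\<integral>\<^sup>+y. ennreal (psi W x y * g y) \<partial>hyp_vol)"
      by (intro nn_integral_cong) (simp add: ennreal_mult'' mult.commute [of "psi W x _"])
    finally show ?thesis .
  qed
  have p: "(\<integral>\<^sup>+y. ennreal (PsiR W x y * f y) \<partial>dom_vol) = (\<integral>\<^sup>+y. ennreal (psi W x y * f y) \<partial>hyp_vol)"
    by (rule eq [OF fm finv])
  have "(\<lambda>y. - f y) \<in> borel_measurable borel" using fm by simp
  from eq [OF this] have m: "(\<integral>\<^sup>+y. ennreal (- (PsiR W x y * f y)) \<partial>dom_vol) = (\<integral>\<^sup>+y. ennreal (- (psi W x y * f y)) \<partial>hyp_vol)"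
    using finv by simp
  have meas: "(\<lambda>y. PsiR W x y * f y) \<in> borel_measurable dom_vol"
    unfolding measurable_cong_sets [OF sets_dom_vol refl] by (rule borel_measurable_times [OF PsiR_measurable fm])
  show i: "integrable dom_vol (\<lambda>y. PsiR W x y * f y)"
    using fi meas unfolding real_integrable_def p m by simp
  show "(\<integral>y. PsiR W x y * f y \<partial>dom_vol) = (\<integral>y. psi W x y * f y \<partial>hyp_vol)"
    unfolding real_lebesgue_integral_def [OF i] real_lebesgue_integral_def [OF fi] p m ..
qed

lemma borel_measurable_dom_vol:
  "f \<in> borel_measurable borel \<Longrightarrow> f \<in> borel_measurable dom_vol"
  by (simp only: measurable_cong_sets [OF sets_dom_vol refl])

lemma eigenspaceD:
  assumes "\<phi> \<in> eigenspace \<Gamma> \<mu>"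
  shows "qfun \<phi>" "C2 (chart_lift \<phi>)" "hyp_laplacian (chart_lift \<phi>) v = complex_of_real \<mu> * chart_lift \<phi> v"
    "L2_mass \<Gamma> \<phi> (hyp_quot \<Gamma>) < \<infinity>"
proof -
  have s: "smooth (chart_lift \<phi>)" using assms by (simp add: eigenspace_def chart_lift_def [abs_def])
  show C: "C2 (chart_lift \<phi>)" by (rule smooth_imp_C2 [OF s])
  show "qfun \<phi>" using assms C2_continuous [OF C] by (simp add: qfun_def eigenspace_def)
  show "hyp_laplacian (chart_lift \<phi>) v = complex_of_real \<mu> * chart_lift \<phi> v"
    using assms by (simp add: eigenspace_def chart_lift_def [abs_def])
  show "L2_mass \<Gamma> \<phi> (hyp_quot \<Gamma>) < \<infinity>" using assms by (simp add: eigenspace_def)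
qed

lemma lift_square_finite:
  "\<phi> \<in> eigenspace \<Gamma> \<mu> \<Longrightarrow> (\<integral>\<^sup>+y. ennreal ((cmod (lift \<phi> y))\<^sup>2) \<partial>dom_vol) < \<infinity>"
  using L2_mass_lift eigenspaceD by metis

text \<open>Unfolding the real and imaginary parts turns the integral over the domain into a third
  radial moment, and the mean value property evaluates it. It is used with the exponent
  \<open>n - 1 - u\<close>, whose eigenvalue is that of \<open>u\<close>.\<close>

lemma reproducing:
  assumes \<phi>: "\<phi> \<in> eigenspace \<Gamma> (spectral_value CARD('n) u)" and W: "W > 1"
  shows "integrable dom_vol (\<lambda>y. PsiR W x y *\<^sub>R lift \<phi> y)"
    and "(\<integral>y. PsiR W x y *\<^sub>R lift \<phi> y \<partial>dom_vol) = complex_of_real (spherical_factor TYPE('n) (real CARD('n) - 1 - u) W) * lift \<phi> x"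
proof -
  have lm: "lift \<phi> \<in> borel_measurable borel" by (rule lift_measurable [OF eigenspaceD(1) [OF \<phi>]])
  have W0: "W > 0" using W by simp
  have hyp_side: "integrable hyp_vol (\<lambda>y. psi W x y *\<^sub>R lift \<phi> y) \<and>
      (\<integral>y. psi W x y *\<^sub>R lift \<phi> y \<partial>hyp_vol) = complex_of_real (spherical_factor TYPE('n) (real CARD('n) - 1 - u) W) * lift \<phi> x"
  proof (cases "x \<in> hyp")
    case True
    have m: "(\<lambda>y. psi W x y *\<^sub>R lift \<phi> y) \<in> borel_measurable borel" using lm by measurable
    have e: "hyp_density v *\<^sub>R (psi W x (hyp_chart v) *\<^sub>R lift \<phi> (hyp_chart v))
        = (hyp_density v * (pp (W - lor x (hyp_chart v))) ^ 3) *\<^sub>R chart_lift \<phi> v" for v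
      using True by (simp add: psi_def lift_chart)
    have "integrable hyp_vol (\<lambda>y. psi W x y *\<^sub>R lift \<phi> y)"
      unfolding integrable_hyp_vol_iff [OF m] e
      by (rule integrable_moment [OF C2_continuous [OF eigenspaceD(2) [OF \<phi>]] True]) simp
    moreover have "(\<integral>y. psi W x y *\<^sub>R lift \<phi> y \<partial>hyp_vol) = radial_moment (chart_lift \<phi>) x 3 W"
      unfolding integral_hyp_vol [OF m] e radial_moment_def ..
    moreover have "radial_moment (chart_lift \<phi>) x 3 W = complex_of_real (spherical_factor TYPE('n) (real CARD('n) - 1 - u) W) * chart_lift \<phi> (space_part x)"
    proof (rule mean_value [OF eigenspaceD(2) [OF \<phi>] _ True W])
      fix v
      have "spectral_value CARD('n) u = (real CARD('n) - 1 - u) * (real CARD('n) - 1 - (real CARD('n) - 1 - u))"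
        by (simp add: spectral_value_def)
      then show "hyp_laplacian (chart_lift \<phi>) v = complex_of_real ((real CARD('n) - 1 - u)
          * (real CARD('n) - 1 - (real CARD('n) - 1 - u))) * chart_lift \<phi> v"
        using eigenspaceD(3) [OF \<phi>] by simp
    qed
    ultimately show ?thesis by (simp add: lift_space_part [OF True])
  next
    case False
    then have "lift \<phi> x = 0" by (rule lift_outside [OF eigenspaceD(1) [OF \<phi>]])
    moreover have "psi W x y = 0" for y using False by (simp add: psi_def)
    ultimately show ?thesis by simp
  qed
  have Re: "integrable hyp_vol (\<lambda>y. psi W x y * Re (lift \<phi> y))"
    using integrable_Re [OF conjunct1 [OF hyp_side]] by simp
  have Im: "integrable hyp_vol (\<lambda>y. psi W x y * Im (lift \<phi> y))"
    using integrable_Im [OF conjunct1 [OF hyp_side]] by simp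
  have mRe: "(\<lambda>y. Re (lift \<phi> y)) \<in> borel_measurable borel" and mIm: "(\<lambda>y. Im (lift \<phi> y)) \<in> borel_measurable borel"
    using lm by measurable
  have uRe: "integrable dom_vol (\<lambda>y. PsiR W x y * Re (lift \<phi> y))"
    "(\<integral>y. PsiR W x y * Re (lift \<phi> y) \<partial>dom_vol) = (\<integral>y. psi W x y * Re (lift \<phi> y) \<partial>hyp_vol)"
    by (rule unfold_real [OF mRe _ Re W0], simp add: lift_act)+
  have uIm: "integrable dom_vol (\<lambda>y. PsiR W x y * Im (lift \<phi> y))"
    "(\<integral>y. PsiR W x y * Im (lift \<phi> y) \<partial>dom_vol) = (\<integral>y. psi W x y * Im (lift \<phi> y) \<partial>hyp_vol)"
    by (rule unfold_real [OF mIm _ Im W0], simp add: lift_act)+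
  show i: "integrable dom_vol (\<lambda>y. PsiR W x y *\<^sub>R lift \<phi> y)"
  proof -
    have "(\<lambda>y. PsiR W x y *\<^sub>R lift \<phi> y) = (\<lambda>y. complex_of_real (PsiR W x y * Re (lift \<phi> y)) + \<i> * complex_of_real (PsiR W x y * Im (lift \<phi> y)))"
      by (simp add: fun_eq_iff complex_eq_iff)
    moreover have "integrable dom_vol (\<lambda>y. complex_of_real (PsiR W x y * Re (lift \<phi> y)) + \<i> * complex_of_real (PsiR W x y * Im (lift \<phi> y)))"
      by (intro Bochner_Integration.integrable_add integrable_mult_right integrable_of_real uRe(1) uIm(1))
    ultimately show ?thesis by (simp only:)
  qed
  have "(\<integral>y. PsiR W x y *\<^sub>R lift \<phi> y \<partial>dom_vol) = (\<integral>y. psi W x y *\<^sub>R lift \<phi> y \<partial>hyp_vol)"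
    using uRe(2) uIm(2) integral_Re [OF i] integral_Im [OF i]
      integral_Re [OF conjunct1 [OF hyp_side]] integral_Im [OF conjunct1 [OF hyp_side]]
    by (simp add: complex_eq_iff)
  then show "(\<integral>y. PsiR W x y *\<^sub>R lift \<phi> y \<partial>dom_vol) = complex_of_real (spherical_factor TYPE('n) (real CARD('n) - 1 - u) W) * lift \<phi> x"
    using hyp_side by simp
qed

section \<open>Orthogonality of eigenspaces for different eigenvalues\<close>

lemma sigma_finite_dom_vol: "sigma_finite_measure dom_vol"
proof
  \<comment> \<open>The complement of the hyperboloid is a null set for this measure; adding it to
    each ball lets the sets exhaust the ambient space.\<close>
  let ?A = "range (\<lambda>k::nat. hball (hyp_origin :: 'n vec1) (real k + 1) \<union> - hyp)"
  have e: "emeasure dom_vol (hball (hyp_origin :: 'n vec1) (real k + 1) \<union> - hyp) \<noteq> \<infinity>" for k :: nat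
  proof -
    have "emeasure dom_vol (hball (hyp_origin :: 'n vec1) (real k + 1) \<union> - hyp)
        = (\<integral>\<^sup>+y. indicator dom y * indicator (hball (hyp_origin :: 'n vec1) (real k + 1) \<union> - hyp) y \<partial>hyp_vol)"
      unfolding dom_vol_def by (rule emeasure_density) measurable
    also have "\<dots> \<le> (\<integral>\<^sup>+y. indicator (hball (hyp_origin :: 'n vec1) (real k + 1)) y \<partial>hyp_vol)"
      using dom_subset by (intro nn_integral_mono) (auto split: split_indicator)
    also have "\<dots> = emeasure hyp_vol (hball (hyp_origin :: 'n vec1) (real k + 1))" by simp
    also have "\<dots> < \<infinity>"
      using emeasure_hball_le_small [of "real k + 1" "hyp_origin :: 'n vec1"] by (auto simp: le_less_trans)
    finally show ?thesis by simp
  qed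
  show "\<exists>A. countable A \<and> A \<subseteq> sets dom_vol \<and> \<Union> A = space dom_vol \<and> (\<forall>a\<in>A. emeasure dom_vol a \<noteq> \<infinity>)"
  proof (intro exI [of _ ?A] conjI)
    have "\<exists>k::nat. lor (hyp_origin :: 'n vec1) y \<le> real k + 1" for y :: "'n vec1"
      using real_arch_simple [of "lor (hyp_origin :: 'n vec1) y"] by (metis add.commute le_add_same_cancel2 order_trans zero_le_one)
    then show "\<Union> ?A = space dom_vol" by (auto simp: hball_def)
    show "?A \<subseteq> sets dom_vol" by auto
    show "\<forall>a\<in>?A. emeasure dom_vol a \<noteq> \<infinity>" using e by blast
  qed simp
qed

text \<open>Unfolding gives the integral of \<open>psi\<close> over one ball, whose volume bound is
  the same for every centre. A bound uniform in \<open>x\<close> is what makes the kernel operator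
  bounded.\<close>

lemma Psi_integral_bound:
  assumes W: "W > 1" obtains c :: real where "c \<ge> 0" "\<And>x. (\<integral>\<^sup>+y. Psi W x y \<partial>dom_vol) \<le> ennreal c"
proof
  let ?c = "W ^ 3 * (unit_ball_vol CARD('n) * sqrt (W\<^sup>2 - 1) ^ CARD('n))"
  show "0 \<le> ?c" using W by simp
  fix x :: "'n vec1"
  have W0: "W > 0" using W by simp
  have "(\<integral>\<^sup>+y. Psi W x y \<partial>dom_vol) = (\<integral>\<^sup>+y. ennreal (psi W x y) \<partial>hyp_vol)"
    unfolding Psi_def by (rule unfold_integral) measurable
  also have "\<dots> \<le> ennreal ?c"
  proof (cases "x \<in> hyp")
    case True
    have "(\<integral>\<^sup>+y. ennreal (psi W x y) \<partial>hyp_vol) \<le> (\<integral>\<^sup>+y. ennreal (W ^ 3) * indicator (hball x W) y \<partial>hyp_vol)"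
    proof (rule nn_integral_mono)
      fix y show "ennreal (psi W x y) \<le> ennreal (W ^ 3) * indicator (hball x W) y"
        by (rule psi_le_ennreal [OF W0])
    qed
    also have "\<dots> = ennreal (W ^ 3) * emeasure hyp_vol (hball x W)"
      by (rule nn_integral_cmult_indicator) simp
    also have "\<dots> \<le> ennreal (W ^ 3) * ennreal (unit_ball_vol CARD('n) * sqrt (W\<^sup>2 - 1) ^ CARD('n))"
      using W True by (intro mult_left_mono emeasure_hball_le_small) auto
    also have "\<dots> = ennreal ?c" using W by (intro ennreal_mult [symmetric]) auto
    finally show ?thesis .
  next
    case False
    then have "psi W x y = 0" for y by (simp add: psi_def)
    then show ?thesis by simp
  qed
  finally show "(\<integral>\<^sup>+y. Psi W x y \<partial>dom_vol) \<le> ennreal ?c" .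
qed

definition qinner :: "('n vec1 set \<Rightarrow> complex) \<Rightarrow> ('n vec1 set \<Rightarrow> complex) \<Rightarrow> complex" where
  "qinner f g = (\<integral>y. lift f y * cnj (lift g y) \<partial>dom_vol)"

lemma lift_dom_measurable: "qfun f \<Longrightarrow> lift f \<in> borel_measurable dom_vol"
  by (rule borel_measurable_dom_vol [OF lift_measurable])

lemma integrable_product:
  assumes "f \<in> eigenspace \<Gamma> \<mu>" "g \<in> eigenspace \<Gamma> \<nu>"
  shows "integrable dom_vol (\<lambda>y. lift f y * cnj (lift g y))"
proof (rule integrableI_bounded)
  have m: "lift f \<in> borel_measurable dom_vol" "lift g \<in> borel_measurable dom_vol"
    using assms eigenspaceD(1) lift_dom_measurable by blast+
  then show "(\<lambda>y. lift f y * cnj (lift g y)) \<in> borel_measurable dom_vol" by measurable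
  have "(\<integral>\<^sup>+y. ennreal (norm (lift f y * cnj (lift g y))) \<partial>dom_vol)
      \<le> (\<integral>\<^sup>+y. ennreal ((cmod (lift f y))\<^sup>2) + ennreal ((cmod (lift g y))\<^sup>2) \<partial>dom_vol)"
  proof (rule nn_integral_mono)
    fix y
    have "0 \<le> cmod (lift f y) * cmod (lift g y)" by simp
    then have "norm (lift f y * cnj (lift g y)) \<le> (cmod (lift f y))\<^sup>2 + (cmod (lift g y))\<^sup>2"
      using sum_squares_bound [of "cmod (lift f y)" "cmod (lift g y)"] unfolding norm_mult complex_mod_cnj by linarith
    then show "ennreal (norm (lift f y * cnj (lift g y))) \<le> ennreal ((cmod (lift f y))\<^sup>2) + ennreal ((cmod (lift g y))\<^sup>2)"
      by (simp only: ennreal_plus [symmetric] zero_le_power2 ennreal_leI)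
  qed
  also have "\<dots> = (\<integral>\<^sup>+y. ennreal ((cmod (lift f y))\<^sup>2) \<partial>dom_vol) + (\<integral>\<^sup>+y. ennreal ((cmod (lift g y))\<^sup>2) \<partial>dom_vol)"
    using m by (intro nn_integral_add measurable_compose [OF _ measurable_ennreal] borel_measurable_power
      measurable_compose [OF _ borel_measurable_norm])
  also have "\<dots> < \<infinity>" using lift_square_finite [OF assms(1)] lift_square_finite [OF assms(2)] by simp
  finally show "(\<integral>\<^sup>+y. ennreal (norm (lift f y * cnj (lift g y))) \<partial>dom_vol) < \<infinity>" .
qed

text \<open>The symmetric kernel stands in for self-adjointness of the Laplacian: integrating it
  against both functions in the two possible orders gives \<open>qinner f g\<close> times the
  multiplier of either parameter. If the inner product were nonzero, the multipliers would agree for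
  all \<open>W\<close>, and with them the eigenvalues.\<close>

lemma eigenfunctions_orthogonal:
  assumes f: "f \<in> eigenspace \<Gamma> (spectral_value CARD('n) u)" and g: "g \<in> eigenspace \<Gamma> (spectral_value CARD('n) t)"
    and u: "u \<le> real CARD('n) - 1" and ne: "spectral_value CARD('n) u \<noteq> spectral_value CARD('n) t"
  shows "qinner f g = 0"
proof (rule ccontr)
  assume nz: "qinner f g \<noteq> 0"
  interpret D: sigma_finite_measure dom_vol by (rule sigma_finite_dom_vol)
  interpret P: pair_sigma_finite dom_vol dom_vol ..
  have mf: "lift f \<in> borel_measurable borel" and mg: "lift g \<in> borel_measurable borel"
    using f g eigenspaceD(1) lift_measurable by blast+
  have "spherical_factor TYPE('n) (real CARD('n) - 1 - u) W = spherical_factor TYPE('n) (real CARD('n) - 1 - t) W" if W: "W > 1" for W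
  proof -
    have W0: "W > 0" using W by simp
    define K where "K x y = lift f x * cnj (lift g y) * complex_of_real (PsiR W x y)" for x y
    have sp: "sets (dom_vol \<Otimes>\<^sub>M dom_vol) = sets (borel \<Otimes>\<^sub>M borel)" by (intro sets_pair_measure_cong) simp_all
    have mK: "(\<lambda>p. K (fst p) (snd p)) \<in> borel_measurable (dom_vol \<Otimes>\<^sub>M dom_vol)"
      unfolding measurable_cong_sets [OF sp refl] K_def
      using measurable_compose [OF measurable_fst mf] measurable_compose [OF measurable_snd mg] PsiR_measurable2 [of W]
      by (intro borel_measurable_times borel_measurable_of_real measurable_cnj) auto
    obtain c where c: "c \<ge> 0" "\<And>x. (\<integral>\<^sup>+y. Psi W x y \<partial>dom_vol) \<le> ennreal c"
      using Psi_integral_bound [OF W] by blast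
    have half: "(\<integral>\<^sup>+x. \<integral>\<^sup>+y. ennreal ((cmod (lift h x))\<^sup>2) * Psi W x y \<partial>dom_vol \<partial>dom_vol) < \<infinity>"
      if h: "h \<in> eigenspace \<Gamma> \<mu>" for h \<mu>
    proof -
      have "(\<integral>\<^sup>+x. \<integral>\<^sup>+y. ennreal ((cmod (lift h x))\<^sup>2) * Psi W x y \<partial>dom_vol \<partial>dom_vol)
          = (\<integral>\<^sup>+x. ennreal ((cmod (lift h x))\<^sup>2) * (\<integral>\<^sup>+y. Psi W x y \<partial>dom_vol) \<partial>dom_vol)"
        by (intro nn_integral_cong nn_integral_cmult borel_measurable_dom_vol Psi_measurable)
      also have "\<dots> \<le> (\<integral>\<^sup>+x. ennreal ((cmod (lift h x))\<^sup>2) * ennreal c \<partial>dom_vol)"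
        by (intro nn_integral_mono mult_left_mono c) simp
      also have "\<dots> = (\<integral>\<^sup>+x. ennreal ((cmod (lift h x))\<^sup>2) \<partial>dom_vol) * ennreal c"
        using lift_measurable [OF eigenspaceD(1) [OF h]] by (intro nn_integral_multc) measurable
      also have "\<dots> < \<infinity>" using lift_square_finite [OF h] by (simp add: ennreal_mult_less_top)
      finally show ?thesis .
    qed
    have mP: "(\<lambda>p. ennreal ((cmod (lift h (fst p)))\<^sup>2) * Psi W (fst p) (snd p)) \<in> borel_measurable (dom_vol \<Otimes>\<^sub>M dom_vol)"
      if h: "h \<in> eigenspace \<Gamma> \<mu>" for h \<mu>
    proof -
      have "(\<lambda>z :: complex. ennreal ((cmod z)\<^sup>2)) \<in> borel_measurable borel" by measurable
      from measurable_compose [OF measurable_compose [OF measurable_fst lift_measurable [OF eigenspaceD(1) [OF h]]] this]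
      have "(\<lambda>p. ennreal ((cmod (lift h (fst p)))\<^sup>2)) \<in> borel_measurable (borel \<Otimes>\<^sub>M borel)" .
      then show ?thesis unfolding measurable_cong_sets [OF sp refl] by (intro borel_measurable_times_ennreal Psi_measurable2)
    qed
    have mP': "(\<lambda>p. ennreal ((cmod (lift h (snd p)))\<^sup>2) * Psi W (fst p) (snd p)) \<in> borel_measurable (dom_vol \<Otimes>\<^sub>M dom_vol)"
      if h: "h \<in> eigenspace \<Gamma> \<mu>" for h \<mu>
    proof -
      have "(\<lambda>z :: complex. ennreal ((cmod z)\<^sup>2)) \<in> borel_measurable borel" by measurable
      from measurable_compose [OF measurable_compose [OF measurable_snd lift_measurable [OF eigenspaceD(1) [OF h]]] this]
      have "(\<lambda>p. ennreal ((cmod (lift h (snd p)))\<^sup>2)) \<in> borel_measurable (borel \<Otimes>\<^sub>M borel)" .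
      then show ?thesis unfolding measurable_cong_sets [OF sp refl] by (intro borel_measurable_times_ennreal Psi_measurable2)
    qed
    \<comment> \<open>Absolute integrability for Fubini: the product of the two moduli is at most
      the sum of their squares, and each square is integrated against the uniformly bounded row
      integrals of the kernel.\<close>
    have bound: "(\<integral>\<^sup>+p. ennreal (norm (K (fst p) (snd p))) \<partial>(dom_vol \<Otimes>\<^sub>M dom_vol)) < \<infinity>"
    proof -
      have "(\<integral>\<^sup>+p. ennreal (norm (K (fst p) (snd p))) \<partial>(dom_vol \<Otimes>\<^sub>M dom_vol))
          \<le> (\<integral>\<^sup>+p. ennreal ((cmod (lift f (fst p)))\<^sup>2) * Psi W (fst p) (snd p)
            + ennreal ((cmod (lift g (snd p)))\<^sup>2) * Psi W (fst p) (snd p) \<partial>(dom_vol \<Otimes>\<^sub>M dom_vol))"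
      proof (rule nn_integral_mono)
        fix p :: "'n vec1 \<times> 'n vec1"
        let ?a = "cmod (lift f (fst p))" and ?b = "cmod (lift g (snd p))" and ?P = "PsiR W (fst p) (snd p)"
        have "0 \<le> ?a * ?b" by simp
        then have "?a * ?b \<le> ?a\<^sup>2 + ?b\<^sup>2" using sum_squares_bound [of ?a ?b] by linarith
        then have "norm (K (fst p) (snd p)) \<le> (?a\<^sup>2 + ?b\<^sup>2) * ?P"
          unfolding K_def by (simp add: norm_mult mult_right_mono)
        then have "ennreal (norm (K (fst p) (snd p))) \<le> ennreal (?a\<^sup>2 * ?P + ?b\<^sup>2 * ?P)"
          by (intro ennreal_leI) (simp add: distrib_right)
        also have "\<dots> = ennreal (?a\<^sup>2) * ennreal ?P + ennreal (?b\<^sup>2) * ennreal ?P"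
          by (simp add: ennreal_mult ennreal_plus)
        finally show "ennreal (norm (K (fst p) (snd p))) \<le> ennreal (?a\<^sup>2) * Psi W (fst p) (snd p) + ennreal (?b\<^sup>2) * Psi W (fst p) (snd p)"
          by (simp only: ennreal_PsiR [OF W0])
      qed
      also have "\<dots> = (\<integral>\<^sup>+p. ennreal ((cmod (lift f (fst p)))\<^sup>2) * Psi W (fst p) (snd p) \<partial>(dom_vol \<Otimes>\<^sub>M dom_vol))
          + (\<integral>\<^sup>+p. ennreal ((cmod (lift g (snd p)))\<^sup>2) * Psi W (fst p) (snd p) \<partial>(dom_vol \<Otimes>\<^sub>M dom_vol))"
        by (rule nn_integral_add [OF mP [OF f] mP' [OF g]])
      also have "(\<integral>\<^sup>+p. ennreal ((cmod (lift f (fst p)))\<^sup>2) * Psi W (fst p) (snd p) \<partial>(dom_vol \<Otimes>\<^sub>M dom_vol))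
          = (\<integral>\<^sup>+x. \<integral>\<^sup>+y. ennreal ((cmod (lift f x))\<^sup>2) * Psi W x y \<partial>dom_vol \<partial>dom_vol)"
        using D.nn_integral_fst [OF mP [OF f]] by simp
      also have "(\<integral>\<^sup>+p. ennreal ((cmod (lift g (snd p)))\<^sup>2) * Psi W (fst p) (snd p) \<partial>(dom_vol \<Otimes>\<^sub>M dom_vol))
          = (\<integral>\<^sup>+y. \<integral>\<^sup>+x. ennreal ((cmod (lift g y))\<^sup>2) * Psi W y x \<partial>dom_vol \<partial>dom_vol)"
        using P.nn_integral_snd [OF mP' [OF g]] by (simp add: Psi_sym [of W])
      finally show ?thesis using half [OF f] half [OF g] by (simp add: le_less_trans)
    qed
    have KI: "integrable (dom_vol \<Otimes>\<^sub>M dom_vol) (\<lambda>(x, y). K x y)"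
      using mK bound by (intro integrableI_bounded) (simp_all add: case_prod_beta)
    have in1: "(\<integral>y. K x y \<partial>dom_vol) = complex_of_real (spherical_factor TYPE('n) (real CARD('n) - 1 - t) W) * (lift f x * cnj (lift g x))" for x
    proof -
      have "(\<integral>y. K x y \<partial>dom_vol) = (\<integral>y. lift f x * cnj (PsiR W x y *\<^sub>R lift g y) \<partial>dom_vol)"
        unfolding K_def by (simp add: scaleR_conv_of_real mult_ac)
      also have "\<dots> = lift f x * cnj (\<integral>y. PsiR W x y *\<^sub>R lift g y \<partial>dom_vol)"
        by (simp only: integral_mult_right_zero integral_bounded_linear [OF bounded_linear_cnj reproducing(1) [OF g W]])
      finally show ?thesis by (simp add: reproducing(2) [OF g W] mult_ac)
    qed
    have in2: "(\<integral>x. K x y \<partial>dom_vol) = complex_of_real (spherical_factor TYPE('n) (real CARD('n) - 1 - u) W) * (lift f y * cnj (lift g y))" for y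
    proof -
      have sym: "PsiR W x y = PsiR W y x" for x by (simp add: PsiR_def Psi_sym)
      have "(\<integral>x. K x y \<partial>dom_vol) = (\<integral>x. cnj (lift g y) * (PsiR W y x *\<^sub>R lift f x) \<partial>dom_vol)"
        unfolding K_def sym by (simp add: scaleR_conv_of_real mult_ac)
      also have "\<dots> = cnj (lift g y) * (\<integral>x. PsiR W y x *\<^sub>R lift f x \<partial>dom_vol)"
        by (simp only: integral_mult_right_zero)
      finally show ?thesis by (simp add: reproducing(2) [OF f W] mult_ac)
    qed
    have "(\<integral>y. \<integral>x. K x y \<partial>dom_vol \<partial>dom_vol) = (\<integral>x. \<integral>y. K x y \<partial>dom_vol \<partial>dom_vol)"
      by (rule P.Fubini_integral [OF KI])
    then have "complex_of_real (spherical_factor TYPE('n) (real CARD('n) - 1 - u) W) * qinner f g = complex_of_real (spherical_factor TYPE('n) (real CARD('n) - 1 - t) W) * qinner f g"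
      unfolding in1 in2 integral_mult_right_zero qinner_def .
    then show ?thesis using nz by simp
  qed
  then have "(real CARD('n) - 1 - u) * (real CARD('n) - 1 - (real CARD('n) - 1 - u))
      = (real CARD('n) - 1 - t) * (real CARD('n) - 1 - (real CARD('n) - 1 - t))"
    using u by (intro spherical_factor_eigenvalue) auto
  then show False using ne by (simp add: spectral_value_def mult.commute)
qed

subsection \<open>No eigenfunctions beyond the critical exponent\<close>

text \<open>Schur's test with the weight \<open>\<Sum>\<gamma>. lor (\<gamma> p) x powr (- t)\<close>: it bounds the kernel operator by a
  multiple of \<open>W powr (t + 3)\<close>, whereas an eigenfunction with parameter \<open>u\<close> is multiplied by at
  least a multiple of \<open>W powr (u + 3)\<close>.\<close>

lemma no_eigenfunctions:
  assumes n: "CARD('n) \<ge> 2" and p: "p \<in> hyp" and t: "t > rho CARD('n)" "t < u" and u: "u \<le> real CARD('n) - 1"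
    and fin: "gsum (\<lambda>\<gamma>. ennreal (lor (\<gamma> *v p) p powr (- t))) < \<infinity>"
    and \<phi>: "\<phi> \<in> eigenspace \<Gamma> (spectral_value CARD('n) u)"
  shows "(\<integral>\<^sup>+y. ennreal ((cmod (lift \<phi> y))\<^sup>2) \<partial>dom_vol) = 0"
proof -
  define K where "K = ball_const CARD('n) * 2 powr t / (1 - 2 powr (rho CARD('n) - t))"
  have t0: "t > 0" using rho_pos [OF n] t(1) by linarith
  have "2 powr (rho CARD('n) - t) < 1" using t(1) by (simp add: powr_less_one)
  then have K0: "K \<ge> 0" unfolding K_def using ball_const_pos [of "CARD('n)"] by (intro divide_nonneg_nonneg mult_nonneg_nonneg) auto
  \<comment> \<open>The weight of Schur's test. The value 1 off the hyperboloid keeps it positive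
    and finite everywhere, so that quotients of weights make sense.\<close>
  define F where "F x = (if x \<in> hyp then gsum (\<lambda>\<gamma>. ennreal (lor (\<gamma> *v p) x powr (- t))) else 1)" for x
  have F_fin: "F x < \<infinity>" for x
  proof (cases "x \<in> hyp")
    case True
    have "F x \<le> gsum (\<lambda>\<gamma>. ennreal ((2 * lor x p) powr t) * ennreal (lor (\<gamma> *v p) p powr (- t)))"
      unfolding F_def using True
    proof (simp only: if_True, intro nn_integral_mono)
      fix \<gamma> assume "\<gamma> \<in> space (count_space \<Gamma>)"
      then have g: "\<gamma> *v p \<in> hyp" using act_hyp p by simp
      have "lor (\<gamma> *v p) p \<le> 2 * lor (\<gamma> *v p) x * lor x p" by (rule lor_triangle [OF g p True])
      then have "lor (\<gamma> *v p) p / (2 * lor x p) \<le> lor (\<gamma> *v p) x"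
        using lor_pos [OF True p] by (simp add: divide_le_eq mult_ac)
      then have "lor (\<gamma> *v p) x powr (- t) \<le> (lor (\<gamma> *v p) p / (2 * lor x p)) powr (- t)"
        using lor_pos [OF True p] lor_pos [OF g p] t0 by (intro powr_mono2') auto
      also have "\<dots> = (2 * lor x p) powr t * lor (\<gamma> *v p) p powr (- t)"
        using lor_pos [OF True p] lor_pos [OF g p] by (simp add: powr_divide powr_minus field_simps)
      finally show "ennreal (lor (\<gamma> *v p) x powr (- t)) \<le> ennreal ((2 * lor x p) powr t) * ennreal (lor (\<gamma> *v p) p powr (- t))"
        by (simp add: ennreal_mult [symmetric] ennreal_leI)
    qed
    also have "\<dots> = ennreal ((2 * lor x p) powr t) * gsum (\<lambda>\<gamma>. ennreal (lor (\<gamma> *v p) p powr (- t)))"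
      by (rule nn_integral_cmult) simp
    also have "\<dots> < \<infinity>" using fin by (simp add: ennreal_mult_less_top)
    finally show ?thesis .
  qed (simp add: F_def)
  have F_pos: "F x > 0" for x
  proof (cases "x \<in> hyp")
    case True
    have l: "lor p x powr (- t) > 0" using lor_pos [OF p True] by simp
    then have "0 < ennreal (lor p x powr (- t))" by (simp add: ennreal_less_zero_iff)
    also have "\<dots> = gsum (\<lambda>\<gamma>. ennreal (lor p x powr (- t)) * indicator {mat 1} \<gamma>)"
      using one by (subst nn_integral_cmult_indicator) simp_all
    also have "\<dots> \<le> gsum (\<lambda>\<gamma>. ennreal (lor (\<gamma> *v p) x powr (- t)))"
      by (intro nn_integral_mono) (simp split: split_indicator)
    finally show ?thesis using True by (simp add: F_def)
  qed (simp add: F_def)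
  have mF: "F \<in> borel_measurable borel"
  proof -
    have "(\<lambda>x. gsum (\<lambda>\<gamma>. ennreal (lor (\<gamma> *v p) x powr (- t)))) \<in> borel_measurable borel"
      by (rule measurable_gsum) measurable
    then show ?thesis unfolding F_def by (intro measurable_If_set) (simp_all add: hyp_in_borel)
  qed
  have F_act: "F (\<gamma> *v x) = F x" if g: "\<gamma> \<in> \<Gamma>" for \<gamma> x
  proof (cases "x \<in> hyp")
    case True
    have "gsum (\<lambda>\<gamma>'. ennreal (lor (\<gamma>' *v p) (\<gamma> *v x) powr (- t))) = gsum (\<lambda>\<gamma>'. ennreal (lor ((\<gamma> ** \<gamma>') *v p) (\<gamma> *v x) powr (- t)))"
      by (rule gsum_mult_left [OF g, symmetric])
    also have "\<dots> = gsum (\<lambda>\<gamma>'. ennreal (lor (\<gamma>' *v p) x powr (- t)))"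
      by (simp only: matrix_vector_mul_assoc [symmetric] lor_act [OF g])
    finally show ?thesis using True act_hyp [OF g True] by (simp add: F_def)
  qed (simp add: F_def act_hyp_iff [OF g])
  define Fr where "Fr x = enn2real (F x)" for x
  have Fr: "ennreal (Fr x) = F x" "Fr x > 0" for x
    using F_fin [of x] F_pos [of x] by (simp_all add: Fr_def enn2real_positive_iff)
  have mFr: "Fr \<in> borel_measurable borel" unfolding Fr_def using mF by measurable
  \<comment> \<open>The invariant weight passes through the unfolding, and each summand is
    reproduced up to a factor by the dyadic estimate for a power of \<open>lor\<close> over a
    ball.\<close>
  have super: "(\<integral>\<^sup>+y. F y * Psi W x y \<partial>dom_vol) \<le> ennreal (K * W powr (t + 3)) * F x" if W: "W > 1" and x: "x \<in> hyp" for W x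
  proof -
    have W0: "W > 0" using W by simp
    have "(\<integral>\<^sup>+y. F y * Psi W x y \<partial>dom_vol) = (\<integral>\<^sup>+y. F y * ennreal (psi W x y) \<partial>hyp_vol)"
      unfolding Psi_def by (rule unfold_integral_invariant [OF _ mF F_act]) measurable
    also have "\<dots> \<le> (\<integral>\<^sup>+y. ennreal (W ^ 3) * gsum (\<lambda>\<gamma>. ennreal (lor (\<gamma> *v p) y powr (- t)) * indicator (hball x W) y) \<partial>hyp_vol)"
    proof (rule nn_integral_mono)
      fix y
      show "F y * ennreal (psi W x y) \<le> ennreal (W ^ 3) * gsum (\<lambda>\<gamma>. ennreal (lor (\<gamma> *v p) y powr (- t)) * indicator (hball x W) y)"
      proof (cases "y \<in> hball x W")
        case True
        then have "y \<in> hyp" by (simp add: hball_def)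
        then have "F y = gsum (\<lambda>\<gamma>. ennreal (lor (\<gamma> *v p) y powr (- t)) * indicator (hball x W) y)"
          using True by (simp add: F_def)
        moreover have "ennreal (psi W x y) \<le> ennreal (W ^ 3)" using psi_le_ennreal [OF W0, of x y] True by simp
        ultimately show ?thesis by (metis mult.commute mult_right_mono zero_le)
      next
        case False
        then have "psi W x y = 0" using psi_le [OF W0, of x y] psi_nonneg [of W x y] by simp
        then show ?thesis by simp
      qed
    qed
    also have "\<dots> = ennreal (W ^ 3) * (\<integral>\<^sup>+y. gsum (\<lambda>\<gamma>. ennreal (lor (\<gamma> *v p) y powr (- t)) * indicator (hball x W) y) \<partial>hyp_vol)"
      by (rule nn_integral_cmult) (simp only: measurable_cong_sets [OF sets_hyp_vol refl], rule measurable_gsum, measurable)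
    also have "(\<integral>\<^sup>+y. gsum (\<lambda>\<gamma>. ennreal (lor (\<gamma> *v p) y powr (- t)) * indicator (hball x W) y) \<partial>hyp_vol)
        = gsum (\<lambda>\<gamma>. \<integral>\<^sup>+y. ennreal (lor (\<gamma> *v p) y powr (- t)) * indicator (hball x W) y \<partial>hyp_vol)"
      by (rule nn_integral_count_space_nn_integral [OF countable_group]) measurable
    also have "\<dots> \<le> gsum (\<lambda>\<gamma>. ennreal (K * W powr t) * ennreal (lor (\<gamma> *v p) x powr (- t)))"
    proof (rule nn_integral_mono)
      fix \<gamma> assume "\<gamma> \<in> space (count_space \<Gamma>)"
      then have g: "\<gamma> *v p \<in> hyp" using act_hyp p by simp
      have "(\<integral>\<^sup>+y. ennreal (lor (\<gamma> *v p) y powr (- t)) * indicator (hball x W) y \<partial>hyp_vol) \<le> ennreal (K * W powr t * lor (\<gamma> *v p) x powr (- t))"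
        unfolding K_def by (rule nn_integral_lor_powr_le [OF n x g W0 t(1)])
      also have "\<dots> = ennreal (K * W powr t) * ennreal (lor (\<gamma> *v p) x powr (- t))"
        using K0 by (intro ennreal_mult) auto
      finally show "(\<integral>\<^sup>+y. ennreal (lor (\<gamma> *v p) y powr (- t)) * indicator (hball x W) y \<partial>hyp_vol)
          \<le> ennreal (K * W powr t) * ennreal (lor (\<gamma> *v p) x powr (- t))" .
    qed
    also have "\<dots> = ennreal (K * W powr t) * F x"
      using x by (simp add: F_def nn_integral_cmult)
    finally have "(\<integral>\<^sup>+y. F y * Psi W x y \<partial>dom_vol) \<le> ennreal (W ^ 3) * (ennreal (K * W powr t) * F x)"
      by (simp add: mult_left_mono)
    also have "\<dots> = ennreal (W ^ 3 * (K * W powr t)) * F x"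
      using K0 W0 by (subst ennreal_mult) (auto simp: mult.assoc)
    also have "W ^ 3 * (K * W powr t) = K * W powr (t + 3)"
      using W0 by (simp add: powr_add powr_numeral)
    finally show ?thesis .
  qed
  define a where "a x = cmod (lift \<phi> x)" for x
  have lm: "lift \<phi> \<in> borel_measurable borel" by (rule lift_measurable [OF eigenspaceD(1) [OF \<phi>]])
  have ma: "a \<in> borel_measurable borel" unfolding a_def using lm by measurable
  define A where "A = (\<integral>\<^sup>+x. ennreal ((a x)\<^sup>2) \<partial>dom_vol)"
  have A_fin: "A < \<infinity>" unfolding A_def a_def by (rule lift_square_finite [OF \<phi>])
  have a_out: "a x = 0" if "x \<notin> hyp" for x
    using lift_outside [OF eigenspaceD(1) [OF \<phi>] that] by (simp add: a_def)
  interpret D: sigma_finite_measure dom_vol by (rule sigma_finite_dom_vol)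
  interpret P: pair_sigma_finite dom_vol dom_vol ..
  have sp: "sets (dom_vol \<Otimes>\<^sub>M dom_vol) = sets (borel \<Otimes>\<^sub>M borel)" by (intro sets_pair_measure_cong) simp_all
  have main: "ennreal (2 * spherical_factor TYPE('n) (real CARD('n) - 1 - u) W) * A \<le> ennreal (2 * (K * W powr (t + 3))) * A"
    if W: "W \<ge> 3/2" for W
  proof -
    have W1: "W > 1" and W0: "W > 0" using W by simp_all
    let ?h = "spherical_factor TYPE('n) (real CARD('n) - 1 - u) W"
    have h0: "?h \<ge> 0"
    proof -
      have "0 \<le> sf_const CARD('n) * W powr (u + 3)" using sf_const_pos [of "CARD('n)"] by simp
      also have "\<dots> \<le> ?h" using t0 t u W by (intro spherical_factor_ge_powr) auto
      finally show ?thesis .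
    qed
    \<comment> \<open>Young's inequality bounds \<open>2 * a x * a y * PsiR W x y\<close> by
      \<open>G x y + G y x\<close>. Both terms have the same double integral, and
      \<open>super\<close> evaluates its inner integral.\<close>
    define G where "G x y = ennreal ((a x)\<^sup>2 * Fr y / Fr x) * Psi W x y" for x y
    have mG: "(\<lambda>p. G (fst p) (snd p)) \<in> borel_measurable (borel \<Otimes>\<^sub>M borel)"
      unfolding G_def
      using measurable_compose [OF measurable_fst ma] measurable_compose [OF measurable_fst mFr]
        measurable_compose [OF measurable_snd mFr] Psi_measurable2 [of W]
      by (intro borel_measurable_times_ennreal measurable_compose [OF _ measurable_ennreal] borel_measurable_divide
        borel_measurable_times borel_measurable_power) auto
    have mG1: "(\<lambda>y. G x y) \<in> borel_measurable borel" for x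
    proof -
      have m: "(\<lambda>y. (x, y)) \<in> measurable borel (borel \<Otimes>\<^sub>M borel)" by measurable
      show ?thesis using measurable_compose [OF m mG] by simp
    qed
    have mG2: "(\<lambda>y. G y x) \<in> borel_measurable borel" for x
    proof -
      have m: "(\<lambda>y. (y, x)) \<in> measurable borel (borel \<Otimes>\<^sub>M borel)" by measurable
      show ?thesis using measurable_compose [OF m mG] by simp
    qed
    have G_bound: "(\<integral>\<^sup>+x. \<integral>\<^sup>+y. G x y \<partial>dom_vol \<partial>dom_vol) \<le> ennreal (K * W powr (t + 3)) * A"
    proof -
      have "(\<integral>\<^sup>+y. G x y \<partial>dom_vol) \<le> ennreal (K * W powr (t + 3)) * ennreal ((a x)\<^sup>2)" for x
      proof (cases "x \<in> hyp")
        case True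
        have "G x y = ennreal ((a x)\<^sup>2 / Fr x) * (F y * Psi W x y)" for y
          unfolding G_def Fr(1) [symmetric] using Fr(2) [of x] Fr(2) [of y]
          by (subst mult.assoc [symmetric], subst ennreal_mult [symmetric]) (auto simp: less_imp_le)
        then have "(\<integral>\<^sup>+y. G x y \<partial>dom_vol) = ennreal ((a x)\<^sup>2 / Fr x) * (\<integral>\<^sup>+y. F y * Psi W x y \<partial>dom_vol)"
          by (simp only:) (intro nn_integral_cmult borel_measurable_dom_vol borel_measurable_times_ennreal mF Psi_measurable)
        also have "\<dots> \<le> ennreal ((a x)\<^sup>2 / Fr x) * (ennreal (K * W powr (t + 3)) * F x)"
          by (intro mult_left_mono super W1 True) simp
        also have "\<dots> = ennreal ((a x)\<^sup>2 / Fr x * (K * W powr (t + 3) * Fr x))"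
          unfolding Fr(1) [symmetric] using Fr(2) [of x] K0
          by (subst ennreal_mult [symmetric], simp, simp, subst ennreal_mult [symmetric]) (auto simp: less_imp_le)
        also have "(a x)\<^sup>2 / Fr x * (K * W powr (t + 3) * Fr x) = K * W powr (t + 3) * (a x)\<^sup>2"
          using Fr(2) [of x] by simp
        finally show ?thesis using K0 by (simp add: ennreal_mult)
      next
        case False
        then have "G x y = 0" for y by (simp add: G_def a_out)
        then show ?thesis by simp
      qed
      then have "(\<integral>\<^sup>+x. \<integral>\<^sup>+y. G x y \<partial>dom_vol \<partial>dom_vol) \<le> (\<integral>\<^sup>+x. ennreal (K * W powr (t + 3)) * ennreal ((a x)\<^sup>2) \<partial>dom_vol)"
        by (intro nn_integral_mono)
      also have "\<dots> = ennreal (K * W powr (t + 3)) * A"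
        unfolding A_def using ma by (intro nn_integral_cmult borel_measurable_dom_vol) measurable
      finally show ?thesis .
    qed
    have swap: "(\<integral>\<^sup>+x. \<integral>\<^sup>+y. G y x \<partial>dom_vol \<partial>dom_vol) = (\<integral>\<^sup>+x. \<integral>\<^sup>+y. G x y \<partial>dom_vol \<partial>dom_vol)"
    proof -
      have "(\<lambda>(x, y). G x y) \<in> borel_measurable (dom_vol \<Otimes>\<^sub>M dom_vol)"
        unfolding measurable_cong_sets [OF sp refl] using mG by (simp add: case_prod_beta)
      from P.Fubini' [OF this] show ?thesis .
    qed
    have pt: "ennreal (2 * ?h) * ennreal ((a x)\<^sup>2) \<le> (\<integral>\<^sup>+y. G x y + G y x \<partial>dom_vol)" for x
    proof (cases "x \<in> hyp")
      case True
      have "ennreal (?h * a x) = ennreal (norm (\<integral>y. PsiR W x y *\<^sub>R lift \<phi> y \<partial>dom_vol))"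
        using h0 by (simp add: reproducing(2) [OF \<phi> W1] a_def norm_mult)
      also have "\<dots> \<le> (\<integral>\<^sup>+y. ennreal (norm (PsiR W x y *\<^sub>R lift \<phi> y)) \<partial>dom_vol)"
        by (rule integral_norm_bound_ennreal [OF reproducing(1) [OF \<phi> W1]])
      also have "\<dots> = (\<integral>\<^sup>+y. ennreal (PsiR W x y * a y) \<partial>dom_vol)" by (simp add: a_def)
      finally have "ennreal (2 * a x) * ennreal (?h * a x) \<le> ennreal (2 * a x) * (\<integral>\<^sup>+y. ennreal (PsiR W x y * a y) \<partial>dom_vol)"
        by (intro mult_left_mono) simp_all
      also have "\<dots> = (\<integral>\<^sup>+y. ennreal (2 * a x) * ennreal (PsiR W x y * a y) \<partial>dom_vol)"
        by (intro nn_integral_cmult [symmetric] borel_measurable_dom_vol measurable_compose [OF _ measurable_ennreal]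
          borel_measurable_times PsiR_measurable ma)
      also have "\<dots> \<le> (\<integral>\<^sup>+y. G x y + G y x \<partial>dom_vol)"
      proof (rule nn_integral_mono)
        fix y
        have a0: "a x \<ge> 0" "a y \<ge> 0" by (simp_all add: a_def)
        have f: "Fr x > 0" "Fr y > 0" using Fr(2) by simp_all
        have "2 * (a x * a y) \<le> (a x)\<^sup>2 * Fr y / Fr x + (a y)\<^sup>2 * Fr x / Fr y"
        proof -
          have "0 \<le> (a x * Fr y - a y * Fr x)\<^sup>2 / (Fr x * Fr y)" using f by simp
          also have "\<dots> = (a x)\<^sup>2 * Fr y / Fr x + (a y)\<^sup>2 * Fr x / Fr y - 2 * (a x * a y)"
            using f by (simp add: power2_eq_square field_simps)
          finally show ?thesis by linarith
        qed
        then have "2 * (a x * a y) * PsiR W x y \<le> ((a x)\<^sup>2 * Fr y / Fr x + (a y)\<^sup>2 * Fr x / Fr y) * PsiR W x y"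
          by (rule mult_right_mono) simp
        then have "ennreal (2 * a x * (PsiR W x y * a y)) \<le> ennreal ((a x)\<^sup>2 * Fr y / Fr x * PsiR W x y + (a y)\<^sup>2 * Fr x / Fr y * PsiR W x y)"
          unfolding distrib_right by (intro ennreal_leI) (simp only: mult_ac)
        also have "\<dots> = ennreal ((a x)\<^sup>2 * Fr y / Fr x) * ennreal (PsiR W x y) + ennreal ((a y)\<^sup>2 * Fr x / Fr y) * ennreal (PsiR W x y)"
        proof -
          have p: "(a x)\<^sup>2 * Fr y / Fr x \<ge> 0" "(a y)\<^sup>2 * Fr x / Fr y \<ge> 0" "PsiR W x y \<ge> 0" using f by simp_all
          show ?thesis
            unfolding ennreal_plus [OF mult_nonneg_nonneg [OF p(1,3)] mult_nonneg_nonneg [OF p(2,3)]]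
              ennreal_mult [OF p(1,3)] ennreal_mult [OF p(2,3)] ..
        qed
        also have "\<dots> = G x y + G y x" by (simp only: G_def ennreal_PsiR [OF W0] Psi_sym [of W y x])
        finally show "ennreal (2 * a x) * ennreal (PsiR W x y * a y) \<le> G x y + G y x"
          using a0 by (simp add: ennreal_mult [symmetric])
      qed
      finally have "ennreal (2 * a x) * ennreal (?h * a x) \<le> (\<integral>\<^sup>+y. G x y + G y x \<partial>dom_vol)" .
      moreover have "ennreal (2 * a x) * ennreal (?h * a x) = ennreal (2 * ?h) * ennreal ((a x)\<^sup>2)"
      proof -
        have a0: "a x \<ge> 0" by (simp add: a_def)
        have "ennreal (2 * a x) * ennreal (?h * a x) = ennreal (2 * a x * (?h * a x))"
          using h0 a0 by (intro ennreal_mult [symmetric]) auto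
        also have "2 * a x * (?h * a x) = 2 * ?h * (a x)\<^sup>2" by (simp add: power2_eq_square)
        also have "ennreal \<dots> = ennreal (2 * ?h) * ennreal ((a x)\<^sup>2)" using h0 by (intro ennreal_mult) auto
        finally show ?thesis .
      qed
      ultimately show ?thesis by simp
    next
      case False
      then show ?thesis by (simp add: a_out)
    qed
    have "ennreal (2 * ?h) * A = (\<integral>\<^sup>+x. ennreal (2 * ?h) * ennreal ((a x)\<^sup>2) \<partial>dom_vol)"
      unfolding A_def using ma by (intro nn_integral_cmult [symmetric] borel_measurable_dom_vol) measurable
    also have "\<dots> \<le> (\<integral>\<^sup>+x. \<integral>\<^sup>+y. G x y + G y x \<partial>dom_vol \<partial>dom_vol)"
      by (intro nn_integral_mono pt)
    also have "\<dots> = (\<integral>\<^sup>+x. (\<integral>\<^sup>+y. G x y \<partial>dom_vol) + (\<integral>\<^sup>+y. G y x \<partial>dom_vol) \<partial>dom_vol)"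
      by (intro nn_integral_cong nn_integral_add borel_measurable_dom_vol mG1 mG2)
    also have "\<dots> = (\<integral>\<^sup>+x. \<integral>\<^sup>+y. G x y \<partial>dom_vol \<partial>dom_vol) + (\<integral>\<^sup>+x. \<integral>\<^sup>+y. G y x \<partial>dom_vol \<partial>dom_vol)"
    proof (rule nn_integral_add)
      have m1: "(\<lambda>(x, y). G x y) \<in> borel_measurable (dom_vol \<Otimes>\<^sub>M dom_vol)"
        unfolding measurable_cong_sets [OF sp refl] using mG by (simp add: case_prod_beta)
      show "(\<lambda>x. \<integral>\<^sup>+y. G x y \<partial>dom_vol) \<in> borel_measurable dom_vol"
        by (rule D.borel_measurable_nn_integral [OF m1])
      have "(\<lambda>p. G (snd p) (fst p)) \<in> borel_measurable (borel \<Otimes>\<^sub>M borel)"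
        using measurable_compose [OF measurable_pair_swap' mG] by (simp add: case_prod_beta)
      then have m2: "(\<lambda>(x, y). G y x) \<in> borel_measurable (dom_vol \<Otimes>\<^sub>M dom_vol)"
        unfolding measurable_cong_sets [OF sp refl] by (simp add: case_prod_beta)
      show "(\<lambda>x. \<integral>\<^sup>+y. G y x \<partial>dom_vol) \<in> borel_measurable dom_vol"
        by (rule D.borel_measurable_nn_integral [OF m2])
    qed
    also have "\<dots> \<le> ennreal (K * W powr (t + 3)) * A + ennreal (K * W powr (t + 3)) * A"
      unfolding swap by (intro add_mono G_bound)
    also have "\<dots> = ennreal (2 * (K * W powr (t + 3))) * A"
    proof -
      have "K * W powr (t + 3) \<ge> 0" using K0 by simp
      from ennreal_plus [OF this this] show ?thesis by (simp only: mult_2 distrib_right)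
    qed
    finally show ?thesis .
  qed
  show ?thesis
  proof (rule ccontr)
    assume "\<not> ?thesis"
    then have A0: "A \<noteq> 0" by (simp add: A_def a_def)
    define c where "c = sf_const CARD('n)"
    have c0: "c > 0" using sf_const_pos by (simp add: c_def)
    have le: "c * W powr (u + 3) \<le> K * W powr (t + 3)" if W: "W \<ge> 3/2" for W
    proof -
      let ?h = "spherical_factor TYPE('n) (real CARD('n) - 1 - u) W"
      have "ennreal (2 * ?h) \<le> ennreal (2 * (K * W powr (t + 3)))"
        using main [OF W] A0 A_fin by (simp only: mult.commute [of _ A]) (simp add: ennreal_mult_le_mult_iff)
      then have "2 * ?h \<le> 2 * (K * W powr (t + 3))"
        using K0 by (subst (asm) ennreal_le_iff) auto
      moreover have "c * W powr (u + 3) \<le> ?h"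
        unfolding c_def using t0 t u W by (intro spherical_factor_ge_powr) auto
      ultimately show ?thesis by linarith
    qed
    \<comment> \<open>Large enough that \<open>c * W powr (u - t) \<ge> K + 1\<close>, contrary to
      the bound \<open>K\<close> implied by \<open>le\<close>; the maximum keeps \<open>W\<close> in
      the range of that estimate.\<close>
    define W where "W = max (3/2) (((K + 1) / c) powr (1 / (u - t)))"
    have W: "W \<ge> 3/2" by (simp add: W_def)
    have "c * (W powr (u - t) * W powr (t + 3)) \<le> K * W powr (t + 3)"
      using le [OF W] W by (simp add: powr_add [symmetric])
    moreover have "W powr (t + 3) > 0" using W by simp
    ultimately have "c * W powr (u - t) \<le> K" by (metis mult.assoc mult_le_cancel_right_pos)
    moreover have "(K + 1) / c \<le> W powr (u - t)"
    proof -
      have "(K + 1) / c = (((K + 1) / c) powr (1 / (u - t))) powr (u - t)"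
        using K0 c0 t(2) by (simp add: powr_powr)
      also have "\<dots> \<le> W powr (u - t)" using t(2) by (intro powr_mono2) (auto simp: W_def)
      finally show ?thesis .
    qed
    ultimately show False using c0 by (simp add: divide_le_eq mult.commute)
  qed
qed

end

subsection \<open>The kernel bound and Bessel's inequality\<close>

text \<open>Pairing the midpoint of \<open>x\<close> and \<open>y\<close> with \<open>z\<close>
  gives the sharp form \<open>cosh (2 * r) = 2 * (cosh r)\<^sup>2 - 1\<close>. The cruder bound
  \<open>2 * W\<^sup>2\<close> would not cut the sum over the group off exactly at length
  \<open>L\<close>.\<close>

lemma lor_common_ball:
  assumes "x \<in> hyp" "y \<in> hyp" "z \<in> hyp" "lor x z \<le> W" "lor y z \<le> W"
  shows "lor x y \<le> 2 * W\<^sup>2 - 1"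
proof -
  define N where "N = 1\<^sup>2 + 1\<^sup>2 + 2 * 1 * 1 * lor x y"
  have N0: "N > 0" using lor_pos [OF assms(1,2)] by (simp add: N_def)
  have m: "(1 / sqrt N) *\<^sub>R (1 *\<^sub>R x + 1 *\<^sub>R y) \<in> hyp"
    unfolding N_def by (rule combination_normalize_in_hyp [OF assms(1,2)]) simp_all
  have "1 \<le> lor ((1 / sqrt N) *\<^sub>R (1 *\<^sub>R x + 1 *\<^sub>R y)) z" by (rule lor_ge_1 [OF m assms(3)])
  also have "\<dots> = (lor x z + lor y z) / sqrt N" by (simp add: lor_bilinear add_divide_distrib)
  also have "\<dots> \<le> (2 * W) / sqrt N" using assms(4,5) N0 by (intro divide_right_mono) auto
  finally have "sqrt N \<le> 2 * W" using N0 by (simp add: le_divide_eq)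
  then have "(sqrt N)\<^sup>2 \<le> (2 * W)\<^sup>2" using N0 by (intro power_mono) auto
  then show ?thesis using N0 by (simp add: N_def power_mult_distrib)
qed

text \<open>The assumption \<open>L \<ge> 2\<close> enters through this: it puts
  \<open>cosh (L / 2)\<close> above the threshold \<open>3/2\<close> of the lower bound for the
  multiplier.\<close>

lemma cosh_one_ge: "cosh (1::real) \<ge> 3/2"
proof -
  have h: "exp (1/2::real) \<ge> 13/8" using exp_lower_Taylor_quadratic [of "1/2::real"] by (simp add: power2_eq_square)
  have "(13/8::real)\<^sup>2 \<le> (exp (1/2))\<^sup>2" by (rule power_mono [OF h]) simp
  then have e: "exp (1::real) \<ge> 169/64" by (simp add: power2_eq_square flip: exp_add)
  \<comment> \<open>The product has linear coefficient \<open>-3\<close> and a constant term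
    slightly below 1, so dividing by \<open>exp 1\<close> gives the next inequality.\<close>
  then have "0 \<le> (exp (1::real) - 263/100) * (exp 1 - 37/100)" by (intro mult_nonneg_nonneg) auto
  then have "exp (1::real) + 1 / exp 1 \<ge> 3" by (simp add: field_simps)
  then show ?thesis by (simp add: cosh_field_def exp_minus inverse_eq_divide)
qed

definition kernel_const :: "nat \<Rightarrow> real" where
  "kernel_const n = ball_const n * 2 powr rho n"

lemma kernel_const_pos: "kernel_const n > 0"
  by (simp add: kernel_const_def ball_const_pos)

text \<open>The quotient of the constants in the upper bound for the kernel and in the squared
  multiplier. The power of 4 pays for replacing \<open>W\<close> by its lower bound
  \<open>exp (L / 2) / 2\<close>.\<close>

definition bessel_const :: "nat \<Rightarrow> real \<Rightarrow> real" where
  "bessel_const n s = kernel_const n / (sf_const n)\<^sup>2 * 4 powr (s - rho n)"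

lemma bessel_const_pos: "bessel_const n s > 0"
  using kernel_const_pos [of n] sf_const_pos [of n] by (simp add: bessel_const_def zero_less_power)

context discrete_group
begin

definition returns :: "real \<Rightarrow> 'n vec1 \<Rightarrow> ennreal" where
  "returns L z = gsum (\<lambda>\<gamma>. ennreal (exp (- rho CARD('n) * hyp_dist z (\<gamma> *v z)))
     * indicator {\<gamma>. hyp_dist z (\<gamma> *v z) \<le> L} \<gamma>)"

text \<open>One factor is kept as an invariant function while the other is unfolded; expanding the
  kept factor leaves a single sum over the group.\<close>

lemma Psi_square:
  assumes "W > 0"
  shows "(\<integral>\<^sup>+y. (Psi W z y)\<^sup>2 \<partial>dom_vol)
    = gsum (\<lambda>\<gamma>. \<integral>\<^sup>+y. ennreal (psi W z (\<gamma> *v y)) * ennreal (psi W z y) \<partial>hyp_vol)"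
proof -
  have m: "(\<lambda>y. ennreal (psi W z y)) \<in> borel_measurable borel" by measurable
  have mg: "(\<lambda>y. ennreal (psi W z (\<gamma> *v y))) \<in> borel_measurable borel" for \<gamma> :: "'n mat1"
  proof -
    have "(\<lambda>y. \<gamma> *v y) \<in> borel_measurable borel"
      by (intro borel_measurable_continuous_onI continuous_intros)
    from measurable_compose [OF this m] show ?thesis .
  qed
  have "(\<integral>\<^sup>+y. (Psi W z y)\<^sup>2 \<partial>dom_vol) = (\<integral>\<^sup>+y. Psi W z y * gsum (\<lambda>\<gamma>. ennreal (psi W z (\<gamma> *v y))) \<partial>dom_vol)"
    by (simp only: power2_eq_square Psi_def)
  also have "\<dots> = (\<integral>\<^sup>+y. Psi W z y * ennreal (psi W z y) \<partial>hyp_vol)"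
    by (rule unfold_integral_invariant [OF m Psi_measurable Psi_act])
  also have "\<dots> = (\<integral>\<^sup>+y. gsum (\<lambda>\<gamma>. ennreal (psi W z (\<gamma> *v y)) * ennreal (psi W z y)) \<partial>hyp_vol)"
    by (simp only: Psi_def) (intro nn_integral_cong nn_integral_multc [symmetric], simp)
  also have "\<dots> = gsum (\<lambda>\<gamma>. \<integral>\<^sup>+y. ennreal (psi W z (\<gamma> *v y)) * ennreal (psi W z y) \<partial>hyp_vol)"
  proof (rule nn_integral_count_space_nn_integral [OF countable_group])
    fix \<gamma> :: "'n mat1"
    show "(\<lambda>y. ennreal (psi W z (\<gamma> *v y)) * ennreal (psi W z y)) \<in> borel_measurable hyp_vol"
      unfolding measurable_cong_sets [OF sets_hyp_vol refl] by (intro borel_measurable_times_ennreal mg m)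
  qed
  finally show ?thesis .
qed

lemma psi_overlap:
  assumes W: "W > 0" and z: "z \<in> hyp" and g: "\<gamma> \<in> \<Gamma>"
  shows "(\<integral>\<^sup>+y. ennreal (psi W z (\<gamma> *v y)) * ennreal (psi W z y) \<partial>hyp_vol)
    \<le> ennreal (W ^ 6) * emeasure hyp_vol (hball z W \<inter> hball (ginv \<gamma> *v z) W)"
proof -
  have p: "psi W z (\<gamma> *v y) = psi W (ginv \<gamma> *v z) y" for y
    using psi_act [OF ginv(1) [OF g], of W z "\<gamma> *v y"] by (simp add: ginv_act g)
  have "(\<integral>\<^sup>+y. ennreal (psi W z (\<gamma> *v y)) * ennreal (psi W z y) \<partial>hyp_vol)
      \<le> (\<integral>\<^sup>+y. ennreal (W ^ 6) * indicator (hball z W \<inter> hball (ginv \<gamma> *v z) W) y \<partial>hyp_vol)"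
  proof (rule nn_integral_mono)
    fix y
    have "ennreal (psi W z (\<gamma> *v y)) * ennreal (psi W z y)
        \<le> (ennreal (W ^ 3) * indicator (hball (ginv \<gamma> *v z) W) y) * (ennreal (W ^ 3) * indicator (hball z W) y)"
      unfolding p by (intro mult_mono psi_le_ennreal W) simp_all
    also have "\<dots> = (ennreal (W ^ 3) * ennreal (W ^ 3)) * indicator (hball z W \<inter> hball (ginv \<gamma> *v z) W) y"
      by (simp add: indicator_inter_arith mult_ac)
    also have "ennreal (W ^ 3) * ennreal (W ^ 3) = ennreal (W ^ 6)"
      using W by (subst ennreal_mult [symmetric]) (simp_all flip: power_add)
    finally show "ennreal (psi W z (\<gamma> *v y)) * ennreal (psi W z y)
        \<le> ennreal (W ^ 6) * indicator (hball z W \<inter> hball (ginv \<gamma> *v z) W) y" .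
  qed
  also have "\<dots> = ennreal (W ^ 6) * emeasure hyp_vol (hball z W \<inter> hball (ginv \<gamma> *v z) W)"
    by (intro nn_integral_cmult_indicator) (simp add: sets_hyp_vol hball_in_borel sets.Int)
  finally show ?thesis .
qed

text \<open>Each summand is at most \<open>W ^ 6\<close> times the volume of the intersection of two
  balls whose centres are at distance \<open>d\<close>. It is 0 unless \<open>d \<le> L\<close>, and
  otherwise of order \<open>(W\<^sup>2 / cosh d) powr \<rho>\<close>, where
  \<open>cosh d \<ge> exp d / 2\<close>.\<close>

lemma Psi_square_le:
  assumes n: "CARD('n) \<ge> 2" and z: "z \<in> hyp" and L: "L \<ge> 0"
  defines "W \<equiv> cosh (L / 2)"
  shows "(\<integral>\<^sup>+y. (Psi W z y)\<^sup>2 \<partial>dom_vol)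
    \<le> ennreal (kernel_const CARD('n) * W powr (2 * rho CARD('n) + 6)) * returns L z"
proof -
  let ?r = "rho CARD('n)"
  have W: "W > 0" by (simp add: W_def)
  have r0: "?r > 0" using n by (simp add: rho_def)
  have W2: "2 * W\<^sup>2 - 1 = cosh L" using cosh_double_cosh [of "L / 2"] by (simp add: W_def)
  have "(\<integral>\<^sup>+y. (Psi W z y)\<^sup>2 \<partial>dom_vol)
      \<le> gsum (\<lambda>\<gamma>. ennreal (W ^ 6) * emeasure hyp_vol (hball z W \<inter> hball (ginv \<gamma> *v z) W))"
    unfolding Psi_square [OF W] by (intro nn_integral_mono psi_overlap W z) simp
  also have "\<dots> = gsum (\<lambda>\<gamma>. ennreal (W ^ 6) * emeasure hyp_vol (hball z W \<inter> hball (\<gamma> *v z) W))"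
    by (rule gsum_ginv)
  also have "\<dots> \<le> gsum (\<lambda>\<gamma>. ennreal (kernel_const CARD('n) * W powr (2 * ?r + 6)) *
      (ennreal (exp (- ?r * hyp_dist z (\<gamma> *v z))) * indicator {\<gamma>. hyp_dist z (\<gamma> *v z) \<le> L} \<gamma>))"
  proof (rule nn_integral_mono)
    fix \<gamma> assume "\<gamma> \<in> space (count_space \<Gamma>)"
    then have g: "\<gamma> \<in> \<Gamma>" by simp
    define d where "d = hyp_dist z (\<gamma> *v z)"
    have gz: "\<gamma> *v z \<in> hyp" by (rule act_hyp [OF g z])
    have cd: "lor z (\<gamma> *v z) = cosh d" and d0: "d \<ge> 0" using cosh_hyp_dist [OF z gz] by (simp_all add: d_def)
    show "ennreal (W ^ 6) * emeasure hyp_vol (hball z W \<inter> hball (\<gamma> *v z) W)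
      \<le> ennreal (kernel_const CARD('n) * W powr (2 * ?r + 6)) *
      (ennreal (exp (- ?r * hyp_dist z (\<gamma> *v z))) * indicator {\<gamma>. hyp_dist z (\<gamma> *v z) \<le> L} \<gamma>)"
    proof (cases "hball z W \<inter> hball (\<gamma> *v z) W = {}")
      case True
      then show ?thesis by simp
    next
      case False
      then obtain y where y: "y \<in> hyp" "lor z y \<le> W" "lor (\<gamma> *v z) y \<le> W" by (auto simp: hball_def)
      have "cosh d \<le> cosh L" using lor_common_ball [OF z gz y] by (simp add: W2 cd)
      then have dL: "d \<le> L" using cosh_real_nonneg_le_iff [OF d0 L] by simp
      have e: "(W * W / cosh d) powr ?r \<le> 2 powr ?r * W powr (2 * ?r) * exp (- ?r * d)"
      proof -
        have "exp d / 2 \<le> cosh d" by (simp add: cosh_field_def)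
        then have "W * W / cosh d \<le> W * W / (exp d / 2)" using W by (intro divide_left_mono) auto
        also have "\<dots> = 2 * (W * W) * exp (- d)" by (simp add: exp_minus field_simps)
        finally have "(W * W / cosh d) powr ?r \<le> (2 * (W * W) * exp (- d)) powr ?r"
          using W r0 by (intro powr_mono2) auto
        also have "\<dots> = 2 powr ?r * (W powr ?r * W powr ?r) * exp (- d) powr ?r"
          using W by (simp add: powr_mult)
        also have "exp (- d) powr ?r = exp (- ?r * d)" by (simp add: powr_def mult.commute)
        also have "W powr ?r * W powr ?r = W powr (2 * ?r)" by (simp flip: powr_add)
        finally show ?thesis .
      qed
      have "ennreal (W ^ 6) * emeasure hyp_vol (hball z W \<inter> hball (\<gamma> *v z) W)
          \<le> ennreal (W ^ 6) * ennreal (ball_const CARD('n) * (W * W / cosh d) powr ?r)"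
        using emeasure_hball_Int_le [OF n z gz W W] by (intro mult_left_mono) (simp_all add: cd)
      also have "\<dots> = ennreal (W ^ 6 * (ball_const CARD('n) * (W * W / cosh d) powr ?r))"
        using W ball_const_pos [of "CARD('n)"] by (intro ennreal_mult [symmetric]) auto
      also have "\<dots> \<le> ennreal (W ^ 6 * (ball_const CARD('n) * (2 powr ?r * W powr (2 * ?r) * exp (- ?r * d))))"
        using W ball_const_pos [of "CARD('n)"] e by (intro ennreal_leI mult_left_mono) auto
      also have "W ^ 6 * (ball_const CARD('n) * (2 powr ?r * W powr (2 * ?r) * exp (- ?r * d)))
          = kernel_const CARD('n) * W powr (2 * ?r + 6) * exp (- ?r * d)"
        using W by (simp add: kernel_const_def powr_add powr_numeral)
      also have "ennreal \<dots> = ennreal (kernel_const CARD('n) * W powr (2 * ?r + 6)) * ennreal (exp (- ?r * d))"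
        using kernel_const_pos [of "CARD('n)"] by (intro ennreal_mult) auto
      finally show ?thesis using dL by (simp add: d_def)
    qed
  qed
  also have "\<dots> = ennreal (kernel_const CARD('n) * W powr (2 * ?r + 6)) * returns L z"
    unfolding returns_def by (rule nn_integral_cmult) simp
  finally show ?thesis .
qed

text \<open>If the kernel has infinite norm the claim is trivial. Otherwise it is the nonnegativity
  of the squared distance between the kernel and its projection; the coefficients are the reproduced
  values \<open>a j\<close>.\<close>

lemma bessel:
  assumes J: "finite J" and ef: "\<And>j. j \<in> J \<Longrightarrow> \<phi> j \<in> eigenspace \<Gamma> (spectral_value CARD('n) (u j))"
    and on: "\<And>i j. i \<in> J \<Longrightarrow> j \<in> J \<Longrightarrow> qinner (\<phi> i) (\<phi> j) = (if i = j then 1 else 0)"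
    and W: "W > 1"
  shows "(\<Sum>j\<in>J. ennreal ((spherical_factor TYPE('n) (real CARD('n) - 1 - u j) W)\<^sup>2 * (cmod (lift (\<phi> j) z))\<^sup>2))
    \<le> (\<integral>\<^sup>+y. (Psi W z y)\<^sup>2 \<partial>dom_vol)"
proof (cases "(\<integral>\<^sup>+y. (Psi W z y)\<^sup>2 \<partial>dom_vol) = \<infinity>")
  case False
  define F where "F = PsiR W z"
  define a where "a j = complex_of_real (spherical_factor TYPE('n) (real CARD('n) - 1 - u j) W) * lift (\<phi> j) z" for j
  \<comment> \<open>The kernel is real and \<open>qinner\<close> is conjugate linear in its second
    argument, so the Fourier coefficients are the conjugates of the \<open>a j\<close>.\<close>
  define S where "S y = (\<Sum>j\<in>J. cnj (a j) * lift (\<phi> j) y)" for y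
  have mF: "F \<in> borel_measurable dom_vol" unfolding F_def by (rule borel_measurable_dom_vol [OF PsiR_measurable])
  have sq: "(\<integral>\<^sup>+y. (Psi W z y)\<^sup>2 \<partial>dom_vol) = (\<integral>\<^sup>+y. ennreal ((F y)\<^sup>2) \<partial>dom_vol)"
    using W by (simp add: F_def ennreal_PsiR [symmetric] ennreal_power)
  have iF: "integrable dom_vol (\<lambda>y. (F y)\<^sup>2)"
    using False mF unfolding sq by (intro integrableI_nonneg) (auto simp: less_top)
  have hF: "has_bochner_integral dom_vol (\<lambda>y. complex_of_real ((F y)\<^sup>2)) (complex_of_real (\<integral>y. (F y)\<^sup>2 \<partial>dom_vol))"
    by (rule has_bochner_integral_of_real [OF has_bochner_integral_integrable [OF iF]])
  have hA: "has_bochner_integral dom_vol (\<lambda>y. complex_of_real (F y) * lift (\<phi> j) y) (a j)" if "j \<in> J" for j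
    using has_bochner_integral_integrable [OF reproducing(1) [OF ef [OF that] W, of z]]
    unfolding reproducing(2) [OF ef [OF that] W] by (simp add: a_def F_def scaleR_conv_of_real)
  have "has_bochner_integral dom_vol (\<lambda>y. \<Sum>j\<in>J. cnj (a j) * (complex_of_real (F y) * lift (\<phi> j) y)) (\<Sum>j\<in>J. cnj (a j) * a j)"
    using hA by (intro has_bochner_integral_sum has_bochner_integral_mult_right) auto
  moreover have "(\<Sum>j\<in>J. cnj (a j) * (complex_of_real (F y) * lift (\<phi> j) y)) = complex_of_real (F y) * S y" for y
    unfolding S_def sum_distrib_left by (intro sum.cong refl) (simp add: mult_ac)
  moreover have norm_a: "(\<Sum>j\<in>J. cnj (a j) * a j) = complex_of_real (\<Sum>j\<in>J. (cmod (a j))\<^sup>2)"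
    unfolding of_real_sum complex_norm_square by (intro sum.cong refl mult.commute)
  ultimately have hFS: "has_bochner_integral dom_vol (\<lambda>y. complex_of_real (F y) * S y) (complex_of_real (\<Sum>j\<in>J. (cmod (a j))\<^sup>2))"
    by simp
  from has_bochner_integral_bounded_linear [OF bounded_linear_cnj this]
  have hFS': "has_bochner_integral dom_vol (\<lambda>y. complex_of_real (F y) * cnj (S y)) (complex_of_real (\<Sum>j\<in>J. (cmod (a j))\<^sup>2))"
    by simp
  have "has_bochner_integral dom_vol (\<lambda>y. \<Sum>i\<in>J. \<Sum>j\<in>J. (cnj (a i) * a j) * (lift (\<phi> i) y * cnj (lift (\<phi> j) y)))
      (\<Sum>i\<in>J. \<Sum>j\<in>J. (cnj (a i) * a j) * qinner (\<phi> i) (\<phi> j))"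
    unfolding qinner_def
    by (intro has_bochner_integral_sum has_bochner_integral_mult_right has_bochner_integral_integrable integrable_product)
      (use ef in auto)
  moreover have "(\<Sum>i\<in>J. \<Sum>j\<in>J. (cnj (a i) * a j) * (lift (\<phi> i) y * cnj (lift (\<phi> j) y))) = S y * cnj (S y)" for y
    unfolding S_def cnj_sum sum_product by (intro sum.cong refl) (simp add: mult_ac)
  moreover have "(\<Sum>i\<in>J. \<Sum>j\<in>J. (cnj (a i) * a j) * qinner (\<phi> i) (\<phi> j)) = complex_of_real (\<Sum>j\<in>J. (cmod (a j))\<^sup>2)"
  proof -
    have "(\<Sum>j\<in>J. (cnj (a i) * a j) * qinner (\<phi> i) (\<phi> j)) = cnj (a i) * a i" if i: "i \<in> J" for i
    proof -
      have "(\<Sum>j\<in>J. (cnj (a i) * a j) * qinner (\<phi> i) (\<phi> j)) = (\<Sum>j\<in>J. if i = j then cnj (a i) * a j else 0)"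
        by (intro sum.cong refl) (simp add: on i)
      then show ?thesis using J i by simp
    qed
    then show ?thesis by (simp only: norm_a [symmetric] cong: sum.cong)
  qed
  ultimately have hSS: "has_bochner_integral dom_vol (\<lambda>y. S y * cnj (S y)) (complex_of_real (\<Sum>j\<in>J. (cmod (a j))\<^sup>2))"
    by simp
  have "has_bochner_integral dom_vol
      (\<lambda>y. complex_of_real ((F y)\<^sup>2) - complex_of_real (F y) * S y - complex_of_real (F y) * cnj (S y) + S y * cnj (S y))
      (complex_of_real (\<integral>y. (F y)\<^sup>2 \<partial>dom_vol) - complex_of_real (\<Sum>j\<in>J. (cmod (a j))\<^sup>2)
        - complex_of_real (\<Sum>j\<in>J. (cmod (a j))\<^sup>2) + complex_of_real (\<Sum>j\<in>J. (cmod (a j))\<^sup>2))"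
    by (intro has_bochner_integral_add has_bochner_integral_diff hF hFS hFS' hSS)
  moreover have "complex_of_real ((F y)\<^sup>2) - complex_of_real (F y) * S y - complex_of_real (F y) * cnj (S y) + S y * cnj (S y)
      = complex_of_real ((cmod (complex_of_real (F y) - S y))\<^sup>2)" for y
    unfolding complex_norm_square by (simp add: algebra_simps power2_eq_square)
  ultimately have "has_bochner_integral dom_vol (\<lambda>y. complex_of_real ((cmod (complex_of_real (F y) - S y))\<^sup>2))
      (complex_of_real ((\<integral>y. (F y)\<^sup>2 \<partial>dom_vol) - (\<Sum>j\<in>J. (cmod (a j))\<^sup>2)))"
    by simp
  from has_bochner_integral_bounded_linear [OF bounded_linear_Re this]
  have "has_bochner_integral dom_vol (\<lambda>y. (cmod (complex_of_real (F y) - S y))\<^sup>2)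
      ((\<integral>y. (F y)\<^sup>2 \<partial>dom_vol) - (\<Sum>j\<in>J. (cmod (a j))\<^sup>2))"
    by simp
  then have "(\<integral>y. (cmod (complex_of_real (F y) - S y))\<^sup>2 \<partial>dom_vol) = (\<integral>y. (F y)\<^sup>2 \<partial>dom_vol) - (\<Sum>j\<in>J. (cmod (a j))\<^sup>2)"
    by (rule has_bochner_integral_integral_eq)
  moreover have "0 \<le> (\<integral>y. (cmod (complex_of_real (F y) - S y))\<^sup>2 \<partial>dom_vol)"
    by (rule Bochner_Integration.integral_nonneg) simp
  ultimately have "(\<Sum>j\<in>J. (cmod (a j))\<^sup>2) \<le> (\<integral>y. (F y)\<^sup>2 \<partial>dom_vol)" by linarith
  then have "ennreal (\<Sum>j\<in>J. (cmod (a j))\<^sup>2) \<le> ennreal (\<integral>y. (F y)\<^sup>2 \<partial>dom_vol)" by (rule ennreal_leI)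
  also have "\<dots> = (\<integral>\<^sup>+y. (Psi W z y)\<^sup>2 \<partial>dom_vol)"
    unfolding sq by (rule nn_integral_eq_integral [OF iF, symmetric]) simp
  finally show ?thesis
    by (simp add: a_def norm_mult power_mult_distrib)
qed simp

text \<open>All multipliers exceed the value at \<open>s\<close> of the lower bound, since that
  bound increases in the parameter. Dividing the kernel bound by its square leaves
  \<open>W powr (- 2 * (s - \<rho>))\<close>.\<close>

lemma orthonormal_pointwise_bound:
  assumes n: "CARD('n) \<ge> 2" and z: "z \<in> hyp" and L: "L \<ge> 2" and s: "s > rho CARD('n)" and J: "finite J"
    and u: "\<And>j. j \<in> J \<Longrightarrow> s \<le> u j \<and> u j \<le> real CARD('n) - 1"
    and ef: "\<And>j. j \<in> J \<Longrightarrow> \<phi> j \<in> eigenspace \<Gamma> (spectral_value CARD('n) (u j))"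
    and on: "\<And>i j. i \<in> J \<Longrightarrow> j \<in> J \<Longrightarrow> qinner (\<phi> i) (\<phi> j) = (if i = j then 1 else 0)"
  shows "(\<Sum>j\<in>J. ennreal ((cmod (lift (\<phi> j) z))\<^sup>2)) \<le> ennreal (bessel_const CARD('n) s * exp (- (s - rho CARD('n)) * L)) * returns L z"
proof -
  let ?r = "rho CARD('n)"
  define W where "W = cosh (L / 2)"
  have r0: "?r > 0" using n by (simp add: rho_def)
  have "cosh 1 \<le> cosh (L / 2)" using L by (subst cosh_real_nonneg_le_iff) auto
  then have W: "W \<ge> 3/2" using cosh_one_ge by (simp add: W_def)
  have W1: "W > 1" and W0: "W > 0" using W by simp_all
  define k where "k = (sf_const CARD('n))\<^sup>2 * W powr (2 * s + 6)"
  define m where "m = kernel_const CARD('n) * W powr (2 * ?r + 6)"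
  have k0: "k > 0" unfolding k_def using sf_const_pos [of "CARD('n)"] W0 by (simp add: zero_less_power)
  have m0: "m > 0" unfolding m_def using kernel_const_pos [of "CARD('n)"] W0 by simp
  have h: "k \<le> (spherical_factor TYPE('n) (real CARD('n) - 1 - u j) W)\<^sup>2" if j: "j \<in> J" for j
  proof -
    have "sf_const CARD('n) * W powr (s + 3) \<le> sf_const CARD('n) * W powr (u j + 3)"
      using u [OF j] W sf_const_pos [of "CARD('n)"] by (intro mult_left_mono powr_mono) auto
    also have "\<dots> \<le> spherical_factor TYPE('n) (real CARD('n) - 1 - u j) W"
      using u [OF j] s r0 W by (intro spherical_factor_ge_powr) auto
    finally have "(sf_const CARD('n) * W powr (s + 3))\<^sup>2 \<le> (spherical_factor TYPE('n) (real CARD('n) - 1 - u j) W)\<^sup>2"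
      using sf_const_pos [of "CARD('n)"] by (intro power_mono) auto
    moreover have "(W powr (s + 3))\<^sup>2 = W powr (2 * s + 6)"
      unfolding power2_eq_square powr_add [symmetric] by (rule arg_cong) simp
    ultimately show ?thesis by (simp add: k_def power_mult_distrib)
  qed
  let ?X = "\<Sum>j\<in>J. ennreal ((cmod (lift (\<phi> j) z))\<^sup>2)"
  have "ennreal k * ?X = (\<Sum>j\<in>J. ennreal (k * (cmod (lift (\<phi> j) z))\<^sup>2))"
    unfolding sum_distrib_left using k0 by (intro sum.cong refl ennreal_mult [symmetric]) auto
  also have "\<dots> \<le> (\<Sum>j\<in>J. ennreal ((spherical_factor TYPE('n) (real CARD('n) - 1 - u j) W)\<^sup>2 * (cmod (lift (\<phi> j) z))\<^sup>2))"
    using h by (intro sum_mono ennreal_leI mult_right_mono) auto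
  also have "\<dots> \<le> (\<integral>\<^sup>+y. (Psi W z y)\<^sup>2 \<partial>dom_vol)" by (rule bessel [OF J ef on W1])
  also have "\<dots> \<le> ennreal m * returns L z"
    unfolding m_def W_def using L by (intro Psi_square_le [OF n z]) simp
  finally have main: "ennreal k * ?X \<le> ennreal m * returns L z" .
  have "?X = ennreal (1 / k) * (ennreal k * ?X)"
    using k0 by (simp add: mult.assoc [symmetric] ennreal_mult [symmetric])
  also have "\<dots> \<le> ennreal (1 / k) * (ennreal m * returns L z)" by (rule mult_left_mono [OF main]) simp
  also have "\<dots> = ennreal (m / k) * returns L z"
    using k0 m0 by (simp add: mult.assoc [symmetric] ennreal_mult [symmetric])
  also have "\<dots> \<le> ennreal (bessel_const CARD('n) s * exp (- (s - ?r) * L)) * returns L z"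
  proof (intro mult_right_mono ennreal_leI)
    have "m / k = kernel_const CARD('n) / (sf_const CARD('n))\<^sup>2 * W powr (- 2 * (s - ?r))"
    proof -
      have "W powr (2 * ?r + 6) / W powr (2 * s + 6) = W powr (- 2 * (s - ?r))"
        unfolding powr_diff [symmetric] by (rule arg_cong) simp
      then show ?thesis unfolding m_def k_def by (metis times_divide_times_eq)
    qed
    also have "\<dots> \<le> kernel_const CARD('n) / (sf_const CARD('n))\<^sup>2 * (4 powr (s - ?r) * exp (- (s - ?r) * L))"
    proof (rule mult_left_mono)
      have "exp (L / 2) / 2 \<le> W" by (simp add: W_def cosh_field_def)
      then have "W powr (- 2 * (s - ?r)) \<le> (exp (L / 2) / 2) powr (- 2 * (s - ?r))"
        using s by (intro powr_mono2') auto
      also have "\<dots> = exp (L / 2) powr (- 2 * (s - ?r)) / 2 powr (- 2 * (s - ?r))"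
        by (simp add: powr_divide)
      also have "exp (L / 2) powr (- 2 * (s - ?r)) = exp (- (s - ?r) * L)"
        by (simp add: powr_def algebra_simps)
      also have "2 powr (- 2 * (s - ?r)) = 1 / 4 powr (s - ?r)"
      proof -
        have "(2::real) powr (- 2 * (s - ?r)) = (2 powr (-2)) powr (s - ?r)" by (simp only: powr_powr)
        also have "(2::real) powr (-2) = 1 / 4" by (simp add: powr_minus_divide powr_numeral)
        also have "(1 / 4 :: real) powr (s - ?r) = 1 / 4 powr (s - ?r)" by (simp add: powr_divide)
        finally show ?thesis .
      qed
      finally show "W powr (- 2 * (s - ?r)) \<le> 4 powr (s - ?r) * exp (- (s - ?r) * L)" by (simp add: mult.commute)
      show "kernel_const CARD('n) / (sf_const CARD('n))\<^sup>2 \<ge> 0" using kernel_const_pos [of "CARD('n)"] by simp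
    qed
    finally show "m / k \<le> bessel_const CARD('n) s * exp (- (s - ?r) * L)" by (simp add: bessel_const_def mult.assoc)
  qed simp
  finally show ?thesis .
qed

end

subsection \<open>Orthonormal systems of eigenfunctions\<close>

lemma sum_fun_apply: "(\<Sum>a\<in>A. F a) x = (\<Sum>a\<in>A. (F a x :: 'b::comm_monoid_add))"
  by (induction A rule: infinite_finite_induct) simp_all

lemma times_diff_linear_combination:
  fixes f g :: "real ^ 'n::finite \<Rightarrow> complex"
  shows "times_diff k f \<Longrightarrow> times_diff k g \<Longrightarrow> times_diff k (\<lambda>v. a * f v + b * g v)"
proof (induction k arbitrary: f g)
  case 0
  then show ?case by (simp add: continuous_intros)
next
  case (Suc k)
  then have d: "f differentiable_on UNIV" "g differentiable_on UNIV" by simp_all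
  have da: "(\<lambda>v. a * f v) differentiable_on UNIV" "(\<lambda>v. b * g v) differentiable_on UNIV"
    using d by (simp_all add: differentiable_on_mult)
  have "times_diff k (partial i (\<lambda>v. a * f v + b * g v))" for i
    unfolding partial_add [OF da] partial_cmult [OF d(1)] partial_cmult [OF d(2)]
    using Suc.prems by (intro Suc.IH) simp_all
  moreover have "(\<lambda>v. a * f v + b * g v) differentiable_on UNIV" using da by (rule differentiable_on_add)
  ultimately show ?case by simp
qed

text \<open>The scaling is the one written out in \<open>multiplicity_of\<close>, so that
  \<open>cfun.independent\<close> is literally the condition used there.\<close>

interpretation cfun: vector_space "\<lambda>(c::complex) (f :: 'a \<Rightarrow> complex) x. c * f x"
  by unfold_locales (simp_all add: fun_eq_iff algebra_simps)

context discrete_group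
begin

lemma eigenspace_linear_combination:
  assumes f: "f \<in> eigenspace \<Gamma> \<mu>" and g: "g \<in> eigenspace \<Gamma> \<mu>"
  shows "(\<lambda>x. a * f x + b * g x) \<in> eigenspace \<Gamma> \<mu>"
proof -
  let ?h = "\<lambda>x. a * f x + b * g x"
  have ch: "chart_lift ?h = (\<lambda>v. a * chart_lift f v + b * chart_lift g v)"
    by (simp add: chart_lift_def [abs_def])
  have out: "?h x = 0" if "x \<notin> hyp_quot \<Gamma>" for x
    using that f g by (simp add: eigenspace_def)
  have q: "qfun ?h"
    unfolding qfun_def ch using out eigenspaceD(1) [OF f] eigenspaceD(1) [OF g]
    by (auto simp: qfun_def intro!: continuous_intros)
  have sm: "smooth (chart_lift ?h)"
    unfolding ch smooth_def using f g
    by (intro allI times_diff_linear_combination) (simp_all add: eigenspace_def smooth_def chart_lift_def [abs_def])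
  have lap: "hyp_laplacian (chart_lift ?h) v = complex_of_real \<mu> * chart_lift ?h v" for v
    unfolding ch using hyp_laplacian_linear_combination [OF eigenspaceD(2) [OF f] eigenspaceD(2) [OF g], of a b v]
    by (simp add: eigenspaceD(3) [OF f] eigenspaceD(3) [OF g] algebra_simps)
  have mf: "(\<lambda>y. ennreal ((cmod (lift f y))\<^sup>2)) \<in> borel_measurable dom_vol" if "qfun f" for f
    by (intro measurable_compose [OF _ measurable_ennreal] borel_measurable_power
        measurable_compose [OF _ borel_measurable_norm] lift_dom_measurable that)
  have "(\<integral>\<^sup>+y. ennreal ((cmod (lift ?h y))\<^sup>2) \<partial>dom_vol)
      \<le> (\<integral>\<^sup>+y. ennreal (2 * (cmod a)\<^sup>2) * ennreal ((cmod (lift f y))\<^sup>2)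
          + ennreal (2 * (cmod b)\<^sup>2) * ennreal ((cmod (lift g y))\<^sup>2) \<partial>dom_vol)"
  proof (rule nn_integral_mono)
    fix y
    let ?p = "cmod a * cmod (lift f y)" and ?q = "cmod b * cmod (lift g y)"
    have "cmod (lift ?h y) \<le> ?p + ?q" unfolding lift_def norm_mult [symmetric] by (rule norm_triangle_ineq)
    then have "(cmod (lift ?h y))\<^sup>2 \<le> (?p + ?q)\<^sup>2" by (intro power_mono) simp_all
    also have "\<dots> \<le> 2 * ?p\<^sup>2 + 2 * ?q\<^sup>2"
      using sum_squares_bound [of ?p ?q] by (simp add: power2_sum)
    finally have "(cmod (lift ?h y))\<^sup>2 \<le> 2 * (cmod a)\<^sup>2 * (cmod (lift f y))\<^sup>2 + 2 * (cmod b)\<^sup>2 * (cmod (lift g y))\<^sup>2"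
      by (simp add: power_mult_distrib)
    then show "ennreal ((cmod (lift ?h y))\<^sup>2) \<le> ennreal (2 * (cmod a)\<^sup>2) * ennreal ((cmod (lift f y))\<^sup>2)
        + ennreal (2 * (cmod b)\<^sup>2) * ennreal ((cmod (lift g y))\<^sup>2)"
      by (simp only: ennreal_mult [symmetric] ennreal_plus [symmetric] zero_le_power2 zero_le_numeral mult_nonneg_nonneg ennreal_leI)
  qed
  also have "\<dots> = ennreal (2 * (cmod a)\<^sup>2) * (\<integral>\<^sup>+y. ennreal ((cmod (lift f y))\<^sup>2) \<partial>dom_vol)
      + ennreal (2 * (cmod b)\<^sup>2) * (\<integral>\<^sup>+y. ennreal ((cmod (lift g y))\<^sup>2) \<partial>dom_vol)"
    using mf [OF eigenspaceD(1) [OF f]] mf [OF eigenspaceD(1) [OF g]]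
    by (simp only: nn_integral_add nn_integral_cmult borel_measurable_times_ennreal borel_measurable_const)
  also have "\<dots> < \<infinity>"
    using lift_square_finite [OF f] lift_square_finite [OF g] by (simp add: ennreal_mult_less_top)
  finally have "L2_mass \<Gamma> ?h (hyp_quot \<Gamma>) < \<infinity>" unfolding L2_mass_lift [OF q] .
  then show ?thesis
    using out sm lap unfolding eigenspace_def chart_lift_def by blast
qed

lemma subspace_eigenspace: "cfun.subspace (eigenspace \<Gamma> \<mu>)"
proof -
  have z: "(0 :: 'n vec1 set \<Rightarrow> complex) \<in> eigenspace \<Gamma> \<mu>"
  proof -
    have "times_diff k (\<lambda>v :: real ^ 'n. 0)" for k
    proof (induction k)
      case (Suc k)
      have "partial i (\<lambda>v :: real ^ 'n. 0 :: complex) = (\<lambda>v. 0)" for i by (simp add: partial_def [abs_def])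
      then show ?case using Suc by simp
    qed (simp add: continuous_intros)
    moreover have "hyp_laplacian (\<lambda>v :: real ^ 'n. 0) v = 0" for v
      by (simp add: hyp_laplacian_def partial_def [abs_def])
    ultimately show ?thesis by (simp add: eigenspace_def smooth_def L2_mass_def)
  qed
  show ?thesis
  proof (rule cfun.subspaceI [OF z])
    show "f + g \<in> eigenspace \<Gamma> \<mu>" if "f \<in> eigenspace \<Gamma> \<mu>" "g \<in> eigenspace \<Gamma> \<mu>" for f g
      using eigenspace_linear_combination [OF that, of 1 1] by (simp add: plus_fun_def)
    show "(\<lambda>x. c * f x) \<in> eigenspace \<Gamma> \<mu>" if "f \<in> eigenspace \<Gamma> \<mu>" for c f
      using eigenspace_linear_combination [OF that z, of c 0] by simp
  qed
qed

lemma qinner_commute: "qinner f g = cnj (qinner g f)"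
proof -
  have "(\<integral>y. cnj (lift g y * cnj (lift f y)) \<partial>dom_vol) = cnj (\<integral>y. lift g y * cnj (lift f y) \<partial>dom_vol)"
    by (rule integral_bounded_linear' [OF bounded_linear_cnj bounded_linear_cnj]) simp
  then show ?thesis by (simp add: qinner_def mult.commute)
qed

lemma qinner_diff_sum:
  assumes b: "b \<in> eigenspace \<Gamma> \<mu>" and A: "A \<subseteq> eigenspace \<Gamma> \<mu>" and h: "h \<in> eigenspace \<Gamma> \<mu>"
  shows "qinner (b - (\<Sum>a\<in>A. (\<lambda>x. c a * a x))) h = qinner b h - (\<Sum>a\<in>A. c a * qinner a h)"
proof -
  have "has_bochner_integral dom_vol (\<lambda>y. lift b y * cnj (lift h y) - (\<Sum>a\<in>A. c a * (lift a y * cnj (lift h y))))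
      (qinner b h - (\<Sum>a\<in>A. c a * qinner a h))"
    unfolding qinner_def using b A h
    by (intro has_bochner_integral_diff has_bochner_integral_sum has_bochner_integral_mult_right
        has_bochner_integral_integrable integrable_product) auto
  moreover have "lift b y * cnj (lift h y) - (\<Sum>a\<in>A. c a * (lift a y * cnj (lift h y)))
      = lift (b - (\<Sum>a\<in>A. (\<lambda>x. c a * a x))) y * cnj (lift h y)" for y
    by (simp add: lift_def sum_fun_apply left_diff_distrib sum_distrib_right mult.assoc)
  ultimately show ?thesis unfolding qinner_def by (simp add: has_bochner_integral_integral_eq)
qed

lemma qinner_cmult: "qinner (\<lambda>x. c * f x) g = c * qinner f g"
  unfolding qinner_def by (simp add: lift_def mult.assoc)

lemma qinner_self:
  assumes f: "f \<in> eigenspace \<Gamma> \<mu>"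
  shows "qinner f f = complex_of_real (Re (qinner f f))" "Re (qinner f f) \<ge> 0"
    and "(\<integral>\<^sup>+y. ennreal ((cmod (lift f y))\<^sup>2) \<partial>dom_vol) = ennreal (Re (qinner f f))"
proof -
  have e: "lift f y * cnj (lift f y) = complex_of_real ((cmod (lift f y))\<^sup>2)" for y by (simp only: complex_norm_square)
  have i: "integrable dom_vol (\<lambda>y. (cmod (lift f y))\<^sup>2)"
  proof -
    have "integrable dom_vol (\<lambda>y. Re (lift f y * cnj (lift f y)))"
      by (rule integrable_bounded_linear [OF bounded_linear_Re integrable_product [OF f f]])
    then show ?thesis by (simp only: e Re_complex_of_real)
  qed
  have q: "qinner f f = complex_of_real (\<integral>y. (cmod (lift f y))\<^sup>2 \<partial>dom_vol)"
    unfolding qinner_def e by (rule integral_of_real [OF i])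
  show "qinner f f = complex_of_real (Re (qinner f f))" by (simp add: q)
  show "Re (qinner f f) \<ge> 0" by (simp add: q)
  show "(\<integral>\<^sup>+y. ennreal ((cmod (lift f y))\<^sup>2) \<partial>dom_vol) = ennreal (Re (qinner f f))"
    unfolding q using nn_integral_eq_integral [OF i] by simp
qed

text \<open>Vanishing almost everywhere on the domain spreads to all of hyperbolic space by
  unfolding; the continuous lift then vanishes identically, since a nonempty open set is not
  negligible.\<close>

lemma eigenfunction_eq_0:
  assumes f: "f \<in> eigenspace \<Gamma> \<mu>" and z: "(\<integral>\<^sup>+y. ennreal ((cmod (lift f y))\<^sup>2) \<partial>dom_vol) = 0"
  shows "f = 0"
proof -
  have qf: "qfun f" by (rule eigenspaceD(1) [OF f])
  define F where "F y = ennreal ((cmod (lift f y))\<^sup>2)" for y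
  have mF: "F \<in> borel_measurable borel" unfolding F_def
    by (intro measurable_compose [OF _ measurable_ennreal] borel_measurable_power
        measurable_compose [OF _ borel_measurable_norm] lift_measurable qf)
  have inv': "F (\<gamma> *v y) = F y" if "\<gamma> \<in> \<Gamma>" for \<gamma> y using that by (simp add: F_def lift_act)
  have "AE y in dom_vol. F y = 0"
    using z mF borel_measurable_dom_vol [OF mF] by (subst (asm) nn_integral_0_iff_AE) (simp_all add: F_def [abs_def])
  \<comment> \<open>Unfolding with the constant function 1 produces a factor that may be infinite;
    it does no harm because \<open>0 * \<infinity> = 0\<close> in \<open>ennreal\<close>.\<close>
  then have "(\<integral>\<^sup>+y. F y * gsum (\<lambda>\<gamma>. 1) \<partial>dom_vol) = (\<integral>\<^sup>+y. 0 \<partial>dom_vol)"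
    by (intro nn_integral_cong_AE) auto
  then have "(\<integral>\<^sup>+y. F y * 1 \<partial>hyp_vol) = 0"
    using unfold_integral_invariant [of "\<lambda>_. 1", OF _ mF inv'] by simp
  then have "(\<integral>\<^sup>+v. ennreal (hyp_density v) * F (hyp_chart v) \<partial>lborel) = 0"
    using nn_integral_hyp_vol [OF mF] by simp
  moreover have mc: "(\<lambda>v. F (hyp_chart v)) \<in> borel_measurable borel"
    unfolding F_def lift_chart using qf
    by (intro measurable_compose [OF _ measurable_ennreal] borel_measurable_power
        measurable_compose [OF _ borel_measurable_norm] borel_measurable_continuous_onI) (simp add: qfun_def)
  ultimately have "AE v in lborel. ennreal (hyp_density v) * F (hyp_chart v) = 0"
    by (subst (asm) nn_integral_0_iff_AE) simp_all
  moreover have "ennreal (hyp_density v) \<noteq> 0" for v :: "real ^ 'n" using hyp_density_pos [of v] by simp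
  ultimately have ae: "AE v in lborel. chart_lift f v = 0" by (simp add: F_def lift_chart)
  have op: "open {v. chart_lift f v \<noteq> 0}"
    using qf by (intro open_Collect_neq continuous_intros) (simp add: qfun_def)
  have "{v. chart_lift f v \<noteq> 0} \<in> null_sets lborel"
    using ae op by (subst (asm) AE_iff_null) simp_all
  then have "negligible {v. chart_lift f v \<noteq> 0}"
    by (simp add: negligible_iff_null_sets null_sets_completionI)
  then have 0: "chart_lift f v = 0" for v using open_not_negligible [OF op] by blast
  show "f = 0"
  proof
    fix x
    show "f x = 0 x"
    proof (cases "x \<in> hyp_quot \<Gamma>")
      case True
      then obtain y where y: "y \<in> hyp" "x = orb \<Gamma> y" by (auto simp: hyp_quot_def)
      then have "f x = lift f y" by (simp add: lift_def)
      then show ?thesis using 0 y by (simp add: lift_space_part)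
    next
      case False
      then show ?thesis using qf by (simp add: qfun_def)
    qed
  qed
qed

text \<open>Definiteness of \<open>qinner\<close> on the eigenspace is what lets the next vector be
  normalized: by independence its orthogonal part \<open>w\<close> is nonzero as a function, hence
  has positive norm.\<close>

lemma gram_schmidt:
  assumes "finite B" "cfun.independent B" "B \<subseteq> eigenspace \<Gamma> \<mu>"
  shows "\<exists>E. finite E \<and> card E = card B \<and> E \<subseteq> cfun.span B \<and> (\<forall>e\<in>E. \<forall>e'\<in>E. qinner e e' = (if e = e' then 1 else 0))"
  using assms
proof (induction B rule: finite_induct)
  case empty
  then show ?case by (intro exI [of _ "{}"]) simp
next
  case (insert b B)
  have ind: "cfun.independent B" "b \<notin> cfun.span B"
    using insert.prems(1) insert.hyps(2) by (simp_all add: cfun.independent_insert)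
  obtain E where E: "finite E" "card E = card B" "E \<subseteq> cfun.span B"
    and on: "\<And>e e'. e \<in> E \<Longrightarrow> e' \<in> E \<Longrightarrow> qinner e e' = (if e = e' then 1 else 0)"
    using insert.IH ind(1) insert.prems(2) by auto
  have b: "b \<in> eigenspace \<Gamma> \<mu>" and EE: "E \<subseteq> eigenspace \<Gamma> \<mu>"
    using insert.prems(2) E(3) cfun.span_minimal [OF _ subspace_eigenspace, of B \<mu>] by auto
  define P where "P = (\<Sum>a\<in>E. (\<lambda>x. qinner b a * a x))"
  define w where "w = b - P"
  have P: "P \<in> cfun.span B"
    unfolding P_def using E(3) by (intro cfun.span_sum cfun.span_scale) auto
  have PE: "P \<in> eigenspace \<Gamma> \<mu>"
    using P cfun.span_minimal [OF _ subspace_eigenspace, of B \<mu>] insert.prems(2) by auto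
  have wE: "w \<in> eigenspace \<Gamma> \<mu>" unfolding w_def by (rule cfun.subspace_diff [OF subspace_eigenspace b PE])
  have w0: "w \<noteq> 0" using P ind(2) by (auto simp: w_def)
  have ws: "w \<in> cfun.span (insert b B)"
    unfolding w_def
  proof (rule cfun.span_diff [OF cfun.span_base])
    show "P \<in> cfun.span (insert b B)" using P cfun.span_mono [of B "insert b B"] by blast
  qed simp
  have we: "qinner w e = 0" if e: "e \<in> E" for e
  proof -
    have "(\<Sum>a\<in>E. qinner b a * qinner a e) = (\<Sum>a\<in>E. if a = e then qinner b a else 0)"
      by (intro sum.cong refl) (simp add: on e)
    then show ?thesis
      using e E(1) EE qinner_diff_sum [OF b EE, of e "qinner b"] unfolding w_def P_def by auto
  qed
  define N where "N = Re (qinner w w)"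
  have N: "N > 0"
  proof (rule ccontr)
    assume "\<not> N > 0"
    then have "(\<integral>\<^sup>+y. ennreal ((cmod (lift w y))\<^sup>2) \<partial>dom_vol) = 0"
      unfolding qinner_self(3) [OF wE] by (simp add: N_def ennreal_neg)
    then show False using eigenfunction_eq_0 [OF wE] w0 by simp
  qed
  have ww: "qinner w w = complex_of_real N" unfolding N_def by (rule qinner_self(1) [OF wE])
  define v where "v = (\<lambda>x. complex_of_real (1 / sqrt N) * w x)"
  have vs: "v \<in> cfun.span (insert b B)" unfolding v_def by (rule cfun.span_scale [OF ws])
  have ve: "qinner v e = 0" "qinner e v = 0" if "e \<in> E" for e
  proof -
    show 1: "qinner v e = 0" unfolding v_def qinner_cmult we [OF that] by simp
    show "qinner e v = 0" using qinner_commute [of e v] 1 by simp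
  qed
  have vv: "qinner v v = 1"
  proof -
    have "qinner w v = cnj (complex_of_real (1 / sqrt N) * qinner w w)"
      using qinner_commute [of w v] unfolding v_def qinner_cmult .
    moreover have "qinner v v = complex_of_real (1 / sqrt N) * qinner w v"
      using qinner_cmult [of _ w v] by (simp only: v_def)
    ultimately have "qinner v v = complex_of_real (1 / sqrt N * (1 / sqrt N * N))"
      by (simp only: ww of_real_mult complex_cnj_mult complex_cnj_complex_of_real)
    also have "1 / sqrt N * (1 / sqrt N * N) = 1" using N by (simp add: field_simps)
    finally show ?thesis by simp
  qed
  have "v \<notin> E" using ve(1) vv by force
  then have "card (insert v E) = card (insert b B)" using E insert.hyps by simp
  moreover have "insert v E \<subseteq> cfun.span (insert b B)"
    using vs E(3) cfun.span_mono [of B "insert b B"] by auto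
  moreover have "\<forall>e\<in>insert v E. \<forall>e'\<in>insert v E. qinner e e' = (if e = e' then 1 else 0)"
    using on ve vv \<open>v \<notin> E\<close> by auto
  ultimately show ?case using E(1) by (intro exI [of _ "insert v E"]) simp
qed

end

subsection \<open>The critical exponent\<close>

text \<open>The two terms with absolute value \<open>M + 1\<close> contribute at most
  \<open>2 / (1 + M) - 2 / (2 + M)\<close>, and the sum telescopes.\<close>

lemma sum_inverse_squares_int_le:
  assumes "finite (A :: int set)" shows "(\<Sum>a\<in>A. 1 / (1 + \<bar>real_of_int a\<bar>)\<^sup>2) \<le> 4"
proof -
  have *: "(\<Sum>a\<in>{- int M..int M}. 1 / (1 + \<bar>real_of_int a\<bar>)\<^sup>2) \<le> 4 - 2 / (1 + real M)" for M
  proof (induction M)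
    case (Suc M)
    have "{- int (Suc M)..int (Suc M)} = insert (int (Suc M)) (insert (- int (Suc M)) {- int M..int M})" by auto
    then have "(\<Sum>a\<in>{- int (Suc M)..int (Suc M)}. 1 / (1 + \<bar>real_of_int a\<bar>)\<^sup>2)
        = 2 / (2 + real M)\<^sup>2 + (\<Sum>a\<in>{- int M..int M}. 1 / (1 + \<bar>real_of_int a\<bar>)\<^sup>2)"
      by (simp add: add.commute)
    also have "\<dots> \<le> 2 / ((1 + real M) * (2 + real M)) + (4 - 2 / (1 + real M))"
      by (intro add_mono Suc.IH divide_left_mono) (auto simp: power2_eq_square intro!: mult_right_mono)
    also have "2 / ((1 + real M) * (2 + real M)) = (2 * (2 + real M) - 2 * (1 + real M)) / ((1 + real M) * (2 + real M))"
      by simp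
    also have "\<dots> = 2 / (1 + real M) - 2 / (2 + real M)" by (rule diff_frac_eq [symmetric]) simp_all
    also have "2 / (1 + real M) - 2 / (2 + real M) + (4 - 2 / (1 + real M)) = 4 - 2 / (1 + real (Suc M))" by simp
    finally show ?case .
  qed simp
  obtain m where m: "\<And>a. a \<in> A \<Longrightarrow> \<bar>a\<bar> \<le> m"
    using finite_imageI [OF assms, of abs] by (metis Max_ge imageI)
  have "(\<Sum>a\<in>A. 1 / (1 + \<bar>real_of_int a\<bar>)\<^sup>2) \<le> (\<Sum>a\<in>{- int (nat m)..int (nat m)}. 1 / (1 + \<bar>real_of_int a\<bar>)\<^sup>2)"
    by (intro sum_mono2) (auto dest!: m)
  also have "\<dots> \<le> 4 - 2 / (1 + real (nat m))" by (rule *)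
  also have "\<dots> \<le> 4" by simp
  finally show ?thesis .
qed

context discrete_group
begin

text \<open>The critical exponent is an infimum of reals and is informative only if some exponent
  converges. A group element is determined by its integer entries, each at most a constant times
  \<open>cosh\<close> of the displacement. The series is thus dominated by a sum over integer
  matrices that factorizes into sums of inverse squares.\<close>

lemma exponential_sum_converges:
  assumes p: "p \<in> hyp" shows "\<exists>t. (\<lambda>\<gamma>. exp (- t * hyp_dist p (\<gamma> *v p))) summable_on \<Gamma>"
proof -
  let ?o = "hyp_origin :: 'n vec1" and ?I = "UNIV :: ('n option \<times> 'n option) set"
  \<comment> \<open>Two triangle inequalities cost \<open>4 * (lor ?o p)\<^sup>2\<close>, and a
    further factor 3 absorbs both the 1 in the entry bound and the 1 added to the entry.\<close>
  define K where "K = 12 * (lor ?o p)\<^sup>2"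
  define k :: "int \<Rightarrow> real" where "k a = K\<^sup>2 * (1 / (1 + \<bar>real_of_int a\<bar>)\<^sup>2)" for a
  define h where "h \<gamma> = (\<lambda>(i, j). \<lfloor>(\<gamma> :: 'n mat1) $ i $ j\<rfloor>)" for \<gamma>
  define N where "N = card ?I"
  have pc: "(\<Prod>x\<in>?I. c) = c ^ N" for c :: real by (simp only: N_def prod_constant)
  \<comment> \<open>Two powers of the exponential for each of the \<open>N\<close> matrix
    entries.\<close>
  let ?t = "real (2 * N)"
  have op: "lor ?o p > 0" by (intro lor_pos p) simp
  have h_eq: "real_of_int (h \<gamma> (i, j)) = \<gamma> $ i $ j" if "\<gamma> \<in> \<Gamma>" for \<gamma> i j
  proof -
    have "\<gamma> $ i $ j \<in> \<int>" using subsetD [OF integral that] by (simp add: GL_int_def)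
    then show ?thesis by (auto simp: h_def elim: Ints_cases)
  qed
  have entry: "1 + \<bar>real_of_int (h \<gamma> x)\<bar> \<le> K * lor p (\<gamma> *v p)" if g: "\<gamma> \<in> \<Gamma>" for \<gamma> x
  proof -
    obtain i j where x: "x = (i, j)" by (cases x)
    have hs: "?o \<in> hyp" "\<gamma> *v p \<in> hyp" "\<gamma> *v ?o \<in> hyp" using p act_hyp [OF g] by simp_all
    have "lor ?o (\<gamma> *v ?o) \<le> 2 * lor ?o p * lor p (\<gamma> *v ?o)" by (rule lor_triangle [OF hs(1,3) p])
    also have "\<dots> \<le> 2 * lor ?o p * (2 * lor p (\<gamma> *v p) * lor (\<gamma> *v p) (\<gamma> *v ?o))"
      using op by (intro mult_left_mono lor_triangle p hs) simp
    also have "\<dots> = 4 * (lor ?o p)\<^sup>2 * lor p (\<gamma> *v p)"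
      unfolding lor_act [OF g] by (simp add: lor_sym [of p ?o] power2_eq_square)
    finally have "3 * lor ?o (\<gamma> *v ?o) \<le> K * lor p (\<gamma> *v p)" by (simp add: K_def mult_ac)
    moreover have "\<bar>\<gamma> $ i $ j\<bar> \<le> 1 + lor ?o (\<gamma> *v ?o)" by (rule lorentz_entries_bound [OF lorc [OF g]]) simp
    moreover have "lor ?o (\<gamma> *v ?o) \<ge> 1" by (intro lor_ge_1 hs)
    ultimately show ?thesis by (simp add: x h_eq [OF g])
  qed
  have bound: "exp (- ?t * hyp_dist p (\<gamma> *v p)) \<le> (\<Prod>x\<in>?I. k (h \<gamma> x))" if g: "\<gamma> \<in> \<Gamma>" for \<gamma>
  proof -
    define l where "l = lor p (\<gamma> *v p)"
    have gp: "\<gamma> *v p \<in> hyp" by (rule act_hyp [OF g p])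
    have l: "l \<ge> 1" unfolding l_def by (rule lor_ge_1 [OF p gp])
    have "l \<le> exp (hyp_dist p (\<gamma> *v p))"
    proof -
      have "exp (- hyp_dist p (\<gamma> *v p)) \<le> exp (hyp_dist p (\<gamma> *v p))" using cosh_hyp_dist(2) [OF p gp] by simp
      moreover have "exp (hyp_dist p (\<gamma> *v p)) + exp (- hyp_dist p (\<gamma> *v p)) = 2 * l"
        using cosh_hyp_dist(1) [OF p gp] unfolding l_def by (simp add: cosh_field_def)
      ultimately show ?thesis by linarith
    qed
    then have "exp (- hyp_dist p (\<gamma> *v p)) \<le> 1 / l"
      using l by (simp add: exp_minus field_simps)
    then have "(exp (- hyp_dist p (\<gamma> *v p))) ^ (2 * N) \<le> (1 / l) ^ (2 * N)"
      by (rule power_mono) simp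
    also have "\<dots> = (\<Prod>x\<in>?I. (1 / l)\<^sup>2)" by (simp only: power_mult pc)
    also have "\<dots> \<le> (\<Prod>x\<in>?I. k (h \<gamma> x))"
    proof (rule prod_mono)
      fix x
      have "1 / l \<le> K * (1 / (1 + \<bar>real_of_int (h \<gamma> x)\<bar>))"
        using entry [OF g, of x] l by (simp add: l_def field_simps)
      then have "(1 / l)\<^sup>2 \<le> (K * (1 / (1 + \<bar>real_of_int (h \<gamma> x)\<bar>)))\<^sup>2" using l by (intro power_mono) auto
      then show "0 \<le> (1 / l)\<^sup>2 \<and> (1 / l)\<^sup>2 \<le> k (h \<gamma> x)" by (simp add: k_def power_mult_distrib power_divide)
    qed
    finally show ?thesis unfolding exp_of_nat_mult [symmetric] by simp
  qed
  have inj: "inj_on h \<Gamma>"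
  proof (rule inj_onI)
    fix \<gamma> \<gamma>' assume "\<gamma> \<in> \<Gamma>" "\<gamma>' \<in> \<Gamma>" "h \<gamma> = h \<gamma>'"
    then show "\<gamma> = \<gamma>'" by (simp add: vec_eq_iff h_eq [symmetric])
  qed
  have "(\<Sum>\<gamma>\<in>F. exp (- ?t * hyp_dist p (\<gamma> *v p))) \<le> (4 * K\<^sup>2) ^ N" if F: "F \<subseteq> \<Gamma>" "finite F" for F
  proof -
    define A where "A = (\<lambda>(\<gamma>, x). h \<gamma> x) ` (F \<times> ?I)"
    have A: "finite A" using F by (simp add: A_def)
    have "(\<Sum>\<gamma>\<in>F. exp (- ?t * hyp_dist p (\<gamma> *v p))) \<le> (\<Sum>\<gamma>\<in>F. \<Prod>x\<in>?I. k (h \<gamma> x))"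
      using F by (intro sum_mono bound) auto
    also have "\<dots> = (\<Sum>g\<in>h ` F. \<Prod>x\<in>?I. k (g x))"
      using inj_on_subset [OF inj F(1)] by (simp add: sum.reindex)
    also have "\<dots> \<le> (\<Sum>g\<in>PiE ?I (\<lambda>_. A). \<Prod>x\<in>?I. k (g x))"
      using A F by (intro sum_mono2 finite_PiE) (auto simp: A_def k_def intro!: prod_nonneg)
    also have "\<dots> = (\<Prod>x\<in>?I. \<Sum>a\<in>A. k a)" by (rule prod_sum_PiE [symmetric]) (simp_all add: A)
    also have "\<dots> \<le> (\<Prod>x\<in>?I. 4 * K\<^sup>2)"
    proof (rule prod_mono)
      fix x
      have "(\<Sum>a\<in>A. k a) \<le> K\<^sup>2 * 4"
        unfolding k_def sum_distrib_left [symmetric] by (intro mult_left_mono sum_inverse_squares_int_le A) simp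
      then show "0 \<le> (\<Sum>a\<in>A. k a) \<and> (\<Sum>a\<in>A. k a) \<le> 4 * K\<^sup>2" by (simp add: k_def sum_nonneg)
    qed
    finally show ?thesis unfolding pc .
  qed
  then have "(\<lambda>\<gamma>. exp (- ?t * hyp_dist p (\<gamma> *v p))) summable_on \<Gamma>"
    by (intro nonneg_bdd_above_summable_on bdd_aboveI [of _ "(4 * K\<^sup>2) ^ N"]) auto
  then show ?thesis by blast
qed

text \<open>The infimum supplies a convergent exponent below \<open>u\<close>, which need not exceed
  \<open>r\<close>. Raising it to the midpoint of \<open>r\<close> and \<open>u\<close> keeps
  convergence, because the terms decrease in the exponent.\<close>

lemma critical_exponent_less:
  assumes p: "p \<in> hyp" and u: "critical_exponent p \<Gamma> < u" and r: "r < u"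
  obtains t where "r < t" "t < u" "(\<lambda>\<gamma>. exp (- t * hyp_dist p (\<gamma> *v p))) summable_on \<Gamma>"
proof -
  let ?S = "{t. (\<lambda>\<gamma>. exp (- t * hyp_dist p (\<gamma> *v p))) summable_on \<Gamma>}"
  have "?S \<noteq> {}" using exponential_sum_converges [OF p] by blast
  then obtain t0 where t0: "t0 \<in> ?S" "t0 < u"
    using cInf_lessD [of ?S u] u by (auto simp: critical_exponent_def)
  define t where "t = max t0 ((r + u) / 2)"
  have "(\<lambda>\<gamma>. exp (- t * hyp_dist p (\<gamma> *v p))) summable_on \<Gamma>"
  proof (rule summable_on_comparison_test)
    show "(\<lambda>\<gamma>. exp (- t0 * hyp_dist p (\<gamma> *v p))) summable_on \<Gamma>" using t0 by simp
    show "exp (- t * hyp_dist p (\<gamma> *v p)) \<le> exp (- t0 * hyp_dist p (\<gamma> *v p))" if "\<gamma> \<in> \<Gamma>" for \<gamma>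
      using cosh_hyp_dist(2) [OF p act_hyp [OF that p]] by (simp add: t_def mult_right_mono)
  qed simp
  moreover have "r < t" "t < u" using t0 r by (auto simp: t_def less_max_iff_disj)
  ultimately show thesis using that by blast
qed

lemma eigenspace_trivial:
  assumes n: "CARD('n) \<ge> 2" and p: "p \<in> hyp" and t: "rho CARD('n) < t" "t < u" and u: "u \<le> real CARD('n) - 1"
    and s: "(\<lambda>\<gamma>. exp (- t * hyp_dist p (\<gamma> *v p))) summable_on \<Gamma>"
    and f: "f \<in> eigenspace \<Gamma> (spectral_value CARD('n) u)"
  shows "f = 0"
proof -
  have t0: "t > 0" using t n by (simp add: rho_def)
  let ?e = "\<lambda>\<gamma>. exp (- t * hyp_dist p (\<gamma> *v p))"
  have "integrable (count_space \<Gamma>) ?e"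
    by (rule abs_summable_on_def [THEN iffD1, OF abs_summable_equivalent [THEN iffD1, OF summable_on_iff_abs_summable_on_real [THEN iffD1, OF s]]])
  then have fin: "gsum (\<lambda>\<gamma>. ennreal (?e \<gamma>)) < \<infinity>" by (simp add: integrable_iff_bounded)
  have "gsum (\<lambda>\<gamma>. ennreal (lor (\<gamma> *v p) p powr (- t))) \<le> gsum (\<lambda>\<gamma>. ennreal (2 powr t) * ennreal (?e \<gamma>))"
  proof (rule nn_integral_mono)
    fix \<gamma> assume "\<gamma> \<in> space (count_space \<Gamma>)"
    then have gp: "\<gamma> *v p \<in> hyp" using act_hyp p by simp
    let ?d = "hyp_dist p (\<gamma> *v p)"
    have "exp ?d / 2 \<le> lor (\<gamma> *v p) p"
      unfolding lor_sym [of _ p] cosh_hyp_dist(1) [OF p gp, symmetric] by (simp add: cosh_field_def)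
    then have "lor (\<gamma> *v p) p powr (- t) \<le> (exp ?d / 2) powr (- t)" using t0 by (intro powr_mono2') auto
    also have "\<dots> = 2 powr t * exp (- t * ?d)"
      by (simp add: powr_divide powr_minus_divide) (simp add: powr_def exp_minus field_simps)
    finally show "ennreal (lor (\<gamma> *v p) p powr (- t)) \<le> ennreal (2 powr t) * ennreal (?e \<gamma>)"
      by (simp add: ennreal_mult [symmetric] ennreal_leI)
  qed
  also have "\<dots> = ennreal (2 powr t) * gsum (\<lambda>\<gamma>. ennreal (?e \<gamma>))" by (rule nn_integral_cmult) simp
  also have "\<dots> < \<infinity>" using fin by (simp add: ennreal_mult_less_top)
  finally show ?thesis
    by (intro eigenfunction_eq_0 [OF f] no_eigenfunctions [OF n p t u _ f])
qed

end

subsection \<open>Integrals of functions that need not be measurable\<close>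

text \<open>A sum of simple functions below \<open>f\<close> and \<open>g\<close> is a simple
  function below \<open>f + g\<close>. No measurability is assumed, and this is the direction needed
  to bring a sum of masses under one integral.\<close>

lemma nn_integral_superadditive:
  fixes M :: "'a measure"
  shows "(\<integral>\<^sup>+x. f x \<partial>M) + (\<integral>\<^sup>+x. g x \<partial>M) \<le> (\<integral>\<^sup>+x. f x + g x \<partial>M)"
proof -
  let ?S = "\<lambda>f :: 'a \<Rightarrow> ennreal. {g. simple_function M g \<and> g \<le> f}"
  have ne: "?S f \<noteq> {}" for f
  proof -
    have "(\<lambda>_. 0) \<in> ?S f" by (simp add: le_fun_def)
    then show ?thesis by blast
  qed
  have "integral\<^sup>S M f' + integral\<^sup>S M g' \<le> (\<integral>\<^sup>+x. f x + g x \<partial>M)" if "f' \<in> ?S f" "g' \<in> ?S g" for f' g'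
  proof -
    have "integral\<^sup>S M f' + integral\<^sup>S M g' = (\<integral>\<^sup>Sx. f' x + g' x \<partial>M)" using that by simp
    also have "\<dots> = (\<integral>\<^sup>+x. f' x + g' x \<partial>M)"
      using that by (intro nn_integral_eq_simple_integral [symmetric] simple_function_add) auto
    also have "\<dots> \<le> (\<integral>\<^sup>+x. f x + g x \<partial>M)"
      using that by (intro nn_integral_mono add_mono) (auto simp: le_fun_def)
    finally show ?thesis .
  qed
  then show ?thesis
    unfolding nn_integral_def [of M f] nn_integral_def [of M g]
      ennreal_SUP_add_left [OF ne, symmetric] ennreal_SUP_add_right [OF ne]
    by (intro SUP_least)
qed

lemma sum_nn_integral_le: "(\<Sum>j\<in>J. \<integral>\<^sup>+x. f j x \<partial>M) \<le> (\<integral>\<^sup>+x. (\<Sum>j\<in>J. f j x) \<partial>M)"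
proof (induction J rule: infinite_finite_induct)
  case (insert j J)
  then have "(\<Sum>j\<in>insert j J. \<integral>\<^sup>+x. f j x \<partial>M) \<le> (\<integral>\<^sup>+x. f j x \<partial>M) + (\<integral>\<^sup>+x. (\<Sum>j\<in>J. f j x) \<partial>M)"
    by (simp add: add_left_mono)
  also have "\<dots> \<le> (\<integral>\<^sup>+x. f j x + (\<Sum>j\<in>J. f j x) \<partial>M)" by (rule nn_integral_superadditive)
  finally show ?case using insert by simp
qed simp_all

lemma cmult_nn_integral_le: "c * (\<integral>\<^sup>+x. f x \<partial>M) \<le> (\<integral>\<^sup>+x. c * f x \<partial>M)"
  unfolding nn_integral_def [of M f] SUP_mult_left_ennreal
proof (rule SUP_least)
  fix g assume g: "g \<in> {g. simple_function M g \<and> g \<le> f}"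
  then have "c * integral\<^sup>S M g = (\<integral>\<^sup>+x. c * g x \<partial>M)"
    by (simp add: nn_integral_cmult nn_integral_eq_simple_integral borel_measurable_simple_function)
  also have "\<dots> \<le> (\<integral>\<^sup>+x. c * f x \<partial>M)" using g by (intro nn_integral_mono mult_left_mono) (auto simp: le_fun_def)
  finally show "c * integral\<^sup>S M g \<le> (\<integral>\<^sup>+x. c * f x \<partial>M)" .
qed

text \<open>The opposite inequality for constants, obtained by applying the previous one to
  \<open>1 / c\<close>; again the integrand is arbitrary.\<close>

lemma nn_integral_cmult_le:
  assumes "c > 0" shows "(\<integral>\<^sup>+x. ennreal c * f x \<partial>M) \<le> ennreal c * (\<integral>\<^sup>+x. f x \<partial>M)"
proof -
  have *: "ennreal c * (ennreal (1 / c) * y) = y" "ennreal (1 / c) * (ennreal c * y) = y" for y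
    using assms by (simp_all add: mult.assoc [symmetric] ennreal_mult [symmetric])
  have "ennreal c * (ennreal (1 / c) * (\<integral>\<^sup>+x. ennreal c * f x \<partial>M))
      \<le> ennreal c * (\<integral>\<^sup>+x. ennreal (1 / c) * (ennreal c * f x) \<partial>M)"
    by (intro mult_left_mono cmult_nn_integral_le) simp
  then show ?thesis by (simp only: *)
qed

text \<open>Bounds a finite sum of suprema by bounding every simultaneous choice. The summand
  \<open>a\<close> collects the choices already made in the induction.\<close>

lemma add_sum_SUP_le:
  fixes f :: "'a \<Rightarrow> 'b \<Rightarrow> ennreal"
  assumes "finite F" and ne: "\<And>m. m \<in> F \<Longrightarrow> A m \<noteq> {}"
    and le: "\<And>b. (\<And>m. m \<in> F \<Longrightarrow> b m \<in> A m) \<Longrightarrow> a + (\<Sum>m\<in>F. f m (b m)) \<le> R"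
  shows "a + (\<Sum>m\<in>F. SUP b\<in>A m. f m b) \<le> R"
  using assms
proof (induction F arbitrary: a rule: finite_induct)
  case empty
  then show ?case by simp
next
  case (insert m F)
  have "a + f m c + (\<Sum>m\<in>F. SUP b\<in>A m. f m b) \<le> R" if c: "c \<in> A m" for c
  proof (rule insert.IH)
    show "A m' \<noteq> {}" if "m' \<in> F" for m' using insert.prems(1) that by simp
    fix b assume b: "\<And>m. m \<in> F \<Longrightarrow> b m \<in> A m"
    have "a + (\<Sum>m'\<in>insert m F. f m' ((b(m := c)) m')) \<le> R"
      using b c by (intro insert.prems(2)) auto
    moreover have "(\<Sum>m'\<in>F. f m' ((b(m := c)) m')) = (\<Sum>m'\<in>F. f m' (b m'))"
      using insert.hyps by (intro sum.cong) auto
    ultimately show "a + f m c + (\<Sum>m\<in>F. f m (b m)) \<le> R" using insert.hyps by (simp add: add.assoc)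
  qed
  then have "(SUP c\<in>A m. a + (\<Sum>m\<in>F. SUP b\<in>A m. f m b) + f m c) \<le> R"
    by (intro SUP_least) (simp add: ac_simps)
  then have "a + (\<Sum>m\<in>F. SUP b\<in>A m. f m b) + (SUP c\<in>A m. f m c) \<le> R"
    using insert.prems(1) [of m] by (simp add: ennreal_SUP_add_right)
  then show ?case using insert.hyps by (simp add: ac_simps)
qed

subsection \<open>The multiplicity bound\<close>

text \<open>The parameter is the larger root \<open>\<rho> + sqrt (\<rho>\<^sup>2 - \<mu>)\<close>.
  The eigenvalue decreases to the right of \<open>\<rho>\<close>, so small eigenvalues mean large
  parameters.\<close>

lemma spectral_parameter:
  assumes n: "n \<ge> 2" and s: "rho n < s" and \<mu>: "0 \<le> \<mu>" "\<mu> \<le> spectral_value n s"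
  obtains u where "spectral_value n u = \<mu>" "s \<le> u" "u \<le> real n - 1"
proof -
  let ?r = "rho n"
  have sv: "spectral_value n u = ?r\<^sup>2 - (u - ?r)\<^sup>2" for u
    by (simp add: spectral_value_def rho_def power2_eq_square field_simps)
  have r0: "?r > 0" using n by (simp add: rho_def)
  define u where "u = ?r + sqrt (?r\<^sup>2 - \<mu>)"
  have le: "(s - ?r)\<^sup>2 \<le> ?r\<^sup>2 - \<mu>" using \<mu>(2) by (simp add: sv)
  have nn: "?r\<^sup>2 - \<mu> \<ge> 0" using le by (meson order_trans zero_le_power2)
  have "spectral_value n u = \<mu>" using nn by (simp add: sv u_def)
  moreover have "s \<le> u" using real_le_rsqrt [OF le] by (simp add: u_def)
  moreover have "u \<le> real n - 1"
  proof -
    have "sqrt (?r\<^sup>2 - \<mu>) \<le> ?r" using \<mu>(1) r0 by (intro real_le_lsqrt) auto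
    then show ?thesis by (simp add: u_def rho_def field_simps)
  qed
  ultimately show thesis by (rule that)
qed

context discrete_group
begin

text \<open>Transitivity guarantees that the chosen representative exists. It need not be known
  further, because the pointwise bound holds at every point of the orbit; the sum has finitely many
  terms, so it agrees with the integral for counting measure.\<close>

lemma return_sum_eq:
  assumes p: "p \<in> hyp" and x: "x \<in> hyp_quot \<Gamma>"
  obtains z where "z \<in> hyp" "orb \<Gamma> z = x" "return_sum p \<Gamma> L x = returns L z"
proof -
  let ?g = "representative p \<Gamma> x"
  obtain y where y: "y \<in> hyp" "x = orb \<Gamma> y" using x by (auto simp: hyp_quot_def)
  obtain g where "g \<in> lorc" "g *v p = y" using lorc_transitive [OF p y(1)] .
  then have "g \<in> lorc \<and> orb \<Gamma> (g *v p) = x" using y by simp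
  then have g: "?g \<in> lorc" "orb \<Gamma> (?g *v p) = x"
    unfolding representative_def by (metis (mono_tags, lifting) someI)+
  define z where "z = ?g *v p"
  have z: "z \<in> hyp" unfolding z_def by (rule lorc_hyp [OF g(1) p])
  let ?A = "{\<gamma> \<in> \<Gamma>. hyp_dist z (\<gamma> *v z) \<le> L}"
  let ?f = "\<lambda>\<gamma>. ennreal (exp (- rho CARD('n) * hyp_dist z (\<gamma> *v z)))"
  have "finite ?A"
  proof (rule finite_subset [OF _ finite_orbit [OF z z, of "cosh L"]], intro subsetI CollectI conjI)
    fix \<gamma> assume g: "\<gamma> \<in> ?A"
    then show "\<gamma> \<in> \<Gamma>" by simp
    have gz: "\<gamma> *v z \<in> hyp" using g act_hyp z by simp
    have "cosh (hyp_dist z (\<gamma> *v z)) \<le> cosh L"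
      using g cosh_hyp_dist(2) [OF z gz] by (subst cosh_real_nonneg_le_iff) auto
    then show "lor z (\<gamma> *v z) \<le> cosh L" by (simp only: cosh_hyp_dist(1) [OF z gz])
  qed
  then have "infsum ?f ?A = (\<integral>\<^sup>+\<gamma>. ?f \<gamma> \<partial>count_space ?A)"
    by (simp only: infsum_finite nn_integral_count_space_finite)
  also have "\<dots> = (\<integral>\<^sup>+\<gamma>. ?f \<gamma> * indicator {\<gamma>. hyp_dist z (\<gamma> *v z) \<le> L} \<gamma> \<partial>count_space ?A)"
    by (intro nn_integral_cong) simp
  also have "\<dots> = returns L z"
    unfolding returns_def by (rule nn_integral_count_space_eq) (auto simp: indicator_def)
  finally have "return_sum p \<Gamma> L x = returns L z"
    by (simp add: return_sum_def return_length_def z_def)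
  then show thesis using that z g(2) by (simp add: z_def)
qed

text \<open>Every function of the system contributes at least \<open>c\<close> to the mass over
  \<open>A\<close>, while the sum of their squared moduli is bounded pointwise by the return
  sum.\<close>

lemma orthonormal_count_bound:
  assumes n: "CARD('n) \<ge> 2" and p: "p \<in> hyp" and L: "L \<ge> 2" and s: "s > rho CARD('n)" and c: "c > 0"
    and A: "A \<subseteq> hyp_quot \<Gamma>" and J: "finite J"
    and u: "\<And>j. j \<in> J \<Longrightarrow> s \<le> u j \<and> u j \<le> real CARD('n) - 1"
    and ef: "\<And>j. j \<in> J \<Longrightarrow> \<phi> j \<in> eigenspace \<Gamma> (spectral_value CARD('n) (u j))"
    and on: "\<And>i j. i \<in> J \<Longrightarrow> j \<in> J \<Longrightarrow> qinner (\<phi> i) (\<phi> j) = (if i = j then 1 else 0)"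
    and collar: "\<And>j. j \<in> J \<Longrightarrow> ennreal c \<le> L2_mass \<Gamma> (\<phi> j) A"
  shows "of_nat (card J) \<le> ennreal (bessel_const CARD('n) s / c * exp (- (s - rho CARD('n)) * L))
    * (\<integral>\<^sup>+x\<in>A. return_sum p \<Gamma> L x \<partial>quot_vol \<Gamma>)"
proof -
  define C where "C = bessel_const CARD('n) s * exp (- (s - rho CARD('n)) * L)"
  have C0: "C > 0" by (simp add: C_def bessel_const_pos)
  let ?R = "\<integral>\<^sup>+x\<in>A. return_sum p \<Gamma> L x \<partial>quot_vol \<Gamma>"
  have "of_nat (card J) * ennreal c = (\<Sum>j\<in>J. ennreal c)" by simp
  also have "\<dots> \<le> (\<Sum>j\<in>J. L2_mass \<Gamma> (\<phi> j) A)" by (intro sum_mono collar)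
  also have "\<dots> \<le> (\<integral>\<^sup>+x. (\<Sum>j\<in>J. ennreal ((cmod (\<phi> j x))\<^sup>2) * indicator A x) \<partial>quot_vol \<Gamma>)"
    unfolding L2_mass_def by (rule sum_nn_integral_le)
  also have "\<dots> \<le> (\<integral>\<^sup>+x. ennreal C * (return_sum p \<Gamma> L x * indicator A x) \<partial>quot_vol \<Gamma>)"
  proof (rule nn_integral_mono)
    fix x
    show "(\<Sum>j\<in>J. ennreal ((cmod (\<phi> j x))\<^sup>2) * indicator A x) \<le> ennreal C * (return_sum p \<Gamma> L x * indicator A x)"
    proof (cases "x \<in> A")
      case True
      then have "x \<in> hyp_quot \<Gamma>" using A by blast
      then obtain z where z: "z \<in> hyp" "orb \<Gamma> z = x" "return_sum p \<Gamma> L x = returns L z"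
        using return_sum_eq [OF p] by metis
      have "(\<Sum>j\<in>J. ennreal ((cmod (lift (\<phi> j) z))\<^sup>2)) \<le> ennreal C * returns L z"
        unfolding C_def by (rule orthonormal_pointwise_bound [where u = u]) (use n z L s J u ef on in auto)
      then show ?thesis using True by (simp add: z lift_def)
    qed simp
  qed
  also have "\<dots> \<le> ennreal C * ?R" by (rule nn_integral_cmult_le [OF C0])
  finally have main: "of_nat (card J) * ennreal c \<le> ennreal C * ?R" .
  have "of_nat (card J) = (of_nat (card J) * ennreal c) * ennreal (1 / c)"
    using c by (simp add: mult.assoc ennreal_mult [symmetric])
  also have "\<dots> \<le> (ennreal C * ?R) * ennreal (1 / c)" by (rule mult_right_mono [OF main]) simp
  also have "\<dots> = (ennreal C * ennreal (1 / c)) * ?R" by (simp add: mult_ac)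
  also have "ennreal C * ennreal (1 / c) = ennreal (bessel_const CARD('n) s / c * exp (- (s - rho CARD('n)) * L))"
    using c C0 by (simp add: ennreal_mult [symmetric] C_def mult_ac)
  finally show ?thesis .
qed

text \<open>It suffices to bound finite choices of eigenvalues with finite independent sets. Each
  set is made orthonormal without changing its size, and different eigenvalues are orthogonal
  already.\<close>

lemma eigenvalue_count_bound:
  assumes n: "CARD('n) \<ge> 2" and p: "p \<in> hyp" and L: "L \<ge> 2" and s: "s > rho CARD('n)" and c: "c > 0"
    and A: "A \<subseteq> hyp_quot \<Gamma>"
    and triv: "\<And>u f. \<delta> < u \<Longrightarrow> u \<le> real CARD('n) - 1 \<Longrightarrow> f \<in> eigenspace \<Gamma> (spectral_value CARD('n) u) \<Longrightarrow> f = 0"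
    and collar: "\<And>u f. u \<in> {s..\<delta>} \<Longrightarrow> f \<in> eigenspace \<Gamma> (spectral_value CARD('n) u) \<Longrightarrow>
      L2_mass \<Gamma> f (hyp_quot \<Gamma>) = 1 \<Longrightarrow> ennreal c \<le> L2_mass \<Gamma> f A"
  shows "eigenvalue_count \<Gamma> (spectral_value CARD('n) s)
    \<le> ennreal (bessel_const CARD('n) s / c * exp (- (s - rho CARD('n)) * L))
      * (\<integral>\<^sup>+x\<in>A. return_sum p \<Gamma> L x \<partial>quot_vol \<Gamma>)" (is "_ \<le> ?R")
proof -
  let ?l = "spectral_value CARD('n) s"
  let ?S = "\<lambda>\<mu>. {B. finite B \<and> B \<subseteq> eigenspace \<Gamma> \<mu> \<and> cfun.independent B}"
  have bound: "(\<Sum>\<mu>\<in>F. of_nat (card (B \<mu>))) \<le> ?R"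
    if F: "finite F" "F \<subseteq> {0..?l}" and B: "\<And>\<mu>. \<mu> \<in> F \<Longrightarrow> B \<mu> \<in> ?S \<mu>" for F B
  proof -
    have "\<forall>\<mu>\<in>F. \<exists>u. spectral_value CARD('n) u = \<mu> \<and> s \<le> u \<and> u \<le> real CARD('n) - 1"
      using F(2) spectral_parameter [OF n s] by (metis atLeastAtMost_iff subsetD)
    then obtain u where u: "\<And>\<mu>. \<mu> \<in> F \<Longrightarrow> spectral_value CARD('n) (u \<mu>) = \<mu> \<and> s \<le> u \<mu> \<and> u \<mu> \<le> real CARD('n) - 1"
      by metis
    have "\<forall>\<mu>\<in>F. \<exists>E. finite E \<and> card E = card (B \<mu>) \<and> E \<subseteq> eigenspace \<Gamma> \<mu>
        \<and> (\<forall>e\<in>E. \<forall>e'\<in>E. qinner e e' = (if e = e' then 1 else 0))"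
    proof
      fix \<mu> assume "\<mu> \<in> F"
      then have b: "finite (B \<mu>)" "cfun.independent (B \<mu>)" "B \<mu> \<subseteq> eigenspace \<Gamma> \<mu>" using B by auto
      show "\<exists>E. finite E \<and> card E = card (B \<mu>) \<and> E \<subseteq> eigenspace \<Gamma> \<mu>
        \<and> (\<forall>e\<in>E. \<forall>e'\<in>E. qinner e e' = (if e = e' then 1 else 0))"
        using gram_schmidt [OF b] cfun.span_minimal [OF b(3) subspace_eigenspace] by blast
    qed
    then obtain E where E: "\<And>\<mu>. \<mu> \<in> F \<Longrightarrow> finite (E \<mu>) \<and> card (E \<mu>) = card (B \<mu>) \<and> E \<mu> \<subseteq> eigenspace \<Gamma> \<mu>
        \<and> (\<forall>e\<in>E \<mu>. \<forall>e'\<in>E \<mu>. qinner e e' = (if e = e' then 1 else 0))"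
      by metis
    \<comment> \<open>Pairs keep the eigenvalue next to the eigenfunction, so the parameter is a
      function of the index and the cardinality is the plain sum.\<close>
    define J where "J = Sigma F E"
    have ef: "snd j \<in> eigenspace \<Gamma> (spectral_value CARD('n) (u (fst j)))" if "j \<in> J" for j
    proof -
      have "fst j \<in> F" "snd j \<in> E (fst j)" using that by (auto simp: J_def)
      then show ?thesis using u [of "fst j"] E [of "fst j"] by auto
    qed
    have on: "qinner (snd i) (snd j) = (if i = j then 1 else 0)" if i: "i \<in> J" and j: "j \<in> J" for i j
    proof (cases "fst i = fst j")
      case True
      then have m: "fst i \<in> F" "snd i \<in> E (fst i)" "snd j \<in> E (fst i)" using i j by (auto simp: J_def)
      then have "qinner (snd i) (snd j) = (if snd i = snd j then 1 else 0)" using E [OF m(1)] by blast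
      then show ?thesis using True by (simp add: prod_eq_iff)
    next
      case False
      have m: "fst i \<in> F" "fst j \<in> F" using i j by (auto simp: J_def)
      have "qinner (snd i) (snd j) = 0"
        using u [OF m(1)] u [OF m(2)] False by (intro eigenfunctions_orthogonal [OF ef [OF i] ef [OF j]]) auto
      then show ?thesis using False by auto
    qed
    have "of_nat (card J) \<le> ?R"
    proof (rule orthonormal_count_bound [OF n p L s c A, where u = "u \<circ> fst" and \<phi> = snd])
      show "finite J" using F E by (auto simp: J_def)
      fix j assume j: "j \<in> J"
      then have m: "fst j \<in> F" by (auto simp: J_def)
      show "s \<le> (u \<circ> fst) j \<and> (u \<circ> fst) j \<le> real CARD('n) - 1" using u [OF m] by simp
      show "snd j \<in> eigenspace \<Gamma> (spectral_value CARD('n) ((u \<circ> fst) j))" using ef [OF j] by simp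
      have m1: "L2_mass \<Gamma> (snd j) (hyp_quot \<Gamma>) = 1"
        unfolding L2_mass_lift [OF eigenspaceD(1) [OF ef [OF j]]] qinner_self(3) [OF ef [OF j]] on [OF j j] by simp
      have "snd j \<noteq> 0"
      proof
        assume "snd j = 0"
        then show False using m1 by (simp add: L2_mass_def)
      qed
      \<comment> \<open>A parameter above \<open>\<delta>\<close> would force the normalized
        eigenfunction to be 0; hence it lies in the range covered by the collar property.\<close>
      then have "u (fst j) \<le> \<delta>" using triv [OF _ _ ef [OF j]] u [OF m] by fastforce
      then show "ennreal c \<le> L2_mass \<Gamma> (snd j) A" using u [OF m] by (intro collar [OF _ ef [OF j] m1]) simp
    qed (rule on)
    moreover have "card J = (\<Sum>\<mu>\<in>F. card (B \<mu>))" unfolding J_def using F E by simp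
    ultimately show ?thesis by simp
  qed
  have "(\<Sum>\<mu>\<in>F. multiplicity_of \<Gamma> \<mu>) \<le> ?R" if F: "finite F" "F \<subseteq> {0..?l}" for F
  proof -
    have ne: "?S \<mu> \<noteq> {}" for \<mu> using cfun.independent_empty by blast
    have "0 + (\<Sum>\<mu>\<in>F. SUP B\<in>?S \<mu>. of_nat (card B)) \<le> ?R"
      by (rule add_sum_SUP_le [OF F(1) ne]) (simp only: add_0 bound [OF F])
    then show ?thesis by (simp add: multiplicity_of_def)
  qed
  \<comment> \<open>In \<open>ennreal\<close> the infinite sum over the interval is the supremum of
    its finite partial sums.\<close>
  then show ?thesis
    unfolding eigenvalue_count_def by (subst nonneg_infsum_complete) (auto intro!: SUP_least)
qed

end

theorem theorem2:
  fixes \<Gamma> K :: "'n::finite mat1 set"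
    and \<Gamma>s :: "nat \<Rightarrow> 'n mat1 set"
    and p :: "'n vec1"
    and \<Omega> :: "'n vec1 set set"
    and s c \<delta> :: real
  assumes "CARD('n) \<ge> 2"
    and "maximal_compact_subgroup K" and "p \<in> hyp" and "\<forall>k\<in>K. k *v p = p"
    and "subgroup \<Gamma> lorentz_group" and "\<Gamma> \<subseteq> GL_int"
    and "torsion_free \<Gamma>" and "geometrically_finite \<Gamma>" and "zariski_dense \<Gamma>"
    and "\<delta> = critical_exponent p \<Gamma>" and "\<delta> > rho CARD('n)"
    and "\<forall>i. finite_index_subgroup (\<Gamma>s i) \<Gamma>"
    and "rho CARD('n) < s" and "s \<le> \<delta>"
    and "uniform_collar \<Gamma> \<Gamma>s s \<delta> \<Omega> c"
  shows "\<exists>C>0. \<forall>i. \<forall>L\<ge>2.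
           eigenvalue_count (\<Gamma>s i) (spectral_value CARD('n) s) / of_nat (index_in \<Gamma> (\<Gamma>s i))
             \<le> ennreal (C * exp (- (s - rho CARD('n)) * L)) * return_energy p \<Gamma> (\<Gamma>s i) \<Omega> L"
proof (intro exI conjI allI impI)
  note n = assms(1) and p = assms(3)
  have c: "c > 0" using assms(15) by (simp add: uniform_collar_def)
  \<comment> \<open>The constant involves only the dimension, \<open>s\<close> and the collar
    constant, which gives uniformity in \<open>i\<close> and \<open>L\<close>.\<close>
  show "bessel_const CARD('n) s / c > 0" using bessel_const_pos c by simp
  fix i and L :: real assume L: "L \<ge> 2"
  interpret G: discrete_group \<Gamma> by (rule discrete_group.intro) (rule assms)+
  have sub: "subgroup (\<Gamma>s i) lorentz_group" "\<Gamma>s i \<subseteq> \<Gamma>" using assms(12) by (simp_all add: finite_index_subgroup_def)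
  interpret H: discrete_group "\<Gamma>s i"
  proof (rule discrete_group.intro)
    show "\<Gamma>s i \<subseteq> GL_int" using sub(2) assms(6) by blast
    show "torsion_free (\<Gamma>s i)" using sub(2) assms(7) by (auto simp: torsion_free_def)
  qed (rule sub)
  let ?A = "cover_preimage \<Gamma> (\<Gamma>s i) \<Omega>"
  have "eigenvalue_count (\<Gamma>s i) (spectral_value CARD('n) s)
    \<le> ennreal (bessel_const CARD('n) s / c * exp (- (s - rho CARD('n)) * L))
      * (\<integral>\<^sup>+x\<in>?A. return_sum p (\<Gamma>s i) L x \<partial>quot_vol (\<Gamma>s i))"
  proof (rule H.eigenvalue_count_bound [OF n p L assms(13) c, where \<delta> = \<delta>])
    show "?A \<subseteq> hyp_quot (\<Gamma>s i)" by (auto simp: cover_preimage_def)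
    fix u f assume f: "f \<in> eigenspace (\<Gamma>s i) (spectral_value CARD('n) u)"
    show "f = 0" if u: "\<delta> < u" "u \<le> real CARD('n) - 1"
    proof -
      \<comment> \<open>Convergence is taken from the big group and restricted to the subgroup, so
        the exponent \<open>\<delta>\<close> serves all covers.\<close>
      have "critical_exponent p \<Gamma> < u" "rho CARD('n) < u" using u(1) assms(10,11) by auto
      then obtain t where t: "rho CARD('n) < t" "t < u" "(\<lambda>\<gamma>. exp (- t * hyp_dist p (\<gamma> *v p))) summable_on \<Gamma>"
        using G.critical_exponent_less [OF p] by metis
      show ?thesis
        by (rule H.eigenspace_trivial [OF n p t(1,2) u(2) summable_on_subset_banach [OF t(3) sub(2)] f])
    qed
    show "ennreal c \<le> L2_mass (\<Gamma>s i) f ?A" if "u \<in> {s..\<delta>}" "L2_mass (\<Gamma>s i) f (hyp_quot (\<Gamma>s i)) = 1"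
      using assms(15) that f by (auto simp: uniform_collar_def)
  qed
  then have "eigenvalue_count (\<Gamma>s i) (spectral_value CARD('n) s) / of_nat (index_in \<Gamma> (\<Gamma>s i))
    \<le> (ennreal (bessel_const CARD('n) s / c * exp (- (s - rho CARD('n)) * L))
      * (\<integral>\<^sup>+x\<in>?A. return_sum p (\<Gamma>s i) L x \<partial>quot_vol (\<Gamma>s i))) / of_nat (index_in \<Gamma> (\<Gamma>s i))"
    by (rule divide_right_mono_ennreal)
  then show "eigenvalue_count (\<Gamma>s i) (spectral_value CARD('n) s) / of_nat (index_in \<Gamma> (\<Gamma>s i))
    \<le> ennreal (bessel_const CARD('n) s / c * exp (- (s - rho CARD('n)) * L)) * return_energy p \<Gamma> (\<Gamma>s i) \<Omega> L"
    by (simp only: return_energy_def ennreal_times_divide)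
qed

end
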